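(* Assume (A.1), (A.2) and (A.3). Then for every $\xi\in\mathbb{R}$, \[ \operatorname{s-lim}_{t\to\infty}\exp\Big(i\xi\frac{\hat x(t)}{t}\Big)=\Pi_{\rm p}(U)+\exp(i\xi\hat v_+)\Pi_{\rm ac}(U). \]
   Context: $\mathcal{H}=\ell^2(\mathbb{Z};\mathbb{C}^2)$; shift $(S\Psi)(x)=(\Psi^{(0)}(x+1),\Psi^{(1)}(x-1))^T$; for $\{C(x)\}\subset U(2)$, $(C\Psi)(x)=C(x)\Psi(x)$, $U=SC$; for $C_0\in U(2)$, $U_0=SC_0$. (A.1): there are $c_1,\epsilon>0$ with $\|C(x)-C_0\|\le c_1|x|^{-1-\epsilon}$ for $x\ne0$. Let $\hat U_0(k)=\operatorname{diag}(e^{ik},e^{-ik})C_0=\sum_{j=1,2}\lambda_j(k)|u_j(k)\rangle\langle u_j(k)|$, $k\in[0,2\pi)$, with eigenvalues $\lambda_j(k)$ differentiable in $k$ and orthonormal eigenvectors $u_j(k)$. (A.2): each $u_j$ is continuously differentiable with $\sup_k\|u_j'(k)\|<\infty$. (A.3): $U$ has empty singular continuous spectrum. $\mathscr{F}\Psi(k)=\sum_x e^{-ikx}\Psi(x)$ maps $\mathcal{H}$ unitarily onto $L^2([0,2\pi),dk/2\pi;\mathbb{C}^2)$; $\hat v_0=\mathscr{F}^{-1}\big(\sum_j\frac{i\lambda_j'(k)}{\lambda_j(k)}|u_j(k)\rangle\langle u_j(k)|\big)\mathscr{F}$. $\Pi_{\rm ac}(V)$, $\Pi_{\rm p}(V)$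 denote the projections onto the absolutely continuous subspace and onto the closed span of all eigenvectors of a unitary $V$. $W_+=\operatorname{s-lim}_{t\to\infty}U^{-t}U_0^t\Pi_{\rm ac}(U_0)$ (which exists and is complete under (A.1), unitary from $\operatorname{Ran}\Pi_{\rm ac}(U_0)$ onto $\operatorname{Ran}\Pi_{\rm ac}(U)$), and $\hat v_+=W_+\hat v_0W_+^*$, so that $\exp(i\xi\hat v_+)\Pi_{\rm ac}(U)=W_+\exp(i\xi\hat v_0)W_+^*\Pi_{\rm ac}(U)$. $\hat x$ is the position operator $(\hat x\Psi)(x)=x\Psi(x)$ and $\hat x(t)=U^{-t}\hat xU^t$, $t\in\mathbb{N}$. *)

theory Defs
  imports "HOL-Analysis.Analysis"
begin

type_synonym state = "int \<Rightarrow> complex^2"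
type_synonym coin = "complex^2^2"

definition l2 :: "state set" where
  "l2 = {\<psi>. (\<lambda>x. (norm (\<psi> x))\<^sup>2) summable_on UNIV}"

definition l2inner :: "state \<Rightarrow> state \<Rightarrow> complex" where
  "l2inner \<phi> \<psi> = (\<Sum>\<^sub>\<infinity>x. \<Sum>i\<in>UNIV. cnj (\<phi> x $ i) * (\<psi> x $ i))"

definition l2norm :: "state \<Rightarrow> real" where
  "l2norm \<psi> = sqrt (\<Sum>\<^sub>\<infinity>x. (norm (\<psi> x))\<^sup>2)"

definition l2conv :: "(nat \<Rightarrow> state) \<Rightarrow> state \<Rightarrow> bool" where
  "l2conv X \<psi> \<longleftrightarrow> \<psi> \<in> l2 \<and> (\<forall>t. X t \<in> l2) \<and>
     ((\<lambda>t. l2norm (\<lambda>x. X t x - \<psi> x)) \<longlongrightarrow> 0) sequentially"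

definition l2closure :: "state set \<Rightarrow> state set" where
  "l2closure S = {\<psi>. \<exists>X. (\<forall>t. X t \<in> S) \<and> l2conv X \<psi>}"

definition l2span :: "state set \<Rightarrow> state set" where
  "l2span S = {\<psi>. \<exists>F c. finite F \<and> F \<subseteq> S \<and> \<psi> = (\<lambda>x. \<Sum>\<phi>\<in>F. c \<phi> *s \<phi> x)}"

definition proj :: "state set \<Rightarrow> state \<Rightarrow> state" where
  "proj K \<psi> = (THE \<phi>. \<phi> \<in> K \<and> (\<forall>\<eta>\<in>K. l2inner \<eta> (\<lambda>x. \<psi> x - \<phi> x) = 0))"

definition adjoint_op :: "(state \<Rightarrow> state) \<Rightarrow> state \<Rightarrow> state" where
  "adjoint_op W \<psi> = (THE \<phi>. \<phi> \<in> l2 \<and> (\<forall>\<eta>\<in>l2. l2inner \<eta> \<phi> = l2inner (W \<eta>) \<psi>))"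

definition madj :: "coin \<Rightarrow> coin" where
  "madj M = (\<chi> i j. cnj (M $ j $ i))"

definition unitary2 :: "coin \<Rightarrow> bool" where
  "unitary2 M \<longleftrightarrow> M ** madj M = mat 1 \<and> madj M ** M = mat 1"

text \<open>Shift: (S psi)(x) = (psi0(x+1), psi1(x-1)); components 0,1 are indices 1,2 of complex^2.\<close>
definition shift :: "state \<Rightarrow> state" where
  "shift \<psi> = (\<lambda>x. \<chi> i. if i = 1 then \<psi> (x + 1) $ 1 else \<psi> (x - 1) $ 2)"

definition shift_inv :: "state \<Rightarrow> state" where
  "shift_inv \<psi> = (\<lambda>x. \<chi> i. if i = 1 then \<psi> (x - 1) $ 1 else \<psi> (x + 1) $ 2)"

definition walk :: "(int \<Rightarrow> coin) \<Rightarrow> state \<Rightarrow> state" where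
  "walk C \<psi> = shift (\<lambda>x. C x *v \<psi> x)"

text \<open>U^{-1} = C^* S^{-1} (the inverse of U when every C(x) is unitary).\<close>
definition walk_inv :: "(int \<Rightarrow> coin) \<Rightarrow> state \<Rightarrow> state" where
  "walk_inv C \<psi> = (\<lambda>x. madj (C x) *v shift_inv \<psi> x)"

definition walk_pow :: "(int \<Rightarrow> coin) \<Rightarrow> int \<Rightarrow> state \<Rightarrow> state" where
  "walk_pow C n = (if 0 \<le> n then walk C ^^ nat n else walk_inv C ^^ nat (- n))"

text \<open>mu is the spectral measure of psi for U (a finite Borel measure on [0,2pi)),
  identified by its Fourier coefficients <psi, U^n psi>.\<close>
definition spectral_measure :: "(int \<Rightarrow> coin) \<Rightarrow> state \<Rightarrow> real measure \<Rightarrow> bool" where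
  "spectral_measure C \<psi> \<mu> \<longleftrightarrow> finite_measure \<mu> \<and>
     sets \<mu> = sets (restrict_space lborel {0..<2*pi}) \<and>
     (\<forall>n::int. l2inner \<psi> (walk_pow C n \<psi>) = (\<integral>\<theta>. cis (of_int n * \<theta>) \<partial>\<mu>))"

definition ac_subspace :: "(int \<Rightarrow> coin) \<Rightarrow> state set" where
  "ac_subspace C = {\<psi>\<in>l2. \<exists>\<mu>. spectral_measure C \<psi> \<mu> \<and>
       absolutely_continuous (restrict_space lborel {0..<2*pi}) \<mu>}"

definition sc_subspace :: "(int \<Rightarrow> coin) \<Rightarrow> state set" where
  "sc_subspace C = {\<psi>\<in>l2. \<exists>\<mu>. spectral_measure C \<psi> \<mu> \<and>
       (\<forall>\<theta>. emeasure \<mu> {\<theta>} = 0) \<and>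
       (\<exists>N\<in>sets \<mu>. emeasure lborel N = 0 \<and> emeasure \<mu> (space \<mu> - N) = 0)}"

definition eigenvectors :: "(int \<Rightarrow> coin) \<Rightarrow> state set" where
  "eigenvectors C = {\<psi>\<in>l2. (\<exists>x. \<psi> x \<noteq> 0) \<and> (\<exists>e::complex. walk C \<psi> = (\<lambda>x. e *s \<psi> x))}"

definition pp_subspace :: "(int \<Rightarrow> coin) \<Rightarrow> state set" where
  "pp_subspace C = l2closure (l2span (eigenvectors C))"

definition Pi_ac :: "(int \<Rightarrow> coin) \<Rightarrow> state \<Rightarrow> state" where
  "Pi_ac C = proj (ac_subspace C)"

definition Pi_p :: "(int \<Rightarrow> coin) \<Rightarrow> state \<Rightarrow> state" where
  "Pi_p C = proj (pp_subspace C)"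

definition sq_int :: "(real \<Rightarrow> complex^2) \<Rightarrow> bool" where
  "sq_int g \<longleftrightarrow> set_borel_measurable lborel {0..<2*pi} g \<and>
     set_integrable lborel {0..<2*pi} (\<lambda>k. (norm (g k))\<^sup>2)"

definition fourier_inv :: "(real \<Rightarrow> complex^2) \<Rightarrow> state" where
  "fourier_inv g = (\<lambda>x. \<chi> i. (LINT k:{0..<2*pi}|lborel. cis (k * of_int x) * (g k $ i)) / (2 * pi))"

text \<open>F psi: the (a.e. unique) square integrable function whose inverse transform is psi.\<close>
definition fourier :: "state \<Rightarrow> real \<Rightarrow> complex^2" where
  "fourier \<psi> = (SOME g. sq_int g \<and> fourier_inv g = \<psi>)"

definition mscale :: "complex \<Rightarrow> coin \<Rightarrow> coin" where
  "mscale c M = (\<chi> a b. c * M $ a $ b)"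

definition proj_vec :: "complex^2 \<Rightarrow> coin" where
  "proj_vec u = (\<chi> a b. u $ a * cnj (u $ b))"

definition exp_v0 :: "(2 \<Rightarrow> real \<Rightarrow> complex) \<Rightarrow> (2 \<Rightarrow> real \<Rightarrow> complex) \<Rightarrow>
    (2 \<Rightarrow> real \<Rightarrow> complex^2) \<Rightarrow> real \<Rightarrow> state \<Rightarrow> state" where
  "exp_v0 lam lam' u \<xi> \<psi> = fourier_inv (\<lambda>k.
     (\<Sum>j\<in>UNIV. mscale (exp (\<i> * of_real \<xi> * (\<i> * lam' j k / lam j k))) (proj_vec (u j k)))
       *v fourier \<psi> k)"

definition wave_op :: "(int \<Rightarrow> coin) \<Rightarrow> coin \<Rightarrow> state \<Rightarrow> state" where
  "wave_op C C0 \<psi> = (THE \<phi>. l2conv (\<lambda>t. (walk_inv C ^^ t) ((walk (\<lambda>_. C0) ^^ t)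
       (Pi_ac (\<lambda>_. C0) \<psi>))) \<phi>)"

definition exp_vplus_ac :: "(int \<Rightarrow> coin) \<Rightarrow> coin \<Rightarrow> (2 \<Rightarrow> real \<Rightarrow> complex) \<Rightarrow>
    (2 \<Rightarrow> real \<Rightarrow> complex) \<Rightarrow> (2 \<Rightarrow> real \<Rightarrow> complex^2) \<Rightarrow> real \<Rightarrow> state \<Rightarrow> state" where
  "exp_vplus_ac C C0 lam lam' u \<xi> \<psi> =
     wave_op C C0 (exp_v0 lam lam' u \<xi> (adjoint_op (wave_op C C0) (Pi_ac C \<psi>)))"

definition exp_pos_t :: "(int \<Rightarrow> coin) \<Rightarrow> real \<Rightarrow> nat \<Rightarrow> state \<Rightarrow> state" where
  "exp_pos_t C \<xi> t \<psi> = (walk_inv C ^^ t)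
     (\<lambda>x. exp (\<i> * of_real (\<xi> * of_int x / real t)) *s (walk C ^^ t) \<psi> x)"

end

theory Submission
  imports Defs "HOL-Probability.Probability"
begin

text \<open>
  For a unitary \<open>U\<close>, trigonometric polynomials in \<open>U\<close> and the density of trigonometric polynomials
  in the mean square of finitely many finite measures on the circle give the indicator functions of
  \<open>U\<close>; with spectral measures obtained from Fejer means and Helly's selection theorem, every vector
  splits into an absolutely continuous, a singular continuous and a pure point part. Vectors with
  bounded spectral density have square summable correlations \<open>\<langle>g, U\<^sup>n \<phi>\<rangle>\<close> and are dense in the
  absolutely continuous subspace. For two walks whose coins differ by a summable amount this
  summability makes Pearson's telescoping argument work, so the wave operators exist in both
  directions, which is completeness.

  For the free walk and a finitely supported state, \<open>U\<^sub>0\<^sup>-\<^sup>t exp (i \<xi> x / t) U\<^sub>0\<^sup>t\<close> becomes in Fourier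
  space the product of the symbol at \<open>k\<close> to the power \<open>- t\<close> with its value at \<open>k - \<xi> / t\<close> to the power
  \<open>t\<close>, which converges pointwise to the exponential of the velocity; dominated convergence and
  isometry extend this to all states. On \<open>\<psi> = W\<^sub>+ \<phi>\<close> the evolution \<open>U\<^sup>t \<psi>\<close> may be replaced by
  \<open>U\<^sub>0\<^sup>t \<phi>\<close>, and on an eigenvector the limit is trivial because \<open>exp (i \<xi> x / t)\<close> tends
  strongly to the identity.
\<close>

text \<open>Projections, adjoint and wave operator are definite descriptions in the statement, so
  each has a known value only after a vector with the defining property has been exhibited. The
  spectral splitting does this for \<open>Pi_ac\<close> and \<open>Pi_p\<close>; the adjoint of the
  wave operator is exhibited as the limit with the two walks exchanged, so completeness is proved
  along the way. The link between a vector and its measure is the isometry sending a trigonometric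
  polynomial p to p(U) applied to the vector. Fejer means serve because they are squared norms of
  such vectors, hence nonnegative densities. The coin difference acts site by site, followed by the
  shift. Its matrix elements are therefore controlled by a weighted sum of squared site norms, with
  weights decaying like |x| to the power -1 - epsilon, which is summable over the integers. In the
  free limit the t-th power of a unimodular number close to 1 appears; the principal logarithm turns
  differentiability of the eigenvalue into the limit, while continuity of the eigenvectors removes
  the cross terms. This is done at interior k, since derivatives at 0 are one-sided.\<close>

section \<open>Complex Hilbert spaces, with an inner product conjugate linear in its first
  argument\<close>

class complex_hilbert = banach +
  fixes scaleC :: "complex \<Rightarrow> 'a \<Rightarrow> 'a" (infixr "*\<^sub>C" 75)
    and cinner :: "'a \<Rightarrow> 'a \<Rightarrow> complex"
  assumes scaleC_of_real: "of_real r *\<^sub>C x = r *\<^sub>R x"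
    and scaleC_add_right: "c *\<^sub>C (x + y) = c *\<^sub>C x + c *\<^sub>C y"
    and scaleC_add_left: "(c + d) *\<^sub>C x = c *\<^sub>C x + d *\<^sub>C x"
    and scaleC_scaleC [simp]: "c *\<^sub>C d *\<^sub>C x = (c * d) *\<^sub>C x"
    and cinner_add_right: "cinner x (y + z) = cinner x y + cinner x z"
    and cinner_scaleC_right [simp]: "cinner x (c *\<^sub>C y) = c * cinner x y"
    and cinner_commute: "cinner x y = cnj (cinner y x)"
    and cinner_self: "cinner x x = of_real ((norm x)\<^sup>2)"

lemma scaleC_one [simp]: "1 *\<^sub>C x = x"
  using scaleC_of_real[of 1 x] by simp

lemma scaleC_zero_left [simp]: "0 *\<^sub>C x = 0"
  using scaleC_of_real[of 0 x] by simp

lemma scaleC_zero_right [simp]: "c *\<^sub>C 0 = 0"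
  using scaleC_add_right[of c 0 0] by simp

lemma scaleC_minus_one: "(-1) *\<^sub>C x = - x"
  using scaleC_of_real[of "-1" x] by simp

lemma scaleC_minus_right: "c *\<^sub>C (- x) = - (c *\<^sub>C x)"
  using scaleC_add_right[of c x "- x"] by (simp add: eq_neg_iff_add_eq_0 add.commute)

lemma scaleC_diff_right: "c *\<^sub>C (x - y) = c *\<^sub>C x - c *\<^sub>C y"
  using scaleC_add_right[of c x "- y"] by (simp add: scaleC_minus_right)

lemma scaleC_sum_right: "c *\<^sub>C (\<Sum>i\<in>I. f i) = (\<Sum>i\<in>I. c *\<^sub>C f i)"
  by (induction I rule: infinite_finite_induct) (auto simp: scaleC_add_right)

lemma cinner_add_left: "cinner (x + y) z = cinner x z + cinner y z"
  by (metis cinner_commute cinner_add_right complex_cnj_add)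

lemma cinner_scaleC_left [simp]: "cinner (c *\<^sub>C x) y = cnj c * cinner x y"
  by (metis cinner_commute cinner_scaleC_right complex_cnj_mult)

lemma cinner_zero_right [simp]: "cinner x 0 = 0"
  using cinner_scaleC_right[of x 0 x] by simp

lemma cinner_zero_left [simp]: "cinner 0 x = 0"
  by (metis cinner_commute cinner_zero_right complex_cnj_zero)

lemma cinner_minus_right [simp]: "cinner x (- y) = - cinner x y"
  using cinner_scaleC_right[of x "- 1" y] by (simp add: scaleC_minus_one)

lemma cinner_minus_left [simp]: "cinner (- x) y = - cinner x y"
  by (metis cinner_commute cinner_minus_right complex_cnj_minus)

lemma cinner_diff_right: "cinner x (y - z) = cinner x y - cinner x z"
  using cinner_add_right[of x y "- z"] by simp

lemma cinner_diff_left: "cinner (x - y) z = cinner x z - cinner y z"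
  using cinner_add_left[of x "- y" z] by simp

lemma cinner_sum_right: "cinner x (\<Sum>i\<in>I. f i) = (\<Sum>i\<in>I. cinner x (f i))"
  by (induction I rule: infinite_finite_induct) (auto simp: cinner_add_right)

lemma cinner_sum_left: "cinner (\<Sum>i\<in>I. f i) x = (\<Sum>i\<in>I. cinner (f i) x)"
  by (induction I rule: infinite_finite_induct) (auto simp: cinner_add_left)

lemma norm_sq_eq: "(norm x)\<^sup>2 = Re (cinner x x)"
  by (simp add: cinner_self)

lemma norm_scaleC [simp]: "norm (c *\<^sub>C x) = cmod c * norm x"
proof -
  have "complex_of_real ((norm (c *\<^sub>C x))\<^sup>2) = cnj c * c * of_real ((norm x)\<^sup>2)"
    by (simp only: cinner_self[symmetric]) simp
  also have "\<dots> = of_real ((cmod c * norm x)\<^sup>2)"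
    by (simp add: power_mult_distrib complex_norm_square[symmetric] mult.commute)
  finally have "(norm (c *\<^sub>C x))\<^sup>2 = (cmod c * norm x)\<^sup>2" using of_real_eq_iff by blast
  thus ?thesis by (simp add: power2_eq_iff_nonneg)
qed

lemma norm_add_sq: "(norm (x + y))\<^sup>2 = (norm x)\<^sup>2 + (norm y)\<^sup>2 + 2 * Re (cinner x y)"
  unfolding norm_sq_eq
  by (simp add: cinner_add_left cinner_add_right) (simp add: cinner_commute[of y x])

lemma norm_diff_sq: "(norm (x - y))\<^sup>2 = (norm x)\<^sup>2 + (norm y)\<^sup>2 - 2 * Re (cinner x y)"
  using norm_add_sq[of x "- y"] by simp

text \<open>Cauchy-Schwarz: \<open>c *\<^sub>C y\<close> is the orthogonal projection of
  \<open>x\<close> onto the line of \<open>y\<close>, and the squared norm of what remains is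
  nonnegative.\<close>

lemma cmod_cinner_le: "cmod (cinner x y) \<le> norm x * norm y"
proof (cases "y = 0")
  case False
  define c where "c = cinner y x / of_real ((norm y)\<^sup>2)"
  have cc: "cnj (cinner y x) = cinner x y" by (metis cinner_commute)
  have y: "(norm y)\<^sup>2 > 0" using False by simp
  have "0 \<le> (norm (x - c *\<^sub>C y))\<^sup>2" by simp
  also have "\<dots> = (norm x)\<^sup>2 + (cmod c)\<^sup>2 * (norm y)\<^sup>2 - 2 * Re (c * cinner x y)"
    by (simp add: norm_diff_sq power_mult_distrib)
  also have "c * cinner x y = of_real ((cmod (cinner x y))\<^sup>2 / (norm y)\<^sup>2)"
    using complex_norm_square[of "cinner x y"] unfolding c_def
    by (simp add: mult.commute cinner_commute[of y x])
  also have "(cmod c)\<^sup>2 * (norm y)\<^sup>2 = (cmod (cinner x y))\<^sup>2 / (norm y)\<^sup>2"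
  proof -
    have "cmod (cinner y x) = cmod (cinner x y)" by (metis cc complex_mod_cnj)
    hence "cmod c = cmod (cinner x y) / (norm y)\<^sup>2"
      by (simp add: c_def norm_divide norm_power)
    thus ?thesis using y by (simp add: power2_eq_square field_simps)
  qed
  finally have "(cmod (cinner x y))\<^sup>2 / (norm y)\<^sup>2 \<le> (norm x)\<^sup>2" by simp
  hence "(cmod (cinner x y))\<^sup>2 \<le> (norm x * norm y)\<^sup>2"
    using y by (simp add: field_simps power_mult_distrib)
  thus ?thesis by (rule power2_le_imp_le) simp
qed simp

lemma bounded_bilinear_cinner: "bounded_bilinear (cinner :: 'a::complex_hilbert \<Rightarrow> _)"
proof
  fix a b :: 'a and r :: real
  show "cinner (r *\<^sub>R a) b = r *\<^sub>R cinner a b" "cinner a (r *\<^sub>R b) = r *\<^sub>R cinner a b"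
    by (simp_all add: scaleC_of_real[symmetric] scaleR_conv_of_real)
  show "\<exists>K. \<forall>a b. norm (cinner (a::'a) b) \<le> norm a * norm b * K"
    by (rule exI[of _ 1]) (simp add: cmod_cinner_le)
qed (simp_all add: cinner_add_left cinner_add_right)

lemmas tendsto_cinner [tendsto_intros] = bounded_bilinear.tendsto[OF bounded_bilinear_cinner]

lemma bounded_linear_scaleC: "bounded_linear (\<lambda>x::'a::complex_hilbert. c *\<^sub>C x)"
proof
  fix r :: real and b :: 'a
  show "c *\<^sub>C (r *\<^sub>R b) = r *\<^sub>R (c *\<^sub>C b)"
    by (simp add: scaleC_of_real[symmetric] mult.commute)
  show "\<exists>K. \<forall>x::'a. norm (c *\<^sub>C x) \<le> norm x * K"
    by (rule exI[of _ "cmod c"]) (simp add: mult.commute)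
qed (simp add: scaleC_add_right)

lemmas tendsto_scaleC [tendsto_intros] = bounded_linear.tendsto[OF bounded_linear_scaleC]

text \<open>The left argument is conjugate linear, so replacing \<open>x\<close> by
  \<open>\<i> *\<^sub>C x\<close> multiplies the inner product by \<open>- \<i>\<close> and turns
  its imaginary part into a real part. Consequence in use: linear isometries preserve
  \<open>cinner\<close>.\<close>

lemma polarization:
  fixes x y :: "'a::complex_hilbert"
  shows "cinner x y = Complex (((norm (x + y))\<^sup>2 - (norm x)\<^sup>2 - (norm y)\<^sup>2) / 2)
     (((norm (\<i> *\<^sub>C x + y))\<^sup>2 - (norm x)\<^sup>2 - (norm y)\<^sup>2) / 2)"
  by (simp add: norm_add_sq complex_eq_iff)

subsection \<open>Unitary operators\<close>

text \<open>The inverse is carried as a second parameter, to be filled with \<open>walk_inv\<close>;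
  its linearity and isometry follow from those of \<open>U\<close>.\<close>

locale unitary_op =
  fixes U V :: "'a::complex_hilbert \<Rightarrow> 'a"
  assumes U_add: "U (x + y) = U x + U y"
    and U_scaleC: "U (c *\<^sub>C x) = c *\<^sub>C U x"
    and U_norm [simp]: "norm (U x) = norm x"
    and UV [simp]: "U (V x) = x"
    and VU [simp]: "V (U x) = x"
begin

lemma V_add: "V (x + y) = V x + V y"
  by (metis U_add UV VU)

lemma V_scaleC: "V (c *\<^sub>C x) = c *\<^sub>C V x"
  by (metis U_scaleC UV VU)

lemma V_norm [simp]: "norm (V x) = norm x"
  by (metis U_norm UV)

text \<open>The same case split as in \<open>walk_pow\<close>, so that the two correspond directly
  under \<open>Rep_l2state\<close>.\<close>

definition upow :: "int \<Rightarrow> 'a \<Rightarrow> 'a" where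
  "upow n = (if 0 \<le> n then U ^^ nat n else V ^^ nat (- n))"

lemma upow_0 [simp]: "upow 0 x = x"
  by (simp add: upow_def)

lemma upow_of_nat: "upow (int n) = U ^^ n"
  by (simp add: upow_def)

lemma upow_minus_of_nat: "upow (- int n) = V ^^ n"
  by (cases n) (simp_all add: upow_def nat_add_distrib)

lemma upow_succ: "upow (n + 1) x = U (upow n x)"
proof (cases "0 \<le> n")
  case True
  thus ?thesis by (simp add: upow_def nat_add_distrib)
next
  case False
  then obtain m where "n = - int (Suc m)" by (metis add.commute int_cases linorder_not_le of_nat_0_le_iff)
  thus ?thesis using upow_minus_of_nat[of m] upow_minus_of_nat[of "Suc m"] by simp
qed

lemma upow_pred: "upow (n - 1) x = V (upow n x)"
  using upow_succ[of "n - 1" x] by simp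

lemma upow_add: "upow (m + n) x = upow m (upow n x)"
proof (induction m rule: int_induct[where k = 0])
  case (step1 i)
  thus ?case using upow_succ[of "i + n" x] upow_succ[of i] by (simp add: add_ac)
next
  case (step2 i)
  thus ?case using upow_pred[of "i + n" x] upow_pred[of i] by (simp add: algebra_simps)
qed simp

lemma upow_1 [simp]: "upow 1 x = U x"
  using upow_succ[of 0] by simp

lemma upow_inv [simp]: "upow n (upow (- n) x) = x" "upow (- n) (upow n x) = x"
  using upow_add[of n "- n" x] upow_add[of "- n" n x] by simp_all

lemma upow_plus: "upow n (x + y) = upow n x + upow n y"
proof (induction n rule: int_induct[where k = 0])
  case (step1 i) thus ?case by (simp add: upow_succ U_add)
next
  case (step2 i) thus ?case by (simp add: upow_pred V_add)
qed simp

lemma upow_scaleC: "upow n (c *\<^sub>C x) = c *\<^sub>C upow n x"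
proof (induction n rule: int_induct[where k = 0])
  case (step1 i) thus ?case by (simp add: upow_succ U_scaleC)
next
  case (step2 i) thus ?case by (simp add: upow_pred V_scaleC)
qed simp

lemma upow_norm [simp]: "norm (upow n x) = norm x"
proof (induction n rule: int_induct[where k = 0])
  case (step1 i) thus ?case by (simp add: upow_succ)
next
  case (step2 i) thus ?case by (simp add: upow_pred)
qed simp

lemma upow_minus: "upow n (- x) = - upow n x"
  using upow_scaleC[of n "-1" x] by (simp add: scaleC_minus_one)

lemma upow_diff: "upow n (x - y) = upow n x - upow n y"
  using upow_plus[of n x "- y"] by (simp add: upow_minus)

lemma upow_zero [simp]: "upow n 0 = 0"
  using upow_scaleC[of n 0 0] by simp

lemma upow_sum: "upow n (\<Sum>i\<in>I. f i) = (\<Sum>i\<in>I. upow n (f i))"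
  by (induction I rule: infinite_finite_induct) (auto simp: upow_plus)

lemma upow_cinner [simp]: "cinner (upow n x) (upow n y) = cinner x y"
  unfolding polarization[of "upow n x"] polarization[of x]
  by (simp add: upow_plus[symmetric] upow_scaleC[symmetric])

lemma upow_cinner_right: "cinner x (upow n y) = cinner (upow (- n) x) y"
  using upow_cinner[of n "upow (- n) x" y] by simp

lemma upow_bounded_linear: "bounded_linear (upow n)"
proof
  show "upow n (r *\<^sub>R b) = r *\<^sub>R upow n b" for r b
    by (simp add: scaleC_of_real[symmetric] upow_scaleC)
  show "\<exists>K. \<forall>x. norm (upow n x) \<le> norm x * K"
    by (rule exI[of _ 1]) simp
qed (simp add: upow_plus)

lemmas tendsto_upow = bounded_linear.tendsto[OF upow_bounded_linear]

lemma U_cinner [simp]: "cinner (U x) (U y) = cinner x y"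
  using upow_cinner[of 1] by simp

end

subsection \<open>Trigonometric polynomials\<close>

definition fin_coeffs :: "(int \<Rightarrow> complex) \<Rightarrow> bool" where
  "fin_coeffs c \<longleftrightarrow> finite {n. c n \<noteq> 0}"

text \<open>Finiteness of the support is kept as a separate predicate. For an infinite support the
  sum is 0 by convention, so scaling and shifting hold without it, while addition asks for
  it.\<close>

definition trig :: "(int \<Rightarrow> complex) \<Rightarrow> real \<Rightarrow> complex" where
  "trig c \<theta> = (\<Sum>n | c n \<noteq> 0. c n * cis (of_int n * \<theta>))"

lemma trig_superset:
  "finite F \<Longrightarrow> {n. c n \<noteq> 0} \<subseteq> F \<Longrightarrow> trig c \<theta> = (\<Sum>n\<in>F. c n * cis (of_int n * \<theta>))"
  unfolding trig_def by (rule sum.mono_neutral_left) auto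

lemma fin_coeffs_add: "fin_coeffs c \<Longrightarrow> fin_coeffs d \<Longrightarrow> fin_coeffs (\<lambda>n. c n + d n)"
  unfolding fin_coeffs_def by (rule finite_subset[of _ "{n. c n \<noteq> 0} \<union> {n. d n \<noteq> 0}"]) auto

lemma fin_coeffs_scale: "fin_coeffs c \<Longrightarrow> fin_coeffs (\<lambda>n. a * c n)"
  unfolding fin_coeffs_def by (rule finite_subset[of _ "{n. c n \<noteq> 0}"]) auto

lemma fin_coeffs_shift:
  assumes "fin_coeffs c" shows "fin_coeffs (\<lambda>n. c (n - m))"
proof -
  have "{n. c (n - m) \<noteq> 0} = (+) m ` {n. c n \<noteq> 0}"
    by (force simp: image_iff)
  thus ?thesis using assms by (simp add: fin_coeffs_def)
qed

lemma trig_add: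
  assumes "fin_coeffs c" "fin_coeffs d"
  shows "trig (\<lambda>n. c n + d n) \<theta> = trig c \<theta> + trig d \<theta>"
proof -
  let ?F = "{n. c n \<noteq> 0} \<union> {n. d n \<noteq> 0}"
  have F: "finite ?F" using assms by (simp add: fin_coeffs_def)
  show ?thesis
    by (subst (1 2 3) trig_superset[OF F]) (auto simp: sum.distrib algebra_simps)
qed

lemma trig_scale: "trig (\<lambda>n. a * c n) \<theta> = a * trig c \<theta>"
  by (cases "a = 0") (simp_all add: trig_def sum_distrib_left mult.assoc)

lemma trig_diff:
  assumes "fin_coeffs c" "fin_coeffs d"
  shows "trig (\<lambda>n. c n - d n) \<theta> = trig c \<theta> - trig d \<theta>"
  using trig_add[OF assms(1) fin_coeffs_scale[OF assms(2), of "-1"], of \<theta>] trig_scale[of "-1" d \<theta>]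
  by simp

lemma trig_shift: "trig (\<lambda>n. c (n - m)) \<theta> = cis (of_int m * \<theta>) * trig c \<theta>"
proof -
  have "{n. c (n - m) \<noteq> 0} = (+) m ` {n. c n \<noteq> 0}"
    by (force simp: image_iff)
  hence "trig (\<lambda>n. c (n - m)) \<theta> = (\<Sum>n | c n \<noteq> 0. c n * cis (of_int (m + n) * \<theta>))"
    unfolding trig_def by (simp add: sum.reindex)
  also have "\<dots> = (\<Sum>n | c n \<noteq> 0. cis (of_int m * \<theta>) * (c n * cis (of_int n * \<theta>)))"
  proof (intro sum.cong refl)
    fix n
    have "cis (of_int (m + n) * \<theta>) = cis (of_int m * \<theta>) * cis (of_int n * \<theta>)"
      by (simp add: cis_mult distrib_right)
    thus "c n * cis (of_int (m + n) * \<theta>) = cis (of_int m * \<theta>) * (c n * cis (of_int n * \<theta>))" by simp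
  qed
  finally show ?thesis unfolding trig_def by (simp add: sum_distrib_left)
qed

definition trig_polys :: "(real \<Rightarrow> complex) set" where
  "trig_polys = {trig c | c. fin_coeffs c}"

lemma trig_polysI: "fin_coeffs c \<Longrightarrow> (\<And>\<theta>. f \<theta> = trig c \<theta>) \<Longrightarrow> f \<in> trig_polys"
  unfolding trig_polys_def by auto

lemma trig_polysE:
  assumes "f \<in> trig_polys"
  obtains c where "fin_coeffs c" "f = trig c"
  using assms unfolding trig_polys_def by auto

lemma trig_polys_add:
  assumes "f \<in> trig_polys" "g \<in> trig_polys"
  shows "(\<lambda>\<theta>. f \<theta> + g \<theta>) \<in> trig_polys"
  by (rule trig_polysE[OF assms(1)], rule trig_polysE[OF assms(2)])
    (auto intro: trig_polysI[OF fin_coeffs_add] simp: trig_add)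

lemma trig_polys_scale: "f \<in> trig_polys \<Longrightarrow> (\<lambda>\<theta>. a * f \<theta>) \<in> trig_polys"
  by (erule trig_polysE) (auto intro: trig_polysI[OF fin_coeffs_scale] simp: trig_scale)

lemma trig_polys_shift: "f \<in> trig_polys \<Longrightarrow> (\<lambda>\<theta>. cis (of_int m * \<theta>) * f \<theta>) \<in> trig_polys"
  by (erule trig_polysE) (auto intro: trig_polysI[OF fin_coeffs_shift] simp: trig_shift)

lemma trig_single: "trig (\<lambda>n. if n = m then 1 else 0) = (\<lambda>\<theta>. cis (of_int m * \<theta>))"
  using trig_superset[of "{m}" "\<lambda>n. if n = m then 1 else 0"] by auto

lemma fin_coeffs_single: "fin_coeffs (\<lambda>n. if n = m then a else 0)"
  unfolding fin_coeffs_def by (rule finite_subset[of _ "{m}"]) auto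

lemma trig_polys_cis: "(\<lambda>\<theta>. cis (of_int m * \<theta>)) \<in> trig_polys"
  by (rule trig_polysI[OF fin_coeffs_single[of m 1]]) (simp add: trig_single)

lemma trig_polys_const: "(\<lambda>\<theta>. a) \<in> trig_polys"
  using trig_polys_scale[OF trig_polys_cis[of 0], of a] by simp

lemma trig_polys_sum:
  "(\<And>i. i \<in> I \<Longrightarrow> f i \<in> trig_polys) \<Longrightarrow> (\<lambda>\<theta>. \<Sum>i\<in>I. f i \<theta>) \<in> trig_polys"
  by (induction I rule: infinite_finite_induct)
    (use trig_polys_const[of 0] in \<open>auto intro: trig_polys_add\<close>)

lemma trig_polys_mult:
  assumes "f \<in> trig_polys" "g \<in> trig_polys"
  shows "(\<lambda>\<theta>. f \<theta> * g \<theta>) \<in> trig_polys"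
proof -
  obtain c where c: "f = trig c" using assms(1) by (auto simp: trig_polys_def)
  have "(\<lambda>\<theta>. \<Sum>n | c n \<noteq> 0. c n * (cis (of_int n * \<theta>) * g \<theta>)) \<in> trig_polys"
    by (intro trig_polys_sum trig_polys_scale trig_polys_shift assms)
  thus ?thesis unfolding c trig_def by (simp add: sum_distrib_right mult.assoc)
qed

text \<open>Induction over the polynomial. The base case is a real-linear functional on the plane;
  on the circle it is a combination of cosine and sine, hence of the frequencies 1 and -1.\<close>

lemma trig_polys_real_polynomial_cis:
  "real_polynomial_function g \<Longrightarrow> (\<lambda>\<theta>. complex_of_real (g (cis \<theta>))) \<in> trig_polys"
proof (induction g rule: real_polynomial_function.induct)
  case (linear f)
  have f: "f z = Re z * f 1 + Im z * f \<i>" for z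
  proof -
    have "z = Re z *\<^sub>R 1 + Im z *\<^sub>R \<i>" by (simp add: complex_eq_iff)
    hence "f z = f (Re z *\<^sub>R 1 + Im z *\<^sub>R \<i>)" by simp
    thus ?thesis using linear by (simp add: linear_simps)
  qed
  have "(\<lambda>\<theta>. of_real (f 1) * (1/2 * cis (of_int 1 * \<theta>) + 1/2 * cis (of_int (-1) * \<theta>)) +
      of_real (f \<i>) * (- \<i>/2 * cis (of_int 1 * \<theta>) + \<i>/2 * cis (of_int (-1) * \<theta>))) \<in> trig_polys"
    by (intro trig_polys_add trig_polys_scale trig_polys_cis)
  also have "(\<lambda>\<theta>. of_real (f 1) * (1/2 * cis (of_int 1 * \<theta>) + 1/2 * cis (of_int (-1) * \<theta>)) +
      of_real (f \<i>) * (- \<i>/2 * cis (of_int 1 * \<theta>) + \<i>/2 * cis (of_int (-1) * \<theta>))) =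
      (\<lambda>\<theta>. complex_of_real (f (cis \<theta>)))"
    by (rule ext, subst f) (simp add: complex_eq_iff)
  finally show ?case .
qed (use trig_polys_const trig_polys_add trig_polys_mult in \<open>simp_all\<close>)

text \<open>Stone-Weierstrass is applied on the unit circle inside the plane rather than on an
  interval, which has periodicity built in.\<close>

lemma trig_uniform_approx:
  fixes F :: "complex \<Rightarrow> real"
  assumes "continuous_on UNIV F" "e > 0"
  obtains c where "fin_coeffs c" "\<And>\<theta>. cmod (trig c \<theta> - of_real (F (cis \<theta>))) < e"
proof -
  obtain g where g: "real_polynomial_function g" "\<And>z. z \<in> sphere 0 1 \<Longrightarrow> \<bar>F z - g z\<bar> < e"
    using Stone_Weierstrass_real_polynomial_function[of "sphere 0 (1::real)" F e]
      assms continuous_on_subset by (metis compact_sphere subset_UNIV)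
  obtain c where c: "fin_coeffs c" "trig c = (\<lambda>\<theta>. complex_of_real (g (cis \<theta>)))"
    using trig_polys_real_polynomial_cis[OF g(1)] unfolding trig_polys_def by force
  show thesis
  proof
    fix \<theta>
    have "cmod (trig c \<theta> - of_real (F (cis \<theta>))) = \<bar>F (cis \<theta>) - g (cis \<theta>)\<bar>"
      unfolding c(2) of_real_diff[symmetric] norm_of_real by simp
    thus "cmod (trig c \<theta> - of_real (F (cis \<theta>))) < e" using g(2)[of "cis \<theta>"] by simp
  qed fact
qed

lemma continuous_trig: "continuous_on S (trig c)"
  unfolding trig_def[abs_def] cis_conv_exp by (intro continuous_intros)

lemma trig_measurable [measurable]: "trig c \<in> borel_measurable borel"
  by (rule borel_measurable_continuous_onI[OF continuous_trig])

lemma trig_bounded: "cmod (trig c \<theta>) \<le> (\<Sum>n | c n \<noteq> 0. cmod (c n))"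
  unfolding trig_def by (rule sum_norm_le) (simp add: norm_mult)

subsection \<open>Approximation in mean square\<close>

lemma cmod_add_sq_le: "(cmod (a + b))\<^sup>2 \<le> 2 * (cmod a)\<^sup>2 + 2 * (cmod b)\<^sup>2"
proof -
  have "(cmod (a + b))\<^sup>2 \<le> (cmod a + cmod b)\<^sup>2"
    by (intro power_mono norm_triangle_ineq) simp
  also have "\<dots> \<le> 2 * (cmod a)\<^sup>2 + 2 * (cmod b)\<^sup>2"
    using sum_squares_bound[of "cmod a" "cmod b"] by (simp add: power2_sum)
  finally show ?thesis .
qed

abbreviation (input) "circ \<equiv> {0..<2 * pi}"

lemma integral_sq_add_le:
  fixes f g :: "'b \<Rightarrow> complex"
  assumes m: "f \<in> borel_measurable M" "g \<in> borel_measurable M"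
    and i: "integrable M (\<lambda>x. (cmod (f x))\<^sup>2)" "integrable M (\<lambda>x. (cmod (g x))\<^sup>2)"
  shows "integrable M (\<lambda>x. (cmod (f x + g x))\<^sup>2)"
    and "(\<integral>x. (cmod (f x + g x))\<^sup>2 \<partial>M) \<le> 2 * (\<integral>x. (cmod (f x))\<^sup>2 \<partial>M) + 2 * (\<integral>x. (cmod (g x))\<^sup>2 \<partial>M)"
proof -
  have i2: "integrable M (\<lambda>x. 2 * (cmod (f x))\<^sup>2 + 2 * (cmod (g x))\<^sup>2)" using i by simp
  show 1: "integrable M (\<lambda>x. (cmod (f x + g x))\<^sup>2)"
    by (rule Bochner_Integration.integrable_bound[OF i2])
      (use m cmod_add_sq_le in \<open>auto intro!: AE_I2 simp: abs_of_nonneg\<close>)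
  have "(\<integral>x. (cmod (f x + g x))\<^sup>2 \<partial>M) \<le> (\<integral>x. 2 * (cmod (f x))\<^sup>2 + 2 * (cmod (g x))\<^sup>2 \<partial>M)"
    by (rule integral_mono[OF 1 i2]) (rule cmod_add_sq_le)
  also have "\<dots> = 2 * (\<integral>x. (cmod (f x))\<^sup>2 \<partial>M) + 2 * (\<integral>x. (cmod (g x))\<^sup>2 \<partial>M)" using i by simp
  finally show "(\<integral>x. (cmod (f x + g x))\<^sup>2 \<partial>M) \<le> 2 * (\<integral>x. (cmod (f x))\<^sup>2 \<partial>M) + 2 * (\<integral>x. (cmod (g x))\<^sup>2 \<partial>M)" .
qed

section \<open>Integration against finite measures on the circle\<close>

locale circle_measure = finite_measure \<mu> for \<mu> :: "real measure" +
  assumes sets_eq: "sets \<mu> = sets (restrict_space lborel circ)"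
begin

lemma space_eq: "space \<mu> = circ"
  using sets_eq_imp_space_eq[OF sets_eq] by (simp add: space_restrict_space)

lemma borel_measurableI:
  assumes "f \<in> borel_measurable borel"
  shows "f \<in> borel_measurable \<mu>"
proof -
  have "f \<in> borel_measurable (restrict_space lborel circ)"
    using assms by (intro measurable_restrict_space1) simp
  thus ?thesis using measurable_cong_sets[OF sets_eq refl] by blast
qed

lemma integrable_bounded:
  fixes f :: "real \<Rightarrow> 'b::{banach, second_countable_topology}"
  shows "f \<in> borel_measurable \<mu> \<Longrightarrow> (\<And>\<theta>. \<theta> \<in> circ \<Longrightarrow> norm (f \<theta>) \<le> B) \<Longrightarrow> integrable \<mu> f"
  by (rule integrable_const_bound[of _ B]) (auto simp: space_eq)

lemma trig_borel [measurable]: "trig c \<in> borel_measurable \<mu>"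
  by (rule borel_measurableI[OF trig_measurable])

lemma cis_borel [measurable]: "(\<lambda>\<theta>. cis (a * \<theta>)) \<in> borel_measurable \<mu>"
  unfolding cis_conv_exp
  by (intro borel_measurableI borel_measurable_continuous_onI continuous_intros)

lemma integrable_sq:
  fixes f :: "real \<Rightarrow> complex"
  assumes "f \<in> borel_measurable \<mu>" "\<And>\<theta>. \<theta> \<in> circ \<Longrightarrow> cmod (f \<theta>) \<le> B"
  shows "integrable \<mu> (\<lambda>\<theta>. (cmod (f \<theta>))\<^sup>2)"
  by (rule integrable_bounded[of _ "B\<^sup>2"]) (use assms in \<open>auto intro!: power_mono\<close>)

definition bdd :: "(real \<Rightarrow> complex) \<Rightarrow> bool" where
  "bdd f \<longleftrightarrow> f \<in> borel_measurable \<mu> \<and> (\<exists>B. \<forall>\<theta>\<in>circ. cmod (f \<theta>) \<le> B)"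

lemma bddI: "f \<in> borel_measurable \<mu> \<Longrightarrow> (\<And>\<theta>. \<theta> \<in> circ \<Longrightarrow> cmod (f \<theta>) \<le> B) \<Longrightarrow> bdd f"
  unfolding bdd_def by blast

lemma bdd_measurable: "bdd f \<Longrightarrow> f \<in> borel_measurable \<mu>"
  by (simp add: bdd_def)

lemma bdd_integrable: "bdd f \<Longrightarrow> integrable \<mu> f"
  using integrable_bounded unfolding bdd_def by blast

lemma bdd_integrable_sq: "bdd f \<Longrightarrow> integrable \<mu> (\<lambda>\<theta>. (cmod (f \<theta>))\<^sup>2)"
  using integrable_sq unfolding bdd_def by blast

lemma bdd_trig: "bdd (trig c)"
  by (rule bddI[OF trig_borel trig_bounded])

lemma bdd_cis: "bdd (\<lambda>\<theta>. cis (a * \<theta>))"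
  by (rule bddI[where B = 1]) auto

lemma bdd_add: assumes "bdd f" "bdd g" shows "bdd (\<lambda>\<theta>. f \<theta> + g \<theta>)"
proof -
  obtain A B where B: "\<And>\<theta>. \<theta> \<in> circ \<Longrightarrow> cmod (f \<theta>) \<le> A" "\<And>\<theta>. \<theta> \<in> circ \<Longrightarrow> cmod (g \<theta>) \<le> B"
    using assms unfolding bdd_def by blast
  have "cmod (f \<theta> + g \<theta>) \<le> A + B" if "\<theta> \<in> circ" for \<theta>
    using norm_triangle_ineq[of "f \<theta>" "g \<theta>"] B[OF that] by simp
  moreover have "(\<lambda>\<theta>. f \<theta> + g \<theta>) \<in> borel_measurable \<mu>"
    using assms by (intro borel_measurable_add bdd_measurable)
  ultimately show ?thesis by (rule bddI[rotated])
qed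

lemma bdd_mult: assumes "bdd f" "bdd g" shows "bdd (\<lambda>\<theta>. f \<theta> * g \<theta>)"
proof -
  obtain A B where B: "\<And>\<theta>. \<theta> \<in> circ \<Longrightarrow> cmod (f \<theta>) \<le> A" "\<And>\<theta>. \<theta> \<in> circ \<Longrightarrow> cmod (g \<theta>) \<le> B"
    using assms unfolding bdd_def by blast
  have "cmod (f \<theta> * g \<theta>) \<le> A * B" if "\<theta> \<in> circ" for \<theta>
    unfolding norm_mult using B[OF that] by (meson mult_mono norm_ge_zero order_trans)
  moreover have "(\<lambda>\<theta>. f \<theta> * g \<theta>) \<in> borel_measurable \<mu>"
    using assms by (intro borel_measurable_times bdd_measurable)
  ultimately show ?thesis by (rule bddI[rotated])
qed

lemma bdd_const: "bdd (\<lambda>_. a)"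
  by (rule bddI[where B = "cmod a"]) auto

lemma bdd_cnj: "bdd f \<Longrightarrow> bdd (\<lambda>\<theta>. cnj (f \<theta>))"
  unfolding bdd_def
  by (auto intro!: borel_measurable_continuous_on[where f = cnj] continuous_intros)

lemma bdd_diff: "bdd f \<Longrightarrow> bdd g \<Longrightarrow> bdd (\<lambda>\<theta>. f \<theta> - g \<theta>)"
  using bdd_add[of f "\<lambda>\<theta>. (-1) * g \<theta>"] bdd_mult[OF bdd_const, of g "-1"] by simp

lemma bdd_indicator: "B \<in> sets borel \<Longrightarrow> bdd (indicator B)"
  by (rule bddI[where B = 1]) (auto intro!: borel_measurableI split: split_indicator)

lemma set_borel: "B \<in> sets \<mu> \<Longrightarrow> B \<in> sets borel"
  unfolding sets_eq by (auto simp: sets_restrict_space)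

lemma integral_sq_indicator:
  assumes "B \<in> sets borel"
  shows "(\<integral>\<theta>. (cmod (indicator B \<theta>))\<^sup>2 \<partial>\<mu>) = measure \<mu> (B \<inter> circ)"
proof -
  have "(\<integral>\<theta>. (cmod (indicator B \<theta>))\<^sup>2 \<partial>\<mu>) = (\<integral>\<theta>. indicator (B \<inter> circ) \<theta> \<partial>\<mu>)"
    by (rule Bochner_Integration.integral_cong) (auto simp: space_eq split: split_indicator)
  also have "\<dots> = measure \<mu> (B \<inter> circ \<inter> space \<mu>)" by (rule Bochner_Integration.integral_indicator)
  finally show ?thesis by (simp add: space_eq Int_absorb2 inf_assoc)
qed

text \<open>Only the Fourier coefficients of \<open>\<mu>\<close> enter the right-hand side. For
  spectral measures they are correlations, for Lebesgue measure they vanish off the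
  diagonal.\<close>

lemma integral_trig_sq:
  "complex_of_real (\<integral>\<theta>. (cmod (trig c \<theta>))\<^sup>2 \<partial>\<mu>) =
    (\<Sum>m | c m \<noteq> 0. \<Sum>n | c n \<noteq> 0. cnj (c m) * c n * (\<integral>\<theta>. cis (of_int (n - m) * \<theta>) \<partial>\<mu>))"
proof -
  let ?F = "{n. c n \<noteq> 0}"
  have int: "integrable \<mu> (\<lambda>\<theta>. a * cis (of_int m * \<theta>))" for a m
    by (intro bdd_integrable bdd_mult bdd_const bdd_cis)
  have pw: "complex_of_real ((cmod (trig c \<theta>))\<^sup>2) =
      (\<Sum>m\<in>?F. \<Sum>n\<in>?F. cnj (c m) * c n * cis (of_int (n - m) * \<theta>))" for \<theta>
  proof -
    have "complex_of_real ((cmod (trig c \<theta>))\<^sup>2) = cnj (trig c \<theta>) * trig c \<theta>"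
      by (simp add: complex_norm_square[symmetric] mult.commute)
    also have "\<dots> = (\<Sum>m\<in>?F. \<Sum>n\<in>?F. cnj (c m * cis (of_int m * \<theta>)) * (c n * cis (of_int n * \<theta>)))"
      unfolding trig_def cnj_sum by (rule sum_product)
    also have "\<dots> = (\<Sum>m\<in>?F. \<Sum>n\<in>?F. cnj (c m) * c n * cis (of_int (n - m) * \<theta>))"
    proof (intro sum.cong refl)
      fix m n
      have "cis (of_int (n - m) * \<theta>) = cnj (cis (of_int m * \<theta>)) * cis (of_int n * \<theta>)"
        by (simp add: cis_cnj cis_mult algebra_simps)
      thus "cnj (c m * cis (of_int m * \<theta>)) * (c n * cis (of_int n * \<theta>)) =
          cnj (c m) * c n * cis (of_int (n - m) * \<theta>)" by simp
    qed
    finally show ?thesis .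
  qed
  have "complex_of_real (\<integral>\<theta>. (cmod (trig c \<theta>))\<^sup>2 \<partial>\<mu>) = (\<integral>\<theta>. complex_of_real ((cmod (trig c \<theta>))\<^sup>2) \<partial>\<mu>)"
    by (rule integral_complex_of_real[symmetric])
  also have "\<dots> = (\<Sum>m\<in>?F. \<Sum>n\<in>?F. \<integral>\<theta>. cnj (c m) * c n * cis (of_int (n - m) * \<theta>) \<partial>\<mu>)"
    unfolding pw using int by (simp only: Bochner_Integration.integral_sum Bochner_Integration.integrable_sum)
  finally show ?thesis unfolding integral_mult_right_zero .
qed

end

lemma circle_measureI:
  "emeasure \<mu> (space \<mu>) \<noteq> \<infinity> \<Longrightarrow> sets \<mu> = sets (restrict_space lborel circ) \<Longrightarrow> circle_measure \<mu>"
  by (intro circle_measure.intro finite_measureI circle_measure_axioms.intro)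

text \<open>A single polynomial has to serve every measure of the family; this is what later allows
  the masses of different spectral measures to be compared.\<close>

definition l2_approx :: "real measure set \<Rightarrow> (real \<Rightarrow> complex) \<Rightarrow> bool" where
  "l2_approx \<M> f \<longleftrightarrow> (\<forall>\<epsilon>>0. \<exists>c. fin_coeffs c \<and>
     (\<forall>\<mu>\<in>\<M>. (\<integral>\<theta>. (cmod (trig c \<theta> - f \<theta>))\<^sup>2 \<partial>\<mu>) < \<epsilon>))"

locale circle_measures =
  fixes \<M> :: "real measure set"
  assumes finite_family: "finite \<M>"
    and circle: "\<And>\<mu>. \<mu> \<in> \<M> \<Longrightarrow> circle_measure \<mu>"
begin

definition bdd_meas :: "(real \<Rightarrow> complex) \<Rightarrow> bool" where
  "bdd_meas f \<longleftrightarrow> (\<forall>\<mu>\<in>\<M>. circle_measure.bdd \<mu> f)"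

lemma l2_approx_continuous:
  fixes F :: "complex \<Rightarrow> real"
  assumes "continuous_on UNIV F"
  shows "l2_approx \<M> (\<lambda>\<theta>. of_real (F (cis \<theta>)))"
  unfolding l2_approx_def
proof (intro allI impI)
  fix e :: real assume e: "e > 0"
  \<comment> \<open>The added 1 makes \<open>m\<close> strictly larger than each total mass, and
    positive even for an empty family.\<close>
  define m where "m = (\<Sum>\<mu>\<in>\<M>. measure \<mu> circ) + 1"
  have m: "m > 0" "measure \<mu> circ < m" if "\<mu> \<in> \<M>" for \<mu>
    using member_le_sum[OF that, of "\<lambda>\<mu>. measure \<mu> circ"] finite_family
      sum_nonneg[of \<M> "\<lambda>\<mu>. measure \<mu> circ"] by (auto simp: m_def)
  have m0: "m > 0" using sum_nonneg[of \<M> "\<lambda>\<mu>. measure \<mu> circ"] by (simp add: m_def add_nonneg_pos)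
  obtain c where c: "fin_coeffs c" "\<And>\<theta>. cmod (trig c \<theta> - of_real (F (cis \<theta>))) < sqrt (e / m)"
    using trig_uniform_approx[OF assms, of "sqrt (e / m)"] e m0 by auto
  have "(\<integral>\<theta>. (cmod (trig c \<theta> - of_real (F (cis \<theta>))))\<^sup>2 \<partial>\<mu>) < e" if \<mu>: "\<mu> \<in> \<M>" for \<mu>
  proof -
    interpret circle_measure \<mu> by (rule circle[OF \<mu>])
    have b: "(cmod (trig c \<theta> - of_real (F (cis \<theta>))))\<^sup>2 \<le> e / m" for \<theta>
    proof -
      have "(cmod (trig c \<theta> - of_real (F (cis \<theta>))))\<^sup>2 \<le> (sqrt (e/m))\<^sup>2"
        using c(2)[of \<theta>] by (intro power_mono) auto
      thus ?thesis using e m0 by simp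
    qed
    have [measurable]: "(\<lambda>\<theta>. F (cis \<theta>)) \<in> borel_measurable \<mu>"
      by (intro borel_measurableI borel_measurable_continuous_onI continuous_on_compose2[OF assms])
        (auto simp: cis_conv_exp intro!: continuous_intros)
    have "integrable \<mu> (\<lambda>\<theta>. (cmod (trig c \<theta> - of_real (F (cis \<theta>))))\<^sup>2)"
      by (rule integrable_bounded[of _ "e/m"]) (use b in auto)
    hence "(\<integral>\<theta>. (cmod (trig c \<theta> - of_real (F (cis \<theta>))))\<^sup>2 \<partial>\<mu>) \<le> (\<integral>\<theta>. e / m \<partial>\<mu>)"
      by (intro integral_mono) (use b in auto)
    also have "\<dots> = measure \<mu> circ * (e / m)" by (simp add: space_eq)
    also have "\<dots> < m * (e / m)" using m(2)[OF \<mu>] e m0 by (intro mult_strict_right_mono) auto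
    finally show ?thesis using m0 by simp
  qed
  thus "\<exists>c. fin_coeffs c \<and> (\<forall>\<mu>\<in>\<M>. (\<integral>\<theta>. (cmod (trig c \<theta> - of_real (F (cis \<theta>))))\<^sup>2 \<partial>\<mu>) < e)"
    using c(1) by blast
qed

lemma l2_approx_limit:
  assumes f: "bdd_meas f"
    and appr: "\<And>\<epsilon>. \<epsilon> > 0 \<Longrightarrow>
      \<exists>g. bdd_meas g \<and> l2_approx \<M> g \<and> (\<forall>\<mu>\<in>\<M>. (\<integral>\<theta>. (cmod (g \<theta> - f \<theta>))\<^sup>2 \<partial>\<mu>) < \<epsilon>)"
  shows "l2_approx \<M> f"
  unfolding l2_approx_def
proof (intro allI impI)
  fix e :: real assume e: "e > 0"
  \<comment> \<open>A quarter for each error, since the square of a sum of two terms costs a factor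
    2 on both.\<close>
  obtain g where g: "bdd_meas g" "l2_approx \<M> g"
     "\<And>\<mu>. \<mu> \<in> \<M> \<Longrightarrow> (\<integral>\<theta>. (cmod (g \<theta> - f \<theta>))\<^sup>2 \<partial>\<mu>) < e / 4"
    using appr[of "e/4"] e by auto
  obtain c where c: "fin_coeffs c" "\<And>\<mu>. \<mu> \<in> \<M> \<Longrightarrow> (\<integral>\<theta>. (cmod (trig c \<theta> - g \<theta>))\<^sup>2 \<partial>\<mu>) < e / 4"
    using g(2) e unfolding l2_approx_def by (metis zero_less_divide_iff zero_less_numeral)
  have "(\<integral>\<theta>. (cmod (trig c \<theta> - f \<theta>))\<^sup>2 \<partial>\<mu>) < e" if \<mu>: "\<mu> \<in> \<M>" for \<mu>
  proof -
    interpret circle_measure \<mu> by (rule circle[OF \<mu>])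
    have b: "bdd f" "bdd g" using f g(1) \<mu> by (auto simp: bdd_meas_def)
    have "(\<integral>\<theta>. (cmod (trig c \<theta> - f \<theta>))\<^sup>2 \<partial>\<mu>) = (\<integral>\<theta>. (cmod ((trig c \<theta> - g \<theta>) + (g \<theta> - f \<theta>)))\<^sup>2 \<partial>\<mu>)"
      by simp
    also have "\<dots> \<le> 2 * (\<integral>\<theta>. (cmod (trig c \<theta> - g \<theta>))\<^sup>2 \<partial>\<mu>) + 2 * (\<integral>\<theta>. (cmod (g \<theta> - f \<theta>))\<^sup>2 \<partial>\<mu>)"
      by (intro integral_sq_add_le(2) bdd_measurable bdd_integrable_sq bdd_diff bdd_trig b)
    also have "\<dots> < e" using c(2)[OF \<mu>] g(3)[OF \<mu>] by simp
    finally show ?thesis .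
  qed
  thus "\<exists>c. fin_coeffs c \<and> (\<forall>\<mu>\<in>\<M>. (\<integral>\<theta>. (cmod (trig c \<theta> - f \<theta>))\<^sup>2 \<partial>\<mu>) < e)"
    using c(1) by blast
qed

text \<open>Dominated convergence works for each measure separately; because the family is finite,
  one index is good for all of them.\<close>

lemma l2_approx_pointwise_limit:
  assumes f: "bdd_meas f" and g: "\<And>n. bdd_meas (g n)" "\<And>n. l2_approx \<M> (g n)"
    and B: "\<And>n \<theta>. \<theta> \<in> circ \<Longrightarrow> cmod (g n \<theta>) \<le> B"
    and lim: "\<And>\<theta>. \<theta> \<in> circ \<Longrightarrow> (\<lambda>n. g n \<theta>) \<longlonglongrightarrow> f \<theta>"
  shows "l2_approx \<M> f"
proof (rule l2_approx_limit[OF f])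
  fix e :: real assume e: "e > 0"
  have "\<forall>\<mu>\<in>\<M>. eventually (\<lambda>n. (\<integral>\<theta>. (cmod (g n \<theta> - f \<theta>))\<^sup>2 \<partial>\<mu>) < e) sequentially"
  proof
    fix \<mu> assume \<mu>: "\<mu> \<in> \<M>"
    interpret circle_measure \<mu> by (rule circle[OF \<mu>])
    have [measurable]: "f \<in> borel_measurable \<mu>" "g n \<in> borel_measurable \<mu>" for n
      using f g(1)[of n] \<mu> by (auto simp: bdd_meas_def bdd_measurable)
    have fB: "cmod (f \<theta>) \<le> B" if "\<theta> \<in> circ" for \<theta>
      using LIMSEQ_le_const2[OF tendsto_norm[OF lim[OF that]]] B[OF that] by blast
    have "(\<lambda>n. \<integral>\<theta>. (cmod (g n \<theta> - f \<theta>))\<^sup>2 \<partial>\<mu>) \<longlonglongrightarrow> (\<integral>\<theta>. 0 \<partial>\<mu>)"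
    proof (rule integral_dominated_convergence[where w = "\<lambda>_. (2 * B)\<^sup>2"])
      show "AE \<theta> in \<mu>. (\<lambda>n. (cmod (g n \<theta> - f \<theta>))\<^sup>2) \<longlonglongrightarrow> 0"
      proof (rule AE_I2)
        fix \<theta> assume "\<theta> \<in> space \<mu>"
        hence "(\<lambda>n. (cmod (g n \<theta> - f \<theta>))\<^sup>2) \<longlonglongrightarrow> (cmod (f \<theta> - f \<theta>))\<^sup>2"
          by (intro tendsto_intros lim) (simp add: space_eq)
        thus "(\<lambda>n. (cmod (g n \<theta> - f \<theta>))\<^sup>2) \<longlonglongrightarrow> 0" by simp
      qed
      show "AE \<theta> in \<mu>. norm ((cmod (g n \<theta> - f \<theta>))\<^sup>2) \<le> (2 * B)\<^sup>2" for n
      proof (rule AE_I2)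
        fix \<theta> assume "\<theta> \<in> space \<mu>"
        hence "cmod (g n \<theta> - f \<theta>) \<le> 2 * B"
          using norm_triangle_ineq4[of "g n \<theta>" "f \<theta>"] B[of \<theta> n] fB[of \<theta>] by (simp add: space_eq)
        from power_mono[OF this, of 2]
        show "norm ((cmod (g n \<theta> - f \<theta>))\<^sup>2) \<le> (2 * B)\<^sup>2" by simp
      qed
    qed simp_all
    hence "(\<lambda>n. \<integral>\<theta>. (cmod (g n \<theta> - f \<theta>))\<^sup>2 \<partial>\<mu>) \<longlonglongrightarrow> 0" by simp
    from order_tendstoD(2)[OF this e]
    show "eventually (\<lambda>n. (\<integral>\<theta>. (cmod (g n \<theta> - f \<theta>))\<^sup>2 \<partial>\<mu>) < e) sequentially" .
  qed
  hence "eventually (\<lambda>n. \<forall>\<mu>\<in>\<M>. (\<integral>\<theta>. (cmod (g n \<theta> - f \<theta>))\<^sup>2 \<partial>\<mu>) < e) sequentially"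
    using finite_family by (simp add: eventually_ball_finite_distrib)
  then obtain n where "\<forall>\<mu>\<in>\<M>. (\<integral>\<theta>. (cmod (g n \<theta> - f \<theta>))\<^sup>2 \<partial>\<mu>) < e"
    by (auto simp: eventually_sequentially)
  thus "\<exists>g. bdd_meas g \<and> l2_approx \<M> g \<and> (\<forall>\<mu>\<in>\<M>. (\<integral>\<theta>. (cmod (g \<theta> - f \<theta>))\<^sup>2 \<partial>\<mu>) < e)"
    using g by blast
qed

lemma l2_approx_add:
  assumes f: "bdd_meas f" "l2_approx \<M> f" and g: "bdd_meas g" "l2_approx \<M> g"
  shows "l2_approx \<M> (\<lambda>\<theta>. f \<theta> + g \<theta>)"
  unfolding l2_approx_def
proof (intro allI impI)
  fix e :: real assume e: "e > 0"
  obtain c where c: "fin_coeffs c" "\<And>\<mu>. \<mu> \<in> \<M> \<Longrightarrow> (\<integral>\<theta>. (cmod (trig c \<theta> - f \<theta>))\<^sup>2 \<partial>\<mu>) < e / 4"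
    using f(2) e unfolding l2_approx_def by (metis zero_less_divide_iff zero_less_numeral)
  obtain d where d: "fin_coeffs d" "\<And>\<mu>. \<mu> \<in> \<M> \<Longrightarrow> (\<integral>\<theta>. (cmod (trig d \<theta> - g \<theta>))\<^sup>2 \<partial>\<mu>) < e / 4"
    using g(2) e unfolding l2_approx_def by (metis zero_less_divide_iff zero_less_numeral)
  have "(\<integral>\<theta>. (cmod (trig (\<lambda>n. c n + d n) \<theta> - (f \<theta> + g \<theta>)))\<^sup>2 \<partial>\<mu>) < e" if \<mu>: "\<mu> \<in> \<M>" for \<mu>
  proof -
    interpret circle_measure \<mu> by (rule circle[OF \<mu>])
    have b: "bdd f" "bdd g" using f g(1) \<mu> by (auto simp: bdd_meas_def)
    have "(\<integral>\<theta>. (cmod (trig (\<lambda>n. c n + d n) \<theta> - (f \<theta> + g \<theta>)))\<^sup>2 \<partial>\<mu>) =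
        (\<integral>\<theta>. (cmod ((trig c \<theta> - f \<theta>) + (trig d \<theta> - g \<theta>)))\<^sup>2 \<partial>\<mu>)"
      unfolding trig_add[OF c(1) d(1)] by (simp only: add_diff_add)
    also have "\<dots> \<le> 2 * (\<integral>\<theta>. (cmod (trig c \<theta> - f \<theta>))\<^sup>2 \<partial>\<mu>) + 2 * (\<integral>\<theta>. (cmod (trig d \<theta> - g \<theta>))\<^sup>2 \<partial>\<mu>)"
      by (intro integral_sq_add_le(2) bdd_measurable bdd_integrable_sq bdd_diff bdd_trig b)
    also have "\<dots> < e" using c(2)[OF \<mu>] d(2)[OF \<mu>] by simp
    finally show ?thesis .
  qed
  thus "\<exists>c. fin_coeffs c \<and> (\<forall>\<mu>\<in>\<M>. (\<integral>\<theta>. (cmod (trig c \<theta> - (f \<theta> + g \<theta>)))\<^sup>2 \<partial>\<mu>) < e)"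
    using fin_coeffs_add[OF c(1) d(1)] by blast
qed

lemma l2_approx_minus:
  assumes "l2_approx \<M> f"
  shows "l2_approx \<M> (\<lambda>\<theta>. - f \<theta>)"
proof -
  have *: "cmod (trig (\<lambda>n. - c n) \<theta> - - f \<theta>) = cmod (trig c \<theta> - f \<theta>)" for c \<theta>
    using trig_scale[of "-1" c \<theta>] by (simp add: norm_minus_commute)
  show ?thesis
    unfolding l2_approx_def
  proof (intro allI impI)
    fix e :: real assume "e > 0"
    then obtain c where "fin_coeffs c" "\<forall>\<mu>\<in>\<M>. (\<integral>\<theta>. (cmod (trig c \<theta> - f \<theta>))\<^sup>2 \<partial>\<mu>) < e"
      using assms unfolding l2_approx_def by blast
    thus "\<exists>c. fin_coeffs c \<and> (\<forall>\<mu>\<in>\<M>. (\<integral>\<theta>. (cmod (trig c \<theta> - - f \<theta>))\<^sup>2 \<partial>\<mu>) < e)"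
      using * fin_coeffs_scale[of c "-1"] by (intro exI[of _ "\<lambda>n. - c n"]) simp
  qed
qed

lemma bdd_measI:
  assumes "f \<in> borel_measurable borel" "\<And>\<theta>. \<theta> \<in> circ \<Longrightarrow> cmod (f \<theta>) \<le> B"
  shows "bdd_meas f"
  unfolding bdd_meas_def
  using assms circle_measure.bddI[OF circle circle_measure.borel_measurableI[OF circle]] by blast

lemma bdd_meas_indicator: "B \<in> sets borel \<Longrightarrow> bdd_meas (indicator B)"
  by (rule bdd_measI[where B = 1]) (simp_all split: split_indicator)

lemma bdd_meas_const: "bdd_meas (\<lambda>_. a)"
  by (rule bdd_measI[where B = "cmod a"]) simp_all

text \<open>Both sides say that \<open>sin (\<theta> / 2) * sin ((\<theta> - a) / 2)\<close> is positive; this form makes an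
  indicator of a ray a limit of continuous functions on the unit circle.\<close>

lemma arc_iff:
  assumes "0 \<le> a" "\<theta> \<in> circ" and that: "a < 2 * pi"
  shows "a < \<theta> \<longleftrightarrow> 0 < cos (\<theta> - (a / 2 + pi)) - cos (pi - a / 2)"
proof -
  have "cos (\<theta> - (a / 2 + pi)) - cos (pi - a / 2) = cos (a / 2) - cos (\<theta> - a / 2)"
  proof -
    have "\<theta> - (a / 2 + pi) = (\<theta> - a / 2) - pi" by simp
    hence "cos (\<theta> - (a / 2 + pi)) = - cos (\<theta> - a / 2)" by (metis cos_minus_pi)
    thus ?thesis by simp
  qed
  also have "\<dots> = 2 * (sin (\<theta> / 2) * sin ((\<theta> - a) / 2))"
    using cos_diff_cos[of "a/2" "\<theta> - a/2"] by (simp add: diff_divide_distrib)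
  finally have eq: "cos (\<theta> - (a / 2 + pi)) - cos (pi - a / 2) = 2 * (sin (\<theta> / 2) * sin ((\<theta> - a) / 2))" .
  have s: "0 \<le> sin (\<theta> / 2)" using assms(2) by (intro sin_ge_zero) auto
  show ?thesis
  proof (cases "a < \<theta>")
    case True
    hence "sin (\<theta> / 2) > 0" "sin ((\<theta> - a) / 2) > 0" using assms by (auto intro!: sin_gt_zero)
    thus ?thesis using True eq by simp
  next
    case False
    have "sin ((a - \<theta>) / 2) \<ge> 0" using False assms that by (intro sin_ge_zero) auto
    moreover have "sin ((\<theta> - a) / 2) = - sin ((a - \<theta>) / 2)"
      by (subst sin_minus[symmetric]) (simp add: diff_divide_distrib)
    ultimately have "sin (\<theta> / 2) * sin ((\<theta> - a) / 2) \<le> 0"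
      using s by (simp add: mult_nonneg_nonpos)
    thus ?thesis using False eq by simp
  qed
qed

lemma l2_approx_const: "l2_approx \<M> (\<lambda>\<theta>. of_real a)"
  using l2_approx_continuous[of "\<lambda>_. a"] by simp

lemma l2_approx_ray: "l2_approx \<M> (indicator {a<..})"
proof -
  consider "a < 0" | "0 \<le> a" "a < 2 * pi" | "a \<ge> 2 * pi" by linarith
  thus ?thesis
  proof cases
    case 1
    show ?thesis
      by (rule l2_approx_pointwise_limit[where g = "\<lambda>n \<theta>. of_real 1" and B = 1])
        (use 1 l2_approx_const[of 1] in \<open>auto intro!: bdd_meas_indicator bdd_meas_const\<close>)
  next
    case 3
    show ?thesis
      by (rule l2_approx_pointwise_limit[where g = "\<lambda>n \<theta>. of_real 0" and B = 1])
        (use 3 l2_approx_const[of 0] in \<open>auto intro!: bdd_meas_indicator bdd_meas_const\<close>)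
  next
    case 2
    \<comment> \<open>\<open>q\<close> is real-affine on the plane, so cutting \<open>n * q\<close>
      off at 0 and 1 gives continuous functions on the circle. They increase to the indicator of the
      open arc from \<open>a\<close> to \<open>2 * pi\<close>, where \<open>q\<close> is
      positive.\<close>
    define q where "q z = Re (z * cis (- (a / 2 + pi))) - cos (pi - a / 2)" for z
    define F where "F n z = min 1 (max 0 (real n * q z))" for n z
    have q: "q (cis \<theta>) = cos (\<theta> - (a / 2 + pi)) - cos (pi - a / 2)" for \<theta>
      by (simp add: q_def cis_mult del: minus_add_distrib)
    have cF: "continuous_on UNIV (F n)" for n
      unfolding F_def q_def by (intro continuous_intros)
    have F01: "0 \<le> F n z" "F n z \<le> 1" for n z by (auto simp: F_def)
    show ?thesis
    proof (rule l2_approx_pointwise_limit[where g = "\<lambda>n \<theta>. of_real (F n (cis \<theta>))" and B = 1])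
      show "bdd_meas (\<lambda>\<theta>. complex_of_real (F n (cis \<theta>)))" for n
      proof (rule bdd_measI[where B = 1])
        show "(\<lambda>\<theta>. complex_of_real (F n (cis \<theta>))) \<in> borel_measurable borel"
          by (intro borel_measurable_continuous_onI continuous_intros continuous_on_compose2[OF cF])
            (auto simp: cis_conv_exp intro!: continuous_intros)
      qed (use F01 in simp)
      show "(\<lambda>n. complex_of_real (F n (cis \<theta>))) \<longlonglongrightarrow> indicator {a<..} \<theta>" if t: "\<theta> \<in> circ" for \<theta>
      proof (cases "a < \<theta>")
        case True
        hence q0: "0 < q (cis \<theta>)" using arc_iff[OF 2(1) t 2(2)] q by simp
        obtain N where N: "1 < real N * q (cis \<theta>)"
          using reals_Archimedean3[OF q0] by blast
        have "F n (cis \<theta>) = 1" if "n \<ge> N" for n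
        proof -
          have "real N * q (cis \<theta>) \<le> real n * q (cis \<theta>)" using q0 that by (intro mult_right_mono) auto
          thus ?thesis using N by (simp add: F_def)
        qed
        hence "eventually (\<lambda>n. complex_of_real (F n (cis \<theta>)) = 1) sequentially"
          by (auto simp: eventually_sequentially)
        thus ?thesis using True by (simp add: tendsto_eventually)
      next
        case False
        hence "q (cis \<theta>) \<le> 0" using arc_iff[OF 2(1) t 2(2)] q by simp
        hence "F n (cis \<theta>) = 0" for n by (simp add: F_def mult_nonneg_nonpos)
        thus ?thesis using False by simp
      qed
    qed (use F01 cF in \<open>auto intro: bdd_meas_indicator l2_approx_continuous\<close>)
  qed
qed

text \<open>Rays form an intersection-stable generator of the Borel sets. Complements follow by
  linearity, and a disjoint union is the bounded pointwise limit of its finite parts.\<close>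

theorem l2_approx_indicator:
  assumes "B \<in> sets borel"
  shows "l2_approx \<M> (indicator B)"
proof -
  have Int: "Int_stable (range (\<lambda>a::real. {a<..}))"
  proof -
    have "{a<..} \<inter> {b<..} = {max a b<..}" for a b :: real by auto
    thus ?thesis by (auto simp: Int_stable_def)
  qed
  have B: "B \<in> sigma_sets UNIV (range (\<lambda>a::real. {a<..}))"
    using assms unfolding borel_Ioi by simp
  have borel: "sigma_sets UNIV (range (\<lambda>a::real. {a<..})) = sets borel"
    unfolding borel_Ioi by simp
  have "range (\<lambda>a::real. {a<..}) \<subseteq> Pow UNIV" by simp
  with Int show ?thesis
    using B
  proof (induction rule: sigma_sets_induct_disjoint)
    case (basic A)
    then show ?case using l2_approx_ray by auto
  next
    case empty
    show ?case using l2_approx_const[of 0] by (simp add: indicator_def[abs_def])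
  next
    case (compl A)
    have "l2_approx \<M> (\<lambda>\<theta>. of_real 1 + - indicator A \<theta>)"
      using compl borel by (intro l2_approx_add l2_approx_const l2_approx_minus bdd_meas_const
          bdd_measI[where B = 1]) (auto split: split_indicator)
    moreover have "(\<lambda>\<theta>. of_real 1 + - indicator A \<theta>) = (indicator (UNIV - A) :: real \<Rightarrow> complex)"
      by (auto split: split_indicator)
    ultimately show ?case by simp
  next
    case (union A)
    have A: "A i \<in> sets borel" for i using union(2) borel by auto
    have fin: "l2_approx \<M> (indicator (\<Union>i<n. A i))" for n
    proof (induction n)
      case 0
      show ?case using l2_approx_const[of 0] by (simp add: indicator_def[abs_def])
    next
      case (Suc n)
      have "A n \<inter> (\<Union>i<n. A i) = {}"
      proof -
        have "A n \<inter> A i = {}" if "i < n" for i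
          using disjoint_family_onD[OF union(1), of n i] that by simp
        thus ?thesis by blast
      qed
      hence "indicator (A n) \<theta> + indicator (\<Union>i<n. A i) \<theta> = (indicator (\<Union>i<Suc n. A i) \<theta> :: complex)" for \<theta>
        unfolding lessThan_Suc UN_insert by (simp add: indicator_add)
      hence "(\<lambda>\<theta>. indicator (A n) \<theta> + indicator (\<Union>i<n. A i) \<theta> :: complex) = indicator (\<Union>i<Suc n. A i)"
        by (rule ext)
      moreover have "l2_approx \<M> (\<lambda>\<theta>. indicator (A n) \<theta> + indicator (\<Union>i<n. A i) \<theta>)"
        using A by (intro l2_approx_add bdd_meas_indicator union(3) Suc) auto
      ultimately show ?case by simp
    qed
    show ?case
    proof (rule l2_approx_pointwise_limit[where g = "\<lambda>n. indicator (\<Union>i<n. A i)" and B = 1])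
      show "(\<lambda>n. indicator (\<Union>i<n. A i) \<theta>) \<longlonglongrightarrow> (indicator (\<Union>i. A i) \<theta> :: complex)" for \<theta>
        by (rule LIMSEQ_indicator_UN)
    qed (use A fin in \<open>auto intro!: bdd_meas_indicator split: split_indicator\<close>)
  qed
qed

end

subsection \<open>Spectral measures\<close>

definition lcirc :: "real measure" where
  "lcirc = restrict_space lborel circ"

lemma sets_lcirc: "sets lcirc = sets (restrict_space lborel circ)"
  by (simp add: lcirc_def)

interpretation lcirc: circle_measure lcirc
proof (rule circle_measureI)
  show "emeasure lcirc (space lcirc) \<noteq> \<infinity>"
    by (simp add: lcirc_def emeasure_restrict_space space_restrict_space)
qed (simp add: lcirc_def)

lemma integral_lcirc:
  fixes f :: "real \<Rightarrow> 'b::{banach, second_countable_topology}"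
  shows "(\<integral>\<theta>. f \<theta> \<partial>lcirc) = (LINT \<theta>:circ|lborel. f \<theta>)"
  unfolding lcirc_def by (subst integral_restrict_space) (simp_all add: set_lebesgue_integral_def)

lemma integral_cis: "(\<integral>\<theta>. cis (of_int m * \<theta>) \<partial>lcirc) = (if m = 0 then of_real (2 * pi) else 0)"
proof -
  have "(\<integral>\<theta>. cis (of_int m * \<theta>) \<partial>lcirc) = (\<integral>\<theta>. indicator circ \<theta> *\<^sub>R cis (of_int m * \<theta>) \<partial>lborel)"
    unfolding integral_lcirc set_lebesgue_integral_def ..
  \<comment> \<open>The fundamental theorem of calculus is stated on closed intervals; the added end
    point is a null set.\<close>
  also have "\<dots> = (\<integral>\<theta>. indicator {0..2*pi} \<theta> *\<^sub>R cis (of_int m * \<theta>) \<partial>lborel)"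
  proof (rule integral_cong_AE)
    show "AE \<theta> in lborel. indicator circ \<theta> *\<^sub>R cis (of_int m * \<theta>) = indicator {0..2*pi} \<theta> *\<^sub>R cis (of_int m * \<theta>)"
      using AE_lborel_singleton[of "2 * pi"] by eventually_elim (auto split: split_indicator)
  qed (auto simp: cis_conv_exp intro!: borel_measurable_scaleR borel_measurable_continuous_onI continuous_intros)
  also have "\<dots> = (if m = 0 then of_real (2 * pi) else 0)"
  proof (cases "m = 0")
    case True
    thus ?thesis by (simp add: scaleR_conv_of_real)
  next
    case False
    define F where "F \<theta> = cis (of_int m * \<theta>) / (\<i> * of_int m)" for \<theta>
    have D: "(F has_vector_derivative cis (of_int m * \<theta>)) (at \<theta> within S)" for \<theta> S
    proof -
      have "((\<lambda>z. exp (\<i> * of_int m * z) / (\<i> * of_int m)) has_field_derivative exp (\<i> * of_int m * of_real \<theta>))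
          (at (of_real \<theta>))"
        using False by (auto intro!: derivative_eq_intros)
      from has_vector_derivative_real_field[OF this]
      show ?thesis unfolding F_def by (simp add: cis_conv_exp mult.assoc)
    qed
    have "(\<integral>\<theta>. indicator {0..2*pi} \<theta> *\<^sub>R cis (of_int m * \<theta>) \<partial>lborel) = F (2 * pi) - F 0"
      by (rule integral_FTC_atLeastAtMost[OF _ D])
        (auto simp: cis_conv_exp intro!: continuous_intros)
    also have "\<dots> = 0"
      using cis_multiple_2pi[of "of_int m"] by (simp add: F_def mult.commute)
    finally show ?thesis using False by simp
  qed
  finally show ?thesis .
qed

text \<open>Reduction modulo \<open>2 * pi\<close> into \<open>circ\<close>. A weak limit of
  measures on \<open>circ\<close> may charge the end point \<open>2 * pi\<close>;
  \<open>wrap\<close> moves that mass to 0 and keeps all integer Fourier coefficients.\<close>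

definition wrap :: "real \<Rightarrow> real" where
  "wrap \<theta> = \<theta> - 2 * pi * of_int \<lfloor>\<theta> / (2 * pi)\<rfloor>"

lemma pi2_pos: "0 < 2 * pi"
  by simp

lemma wrap_in: "wrap \<theta> \<in> circ"
proof -
  have "of_int \<lfloor>\<theta> / (2 * pi)\<rfloor> \<le> \<theta> / (2 * pi)" "\<theta> / (2 * pi) < of_int \<lfloor>\<theta> / (2 * pi)\<rfloor> + 1"
    by linarith+
  hence "of_int \<lfloor>\<theta> / (2 * pi)\<rfloor> * (2 * pi) \<le> \<theta>" "\<theta> < (of_int \<lfloor>\<theta> / (2 * pi)\<rfloor> + 1) * (2 * pi)"
    by (simp_all only: pos_le_divide_eq[OF pi2_pos] pos_divide_less_eq[OF pi2_pos])
  thus ?thesis by (simp add: wrap_def algebra_simps)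
qed

lemma wrap_measurable: "wrap \<in> measurable borel lcirc"
  unfolding lcirc_def wrap_def[abs_def] using wrap_in[unfolded wrap_def]
  by (intro measurable_restrict_space2) auto

lemma cis_wrap: "cis (of_int n * wrap \<theta>) = cis (of_int n * \<theta>)"
proof -
  have "of_int n * wrap \<theta> = of_int n * \<theta> - 2 * pi * of_int (n * \<lfloor>\<theta> / (2 * pi)\<rfloor>)"
    by (simp add: wrap_def algebra_simps)
  hence "cis (of_int n * wrap \<theta>) = cis (of_int n * \<theta>) / cis (2 * pi * of_int (n * \<lfloor>\<theta> / (2 * pi)\<rfloor>))"
    by (simp only: cis_divide)
  thus ?thesis by (subst (asm) cis_multiple_2pi) auto
qed

text \<open>The ratio is the Fejer weight \<open>1 - \<bar>n\<bar> / (N + 1)\<close> once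
  \<open>N\<close> is at least \<open>\<bar>n\<bar>\<close>; it appears here as the share of indices
  \<open>j\<close> for which \<open>j + n\<close> stays in range.\<close>

lemma count_shifted_limit:
  "(\<lambda>N. real (card {j. j < Suc N \<and> 0 \<le> int j + n \<and> int j + n < int (Suc N)}) / real (Suc N)) \<longlonglongrightarrow> 1"
proof -
  let ?A = "\<lambda>N. {j. j < Suc N \<and> 0 \<le> int j + n \<and> int j + n < int (Suc N)}"
  have up: "card (?A N) \<le> Suc N" for N
    using card_mono[of "{..<Suc N}" "?A N"] by auto
  have lo: "Suc N \<le> card (?A N) + nat \<bar>n\<bar>" for N
  proof -
    have "{..<Suc N} \<subseteq> ?A N \<union> (if 0 \<le> n then {Suc N - nat n..<Suc N} else {..<nat (- n)})"
      by (auto split: if_splits)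
    hence "card {..<Suc N} \<le> card (?A N \<union> (if 0 \<le> n then {Suc N - nat n..<Suc N} else {..<nat (- n)}))"
      by (intro card_mono) auto
    also have "\<dots> \<le> card (?A N) + card (if 0 \<le> n then {Suc N - nat n..<Suc N} else {..<nat (- n)})"
      by (rule card_Un_le)
    also have "\<dots> \<le> card (?A N) + nat \<bar>n\<bar>" by auto
    finally show ?thesis by simp
  qed
  have lim: "(\<lambda>N. 1 - real (nat \<bar>n\<bar>) * inverse (real (Suc N))) \<longlonglongrightarrow> 1 - real (nat \<bar>n\<bar>) * 0"
    by (intro tendsto_intros LIMSEQ_inverse_real_of_nat)
  show ?thesis
  proof (rule tendsto_sandwich[OF _ _ _ tendsto_const])
    show "(\<lambda>N. 1 - real (nat \<bar>n\<bar>) * inverse (real (Suc N))) \<longlonglongrightarrow> 1" using lim by simp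
    show "\<forall>\<^sub>F N in sequentially. 1 - real (nat \<bar>n\<bar>) * inverse (real (Suc N)) \<le> real (card (?A N)) / real (Suc N)"
    proof (intro always_eventually allI)
      fix N
      have "real (Suc N) \<le> real (card (?A N) + nat \<bar>n\<bar>)" using lo[of N] by (simp only: of_nat_le_iff)
      hence "real (Suc N) - real (nat \<bar>n\<bar>) \<le> real (card (?A N))" by simp
      hence "(real (Suc N) - real (nat \<bar>n\<bar>)) / real (Suc N) \<le> real (card (?A N)) / real (Suc N)"
        by (rule divide_right_mono) simp
      thus "1 - real (nat \<bar>n\<bar>) * inverse (real (Suc N)) \<le> real (card (?A N)) / real (Suc N)"
        by (simp add: field_simps del: of_nat_Suc)
    qed
    show "\<forall>\<^sub>F N in sequentially. real (card (?A N)) / real (Suc N) \<le> 1"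
    proof (intro always_eventually allI)
      fix N
      have "real (card (?A N)) \<le> real (Suc N)" using up[of N] by (simp only: of_nat_le_iff)
      thus "real (card (?A N)) / real (Suc N) \<le> 1" by (simp only: divide_le_eq_1_pos of_nat_0_less_iff zero_less_Suc)
    qed
  qed
qed

context unitary_op
begin

definition spec_meas :: "'a \<Rightarrow> real measure \<Rightarrow> bool" where
  "spec_meas \<psi> \<mu> \<longleftrightarrow> circle_measure \<mu> \<and>
     (\<forall>n. cinner \<psi> (upow n \<psi>) = (\<integral>\<theta>. cis (of_int n * \<theta>) \<partial>\<mu>))"

lemma cinner_upow_upow: "cinner (upow j \<psi>) (upow k \<psi>) = cinner \<psi> (upow (k - j) \<psi>)"
  using upow_cinner[of j \<psi> "upow (k - j) \<psi>"] upow_add[of j "k - j" \<psi>] by simp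

text \<open>\<open>N\<close> times the N-th Fejer mean of the Fourier series of the correlations.
  Written as a squared norm it is visibly nonnegative; the minus sign in \<open>cis\<close> makes
  its n-th moment a multiple of \<open>cinner \<psi> (upow n \<psi>)\<close>.\<close>

definition fejer :: "'a \<Rightarrow> nat \<Rightarrow> real \<Rightarrow> real" where
  "fejer \<psi> N \<theta> = (norm (\<Sum>k<N. cis (- real k * \<theta>) *\<^sub>C upow (int k) \<psi>))\<^sup>2"

lemma fejer_eq: "complex_of_real (fejer \<psi> N \<theta>) =
    (\<Sum>j<N. \<Sum>k<N. cis (of_int (int j - int k) * \<theta>) * cinner \<psi> (upow (int k - int j) \<psi>))"
  unfolding fejer_def cinner_self[symmetric]
proof (subst cinner_sum_left, intro sum.cong refl, subst cinner_sum_right, intro sum.cong refl)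
  fix j k
  have "cis (of_int (int j - int k) * \<theta>) = cnj (cis (- real j * \<theta>)) * cis (- real k * \<theta>)"
    by (simp add: cis_cnj cis_mult algebra_simps)
  thus "cinner (cis (- real j * \<theta>) *\<^sub>C upow (int j) \<psi>) (cis (- real k * \<theta>) *\<^sub>C upow (int k) \<psi>) =
      cis (of_int (int j - int k) * \<theta>) * cinner \<psi> (upow (int k - int j) \<psi>)"
    by (simp add: cinner_upow_upow)
qed

lemma fejer_measurable: "fejer \<psi> N \<in> borel_measurable borel"
proof -
  have "fejer \<psi> N = (\<lambda>\<theta>. Re (\<Sum>j<N. \<Sum>k<N. cis (of_int (int j - int k) * \<theta>) * cinner \<psi> (upow (int k - int j) \<psi>)))"
    by (rule ext) (simp only: fejer_eq[symmetric] Re_complex_of_real)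
  moreover have "\<dots> \<in> borel_measurable borel"
    unfolding cis_conv_exp by (intro borel_measurable_continuous_onI continuous_intros)
  ultimately show ?thesis by simp
qed

lemma fejer_bounded: "fejer \<psi> N \<theta> \<le> (real N * norm \<psi>)\<^sup>2"
proof -
  have "norm (\<Sum>k<N. cis (- real k * \<theta>) *\<^sub>C upow (int k) \<psi>) \<le> (\<Sum>k<N. norm \<psi>)"
    by (rule sum_norm_le) simp
  thus ?thesis unfolding fejer_def by (intro power_mono) auto
qed

text \<open>Orthogonality of the exponentials leaves the pairs with \<open>k = j + n\<close>, and
  each of them contributes the same correlation.\<close>

lemma fejer_integral:
  "(\<integral>\<theta>. complex_of_real (fejer \<psi> N \<theta>) * cis (of_int n * \<theta>) \<partial>lcirc) =
    of_real (2 * pi * real (card {j. j < N \<and> 0 \<le> int j + n \<and> int j + n < int N})) * cinner \<psi> (upow n \<psi>)"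
proof -
  let ?a = "\<lambda>n. cinner \<psi> (upow n \<psi>)"
  have int: "integrable lcirc (\<lambda>\<theta>. a * cis (of_int m * \<theta>))" for a m
    by (rule lcirc.integrable_bounded[where B = "cmod a"]) (auto simp: norm_mult)
  have "(\<integral>\<theta>. complex_of_real (fejer \<psi> N \<theta>) * cis (of_int n * \<theta>) \<partial>lcirc) =
      (\<integral>\<theta>. (\<Sum>j<N. \<Sum>k<N. ?a (int k - int j) * cis (of_int (int j - int k + n) * \<theta>)) \<partial>lcirc)"
    unfolding fejer_eq sum_distrib_right
  proof (intro Bochner_Integration.integral_cong refl sum.cong)
    fix \<theta> j k
    have "cis (of_int (int j - int k + n) * \<theta>) = cis (of_int (int j - int k) * \<theta>) * cis (of_int n * \<theta>)"
      by (simp only: cis_mult of_int_add distrib_right)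
    thus "cis (of_int (int j - int k) * \<theta>) * ?a (int k - int j) * cis (of_int n * \<theta>)
      = ?a (int k - int j) * cis (of_int (int j - int k + n) * \<theta>)" by simp
  qed
  also have "\<dots> = (\<Sum>j<N. \<Sum>k<N. \<integral>\<theta>. ?a (int k - int j) * cis (of_int (int j - int k + n) * \<theta>) \<partial>lcirc)"
    using int by (simp only: Bochner_Integration.integral_sum Bochner_Integration.integrable_sum)
  also have "\<dots> = (\<Sum>j<N. \<Sum>k<N. if int k = int j + n then ?a n * of_real (2 * pi) else 0)"
    unfolding integral_mult_right_zero integral_cis by (intro sum.cong refl) auto
  also have "\<dots> = (\<Sum>j<N. if 0 \<le> int j + n \<and> int j + n < int N then ?a n * of_real (2 * pi) else 0)"
  proof (intro sum.cong refl)
    fix j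
    show "(\<Sum>k<N. if int k = int j + n then ?a n * of_real (2 * pi) else 0) =
      (if 0 \<le> int j + n \<and> int j + n < int N then ?a n * of_real (2 * pi) else 0)"
    proof (cases "0 \<le> int j + n")
      case True
      hence "int k = int j + n \<longleftrightarrow> k = nat (int j + n)" for k by auto
      thus ?thesis using True by (simp add: sum.delta nat_less_iff)
    next
      case False
      hence "int k \<noteq> int j + n" for k by linarith
      thus ?thesis using False by simp
    qed
  qed
  also have "\<dots> = (\<Sum>j\<in>{j. j < N \<and> 0 \<le> int j + n \<and> int j + n < int N}. ?a n * of_real (2 * pi))"
    by (rule sum.mono_neutral_cong_right) auto
  finally show ?thesis by simp
qed

text \<open>Herglotz's theorem for the correlation sequence. The normalised Fejer densities have
  Fourier coefficients equal to the normalised correlations times weights tending to 1; the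
  exponentials are bounded and continuous, so a weak limit has exactly those correlations as
  coefficients.\<close>

theorem spec_meas_exists: "\<exists>\<mu>. spec_meas \<psi> \<mu>"
proof (cases "\<psi> = 0")
  case True
  have "circle_measure (null_measure lcirc)"
    by (rule circle_measureI) (simp_all add: sets_lcirc)
  thus ?thesis using True
    by (intro exI[of _ "null_measure lcirc"]) (simp add: spec_meas_def)
next
  case False
  define s where "s = (norm \<psi>)\<^sup>2"
  have s: "s > 0" using False by (simp add: s_def)
  \<comment> \<open>The divisor makes the total mass 1, which is why the zero vector is treated
    apart.\<close>
  define w where "w N \<theta> = fejer \<psi> (Suc N) \<theta> / (2 * pi * real (Suc N) * s)" for N \<theta>
  define D where "D N = density lcirc (w N)" for N
  \<comment> \<open>Selection of a weakly convergent subsequence takes place among distributions on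
    the whole line, hence the push-forward to \<open>borel\<close>.\<close>
  define M where "M N = distr (D N) borel (\<lambda>x. x)" for N
  let ?cnt = "\<lambda>n N. real (card {j. j < Suc N \<and> 0 \<le> int j + n \<and> int j + n < int (Suc N)})"
  have w0: "0 \<le> w N \<theta>" for N \<theta> using s by (simp add: w_def fejer_def)
  have wm: "w N \<in> borel_measurable lcirc" for N
    unfolding w_def[abs_def] using lcirc.borel_measurableI[OF fejer_measurable] by measurable
  have wi: "(\<integral>\<theta>. w N \<theta> *\<^sub>R cis (of_int n * \<theta>) \<partial>lcirc) =
      of_real (?cnt n N / real (Suc N)) * (cinner \<psi> (upow n \<psi>) / of_real s)" for n N
  proof -
    have "(\<integral>\<theta>. w N \<theta> *\<^sub>R cis (of_int n * \<theta>) \<partial>lcirc) = (\<integral>\<theta>. of_real (1 / (2 * pi * real (Suc N) * s)) *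
        (complex_of_real (fejer \<psi> (Suc N) \<theta>) * cis (of_int n * \<theta>)) \<partial>lcirc)"
      by (intro Bochner_Integration.integral_cong refl) (simp add: w_def scaleR_conv_of_real)
    also have "\<dots> = of_real (1 / (2 * pi * real (Suc N) * s)) *
        (\<integral>\<theta>. complex_of_real (fejer \<psi> (Suc N) \<theta>) * cis (of_int n * \<theta>) \<partial>lcirc)"
      by (rule integral_mult_right_zero)
    also have "\<dots> = of_real (?cnt n N / real (Suc N)) * (cinner \<psi> (upow n \<psi>) / of_real s)"
      unfolding fejer_integral using s by (simp del: of_nat_Suc)
    finally show ?thesis .
  qed
  have Mi: "(\<integral>\<theta>. cis (of_int n * \<theta>) \<partial>M N) = of_real (?cnt n N / real (Suc N)) * (cinner \<psi> (upow n \<psi>) / of_real s)" for n N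
  proof -
    have id: "(\<lambda>x. x) \<in> measurable (D N) borel"
      using lcirc.borel_measurableI[of "\<lambda>x. x"] by (simp add: D_def)
    have "(\<integral>\<theta>. cis (of_int n * \<theta>) \<partial>M N) = (\<integral>\<theta>. cis (of_int n * \<theta>) \<partial>D N)"
      unfolding M_def by (rule integral_distr[OF id])
        (auto simp: cis_conv_exp intro!: borel_measurable_continuous_onI continuous_intros)
    also have "\<dots> = (\<integral>\<theta>. w N \<theta> *\<^sub>R cis (of_int n * \<theta>) \<partial>lcirc)"
      unfolding D_def using wm w0 by (intro integral_density) auto
    finally show ?thesis using wi by simp
  qed
  have mass: "emeasure (D N) (space (D N)) = 1" for N
  proof -
    have bd: "w N \<theta> \<le> (real (Suc N) * norm \<psi>)\<^sup>2 / (2 * pi * real (Suc N) * s)" for \<theta>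
      unfolding w_def using s fejer_bounded[of \<psi> "Suc N" \<theta>] by (intro divide_right_mono) auto
    have "integrable lcirc (w N)"
      by (rule lcirc.integrable_bounded[OF wm, where B = "(real (Suc N) * norm \<psi>)\<^sup>2 / (2 * pi * real (Suc N) * s)"])
        (use bd w0 in auto)
    hence "emeasure (D N) (space (D N)) = ennreal (\<integral>\<theta>. w N \<theta> \<partial>lcirc)"
      unfolding D_def using wm w0
      by (subst emeasure_density) (auto simp: nn_integral_eq_integral nn_integral_set_ennreal[symmetric] cong: nn_integral_cong)
    also have "complex_of_real (\<integral>\<theta>. w N \<theta> \<partial>lcirc) = (\<integral>\<theta>. w N \<theta> *\<^sub>R cis (of_int 0 * \<theta>) \<partial>lcirc)"
      by (simp add: scaleR_conv_of_real)
    hence "(\<integral>\<theta>. w N \<theta> \<partial>lcirc) = 1"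
      unfolding wi using s by (simp add: cinner_self s_def[symmetric] del: of_nat_Suc)
    finally show ?thesis by simp
  qed
  have id: "(\<lambda>x. x) \<in> measurable (D N) borel" for N
    using lcirc.borel_measurableI[of "\<lambda>x. x"] by (simp add: D_def)
  have prob: "prob_space (D N)" for N by (rule prob_spaceI) (rule mass)
  have rd: "real_distribution (M N)" for N
  proof -
    interpret prob_space "M N" unfolding M_def by (rule prob_space.prob_space_distr[OF prob id])
    show ?thesis by standard (simp add: M_def)
  qed
  have "tight M"
    unfolding tight_def
  proof (intro conjI allI impI)
    fix e :: real assume e: "e > 0"
    \<comment> \<open>\<open>tight\<close> speaks of intervals open on the left, so the left end has
      to lie below 0.\<close>
    have "measure (M N) {-1<..2*pi} = 1" for N
    proof -
      have sp: "space (D N) = circ" by (simp add: D_def lcirc.space_eq)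
      have "(\<lambda>x. x) -` {-1<..2*pi} \<inter> space (D N) = space (D N)"
        unfolding sp using pi_gt_zero by (auto simp del: pi_gt_zero)
      hence "measure (M N) {-1<..2*pi} = measure (D N) (space (D N))"
        unfolding M_def by (subst measure_distr[OF id]) auto
      thus ?thesis using prob_space.prob_space[OF prob] by simp
    qed
    moreover have "(-1::real) < 2 * pi" using pi_gt_zero by linarith
    ultimately show "\<exists>a b. a < b \<and> (\<forall>N. 1 - e < measure (M N) {a<..b})"
      using e by (intro exI[of _ "-1"] exI[of _ "2*pi"]) simp
  qed (rule rd)
  from tight_imp_convergent_subsubsequence[OF this strict_mono_id]
  obtain r L where r: "strict_mono r" and L: "real_distribution L" and conv: "weak_conv_m (M \<circ> id \<circ> r) L"
    by auto
  interpret L: real_distribution L by (rule L)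
  have Li: "(\<integral>\<theta>. cis (of_int n * \<theta>) \<partial>L) = cinner \<psi> (upow n \<psi>) / of_real s" for n
  proof (rule LIMSEQ_unique)
    show "(\<lambda>N. \<integral>\<theta>. cis (of_int n * \<theta>) \<partial>((M \<circ> id \<circ> r) N)) \<longlonglongrightarrow> (\<integral>\<theta>. cis (of_int n * \<theta>) \<partial>L)"
    proof (rule weak_conv_imp_integral_bdd_continuous_conv[OF _ L conv, where B = 1])
      show "isCont (\<lambda>\<theta>. cis (of_int n * \<theta>)) x" for x
        by (auto simp: cis_conv_exp intro!: continuous_intros)
    qed (simp_all add: rd)
    have "(\<lambda>N. of_real (?cnt n N / real (Suc N)) * (cinner \<psi> (upow n \<psi>) / of_real s)) \<longlonglongrightarrow>
        of_real 1 * (cinner \<psi> (upow n \<psi>) / of_real s)"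
      by (intro tendsto_mult tendsto_const tendsto_of_real count_shifted_limit)
    from LIMSEQ_subseq_LIMSEQ[OF this r]
    show "(\<lambda>N. \<integral>\<theta>. cis (of_int n * \<theta>) \<partial>((M \<circ> id \<circ> r) N)) \<longlonglongrightarrow> cinner \<psi> (upow n \<psi>) / of_real s"
      by (simp add: Mi o_def)
  qed
  define \<mu> where "\<mu> = density (distr L lcirc wrap) (\<lambda>_. s)"
  have wrapm: "wrap \<in> measurable L lcirc"
    using wrap_measurable measurable_cong_sets[OF L.events_eq_borel refl] by blast
  have setsmu: "sets \<mu> = sets lcirc" by (simp add: \<mu>_def)
  have "circle_measure \<mu>"
  proof (rule circle_measureI)
    interpret W: prob_space "distr L lcirc wrap" by (rule L.prob_space_distr[OF wrapm])
    have "emeasure \<mu> (space \<mu>) = ennreal s * emeasure (distr L lcirc wrap) (space (distr L lcirc wrap))"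
      unfolding \<mu>_def by (subst emeasure_density_const) simp_all
    thus "emeasure \<mu> (space \<mu>) \<noteq> \<infinity>" using W.emeasure_space_1 by simp
  qed (simp add: setsmu sets_lcirc)
  moreover have "cinner \<psi> (upow n \<psi>) = (\<integral>\<theta>. cis (of_int n * \<theta>) \<partial>\<mu>)" for n
  proof -
    have "(\<integral>\<theta>. cis (of_int n * \<theta>) \<partial>\<mu>) = (\<integral>\<theta>. s *\<^sub>R cis (of_int n * \<theta>) \<partial>distr L lcirc wrap)"
      unfolding \<mu>_def using s by (intro integral_density) (auto simp: lcirc.cis_borel)
    also have "\<dots> = (\<integral>\<theta>. s *\<^sub>R cis (of_int n * \<theta>) \<partial>L)"
      by (subst integral_distr[OF wrapm]) (auto simp: lcirc.cis_borel cis_wrap)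
    also have "\<dots> = cinner \<psi> (upow n \<psi>)"
      using s by (simp add: Li scaleR_conv_of_real)
    finally show ?thesis by simp
  qed
  ultimately show ?thesis unfolding spec_meas_def by blast
qed

end

subsection \<open>Functional calculus\<close>

context circle_measure
begin

text \<open>The difference of two squared moduli is bounded by a large multiple of the squared
  distance plus a small multiple \<open>d\<close> of the squared modulus of the limit. Choosing
  \<open>d\<close> before \<open>N\<close> replaces an appeal to the triangle inequality in
  L2.\<close>

lemma l2_lim_integral:
  assumes f: "bdd f" and g: "\<And>k. bdd (g k)"
    and lim: "(\<lambda>k. \<integral>\<theta>. (cmod (g k \<theta> - f \<theta>))\<^sup>2 \<partial>\<mu>) \<longlonglongrightarrow> 0"
  shows "(\<lambda>k. \<integral>\<theta>. (cmod (g k \<theta>))\<^sup>2 \<partial>\<mu>) \<longlonglongrightarrow> (\<integral>\<theta>. (cmod (f \<theta>))\<^sup>2 \<partial>\<mu>)"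
proof (rule LIMSEQ_I)
  fix e :: real assume e: "e > 0"
  define F where "F = (\<integral>\<theta>. (cmod (f \<theta>))\<^sup>2 \<partial>\<mu>)"
  have F0: "F \<ge> 0" by (simp add: F_def)
  \<comment> \<open>Chosen so that \<open>d * F\<close> is at most half of \<open>e\<close>; the 1
    keeps the denominator positive when \<open>F\<close> is 0.\<close>
  define d where "d = e / (2 * (F + 1))"
  have d: "d > 0" "d * F \<le> e / 2"
    using e F0 by (auto simp: d_def field_simps)
  have "eventually (\<lambda>k. (\<integral>\<theta>. (cmod (g k \<theta> - f \<theta>))\<^sup>2 \<partial>\<mu>) < e / (2 * (1 + 1 / d))) sequentially"
    by (rule order_tendstoD(2)[OF lim]) (use e d in \<open>auto intro!: divide_pos_pos mult_pos_pos add_pos_pos\<close>)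
  then obtain N where N: "\<And>k. k \<ge> N \<Longrightarrow> (\<integral>\<theta>. (cmod (g k \<theta> - f \<theta>))\<^sup>2 \<partial>\<mu>) < e / (2 * (1 + 1 / d))"
    unfolding eventually_sequentially by blast
  have "norm ((\<integral>\<theta>. (cmod (g k \<theta>))\<^sup>2 \<partial>\<mu>) - F) < e" if k: "k \<ge> N" for k
  proof -
    have pw: "\<bar>(cmod (a))\<^sup>2 - (cmod b)\<^sup>2\<bar> \<le> (1 + 1/d) * (cmod (a - b))\<^sup>2 + d * (cmod b)\<^sup>2" for a b
    proof -
      have "\<bar>(cmod a)\<^sup>2 - (cmod b)\<^sup>2\<bar> = \<bar>cmod a - cmod b\<bar> * (cmod a + cmod b)"
        by (simp add: power2_eq_square square_diff_square_factored abs_mult)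
      also have "\<dots> \<le> cmod (a - b) * (cmod (a - b) + 2 * cmod b)"
      proof (rule mult_mono)
        show "\<bar>cmod a - cmod b\<bar> \<le> cmod (a - b)" by (rule norm_triangle_ineq3)
        show "cmod a + cmod b \<le> cmod (a - b) + 2 * cmod b"
          using norm_triangle_ineq[of "a - b" b] by simp
      qed auto
      also have "\<dots> \<le> (1 + 1/d) * (cmod (a - b))\<^sup>2 + d * (cmod b)\<^sup>2"
      proof -
        have "0 \<le> (cmod (a - b) - d * cmod b)\<^sup>2 / d" using d by simp
        also have "\<dots> = (1 / d) * (cmod (a - b))\<^sup>2 - 2 * cmod (a - b) * cmod b + d * (cmod b)\<^sup>2"
          using d by (simp add: power2_eq_square field_simps)
        finally show ?thesis by (simp add: power2_eq_square algebra_simps)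
      qed
      finally show ?thesis .
    qed
    have i: "integrable \<mu> (\<lambda>\<theta>. (cmod (g k \<theta> - f \<theta>))\<^sup>2)" by (intro bdd_integrable_sq bdd_diff g f)
    have "norm ((\<integral>\<theta>. (cmod (g k \<theta>))\<^sup>2 \<partial>\<mu>) - F) = norm (\<integral>\<theta>. (cmod (g k \<theta>))\<^sup>2 - (cmod (f \<theta>))\<^sup>2 \<partial>\<mu>)"
      unfolding F_def using bdd_integrable_sq[OF g] bdd_integrable_sq[OF f] by simp
    also have "\<dots> \<le> (\<integral>\<theta>. norm ((cmod (g k \<theta>))\<^sup>2 - (cmod (f \<theta>))\<^sup>2) \<partial>\<mu>)"
      by (rule integral_norm_bound)
    also have "\<dots> \<le> (\<integral>\<theta>. (1 + 1/d) * (cmod (g k \<theta> - f \<theta>))\<^sup>2 + d * (cmod (f \<theta>))\<^sup>2 \<partial>\<mu>)"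
      by (intro integral_mono integrable_norm Bochner_Integration.integrable_diff
          Bochner_Integration.integrable_add integrable_mult_right i bdd_integrable_sq g f)
        (simp only: real_norm_def, rule pw)
    also have "\<dots> = (1 + 1/d) * (\<integral>\<theta>. (cmod (g k \<theta> - f \<theta>))\<^sup>2 \<partial>\<mu>) + d * F"
      unfolding F_def using i bdd_integrable_sq[OF f] by simp
    also have "\<dots> < (1 + 1/d) * (e / (2 * (1 + 1 / d))) + e / 2"
    proof (rule add_less_le_mono)
      show "(1 + 1/d) * (\<integral>\<theta>. (cmod (g k \<theta> - f \<theta>))\<^sup>2 \<partial>\<mu>) < (1 + 1/d) * (e / (2 * (1 + 1 / d)))"
        using d by (intro mult_strict_left_mono N k) (auto intro: add_pos_pos)
    qed (rule d)
    also have "(1 + 1/d) * (e / (2 * (1 + 1 / d))) = e / 2"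
    proof -
      have "1 + 1/d \<noteq> 0" using d by (metis add_pos_pos less_irrefl zero_less_divide_1_iff zero_less_one)
      thus ?thesis by (metis nonzero_mult_div_cancel_left mult.commute times_divide_eq_right mult_divide_mult_cancel_left)
    qed
    finally show ?thesis by simp
  qed
  thus "\<exists>no. \<forall>n\<ge>no. norm ((\<integral>\<theta>. (cmod (g n \<theta>))\<^sup>2 \<partial>\<mu>) - (\<integral>\<theta>. (cmod (f \<theta>))\<^sup>2 \<partial>\<mu>)) < e"
    unfolding F_def by blast
qed

end

lemma (in circle_measures) approx_seq:
  assumes "B \<in> sets borel"
  shows "\<exists>c. (\<forall>k. fin_coeffs (c k)) \<and>
    (\<forall>\<mu>\<in>\<M>. (\<lambda>k. \<integral>\<theta>. (cmod (trig (c k) \<theta> - indicator B \<theta>))\<^sup>2 \<partial>\<mu>) \<longlonglongrightarrow> 0)"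
proof -
  have "\<forall>k. \<exists>c. fin_coeffs c \<and> (\<forall>\<mu>\<in>\<M>. (\<integral>\<theta>. (cmod (trig c \<theta> - indicator B \<theta>))\<^sup>2 \<partial>\<mu>) < inverse (real (Suc k)))"
    using l2_approx_indicator[OF assms] unfolding l2_approx_def by simp
  then obtain c where c: "\<And>k. fin_coeffs (c k)"
    "\<And>k \<mu>. \<mu> \<in> \<M> \<Longrightarrow> (\<integral>\<theta>. (cmod (trig (c k) \<theta> - indicator B \<theta>))\<^sup>2 \<partial>\<mu>) < inverse (real (Suc k))"
    by metis
  show ?thesis
  proof (intro exI[of _ c] conjI allI ballI c(1))
    fix \<mu> assume "\<mu> \<in> \<M>"
    from c(2)[OF this] show "(\<lambda>k. \<integral>\<theta>. (cmod (trig (c k) \<theta> - indicator B \<theta>))\<^sup>2 \<partial>\<mu>) \<longlonglongrightarrow> 0"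
      by (intro tendsto_sandwich[OF _ _ tendsto_const LIMSEQ_inverse_real_of_nat] always_eventually allI)
        (auto intro: less_imp_le simp del: of_nat_Suc)
  qed
qed

context unitary_op
begin

text \<open>The polynomial \<open>trig c\<close> evaluated at the unitary: \<open>upow n\<close>
  replaces the n-th exponential.\<close>

definition pop :: "(int \<Rightarrow> complex) \<Rightarrow> 'a \<Rightarrow> 'a" where
  "pop c \<psi> = (\<Sum>n | c n \<noteq> 0. c n *\<^sub>C upow n \<psi>)"

lemma pop_superset:
  "finite F \<Longrightarrow> {n. c n \<noteq> 0} \<subseteq> F \<Longrightarrow> pop c \<psi> = (\<Sum>n\<in>F. c n *\<^sub>C upow n \<psi>)"
  unfolding pop_def by (rule sum.mono_neutral_left) auto

lemma pop_add:
  assumes "fin_coeffs c" "fin_coeffs d"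
  shows "pop (\<lambda>n. c n + d n) \<psi> = pop c \<psi> + pop d \<psi>"
proof -
  let ?F = "{n. c n \<noteq> 0} \<union> {n. d n \<noteq> 0}"
  have F: "finite ?F" using assms by (simp add: fin_coeffs_def)
  show ?thesis
    by (subst (1 2 3) pop_superset[OF F]) (auto simp: sum.distrib scaleC_add_left)
qed

lemma pop_scale: "pop (\<lambda>n. a * c n) \<psi> = a *\<^sub>C pop c \<psi>"
  by (cases "a = 0") (simp_all add: pop_def scaleC_sum_right)

lemma pop_diff:
  assumes "fin_coeffs c" "fin_coeffs d"
  shows "pop (\<lambda>n. c n - d n) \<psi> = pop c \<psi> - pop d \<psi>"
  using pop_add[OF assms(1) fin_coeffs_scale[OF assms(2), of "-1"], of \<psi>] pop_scale[of "-1" d \<psi>]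
  by (simp add: scaleC_minus_one)

lemma pop_shift: "pop (\<lambda>n. c (n - m)) \<psi> = upow m (pop c \<psi>)"
proof -
  have "{n. c (n - m) \<noteq> 0} = (+) m ` {n. c n \<noteq> 0}"
    by (force simp: image_iff)
  hence "pop (\<lambda>n. c (n - m)) \<psi> = (\<Sum>n | c n \<noteq> 0. c n *\<^sub>C upow (m + n) \<psi>)"
    unfolding pop_def by (simp add: sum.reindex)
  thus ?thesis unfolding pop_def by (simp add: upow_sum upow_scaleC upow_add)
qed

lemma pop_one: "pop (\<lambda>n. if n = 0 then 1 else 0) \<psi> = \<psi>"
  using pop_superset[of "{0}" "\<lambda>n. if n = 0 then 1 else 0" \<psi>] by auto

lemma pop_vec_add: "pop c (x + y) = pop c x + pop c y"
  unfolding pop_def by (simp add: upow_plus scaleC_add_right sum.distrib)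

lemma pop_vec_scale: "pop c (a *\<^sub>C x) = a *\<^sub>C pop c x"
  unfolding pop_def by (simp add: upow_scaleC scaleC_sum_right mult.commute)

lemma spec_measD: "spec_meas \<psi> \<mu> \<Longrightarrow> circle_measure \<mu>"
  by (simp add: spec_meas_def)

text \<open>Both sides expand into the same double sum, because the correlations of
  \<open>\<psi>\<close> are the moments of \<open>\<mu>\<close>. This isometry carries mean-square
  statements about \<open>\<mu>\<close> over to norms of vectors.\<close>

lemma norm_pop:
  assumes "spec_meas \<psi> \<mu>"
  shows "(norm (pop c \<psi>))\<^sup>2 = (\<integral>\<theta>. (cmod (trig c \<theta>))\<^sup>2 \<partial>\<mu>)"
proof -
  interpret circle_measure \<mu> by (rule spec_measD[OF assms])
  have "complex_of_real ((norm (pop c \<psi>))\<^sup>2) =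
      (\<Sum>m | c m \<noteq> 0. \<Sum>n | c n \<noteq> 0. cnj (c m) * c n * cinner \<psi> (upow (n - m) \<psi>))"
    unfolding cinner_self[symmetric] pop_def
    by (subst cinner_sum_left, intro sum.cong refl, subst cinner_sum_right, intro sum.cong refl)
      (simp add: cinner_upow_upow)
  also have "\<dots> = complex_of_real (\<integral>\<theta>. (cmod (trig c \<theta>))\<^sup>2 \<partial>\<mu>)"
    using assms unfolding integral_trig_sq spec_meas_def by simp
  finally show ?thesis by (simp only: of_real_eq_iff)
qed

lemma spec_meas_dominated:
  assumes x: "spec_meas x \<mu>" and y: "spec_meas y \<mu>1" and z: "spec_meas z \<mu>2"
    and le: "\<And>c. fin_coeffs c \<Longrightarrow> (norm (pop c x))\<^sup>2 \<le> K * ((norm (pop c y))\<^sup>2 + (norm (pop c z))\<^sup>2)"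
    and B: "B \<in> sets borel"
  shows "measure \<mu> (B \<inter> circ) \<le> K * (measure \<mu>1 (B \<inter> circ) + measure \<mu>2 (B \<inter> circ))"
proof -
  interpret m: circle_measures "{\<mu>, \<mu>1, \<mu>2}"
    by (rule circle_measures.intro) (use spec_measD[OF x] spec_measD[OF y] spec_measD[OF z] in blast)+
  obtain c where c: "\<And>k. fin_coeffs (c k)" and
    lim: "\<And>\<nu>. \<nu> \<in> {\<mu>, \<mu>1, \<mu>2} \<Longrightarrow> (\<lambda>k. \<integral>\<theta>. (cmod (trig (c k) \<theta> - indicator B \<theta>))\<^sup>2 \<partial>\<nu>) \<longlonglongrightarrow> 0"
    using m.approx_seq[OF B] by blast
  have L: "(\<lambda>k. (norm (pop (c k) v))\<^sup>2) \<longlonglongrightarrow> measure \<nu> (B \<inter> circ)"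
    if "spec_meas v \<nu>" "\<nu> \<in> {\<mu>, \<mu>1, \<mu>2}" for v \<nu>
  proof -
    interpret n: circle_measure \<nu> by (rule spec_measD[OF that(1)])
    show ?thesis
      using n.l2_lim_integral[OF n.bdd_indicator[OF B] n.bdd_trig lim[OF that(2)]]
      by (simp add: norm_pop[OF that(1)] n.integral_sq_indicator[OF B])
  qed
  show ?thesis
  proof (rule LIMSEQ_le)
    show "(\<lambda>k. K * ((norm (pop (c k) y))\<^sup>2 + (norm (pop (c k) z))\<^sup>2)) \<longlonglongrightarrow>
        K * (measure \<mu>1 (B \<inter> circ) + measure \<mu>2 (B \<inter> circ))"
      by (intro tendsto_intros L y z) auto
  qed (use L[OF x] le c in auto)
qed

text \<open>Reads as: \<open>\<phi>\<close> is f(U) applied to \<open>\<psi>\<close>. It is a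
  relation witnessed by approximating polynomials, so that its algebraic rules can be proved before
  existence and uniqueness.\<close>

definition calc :: "'a \<Rightarrow> real measure \<Rightarrow> (real \<Rightarrow> complex) \<Rightarrow> 'a \<Rightarrow> bool" where
  "calc \<psi> \<mu> f \<phi> \<longleftrightarrow> (\<exists>c. (\<forall>k. fin_coeffs (c k)) \<and>
     (\<lambda>k. \<integral>\<theta>. (cmod (trig (c k) \<theta> - f \<theta>))\<^sup>2 \<partial>\<mu>) \<longlonglongrightarrow> 0 \<and> (\<lambda>k. pop (c k) \<psi>) \<longlonglongrightarrow> \<phi>)"

context
  fixes \<psi> :: 'a and \<mu> :: "real measure"
  assumes sm: "spec_meas \<psi> \<mu>"
begin

interpretation circle_measure \<mu>
  by (rule spec_measD[OF sm])

lemma calc_one: "calc \<psi> \<mu> (\<lambda>_. 1) \<psi>"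
  unfolding calc_def
  by (intro exI[of _ "\<lambda>k n. if n = 0 then 1 else 0"]) (simp add: fin_coeffs_single trig_single pop_one)

lemma calc_add:
  assumes f: "bdd f" "calc \<psi> \<mu> f \<phi>" and g: "bdd g" "calc \<psi> \<mu> g \<eta>"
  shows "calc \<psi> \<mu> (\<lambda>\<theta>. f \<theta> + g \<theta>) (\<phi> + \<eta>)"
proof -
  obtain c where c: "\<And>k. fin_coeffs (c k)" "(\<lambda>k. \<integral>\<theta>. (cmod (trig (c k) \<theta> - f \<theta>))\<^sup>2 \<partial>\<mu>) \<longlonglongrightarrow> 0"
    "(\<lambda>k. pop (c k) \<psi>) \<longlonglongrightarrow> \<phi>" using f(2) unfolding calc_def by blast
  obtain d where d: "\<And>k. fin_coeffs (d k)" "(\<lambda>k. \<integral>\<theta>. (cmod (trig (d k) \<theta> - g \<theta>))\<^sup>2 \<partial>\<mu>) \<longlonglongrightarrow> 0"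
    "(\<lambda>k. pop (d k) \<psi>) \<longlonglongrightarrow> \<eta>" using g(2) unfolding calc_def by blast
  have "(\<lambda>k. 2 * (\<integral>\<theta>. (cmod (trig (c k) \<theta> - f \<theta>))\<^sup>2 \<partial>\<mu>) + 2 * (\<integral>\<theta>. (cmod (trig (d k) \<theta> - g \<theta>))\<^sup>2 \<partial>\<mu>)) \<longlonglongrightarrow> 2 * 0 + 2 * 0"
    by (intro tendsto_intros c d)
  hence up: "(\<lambda>k. 2 * (\<integral>\<theta>. (cmod (trig (c k) \<theta> - f \<theta>))\<^sup>2 \<partial>\<mu>) + 2 * (\<integral>\<theta>. (cmod (trig (d k) \<theta> - g \<theta>))\<^sup>2 \<partial>\<mu>)) \<longlonglongrightarrow> 0"
    by simp
  have le: "(\<integral>\<theta>. (cmod (trig (\<lambda>n. c k n + d k n) \<theta> - (f \<theta> + g \<theta>)))\<^sup>2 \<partial>\<mu>) \<le>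
     2 * (\<integral>\<theta>. (cmod (trig (c k) \<theta> - f \<theta>))\<^sup>2 \<partial>\<mu>) + 2 * (\<integral>\<theta>. (cmod (trig (d k) \<theta> - g \<theta>))\<^sup>2 \<partial>\<mu>)" for k
  proof -
    have "trig (\<lambda>n. c k n + d k n) \<theta> - (f \<theta> + g \<theta>) = (trig (c k) \<theta> - f \<theta>) + (trig (d k) \<theta> - g \<theta>)" for \<theta>
      by (simp add: trig_add[OF c(1) d(1)])
    thus ?thesis
      by (simp only:) (intro integral_sq_add_le(2) bdd_measurable bdd_integrable_sq bdd_diff bdd_trig f g)
  qed
  have 1: "(\<lambda>k. \<integral>\<theta>. (cmod (trig (\<lambda>n. c k n + d k n) \<theta> - (f \<theta> + g \<theta>)))\<^sup>2 \<partial>\<mu>) \<longlonglongrightarrow> 0"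
    by (rule tendsto_sandwich[OF _ _ tendsto_const up]) (use le in auto)
  have 2: "(\<lambda>k. pop (\<lambda>n. c k n + d k n) \<psi>) \<longlonglongrightarrow> \<phi> + \<eta>"
    using tendsto_add[OF c(3) d(3)] by (simp add: pop_add[OF c(1) d(1)])
  show ?thesis
    unfolding calc_def
    by (rule exI[of _ "\<lambda>k n. c k n + d k n"]) (use 1 2 fin_coeffs_add[OF c(1) d(1)] in blast)
qed

lemma calc_scale:
  assumes "calc \<psi> \<mu> f \<phi>"
  shows "calc \<psi> \<mu> (\<lambda>\<theta>. a * f \<theta>) (a *\<^sub>C \<phi>)"
proof -
  obtain c where c: "\<And>k. fin_coeffs (c k)" "(\<lambda>k. \<integral>\<theta>. (cmod (trig (c k) \<theta> - f \<theta>))\<^sup>2 \<partial>\<mu>) \<longlonglongrightarrow> 0"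
    "(\<lambda>k. pop (c k) \<psi>) \<longlonglongrightarrow> \<phi>" using assms unfolding calc_def by blast
  have "cmod (trig (\<lambda>n. a * c k n) \<theta> - a * f \<theta>) = cmod a * cmod (trig (c k) \<theta> - f \<theta>)" for k \<theta>
    unfolding trig_scale right_diff_distrib[symmetric] norm_mult ..
  hence 1: "(\<lambda>k. \<integral>\<theta>. (cmod (trig (\<lambda>n. a * c k n) \<theta> - a * f \<theta>))\<^sup>2 \<partial>\<mu>) \<longlonglongrightarrow> 0"
    using tendsto_mult_left[OF c(2), of "(cmod a)\<^sup>2"] by (simp add: power_mult_distrib)
  have 2: "(\<lambda>k. pop (\<lambda>n. a * c k n) \<psi>) \<longlonglongrightarrow> a *\<^sub>C \<phi>"
    unfolding pop_scale by (intro tendsto_scaleC c)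
  show ?thesis
    unfolding calc_def
    by (rule exI[of _ "\<lambda>k n. a * c k n"]) (use 1 2 fin_coeffs_scale[OF c(1)] in blast)
qed

lemma calc_upow:
  assumes "calc \<psi> \<mu> f \<phi>"
  shows "calc \<psi> \<mu> (\<lambda>\<theta>. cis (of_int m * \<theta>) * f \<theta>) (upow m \<phi>)"
proof -
  obtain c where c: "\<And>k. fin_coeffs (c k)" "(\<lambda>k. \<integral>\<theta>. (cmod (trig (c k) \<theta> - f \<theta>))\<^sup>2 \<partial>\<mu>) \<longlonglongrightarrow> 0"
    "(\<lambda>k. pop (c k) \<psi>) \<longlonglongrightarrow> \<phi>" using assms unfolding calc_def by blast
  have "cmod (trig (\<lambda>n. c k (n - m)) \<theta> - cis (of_int m * \<theta>) * f \<theta>) = cmod (trig (c k) \<theta> - f \<theta>)" for k \<theta>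
    unfolding trig_shift right_diff_distrib[symmetric] norm_mult by simp
  hence 1: "(\<lambda>k. \<integral>\<theta>. (cmod (trig (\<lambda>n. c k (n - m)) \<theta> - cis (of_int m * \<theta>) * f \<theta>))\<^sup>2 \<partial>\<mu>) \<longlonglongrightarrow> 0"
    using c(2) by simp
  have 2: "(\<lambda>k. pop (\<lambda>n. c k (n - m)) \<psi>) \<longlonglongrightarrow> upow m \<phi>"
    unfolding pop_shift by (intro tendsto_upow c)
  show ?thesis
    unfolding calc_def
    by (rule exI[of _ "\<lambda>k n. c k (n - m)"]) (use 1 2 fin_coeffs_shift[OF c(1)] in blast)
qed

lemma calc_norm:
  assumes f: "bdd f" "calc \<psi> \<mu> f \<phi>"
  shows "(norm \<phi>)\<^sup>2 = (\<integral>\<theta>. (cmod (f \<theta>))\<^sup>2 \<partial>\<mu>)"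
proof -
  obtain c where c: "\<And>k. fin_coeffs (c k)" "(\<lambda>k. \<integral>\<theta>. (cmod (trig (c k) \<theta> - f \<theta>))\<^sup>2 \<partial>\<mu>) \<longlonglongrightarrow> 0"
    "(\<lambda>k. pop (c k) \<psi>) \<longlonglongrightarrow> \<phi>" using f(2) unfolding calc_def by blast
  have "(\<lambda>k. (norm (pop (c k) \<psi>))\<^sup>2) \<longlonglongrightarrow> (norm \<phi>)\<^sup>2"
    by (intro tendsto_intros c)
  moreover have "(\<lambda>k. (norm (pop (c k) \<psi>))\<^sup>2) \<longlonglongrightarrow> (\<integral>\<theta>. (cmod (f \<theta>))\<^sup>2 \<partial>\<mu>)"
    unfolding norm_pop[OF sm] by (rule l2_lim_integral[OF f(1) bdd_trig c(2)])
  ultimately show ?thesis by (rule LIMSEQ_unique)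
qed

lemma calc_diff:
  assumes f: "bdd f" "calc \<psi> \<mu> f \<phi>" and g: "bdd g" "calc \<psi> \<mu> g \<eta>"
  shows "calc \<psi> \<mu> (\<lambda>\<theta>. f \<theta> - g \<theta>) (\<phi> - \<eta>)"
proof -
  have "bdd (\<lambda>\<theta>. - 1 * g \<theta>)" by (intro bdd_mult bdd_const g)
  from calc_add[OF f this calc_scale[OF g(2)]] show ?thesis by (simp add: scaleC_minus_one)
qed

lemma calc_unique:
  assumes f: "bdd f" "calc \<psi> \<mu> f \<phi>" and g: "bdd g" "calc \<psi> \<mu> g \<eta>"
    and eq: "\<And>\<theta>. \<theta> \<in> circ \<Longrightarrow> f \<theta> = g \<theta>"
  shows "\<phi> = \<eta>"
proof -
  have "(norm (\<phi> - \<eta>))\<^sup>2 = (\<integral>\<theta>. (cmod (f \<theta> - g \<theta>))\<^sup>2 \<partial>\<mu>)"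
    by (rule calc_norm[OF bdd_diff[OF f(1) g(1)] calc_diff[OF f g]])
  also have "\<dots> = (\<integral>\<theta>. 0 \<partial>\<mu>)"
    by (rule Bochner_Integration.integral_cong) (auto simp: space_eq eq)
  finally show ?thesis by simp
qed

text \<open>Polarisation: \<open>calc_norm\<close> gives the norm of
  \<open>a *\<^sub>C \<phi> + \<eta>\<close>, and the values at \<open>a = 1\<close> and
  \<open>a = \<i>\<close> determine the inner product.\<close>

lemma calc_cinner:
  assumes f: "bdd f" "calc \<psi> \<mu> f \<phi>" and g: "bdd g" "calc \<psi> \<mu> g \<eta>"
  shows "cinner \<phi> \<eta> = (\<integral>\<theta>. cnj (f \<theta>) * g \<theta> \<partial>\<mu>)"
proof -
  have ib: "integrable \<mu> (\<lambda>\<theta>. cnj (f \<theta>) * g \<theta>)"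
    by (intro bdd_integrable bdd_mult bdd_cnj f g)
  have sq: "(cmod (a + b))\<^sup>2 = (cmod a)\<^sup>2 + (cmod b)\<^sup>2 + 2 * Re (cnj a * b)" for a b
    unfolding cmod_power2 by (simp add: power2_eq_square algebra_simps)
  have n: "(norm (a *\<^sub>C \<phi> + \<eta>))\<^sup>2 = (cmod a)\<^sup>2 * (norm \<phi>)\<^sup>2 + (norm \<eta>)\<^sup>2 + 2 * Re (cnj a * (\<integral>\<theta>. cnj (f \<theta>) * g \<theta> \<partial>\<mu>))" for a
  proof -
    have af: "bdd (\<lambda>\<theta>. a * f \<theta>)" by (intro bdd_mult bdd_const f)
    have "(norm (a *\<^sub>C \<phi> + \<eta>))\<^sup>2 = (\<integral>\<theta>. (cmod (a * f \<theta> + g \<theta>))\<^sup>2 \<partial>\<mu>)"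
      by (rule calc_norm[OF bdd_add[OF af g(1)] calc_add[OF af calc_scale[OF f(2)] g]])
    also have "\<dots> = (\<integral>\<theta>. (cmod a)\<^sup>2 * (cmod (f \<theta>))\<^sup>2 + (cmod (g \<theta>))\<^sup>2 + 2 * Re (cnj a * (cnj (f \<theta>) * g \<theta>)) \<partial>\<mu>)"
      by (simp only: sq norm_mult power_mult_distrib complex_cnj_mult mult.assoc)
    also have "\<dots> = (cmod a)\<^sup>2 * (norm \<phi>)\<^sup>2 + (norm \<eta>)\<^sup>2 + 2 * Re (\<integral>\<theta>. cnj a * (cnj (f \<theta>) * g \<theta>) \<partial>\<mu>)"
      unfolding calc_norm[OF f] calc_norm[OF g]
      using bdd_integrable_sq[OF f(1)] bdd_integrable_sq[OF g(1)] integrable_mult_right[OF ib, of "cnj a"]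
      by (simp add: integral_Re integrable_Re del: times_complex.sel)
    finally show ?thesis by simp
  qed
  show ?thesis
    unfolding polarization[of \<phi> \<eta>] using n[of 1] n[of \<i>] by (simp add: complex_eq_iff)
qed

text \<open>By \<open>calc_upow\<close> and \<open>calc_cinner\<close>, the correlations of
  \<open>\<phi>\<close> integrate the exponentials against the squared modulus of \<open>f\<close>,
  so this density has the right moments.\<close>

lemma calc_spec_meas:
  assumes f: "bdd f" "calc \<psi> \<mu> f \<phi>"
  shows "spec_meas \<phi> (density \<mu> (\<lambda>\<theta>. ennreal ((cmod (f \<theta>))\<^sup>2)))"
  unfolding spec_meas_def
proof
  note [measurable] = bdd_measurable[OF f(1)]
  show "circle_measure (density \<mu> (\<lambda>\<theta>. ennreal ((cmod (f \<theta>))\<^sup>2)))"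
  proof (rule circle_measureI)
    have "emeasure (density \<mu> (\<lambda>\<theta>. ennreal ((cmod (f \<theta>))\<^sup>2))) (space \<mu>) = (\<integral>\<^sup>+\<theta>. ennreal ((cmod (f \<theta>))\<^sup>2) \<partial>\<mu>)"
      by (subst emeasure_density) (auto intro!: nn_integral_cong)
    also have "\<dots> < \<infinity>"
      using bdd_integrable_sq[OF f(1)] by (simp add: nn_integral_eq_integral)
    finally show "emeasure (density \<mu> (\<lambda>\<theta>. ennreal ((cmod (f \<theta>))\<^sup>2)))
        (space (density \<mu> (\<lambda>\<theta>. ennreal ((cmod (f \<theta>))\<^sup>2)))) \<noteq> \<infinity>" by simp
  qed (simp add: sets_eq)
  show "\<forall>n. cinner \<phi> (upow n \<phi>) = (\<integral>\<theta>. cis (of_int n * \<theta>) \<partial>density \<mu> (\<lambda>\<theta>. ennreal ((cmod (f \<theta>))\<^sup>2)))"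
  proof
    fix n
    have "cinner \<phi> (upow n \<phi>) = (\<integral>\<theta>. cnj (f \<theta>) * (cis (of_int n * \<theta>) * f \<theta>) \<partial>\<mu>)"
      by (intro calc_cinner f calc_upow bdd_mult bdd_cis)
    also have "\<dots> = (\<integral>\<theta>. (cmod (f \<theta>))\<^sup>2 *\<^sub>R cis (of_int n * \<theta>) \<partial>\<mu>)"
      by (intro Bochner_Integration.integral_cong refl)
        (simp add: scaleR_conv_of_real complex_norm_square del: of_real_power)
    also have "\<dots> = (\<integral>\<theta>. cis (of_int n * \<theta>) \<partial>density \<mu> (\<lambda>\<theta>. ennreal ((cmod (f \<theta>))\<^sup>2)))"
      by (subst integral_density) auto
    finally show "cinner \<phi> (upow n \<phi>) = (\<integral>\<theta>. cis (of_int n * \<theta>) \<partial>density \<mu> (\<lambda>\<theta>. ennreal ((cmod (f \<theta>))\<^sup>2)))" .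
  qed
qed

text \<open>Mean-square convergence of the polynomials makes the vectors
  \<open>pop (c k) \<psi>\<close> a Cauchy sequence through \<open>norm_pop\<close>; completeness of
  the space supplies the limit.\<close>

lemma calc_exists:
  assumes B: "B \<in> sets borel"
  shows "\<exists>\<phi>. calc \<psi> \<mu> (indicator B) \<phi>"
proof -
  interpret m: circle_measures "{\<mu>}"
    by (rule circle_measures.intro) (use spec_measD[OF sm] in blast)+
  obtain c where c: "\<And>k. fin_coeffs (c k)" and
    lim: "(\<lambda>k. \<integral>\<theta>. (cmod (trig (c k) \<theta> - indicator B \<theta>))\<^sup>2 \<partial>\<mu>) \<longlonglongrightarrow> 0"
    using m.approx_seq[OF B] by blast
  let ?e = "\<lambda>k. \<integral>\<theta>. (cmod (trig (c k) \<theta> - indicator B \<theta>))\<^sup>2 \<partial>\<mu>"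
  have d: "(norm (pop (c k) \<psi> - pop (c l) \<psi>))\<^sup>2 \<le> 2 * ?e k + 2 * ?e l" for k l
  proof -
    have "(norm (pop (c k) \<psi> - pop (c l) \<psi>))\<^sup>2 = (\<integral>\<theta>. (cmod (trig (\<lambda>n. c k n - c l n) \<theta>))\<^sup>2 \<partial>\<mu>)"
      unfolding pop_diff[OF c c, symmetric] by (rule norm_pop[OF sm])
    also have "\<dots> = (\<integral>\<theta>. (cmod ((trig (c k) \<theta> - indicator B \<theta>) + (indicator B \<theta> - trig (c l) \<theta>)))\<^sup>2 \<partial>\<mu>)"
      by (simp add: trig_diff[OF c c])
    also have "\<dots> \<le> 2 * ?e k + 2 * (\<integral>\<theta>. (cmod (indicator B \<theta> - trig (c l) \<theta>))\<^sup>2 \<partial>\<mu>)"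
      by (intro integral_sq_add_le(2) bdd_measurable bdd_integrable_sq bdd_diff bdd_trig bdd_indicator B)
    finally show ?thesis by (simp add: norm_minus_commute)
  qed
  have "Cauchy (\<lambda>k. pop (c k) \<psi>)"
  proof (rule CauchyI)
    fix e :: real assume e: "e > 0"
    have "eventually (\<lambda>k. ?e k < e\<^sup>2 / 4) sequentially"
      by (rule order_tendstoD(2)[OF lim]) (use e in simp)
    then obtain N where N: "\<And>k. k \<ge> N \<Longrightarrow> ?e k < e\<^sup>2 / 4" unfolding eventually_sequentially by blast
    have "norm (pop (c k) \<psi> - pop (c l) \<psi>) < e" if "k \<ge> N" "l \<ge> N" for k l
    proof -
      have "(norm (pop (c k) \<psi> - pop (c l) \<psi>))\<^sup>2 < e\<^sup>2"
        using d[of k l] N[OF that(1)] N[OF that(2)] by linarith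
      thus ?thesis using e by (simp add: power2_less_imp_less)
    qed
    thus "\<exists>M. \<forall>m\<ge>M. \<forall>n\<ge>M. norm (pop (c m) \<psi> - pop (c n) \<psi>) < e" by blast
  qed
  then obtain \<phi> where "(\<lambda>k. pop (c k) \<psi>) \<longlonglongrightarrow> \<phi>"
    using Cauchy_convergent convergent_def by blast
  thus ?thesis unfolding calc_def using c lim by blast
qed

end

end

subsection \<open>Absolutely continuous, singular and smooth vectors\<close>

lemma norm_add_sq_le: "(norm (x + y :: 'a::real_normed_vector))\<^sup>2 \<le> 2 * ((norm x)\<^sup>2 + (norm y)\<^sup>2)"
proof -
  have "(norm (x + y))\<^sup>2 \<le> (norm x + norm y)\<^sup>2"
    by (intro power_mono norm_triangle_ineq) simp
  also have "\<dots> \<le> 2 * ((norm x)\<^sup>2 + (norm y)\<^sup>2)"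
    using sum_squares_bound[of "norm x" "norm y"] by (simp add: power2_sum)
  finally show ?thesis .
qed

lemma null_sets_lcirc: "B \<in> null_sets lcirc \<longleftrightarrow> B \<subseteq> circ \<and> B \<in> null_sets lborel"
  unfolding lcirc_def by (rule null_sets_restrict_space) simp

lemma sets_lcirc_iff: "B \<in> sets lcirc \<longleftrightarrow> B \<in> sets borel \<and> B \<subseteq> circ"
  unfolding lcirc_def by (subst sets_restrict_space_iff) auto

lemma (in circle_measure) sets_iff: "B \<in> sets \<mu> \<longleftrightarrow> B \<in> sets borel \<and> B \<subseteq> circ"
  using sets_lcirc_iff sets_eq by (simp add: sets_lcirc)

lemma (in circle_measure) abs_cont_iff:
  "absolutely_continuous lcirc \<mu> \<longleftrightarrow> (\<forall>B. B \<subseteq> circ \<longrightarrow> B \<in> null_sets lborel \<longrightarrow> measure \<mu> B = 0)"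
proof
  assume "absolutely_continuous lcirc \<mu>"
  thus "\<forall>B. B \<subseteq> circ \<longrightarrow> B \<in> null_sets lborel \<longrightarrow> measure \<mu> B = 0"
    unfolding absolutely_continuous_def
    using null_sets_lcirc by (metis measure_eq_0_null_sets subsetD)
next
  assume *: "\<forall>B. B \<subseteq> circ \<longrightarrow> B \<in> null_sets lborel \<longrightarrow> measure \<mu> B = 0"
  show "absolutely_continuous lcirc \<mu>"
    unfolding absolutely_continuous_def
  proof
    fix B assume "B \<in> null_sets lcirc"
    hence B: "B \<subseteq> circ" "B \<in> null_sets lborel" by (simp_all add: null_sets_lcirc)
    have "B \<in> sets \<mu>" using B by (auto simp: sets_iff null_sets_def)
    moreover have "emeasure \<mu> B = 0" using * B by (simp add: emeasure_eq_measure)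
    ultimately show "B \<in> null_sets \<mu>" by (simp add: null_sets_def)
  qed
qed

lemma trig_reflect: "trig (\<lambda>n. cnj (c (- n))) \<theta> = cnj (trig c \<theta>)"
proof -
  have "{n. cnj (c (- n)) \<noteq> 0} = uminus ` {n. c n \<noteq> 0}"
    by (force simp: image_iff)
  thus ?thesis unfolding trig_def by (simp add: sum.reindex cis_cnj)
qed

lemma parseval_trig:
  assumes "fin_coeffs c"
  shows "(\<integral>\<theta>. (cmod (trig c \<theta>))\<^sup>2 \<partial>lcirc) = 2 * pi * (\<Sum>n | c n \<noteq> 0. (cmod (c n))\<^sup>2)"
proof -
  let ?F = "{n. c n \<noteq> 0}"
  have fin: "finite ?F" using assms by (simp add: fin_coeffs_def)
  have "complex_of_real (\<integral>\<theta>. (cmod (trig c \<theta>))\<^sup>2 \<partial>lcirc) =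
      (\<Sum>m\<in>?F. \<Sum>n\<in>?F. if n = m then cnj (c m) * c m * of_real (2 * pi) else 0)"
    unfolding lcirc.integral_trig_sq integral_cis by (intro sum.cong refl) auto
  also have "\<dots> = (\<Sum>m\<in>?F. cnj (c m) * c m * of_real (2 * pi))"
    using fin by (intro sum.cong refl) (simp add: sum.delta)
  also have "\<dots> = (\<Sum>m\<in>?F. of_real (2 * pi * (cmod (c m))\<^sup>2))"
    by (intro sum.cong refl) (simp add: complex_norm_square mult.commute del: of_real_power)
  also have "\<dots> = of_real (2 * pi * (\<Sum>n\<in>?F. (cmod (c n))\<^sup>2))"
    by (simp only: of_real_sum[symmetric] sum_distrib_left)
  finally show ?thesis by (simp only: of_real_eq_iff)
qed

context unitary_op
begin

definition ac_vec :: "'a \<Rightarrow> bool" where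
  "ac_vec \<psi> \<longleftrightarrow> (\<exists>\<mu>. spec_meas \<psi> \<mu> \<and> absolutely_continuous lcirc \<mu>)"

definition sc_vec :: "'a \<Rightarrow> bool" where
  "sc_vec \<psi> \<longleftrightarrow> (\<exists>\<mu>. spec_meas \<psi> \<mu> \<and> (\<forall>\<theta>. emeasure \<mu> {\<theta>} = 0) \<and>
     (\<exists>N\<in>sets \<mu>. emeasure lborel N = 0 \<and> emeasure \<mu> (space \<mu> - N) = 0))"

definition sing_vec :: "'a \<Rightarrow> bool" where
  "sing_vec \<psi> \<longleftrightarrow> (\<exists>\<mu> N. spec_meas \<psi> \<mu> \<and> N \<subseteq> circ \<and> N \<in> null_sets lborel \<and> measure \<mu> (circ - N) = 0)"

definition eigvecs :: "'a set" where
  "eigvecs = {v. \<exists>e. U v = e *\<^sub>C v}"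

text \<open>\<open>span\<close> is the real span; since \<open>eigvecs\<close> contains 0 and is
  closed under complex multiples, it is the complex span as well.\<close>

definition pp :: "'a set" where
  "pp = closure (span eigvecs)"

text \<open>A Bessel inequality for the forward orbit, uniform in its length. It holds for vectors
  whose spectral measure has bounded density.\<close>

definition smooth :: "real \<Rightarrow> 'a \<Rightarrow> bool" where
  "smooth K \<phi> \<longleftrightarrow> 0 \<le> K \<and> (\<forall>g N. (\<Sum>n<N. (cmod (cinner g ((U ^^ n) \<phi>)))\<^sup>2) \<le> K * (norm g)\<^sup>2)"

text \<open>By \<open>spec_meas_dominated\<close>, a set that is null for the measures of
  \<open>y\<close> and \<open>z\<close> is null for that of \<open>x\<close>. This yields closure of
  \<open>ac_vec\<close> under linear combinations although spectral measures are not additive in the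
  vector.\<close>

lemma ac_vec_dominated:
  assumes y: "ac_vec y" and z: "ac_vec z"
    and le: "\<And>c. fin_coeffs c \<Longrightarrow> (norm (pop c x))\<^sup>2 \<le> K * ((norm (pop c y))\<^sup>2 + (norm (pop c z))\<^sup>2)"
  shows "ac_vec x"
proof -
  obtain \<mu> where x: "spec_meas x \<mu>" using spec_meas_exists by blast
  obtain \<mu>1 where y: "spec_meas y \<mu>1" "absolutely_continuous lcirc \<mu>1" using y ac_vec_def by auto
  obtain \<mu>2 where z: "spec_meas z \<mu>2" "absolutely_continuous lcirc \<mu>2" using z ac_vec_def by auto
  interpret m: circle_measure \<mu> by (rule spec_measD[OF x])
  interpret m1: circle_measure \<mu>1 by (rule spec_measD[OF y(1)])
  interpret m2: circle_measure \<mu>2 by (rule spec_measD[OF z(1)])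
  have "measure \<mu> B = 0" if B: "B \<subseteq> circ" "B \<in> null_sets lborel" for B
  proof -
    have "measure \<mu> (B \<inter> circ) \<le> K * (measure \<mu>1 (B \<inter> circ) + measure \<mu>2 (B \<inter> circ))"
      by (rule spec_meas_dominated[OF x y(1) z(1) le]) (use B in \<open>auto simp: null_sets_def\<close>)
    also have "B \<inter> circ = B" using B by blast
    also have "K * (measure \<mu>1 B + measure \<mu>2 B) = 0"
      using y(2) z(2) B unfolding m1.abs_cont_iff m2.abs_cont_iff by simp
    finally show ?thesis by (simp add: measure_le_0_iff)
  qed
  hence "absolutely_continuous lcirc \<mu>" unfolding m.abs_cont_iff by blast
  thus ?thesis using x ac_vec_def by blast
qed

lemma ac_vec_add: "ac_vec x \<Longrightarrow> ac_vec y \<Longrightarrow> ac_vec (x + y)"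
  by (rule ac_vec_dominated[where K = 2 and y = x and z = y]) (simp_all only: pop_vec_add norm_add_sq_le)

lemma ac_vec_scaleC: "ac_vec x \<Longrightarrow> ac_vec (a *\<^sub>C x)"
  by (rule ac_vec_dominated[where K = "(cmod a)\<^sup>2" and y = x and z = x])
    (auto simp: pop_vec_scale power_mult_distrib algebra_simps)

lemma ac_vec_diff: "ac_vec x \<Longrightarrow> ac_vec y \<Longrightarrow> ac_vec (x - y)"
  using ac_vec_add[of x "(-1) *\<^sub>C y"] ac_vec_scaleC[of y "-1"] by (simp add: scaleC_minus_one)

lemma cinner_pop: "cinner x (pop c y) = cinner (pop (\<lambda>n. cnj (c (- n))) x) y"
proof -
  have "{n. cnj (c (- n)) \<noteq> 0} = uminus ` {n. c n \<noteq> 0}"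
    by (force simp: image_iff)
  hence "pop (\<lambda>n. cnj (c (- n))) x = (\<Sum>n | c n \<noteq> 0. cnj (c n) *\<^sub>C upow (- n) x)"
    unfolding pop_def by (simp add: sum.reindex)
  thus ?thesis unfolding pop_def
    by (simp add: cinner_sum_left cinner_sum_right upow_cinner_right[symmetric])
qed

text \<open>Let \<open>N\<close> be a Lebesgue null set carrying the measure of \<open>y\<close>,
  and approximate its indicator by polynomials for both measures. Then p(U) \<open>y\<close> tends
  to \<open>y\<close>, while the adjoint of p(U) sends \<open>x\<close> to vectors tending to 0;
  moving p(U) across the inner product gives the claim.\<close>

lemma ac_sing_orthogonal:
  assumes "ac_vec x" "sing_vec y"
  shows "cinner x y = 0"
proof -
  obtain \<mu> where x: "spec_meas x \<mu>" "absolutely_continuous lcirc \<mu>" using assms(1) ac_vec_def by blast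
  obtain \<nu> N where y: "spec_meas y \<nu>" and N: "N \<subseteq> circ" "N \<in> null_sets lborel" "measure \<nu> (circ - N) = 0"
    using assms(2) sing_vec_def by blast
  interpret m: circle_measure \<mu> by (rule spec_measD[OF x(1)])
  interpret n: circle_measure \<nu> by (rule spec_measD[OF y])
  interpret mm: circle_measures "{\<mu>, \<nu>}"
    by (rule circle_measures.intro) (use spec_measD[OF x(1)] spec_measD[OF y] in blast)+
  have Nb: "N \<in> sets borel" using N by (auto simp: null_sets_def)
  obtain c where c: "\<And>k. fin_coeffs (c k)" and
    lim: "\<And>\<rho>. \<rho> \<in> {\<mu>, \<nu>} \<Longrightarrow> (\<lambda>k. \<integral>\<theta>. (cmod (trig (c k) \<theta> - indicator N \<theta>))\<^sup>2 \<partial>\<rho>) \<longlonglongrightarrow> 0"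
    using mm.approx_seq[OF Nb] by blast
  have "(\<lambda>k. \<integral>\<theta>. (cmod (trig (c k) \<theta>))\<^sup>2 \<partial>\<mu>) \<longlonglongrightarrow> (\<integral>\<theta>. (cmod (indicator N \<theta>))\<^sup>2 \<partial>\<mu>)"
    by (rule m.l2_lim_integral[OF m.bdd_indicator[OF Nb] m.bdd_trig lim]) simp
  also have "(\<integral>\<theta>. (cmod (indicator N \<theta>))\<^sup>2 \<partial>\<mu>) = 0"
    using m.integral_sq_indicator[OF Nb] N x(2) unfolding m.abs_cont_iff by (simp add: Int_absorb2)
  finally have L1: "(\<lambda>k. (norm (pop (\<lambda>n. cnj (c k (- n))) x))\<^sup>2) \<longlonglongrightarrow> 0"
    by (simp add: norm_pop[OF x(1)] trig_reflect)
  have nN: "AE \<theta> in \<nu>. \<theta> \<in> N"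
  proof -
    have "circ - N \<in> null_sets \<nu>"
      using N Nb by (simp add: null_sets_def n.sets_iff n.emeasure_eq_measure)
    thus ?thesis by (rule AE_I') (auto simp: n.space_eq)
  qed
  have "(norm (pop (c k) y - y))\<^sup>2 = (\<integral>\<theta>. (cmod (trig (c k) \<theta> - indicator N \<theta>))\<^sup>2 \<partial>\<nu>)" for k
  proof -
    \<comment> \<open>The coefficients of the constant polynomial 1, so that \<open>y\<close> is
      itself a value of \<open>pop\<close>.\<close>
    let ?\<delta> = "\<lambda>n::int. if n = 0 then 1 else 0 :: complex"
    have "(norm (pop (c k) y - y))\<^sup>2 = (\<integral>\<theta>. (cmod (trig (\<lambda>n. c k n - ?\<delta> n) \<theta>))\<^sup>2 \<partial>\<nu>)"
      using norm_pop[OF y, of "\<lambda>n. c k n - ?\<delta> n"]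
      by (simp only: pop_diff[OF c fin_coeffs_single] pop_one)
    also have "\<dots> = (\<integral>\<theta>. (cmod (trig (c k) \<theta> - 1))\<^sup>2 \<partial>\<nu>)"
      by (simp add: trig_diff[OF c fin_coeffs_single] trig_single)
    also have "\<dots> = (\<integral>\<theta>. (cmod (trig (c k) \<theta> - indicator N \<theta>))\<^sup>2 \<partial>\<nu>)"
    proof (rule integral_cong_AE)
      show "AE \<theta> in \<nu>. (cmod (trig (c k) \<theta> - 1))\<^sup>2 = (cmod (trig (c k) \<theta> - indicator N \<theta>))\<^sup>2"
        using nN by eventually_elim simp
    qed (use n.bdd_measurable[OF n.bdd_indicator[OF Nb]] in measurable)
    finally show ?thesis .
  qed
  hence L2: "(\<lambda>k. (norm (pop (c k) y - y))\<^sup>2) \<longlonglongrightarrow> 0" using lim by simp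
  have "(\<lambda>k. norm (pop (c k) y - y)) \<longlonglongrightarrow> 0"
    using tendsto_real_sqrt[OF L2] by simp
  hence "(\<lambda>k. pop (c k) y) \<longlonglongrightarrow> y" by (simp add: LIM_zero_iff tendsto_norm_zero_iff)
  hence A: "(\<lambda>k. cinner x (pop (c k) y)) \<longlonglongrightarrow> cinner x y" by (intro tendsto_intros)
  have "(\<lambda>k. norm (pop (\<lambda>n. cnj (c k (- n))) x)) \<longlonglongrightarrow> 0"
    using tendsto_real_sqrt[OF L1] by simp
  hence "(\<lambda>k. pop (\<lambda>n. cnj (c k (- n))) x) \<longlonglongrightarrow> 0" by (simp only: tendsto_norm_zero_iff)
  hence "(\<lambda>k. cinner (pop (\<lambda>n. cnj (c k (- n))) x) y) \<longlonglongrightarrow> cinner 0 y" by (intro tendsto_intros)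
  hence "(\<lambda>k. cinner x (pop (c k) y)) \<longlonglongrightarrow> 0" by (simp add: cinner_pop)
  thus ?thesis using A LIMSEQ_unique by blast
qed

lemma smooth_cinner_tendsto:
  assumes "smooth K \<phi>"
  shows "(\<lambda>n. cinner g ((U ^^ n) \<phi>)) \<longlonglongrightarrow> 0"
proof -
  have "summable (\<lambda>n. (cmod (cinner g ((U ^^ n) \<phi>)))\<^sup>2)"
    by (rule summableI_nonneg_bounded[where x = "K * (norm g)\<^sup>2"])
      (use assms in \<open>auto simp: smooth_def\<close>)
  hence "(\<lambda>n. (cmod (cinner g ((U ^^ n) \<phi>)))\<^sup>2) \<longlonglongrightarrow> 0" by (rule summable_LIMSEQ_zero)
  from tendsto_real_sqrt[OF this] show ?thesis by (simp add: tendsto_norm_zero_iff)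
qed

text \<open>Duality: with the conjugated orbit coefficients of \<open>g\<close> as polynomial
  coefficients, their square sum \<open>S\<close> equals an inner product of \<open>g\<close> with
  \<open>pop c \<phi>\<close>. Cauchy-Schwarz bounds \<open>S\<close> squared by a multiple of
  \<open>S\<close>, and one factor cancels.\<close>

lemma smoothI:
  assumes K: "0 \<le> K" and le: "\<And>c. fin_coeffs c \<Longrightarrow> (norm (pop c \<phi>))\<^sup>2 \<le> K * (\<Sum>n | c n \<noteq> 0. (cmod (c n))\<^sup>2)"
  shows "smooth K \<phi>"
  unfolding smooth_def
proof (intro conjI allI K)
  fix g N
  define a where "a n = cinner g ((U ^^ n) \<phi>)" for n
  define S where "S = (\<Sum>n<N. (cmod (a n))\<^sup>2)"
  define c where "c n = (if 0 \<le> n \<and> n < int N then cnj (a (nat n)) else 0)" for n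
  have sub: "{n. c n \<noteq> 0} \<subseteq> int ` {..<N}"
    by (auto simp: c_def image_iff intro!: bexI[of _ "nat _"] split: if_splits)
  hence fc: "fin_coeffs c" unfolding fin_coeffs_def by (rule finite_subset) simp
  have cs: "(\<Sum>n | c n \<noteq> 0. (cmod (c n))\<^sup>2) = S"
  proof -
    have "(\<Sum>n | c n \<noteq> 0. (cmod (c n))\<^sup>2) = (\<Sum>n\<in>int ` {..<N}. (cmod (c n))\<^sup>2)"
      by (rule sum.mono_neutral_left) (use sub in auto)
    thus ?thesis by (simp add: sum.reindex S_def c_def)
  qed
  have "pop c \<phi> = (\<Sum>n\<in>int ` {..<N}. c n *\<^sub>C upow n \<phi>)"
    by (rule pop_superset) (use sub in auto)
  also have "\<dots> = (\<Sum>n<N. cnj (a n) *\<^sub>C (U ^^ n) \<phi>)"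
    by (simp add: sum.reindex c_def upow_of_nat)
  finally have "cinner g (pop c \<phi>) = (\<Sum>n<N. cnj (a n) * a n)"
    by (simp add: cinner_sum_right a_def)
  also have "\<dots> = of_real S"
    unfolding S_def of_real_sum
    by (intro sum.cong refl) (simp add: complex_norm_square mult.commute del: of_real_power)
  finally have inner: "cinner g (pop c \<phi>) = complex_of_real S" .
  have S0: "0 \<le> S" by (simp add: S_def sum_nonneg)
  hence "S = cmod (cinner g (pop c \<phi>))" by (simp add: inner)
  also have "\<dots> \<le> norm g * norm (pop c \<phi>)" by (rule cmod_cinner_le)
  finally have "S\<^sup>2 \<le> (norm g * norm (pop c \<phi>))\<^sup>2"
    by (intro power_mono) (simp_all add: S_def sum_nonneg)
  also have "\<dots> \<le> (norm g)\<^sup>2 * (K * S)"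
    unfolding power_mult_distrib using le[OF fc] cs by (intro mult_left_mono) auto
  finally have "S * S \<le> (K * (norm g)\<^sup>2) * S" by (simp add: power2_eq_square mult_ac)
  moreover have "0 \<le> S" by (simp add: S_def sum_nonneg)
  ultimately have "S \<le> K * (norm g)\<^sup>2"
    using K by (cases "S = 0") (simp_all add: mult_le_cancel_right)
  thus "(\<Sum>n<N. (cmod (cinner g ((U ^^ n) \<phi>)))\<^sup>2) \<le> K * (norm g)\<^sup>2"
    by (simp add: S_def a_def)
qed

text \<open>Cut the spectral density \<open>f\<close> off at height \<open>k\<close>:
  \<open>X k\<close> is the spectral projection of \<open>\<psi>\<close> onto the set where
  \<open>f\<close> is at most \<open>k\<close>. Its measure has density at most \<open>k\<close>, so
  Parseval gives the smoothness constant \<open>k * (2 * pi)\<close>; since \<open>f\<close> is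
  finite almost everywhere, these sets exhaust the circle.\<close>

lemma ac_approx_smooth:
  assumes "ac_vec \<psi>"
  obtains X K where "\<And>n. smooth (K n) (X n)" "X \<longlonglongrightarrow> \<psi>"
proof -
  obtain \<mu> where sm: "spec_meas \<psi> \<mu>" and ac: "absolutely_continuous lcirc \<mu>" using assms ac_vec_def by blast
  interpret m: circle_measure \<mu> by (rule spec_measD[OF sm])
  obtain f where f: "f \<in> borel_measurable lcirc" "density lcirc f = \<mu>"
    using lcirc.Radon_Nikodym[OF ac] m.sets_eq sets_lcirc by auto
  define B where "B k = {\<theta>\<in>circ. f \<theta> \<le> of_nat k}" for k :: nat
  have Bl: "B k \<in> sets lcirc" for k
    using f(1) unfolding B_def lcirc.space_eq[symmetric] by measurable
  have Bb: "B k \<in> sets borel" for k using Bl[of k] sets_lcirc_iff by blast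
  have Bc: "B k \<subseteq> circ" for k by (auto simp: B_def)
  obtain X where X: "\<And>k. calc \<psi> \<mu> (indicator (B k)) (X k)"
    using calc_exists[OF sm Bb] by metis
  have bdd: "m.bdd (indicator (B k))" for k by (rule m.bdd_indicator[OF Bb])
  show thesis
  proof
    fix k
    show "smooth (real k * (2 * pi)) (X k)"
    proof (rule smoothI)
      fix c assume c: "fin_coeffs c"
      let ?\<nu> = "density \<mu> (\<lambda>\<theta>. ennreal ((cmod (indicator (B k) \<theta>))\<^sup>2))"
      have sX: "spec_meas (X k) ?\<nu>" by (rule calc_spec_meas[OF sm bdd X])
      have "ennreal ((norm (pop c (X k)))\<^sup>2) = ennreal (\<integral>\<theta>. (cmod (trig c \<theta>))\<^sup>2 \<partial>?\<nu>)"
        by (simp add: norm_pop[OF sX])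
      also have "\<dots> = (\<integral>\<^sup>+\<theta>. ennreal ((cmod (trig c \<theta>))\<^sup>2) \<partial>?\<nu>)"
      proof -
        interpret n: circle_measure ?\<nu> by (rule spec_measD[OF sX])
        show ?thesis by (rule nn_integral_eq_integral[symmetric]) (auto intro!: n.bdd_integrable_sq n.bdd_trig)
      qed
      also have "\<dots> = (\<integral>\<^sup>+\<theta>. ennreal ((cmod (indicator (B k) \<theta>))\<^sup>2) * ennreal ((cmod (trig c \<theta>))\<^sup>2) \<partial>\<mu>)"
        using m.bdd_measurable[OF bdd] by (intro nn_integral_density) auto
      also have "\<dots> = (\<integral>\<^sup>+\<theta>. f \<theta> * (ennreal ((cmod (indicator (B k) \<theta>))\<^sup>2) * ennreal ((cmod (trig c \<theta>))\<^sup>2)) \<partial>lcirc)"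
        unfolding f(2)[symmetric] using f(1) lcirc.bdd_measurable[OF lcirc.bdd_indicator[OF Bb, of k]]
        by (intro nn_integral_density) auto
      also have "\<dots> \<le> (\<integral>\<^sup>+\<theta>. of_nat k * ennreal ((cmod (trig c \<theta>))\<^sup>2) \<partial>lcirc)"
      proof (rule nn_integral_mono)
        fix \<theta>
        show "f \<theta> * (ennreal ((cmod (indicator (B k) \<theta>))\<^sup>2) * ennreal ((cmod (trig c \<theta>))\<^sup>2))
          \<le> of_nat k * ennreal ((cmod (trig c \<theta>))\<^sup>2)"
          by (auto simp: B_def intro!: mult_right_mono split: split_indicator)
      qed
      also have "\<dots> = of_nat k * (\<integral>\<^sup>+\<theta>. ennreal ((cmod (trig c \<theta>))\<^sup>2) \<partial>lcirc)"
        by (rule nn_integral_cmult) simp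
      also have "(\<integral>\<^sup>+\<theta>. ennreal ((cmod (trig c \<theta>))\<^sup>2) \<partial>lcirc) = ennreal (\<integral>\<theta>. (cmod (trig c \<theta>))\<^sup>2 \<partial>lcirc)"
        by (rule nn_integral_eq_integral) (auto intro!: lcirc.bdd_integrable_sq lcirc.bdd_trig)
      also have "of_nat k * \<dots> = ennreal (real k * (2 * pi) * (\<Sum>n | c n \<noteq> 0. (cmod (c n))\<^sup>2))"
        unfolding parseval_trig[OF c] ennreal_of_nat_eq_real_of_nat
        by (subst ennreal_mult[symmetric]) (auto simp: sum_nonneg mult.assoc)
      finally show "(norm (pop c (X k)))\<^sup>2 \<le> real k * (2 * pi) * (\<Sum>n | c n \<noteq> 0. (cmod (c n))\<^sup>2)"
        by (subst (asm) ennreal_le_iff) (auto simp: sum_nonneg)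
    qed simp
  next
    have nrm: "(norm (X k - \<psi>))\<^sup>2 = measure \<mu> circ - measure \<mu> (B k)" for k
    proof -
      have "(norm (\<psi> - X k))\<^sup>2 = (\<integral>\<theta>. (cmod (1 - indicator (B k) \<theta>))\<^sup>2 \<partial>\<mu>)"
        by (rule calc_norm[OF sm m.bdd_diff[OF m.bdd_const bdd] calc_diff[OF sm m.bdd_const calc_one[OF sm] bdd X]])
      also have "\<dots> = (\<integral>\<theta>. (cmod (indicator (circ - B k) \<theta>))\<^sup>2 \<partial>\<mu>)"
        by (rule Bochner_Integration.integral_cong) (auto simp: m.space_eq split: split_indicator)
      also have "\<dots> = measure \<mu> ((circ - B k) \<inter> circ)"
        by (rule m.integral_sq_indicator) (use Bb in auto)
      also have "(circ - B k) \<inter> circ = space \<mu> - B k" by (auto simp: m.space_eq)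
      also have "measure \<mu> \<dots> = measure \<mu> circ - measure \<mu> (B k)"
        using Bb Bc by (subst m.finite_measure_compl) (auto simp: m.sets_iff m.space_eq)
      finally show ?thesis by (simp add: norm_minus_commute)
    qed
    have "(\<lambda>k. measure \<mu> (B k)) \<longlonglongrightarrow> measure \<mu> (\<Union>k. B k)"
    proof (rule m.finite_Lim_measure_incseq)
      show "range B \<subseteq> sets \<mu>" using Bb Bc by (auto simp: m.sets_iff)
      show "incseq B"
        unfolding incseq_def B_def by (auto intro: order_trans)
    qed
    also have "measure \<mu> (\<Union>k. B k) = measure \<mu> circ"
    proof (rule measure_eq_AE)
      have "(\<integral>\<^sup>+\<theta>. f \<theta> \<partial>lcirc) = emeasure \<mu> (space \<mu>)"
        unfolding f(2)[symmetric] using f(1) by (subst emeasure_density) (auto intro!: nn_integral_cong)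
      hence "AE \<theta> in lcirc. f \<theta> \<noteq> \<infinity>"
        using f(1) by (intro nn_integral_PInf_AE) (auto simp: m.emeasure_eq_measure)
      hence "AE \<theta> in \<mu>. f \<theta> \<noteq> \<infinity>"
        by (rule absolutely_continuous_AE[OF _ ac, rotated]) (use m.sets_eq sets_lcirc in simp)
      thus "AE \<theta> in \<mu>. (\<theta> \<in> (\<Union>k. B k)) = (\<theta> \<in> circ)"
      proof eventually_elim
        case (elim \<theta>)
        hence "f \<theta> < top" by (simp add: less_top)
        then obtain n where "f \<theta> < of_nat n" using ennreal_Ex_less_of_nat by blast
        thus ?case unfolding B_def by (auto intro: less_imp_le)
      qed
      show "(\<Union>k. B k) \<in> sets \<mu>" "circ \<in> sets \<mu>" using Bb Bc by (auto simp: m.sets_iff)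
    qed
    finally have "(\<lambda>k. measure \<mu> circ - measure \<mu> (B k)) \<longlonglongrightarrow> measure \<mu> circ - measure \<mu> circ"
      by (intro tendsto_intros)
    hence "(\<lambda>k. (norm (X k - \<psi>))\<^sup>2) \<longlonglongrightarrow> 0" by (simp add: nrm)
    from tendsto_real_sqrt[OF this] have "(\<lambda>k. norm (X k - \<psi>)) \<longlonglongrightarrow> 0" by simp
    thus "X \<longlonglongrightarrow> \<psi>" by (simp add: LIM_zero_iff tendsto_norm_zero_iff)
  qed
qed

end

subsection \<open>Spectral decomposition\<close>

text \<open>Exhaustion: the union of a maximising sequence of null sets is again null and attains
  the supremum \<open>S\<close>, so no further null set can add mass outside it.\<close>

lemma (in circle_measure) max_null_set:
  obtains N where "N \<in> null_sets lborel" "N \<subseteq> circ"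
    "\<And>B. B \<subseteq> circ \<Longrightarrow> B \<in> null_sets lborel \<Longrightarrow> measure \<mu> (B - N) = 0"
proof -
  define \<N> where "\<N> = {N. N \<subseteq> circ \<and> N \<in> null_sets lborel}"
  define S where "S = (SUP N\<in>\<N>. measure \<mu> N)"
  have bdd: "bdd_above (measure \<mu> ` \<N>)"
    by (rule bdd_aboveI2[where M = "measure \<mu> (space \<mu>)"]) (rule bounded_measure)
  have ne: "\<N> \<noteq> {}" by (auto simp: \<N>_def)
  have "\<exists>N\<in>\<N>. S - inverse (real (Suc k)) < measure \<mu> N" for k
    using less_cSUP_iff[OF ne bdd, of "S - inverse (real (Suc k))"] by (simp add: S_def)
  then obtain N where N: "\<And>k. N k \<in> \<N>" "\<And>k. S - inverse (real (Suc k)) < measure \<mu> (N k)"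
    by metis
  define M where "M = (\<Union>k. N k)"
  have M: "M \<in> \<N>" using N(1) by (auto simp: M_def \<N>_def)
  have setsN: "A \<in> sets \<mu>" if "A \<in> \<N>" for A
    using that by (auto simp: \<N>_def sets_iff null_sets_def)
  have SM: "S \<le> measure \<mu> M"
  proof (rule LIMSEQ_le_const2)
    have "(\<lambda>k. S - inverse (real (Suc k))) \<longlonglongrightarrow> S - 0"
      by (intro tendsto_intros LIMSEQ_inverse_real_of_nat)
    thus "(\<lambda>k. S - inverse (real (Suc k))) \<longlonglongrightarrow> S" by simp
    have "measure \<mu> (N k) \<le> measure \<mu> M" for k
      by (rule finite_measure_mono) (use M setsN in \<open>auto simp: M_def\<close>)
    thus "\<exists>K. \<forall>k\<ge>K. S - inverse (real (Suc k)) \<le> measure \<mu> M"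
      using N(2) by (meson less_imp_le order_trans)
  qed
  show thesis
  proof
    fix B assume B: "B \<subseteq> circ" "B \<in> null_sets lborel"
    hence BN: "B \<in> \<N>" by (simp add: \<N>_def)
    have "M \<union> (B - M) \<in> \<N>" using M B by (auto simp: \<N>_def intro: null_set_Diff)
    hence "measure \<mu> (M \<union> (B - M)) \<le> S" unfolding S_def by (rule cSUP_upper[OF _ bdd])
    moreover have "measure \<mu> (M \<union> (B - M)) = measure \<mu> M + measure \<mu> (B - M)"
      using setsN[OF M] setsN[OF BN] by (intro finite_measure_Union) auto
    ultimately show "measure \<mu> (B - M) = 0" using SM measure_nonneg[of \<mu> "B - M"] by linarith
  qed (use M in \<open>auto simp: \<N>_def\<close>)
qed

context unitary_op
begin

lemma calc_indicator_spec_meas: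
  assumes "spec_meas \<psi> \<mu>" "B \<in> sets borel" "calc \<psi> \<mu> (indicator B) \<phi>"
  shows "spec_meas \<phi> (density \<mu> (indicator B))"
proof -
  interpret circle_measure \<mu> by (rule spec_measD[OF assms(1)])
  have "(\<lambda>\<theta>. ennreal ((cmod (indicator B \<theta>))\<^sup>2)) = indicator B"
    by (auto split: split_indicator)
  with calc_spec_meas[OF assms(1) bdd_indicator[OF assms(2)] assms(3)] show ?thesis by simp
qed

lemma calc_indicator_union:
  assumes sm: "spec_meas \<psi> \<mu>" and B: "A \<in> sets borel" "B \<in> sets borel" "A \<inter> B = {}"
    and c: "calc \<psi> \<mu> (indicator A) \<phi>" "calc \<psi> \<mu> (indicator B) \<eta>"
  shows "calc \<psi> \<mu> (indicator (A \<union> B)) (\<phi> + \<eta>)"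
proof -
  interpret circle_measure \<mu> by (rule spec_measD[OF sm])
  have "(\<lambda>\<theta>. indicator A \<theta> + indicator B \<theta> :: complex) = indicator (A \<union> B)"
    using B(3) by (intro ext) (simp add: indicator_add)
  with calc_add[OF sm bdd_indicator[OF B(1)] c(1) bdd_indicator[OF B(2)] c(2)] show ?thesis by simp
qed

lemma calc_indicator_unique:
  assumes sm: "spec_meas \<psi> \<mu>" and B: "B \<in> sets borel"
    and c: "calc \<psi> \<mu> (indicator B) \<phi>" "calc \<psi> \<mu> (indicator B) \<eta>"
  shows "\<phi> = \<eta>"
proof -
  interpret circle_measure \<mu> by (rule spec_measD[OF sm])
  show ?thesis by (rule calc_unique[OF sm bdd_indicator[OF B] c(1) bdd_indicator[OF B] c(2)]) simp
qed

lemma calc_indicator_empty: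
  assumes sm: "spec_meas \<psi> \<mu>" and c: "calc \<psi> \<mu> (indicator {}) \<phi>"
  shows "\<phi> = 0"
proof -
  interpret circle_measure \<mu> by (rule spec_measD[OF sm])
  have "(norm \<phi>)\<^sup>2 = 0"
    using calc_norm[OF sm bdd_indicator c] by simp
  thus ?thesis by simp
qed

text \<open>On the one-point set the function \<open>cis \<theta>\<close> is the constant
  \<open>cis a\<close>, so U acts on the projected vector as this scalar.\<close>

lemma calc_singleton_eigvec:
  assumes sm: "spec_meas \<psi> \<mu>" and c: "calc \<psi> \<mu> (indicator {a}) \<phi>"
  shows "\<phi> \<in> eigvecs"
proof -
  interpret circle_measure \<mu> by (rule spec_measD[OF sm])
  have b: "bdd (indicator {a})" by (rule bdd_indicator) simp
  have "upow 1 \<phi> = cis a *\<^sub>C \<phi>"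
  proof (rule calc_unique[OF sm])
    show "calc \<psi> \<mu> (\<lambda>\<theta>. cis (of_int 1 * \<theta>) * indicator {a} \<theta>) (upow 1 \<phi>)"
      by (rule calc_upow[OF sm c])
    show "calc \<psi> \<mu> (\<lambda>\<theta>. cis a * indicator {a} \<theta>) (cis a *\<^sub>C \<phi>)"
      by (rule calc_scale[OF sm c])
  qed (auto intro!: bdd_mult bdd_cis[of 1, simplified] bdd_const b split: split_indicator)
  thus ?thesis by (auto simp: eigvecs_def)
qed

lemma calc_finite_span:
  assumes sm: "spec_meas \<psi> \<mu>" and F: "finite F" and c: "calc \<psi> \<mu> (indicator F) \<phi>"
  shows "\<phi> \<in> span eigvecs"
  using F c
proof (induction F arbitrary: \<phi> rule: finite_induct)
  case empty
  hence "\<phi> = 0" by (intro calc_indicator_empty[OF sm])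
  thus ?case by (simp add: span_zero)
next
  case (insert a F)
  have Fb: "F \<in> sets borel" "{a} \<in> sets borel"
    using insert.hyps(1) by (auto intro: borel_closed finite_imp_closed)
  obtain x where x: "calc \<psi> \<mu> (indicator {a}) x" using calc_exists[OF sm Fb(2)] by blast
  obtain y where y: "calc \<psi> \<mu> (indicator F) y" using calc_exists[OF sm Fb(1)] by blast
  have "calc \<psi> \<mu> (indicator ({a} \<union> F)) (x + y)"
    by (rule calc_indicator_union[OF sm Fb(2,1) _ x y]) (use insert.hyps in auto)
  hence "\<phi> = x + y"
    using insert.prems Fb by (intro calc_indicator_unique[OF sm, of "insert a F"]) auto
  thus ?case using insert.IH[OF y] calc_singleton_eigvec[OF sm x] by (auto intro: span_add span_base)
qed

text \<open>Along an enumeration of \<open>C\<close> the masses of the finite initial segments tend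
  to the mass of \<open>C\<close>; by \<open>calc_norm\<close> the corresponding vectors, which lie
  in the span, converge.\<close>

lemma calc_countable_pp:
  assumes sm: "spec_meas \<psi> \<mu>" and C: "countable C" "C \<subseteq> circ" and c: "calc \<psi> \<mu> (indicator C) \<phi>"
  shows "\<phi> \<in> pp"
proof (cases "C = {}")
  case True
  hence "\<phi> = 0" using c by (intro calc_indicator_empty[OF sm]) simp
  thus ?thesis using closure_subset[of "span eigvecs"] span_zero by (auto simp: pp_def)
next
  case False
  interpret circle_measure \<mu> by (rule spec_measD[OF sm])
  define D where "D n = from_nat_into C ` {..<n}" for n
  have finD: "finite (D n)" for n by (simp add: D_def)
  have DC: "D n \<subseteq> C" for n using from_nat_into[OF False] by (auto simp: D_def)
  have UD: "(\<Union>n. D n) = C"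
  proof
    show "C \<subseteq> (\<Union>n. D n)"
    proof
      fix x assume "x \<in> C"
      then obtain n where "from_nat_into C n = x" using from_nat_into_surj[OF C(1)] by blast
      hence "x \<in> D (Suc n)" by (auto simp: D_def)
      thus "x \<in> (\<Union>n. D n)" by blast
    qed
  qed (use DC in blast)
  have Db: "D n \<in> sets borel" for n using finD by (auto intro: borel_closed finite_imp_closed)
  have Cb: "C \<in> sets borel" unfolding UD[symmetric] using Db by auto
  obtain X where X: "\<And>n. calc \<psi> \<mu> (indicator (D n)) (X n)" using calc_exists[OF sm Db] by metis
  have nrm: "(norm (X n - \<phi>))\<^sup>2 = measure \<mu> C - measure \<mu> (D n)" for n
  proof -
    have "(norm (\<phi> - X n))\<^sup>2 = (\<integral>\<theta>. (cmod (indicator C \<theta> - indicator (D n) \<theta>))\<^sup>2 \<partial>\<mu>)"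
      by (rule calc_norm[OF sm bdd_diff[OF bdd_indicator[OF Cb] bdd_indicator[OF Db]]
            calc_diff[OF sm bdd_indicator[OF Cb] c bdd_indicator[OF Db] X]])
    also have "\<dots> = (\<integral>\<theta>. (cmod (indicator (C - D n) \<theta>))\<^sup>2 \<partial>\<mu>)"
      by (rule Bochner_Integration.integral_cong) (use DC[of n] in \<open>auto split: split_indicator\<close>)
    also have "\<dots> = measure \<mu> ((C - D n) \<inter> circ)"
      by (rule integral_sq_indicator) (use Db Cb in auto)
    also have "(C - D n) \<inter> circ = C - D n" using C by auto
    also have "measure \<mu> \<dots> = measure \<mu> C - measure \<mu> (D n)"
    proof (rule finite_measure_Diff)
      show "C \<in> sets \<mu>" using Cb C(2) by (simp add: sets_iff)
      show "D n \<in> sets \<mu>" using Db[of n] DC[of n] C(2) unfolding sets_iff by blast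
    qed (rule DC)
    finally show ?thesis by (simp add: norm_minus_commute)
  qed
  have "(\<lambda>n. measure \<mu> (D n)) \<longlonglongrightarrow> measure \<mu> (\<Union>n. D n)"
  proof (rule finite_Lim_measure_incseq)
    show "range D \<subseteq> sets \<mu>" 
    proof
      fix A assume "A \<in> range D"
      then obtain n where "A = D n" by blast
      thus "A \<in> sets \<mu>" using Db[of n] DC[of n] C(2) unfolding sets_iff by blast
    qed
    show "incseq D" by (auto simp: incseq_def D_def)
  qed
  hence "(\<lambda>n. measure \<mu> C - measure \<mu> (D n)) \<longlonglongrightarrow> measure \<mu> C - measure \<mu> C"
    unfolding UD by (intro tendsto_intros)
  hence "(\<lambda>n. (norm (X n - \<phi>))\<^sup>2) \<longlonglongrightarrow> 0" by (simp add: nrm)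
  from tendsto_real_sqrt[OF this] have "(\<lambda>n. norm (X n - \<phi>)) \<longlonglongrightarrow> 0" by simp
  hence "X \<longlonglongrightarrow> \<phi>" by (simp add: LIM_zero_iff tendsto_norm_zero_iff)
  moreover have "X n \<in> span eigvecs" for n by (rule calc_finite_span[OF sm finD X])
  ultimately show ?thesis unfolding pp_def closure_sequential by blast
qed

text \<open>The absolutely continuous part is cut out by the complement of a Lebesgue null set carrying
  the largest possible spectral mass.\<close>

theorem spectral_decomposition:
  obtains a s p where "\<psi> = a + (s + p)" "ac_vec a" "sc_vec s" "p \<in> pp" "sing_vec (s + p)"
proof -
  obtain \<mu> where sm: "spec_meas \<psi> \<mu>" using spec_meas_exists by blast
  interpret circle_measure \<mu> by (rule spec_measD[OF sm])
  obtain N where N: "N \<in> null_sets lborel" "N \<subseteq> circ"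
    "\<And>B. B \<subseteq> circ \<Longrightarrow> B \<in> null_sets lborel \<Longrightarrow> measure \<mu> (B - N) = 0"
    using max_null_set by blast
  \<comment> \<open>The atoms in \<open>N\<close>, at most countably many because
    \<open>\<mu>\<close> is finite. Removing them from \<open>N\<close> leaves the singular
    continuous piece.\<close>
  define A where "A = {\<theta>. measure \<mu> {\<theta>} \<noteq> 0} \<inter> N"
  have A: "countable A" unfolding A_def using countable_support by blast
  have Ab: "A \<in> sets borel" using A by (rule countable_imp_null_set_lborel[THEN null_setsD2, unfolded sets_lborel])
  have Nb: "N \<in> sets borel" using N(1) by (auto simp: null_sets_def)
  have AN: "A \<subseteq> N" by (simp add: A_def)
  obtain a where a: "calc \<psi> \<mu> (indicator (- N)) a" using calc_exists[OF sm, of "- N"] Nb by auto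
  obtain s where s: "calc \<psi> \<mu> (indicator (N - A)) s" using calc_exists[OF sm, of "N - A"] Nb Ab by auto
  obtain p where p: "calc \<psi> \<mu> (indicator A) p" using calc_exists[OF sm Ab] by blast
  have "calc \<psi> \<mu> (indicator ((N - A) \<union> A)) (s + p)"
    by (rule calc_indicator_union[OF sm _ Ab _ s p]) (use Nb Ab in auto)
  moreover have "(N - A) \<union> A = N" using AN by blast
  ultimately have sp: "calc \<psi> \<mu> (indicator N) (s + p)" by simp
  have "calc \<psi> \<mu> (indicator (- N \<union> N)) (a + (s + p))"
    by (rule calc_indicator_union[OF sm _ Nb _ a sp]) (use Nb in auto)
  moreover have "calc \<psi> \<mu> (indicator (- N \<union> N)) \<psi>"
    using calc_one[OF sm] by (simp add: indicator_def[abs_def] Compl_partition2)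
  ultimately have eq: "\<psi> = a + (s + p)"
    using Nb by (intro calc_indicator_unique[OF sm, of "- N \<union> N"]) auto
  have em: "emeasure (density \<mu> (indicator X)) B = emeasure \<mu> (X \<inter> B)"
    if "X \<in> sets borel" "B \<in> sets \<mu>" for X B
  proof -
    have "indicator X \<in> borel_measurable \<mu>" using that by (intro borel_measurableI) simp
    hence "emeasure (density \<mu> (indicator X)) B = (\<integral>\<^sup>+\<theta>. indicator X \<theta> * indicator B \<theta> \<partial>\<mu>)"
      using that by (intro emeasure_density) auto
    also have "\<dots> = (\<integral>\<^sup>+\<theta>. indicator (X \<inter> B) \<theta> \<partial>\<mu>)"
      by (intro nn_integral_cong) (auto split: split_indicator)
    also have "\<dots> = emeasure \<mu> (X \<inter> B)"
      by (rule nn_integral_indicator) (use that in \<open>auto simp: sets_iff\<close>)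
    finally show ?thesis .
  qed
  have "ac_vec a"
    unfolding ac_vec_def
  proof (intro exI conjI)
    show sa: "spec_meas a (density \<mu> (indicator (- N)))"
      by (rule calc_indicator_spec_meas[OF sm _ a]) (use Nb in auto)
    interpret d: circle_measure "density \<mu> (indicator (- N))" by (rule spec_measD[OF sa])
    show "absolutely_continuous lcirc (density \<mu> (indicator (- N)))"
      unfolding d.abs_cont_iff
    proof (intro allI impI)
      fix B assume B: "B \<subseteq> circ" "B \<in> null_sets lborel"
      have "B \<in> sets \<mu>" using B by (auto simp: sets_iff null_sets_def)
      hence "emeasure (density \<mu> (indicator (- N))) B = emeasure \<mu> (- N \<inter> B)"
        using Nb by (intro em) auto
      also have "- N \<inter> B = B - N" by blast
      also have "emeasure \<mu> (B - N) = 0" using N(3)[OF B] by (simp add: emeasure_eq_measure)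
      finally show "measure (density \<mu> (indicator (- N))) B = 0" by (simp add: measure_def)
    qed
  qed
  moreover have "sc_vec s"
    unfolding sc_vec_def
  proof (intro exI conjI allI bexI[of _ N])
    show "spec_meas s (density \<mu> (indicator (N - A)))"
      by (rule calc_indicator_spec_meas[OF sm _ s]) (use Nb Ab in auto)
    show "N \<in> sets (density \<mu> (indicator (N - A)))" using Nb N(2) by (simp add: sets_iff)
    show "emeasure lborel N = 0" using N(1) by (simp add: null_sets_def)
    have "emeasure (density \<mu> (indicator (N - A))) (circ - N) = emeasure \<mu> ((N - A) \<inter> (circ - N))"
      using Nb Ab by (intro em) (auto simp: sets_iff)
    also have "(N - A) \<inter> (circ - N) = {}" by blast
    finally show "emeasure (density \<mu> (indicator (N - A))) (space (density \<mu> (indicator (N - A))) - N) = 0"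
      by (simp add: space_eq)
    fix \<theta>
    show "emeasure (density \<mu> (indicator (N - A))) {\<theta>} = 0"
    proof (cases "\<theta> \<in> circ")
      case True
      hence "emeasure (density \<mu> (indicator (N - A))) {\<theta>} = emeasure \<mu> ((N - A) \<inter> {\<theta>})"
        using Nb Ab by (intro em) (auto simp: sets_iff)
      also have "\<dots> = 0"
      proof (cases "\<theta> \<in> N - A")
        case True
        hence "measure \<mu> {\<theta>} = 0" "(N - A) \<inter> {\<theta>} = {\<theta>}" by (auto simp: A_def)
        thus ?thesis by (simp add: emeasure_eq_measure)
      qed simp
      finally show ?thesis .
    next
      case False
      \<comment> \<open>The absence of atoms is claimed for all real points; off the circle the
        singleton is not measurable and \<open>emeasure\<close> is 0 by convention.\<close>
      hence "{\<theta>} \<notin> sets (density \<mu> (indicator (N - A)))" by (simp add: sets_iff)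
      thus ?thesis by (rule emeasure_notin_sets)
    qed
  qed
  moreover have "p \<in> pp" by (rule calc_countable_pp[OF sm A _ p]) (use AN N(2) in blast)
  moreover have "sing_vec (s + p)"
    unfolding sing_vec_def
  proof (intro exI conjI)
    show "spec_meas (s + p) (density \<mu> (indicator N))"
      by (rule calc_indicator_spec_meas[OF sm Nb sp])
    have "emeasure (density \<mu> (indicator N)) (circ - N) = emeasure \<mu> (N \<inter> (circ - N))"
      using Nb by (intro em) (auto simp: sets_iff)
    also have "N \<inter> (circ - N) = {}" by blast
    finally show "measure (density \<mu> (indicator N)) (circ - N) = 0" by (simp add: measure_def)
  qed (use N in auto)
  ultimately show thesis using that eq by blast
qed

lemma eigvec_scaleC: "v \<in> eigvecs \<Longrightarrow> c *\<^sub>C v \<in> eigvecs"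
  by (auto simp: eigvecs_def U_scaleC mult.commute)

text \<open>The eigenvalue is unimodular, so the modulus of the pairing of \<open>v\<close> with a
  smooth vector is constant along the orbit, while the Bessel bound forces it to 0. Smooth vectors
  then approximate \<open>x\<close>.\<close>

lemma ac_eigvec_orthogonal:
  assumes "ac_vec x" "v \<in> eigvecs"
  shows "cinner v x = 0"
proof -
  obtain e where e: "U v = e *\<^sub>C v" using assms(2) by (auto simp: eigvecs_def)
  obtain X K where X: "\<And>n. smooth (K n) (X n)" "X \<longlonglongrightarrow> x" using ac_approx_smooth[OF assms(1)] by blast
  have "cinner v (X n) = 0" for n
  proof (cases "v = 0")
    case False
    have "norm (U v) = cmod e * norm v" by (simp only: e norm_scaleC)
    hence e1: "cmod e = 1" using False by simp
    have "(U ^^ k) v = (e ^ k) *\<^sub>C v" for k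
      by (induction k) (simp_all add: U_scaleC e mult.commute)
    moreover have "cinner ((U ^^ k) v) ((U ^^ k) (X n)) = cinner v (X n)" for k
      by (induction k) simp_all
    ultimately have "cmod (cinner v (X n)) = cmod (cinner v ((U ^^ k) (X n)))" for k
      by (metis cinner_scaleC_left complex_mod_cnj e1 mult_1 norm_mult norm_power power_one complex_cnj_power)
    moreover have "(\<lambda>k. cmod (cinner v ((U ^^ k) (X n)))) \<longlonglongrightarrow> 0"
      by (rule tendsto_norm_zero[OF smooth_cinner_tendsto[OF X(1)]])
    ultimately have "(\<lambda>k::nat. cmod (cinner v (X n))) \<longlonglongrightarrow> 0" by simp
    thus ?thesis by (simp add: LIMSEQ_const_iff)
  qed simp
  moreover have "(\<lambda>n. cinner v (X n)) \<longlonglongrightarrow> cinner v x" by (intro tendsto_intros X)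
  ultimately show ?thesis by (simp add: LIMSEQ_const_iff)
qed

lemma ac_pp_orthogonal:
  assumes "ac_vec x" "v \<in> pp"
  shows "cinner v x = 0"
proof -
  obtain V where V: "\<And>n. V n \<in> span eigvecs" "V \<longlonglongrightarrow> v"
    using assms(2) unfolding pp_def closure_sequential by blast
  have "cinner w x = 0" if "w \<in> span eigvecs" for w
    using that
  proof (induction rule: span_induct_alt)
    case (step c y z)
    have "cinner (c *\<^sub>R y) x = 0"
      using ac_eigvec_orthogonal[OF assms(1) step.hyps] by (simp add: scaleC_of_real[symmetric])
    thus ?case using step by (simp add: cinner_add_left)
  qed simp
  hence "cinner (V n) x = 0" for n using V by blast
  moreover have "(\<lambda>n. cinner (V n) x) \<longlonglongrightarrow> cinner v x" by (intro tendsto_intros V)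
  ultimately show ?thesis by (simp add: LIMSEQ_const_iff)
qed

end

subsection \<open>Existence of wave operators\<close>

lemma sum_sqrt_mult_le:
  fixes p q :: "nat \<Rightarrow> real"
  assumes "\<And>a. 0 \<le> p a" "\<And>a. 0 \<le> q a" "(\<Sum>a<N. p a) \<le> P" "(\<Sum>a<N. q a) \<le> R"
  shows "(\<Sum>a<N. sqrt (p a * q a)) \<le> sqrt P * sqrt R"
proof -
  have "(\<Sum>a<N. sqrt (p a * q a)) = (\<Sum>a<N. \<bar>sqrt (p a)\<bar> * \<bar>sqrt (q a)\<bar>)"
    using assms by (simp add: real_sqrt_mult)
  also have "\<dots> \<le> L2_set (\<lambda>a. sqrt (p a)) {..<N} * L2_set (\<lambda>a. sqrt (q a)) {..<N}"
    by (rule L2_set_mult_ineq)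
  also have "\<dots> = sqrt (\<Sum>a<N. p a) * sqrt (\<Sum>a<N. q a)"
    using assms by (simp add: L2_set_def)
  also have "\<dots> \<le> sqrt P * sqrt R"
    using assms by (intro mult_mono) (auto intro: sum_nonneg order_trans[OF sum_nonneg])
  finally show ?thesis .
qed

section \<open>Bessel sequences and transfer of moments between two unitaries\<close>

text \<open>The inequality of \<open>smooth\<close> for arbitrary sequences. The generality matters
  because orbits of one unitary get moved by powers of the other, and such sequences are no longer
  orbits.\<close>

definition bessel :: "real \<Rightarrow> (nat \<Rightarrow> 'a::complex_hilbert) \<Rightarrow> bool" where
  "bessel K v \<longleftrightarrow> 0 \<le> K \<and> (\<forall>g N. (\<Sum>n<N. (cmod (cinner g (v n)))\<^sup>2) \<le> K * (norm g)\<^sup>2)"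

lemma bessel_shift:
  assumes "bessel K v" shows "bessel K (\<lambda>a. v (m + a))"
  unfolding bessel_def
proof (intro conjI allI)
  fix g N
  have "(\<Sum>n<N. (cmod (cinner g (v (m + n))))\<^sup>2) = (\<Sum>n\<in>(+) m ` {..<N}. (cmod (cinner g (v n)))\<^sup>2)"
    by (simp add: sum.reindex)
  also have "\<dots> \<le> (\<Sum>n<m + N. (cmod (cinner g (v n)))\<^sup>2)"
    by (rule sum_mono2) auto
  also have "\<dots> \<le> K * (norm g)\<^sup>2" using assms unfolding bessel_def by blast
  finally show "(\<Sum>n<N. (cmod (cinner g (v (m + n))))\<^sup>2) \<le> K * (norm g)\<^sup>2" .
qed (use assms in \<open>simp add: bessel_def\<close>)

lemma (in unitary_op) bessel_upow:
  assumes "bessel K v" shows "bessel K (\<lambda>a. upow n (v a))"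
  using assms unfolding bessel_def upow_cinner_right by (metis upow_norm)

lemma (in unitary_op) smooth_bessel: "smooth K \<phi> \<Longrightarrow> bessel K (\<lambda>n. (U ^^ n) \<phi>)"
  by (simp add: smooth_def bessel_def)

text \<open>Negative moments are conjugates of positive ones, so equal forward correlations give the
  same spectral measure even for vectors and unitaries that differ.\<close>

lemma (in unitary_op) ac_vec_same_moments:
  assumes "unitary_op U' V'" and ac: "ac_vec x"
    and eq: "\<And>n. cinner y ((U' ^^ n) y) = cinner x ((U ^^ n) x)"
  shows "unitary_op.ac_vec U' V' y"
proof -
  interpret B: unitary_op U' V' by fact
  have eqi: "cinner y (B.upow n y) = cinner x (upow n x)" for n
  proof (cases "0 \<le> n")
    case True
    then obtain m where "n = int m" using zero_le_imp_eq_int by blast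
    thus ?thesis using eq by (simp add: B.upow_of_nat upow_of_nat)
  next
    case False
    then obtain m where m: "n = - int m" by (metis int_cases2 linorder_not_le of_nat_0_le_iff)
    have "cinner y (B.upow n y) = cnj (cinner y (B.upow (int m) y))"
      using B.upow_cinner_right[of y "- int m" y] cinner_commute[of "B.upow (int m) y" y] by (simp add: m)
    also have "\<dots> = cnj (cinner x (upow (int m) x))"
      using eq by (simp add: B.upow_of_nat upow_of_nat)
    also have "\<dots> = cinner x (upow n x)"
      using upow_cinner_right[of x "- int m" x] cinner_commute[of "upow (int m) x" x] by (simp add: m)
    finally show ?thesis .
  qed
  thus ?thesis using ac unfolding ac_vec_def B.ac_vec_def spec_meas_def B.spec_meas_def by simp
qed

text \<open>Pearson's method. In the application the difference of the two operators is of trace class,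
  with singular vectors \<open>f\<^sub>n\<close>, \<open>g\<^sub>n\<close> and weights \<open>d\<^sub>n\<close>, and \<open>Q v\<close> is
  \<open>\<Sum>\<^sub>n d\<^sub>n (|\<langle>f\<^sub>n, v\<rangle>|\<^sup>2 + |\<langle>g\<^sub>n, v\<rangle>|\<^sup>2)\<close>.\<close>

locale trace_class_pair = A: unitary_op U1 V1 + B: unitary_op U2 V2
  for U1 V1 U2 V2 :: "'a::complex_hilbert \<Rightarrow> 'a" +
  fixes Q :: "'a \<Rightarrow> real" and \<kappa> :: real
  assumes Q_nonneg: "0 \<le> Q x" and kappa_nonneg: "0 \<le> \<kappa>"
    and Q_bound: "(cmod (cinner y (U1 x - U2 x)))\<^sup>2 \<le> Q y * Q x"
    and Q_bessel: "bessel K v \<Longrightarrow> (\<Sum>n<N. Q (v n)) \<le> \<kappa> * K"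
begin

definition W :: "nat \<Rightarrow> 'a \<Rightarrow> 'a" where
  "W t x = (V2 ^^ t) ((U1 ^^ t) x)"

lemma W_upow: "W t x = B.upow (- int t) (A.upow (int t) x)"
  by (simp add: W_def B.upow_minus_of_nat A.upow_of_nat)

lemma W_norm [simp]: "norm (W t x) = norm x"
  by (simp add: W_upow)

lemma W_diff: "W t (x - y) = W t x - W t y"
  by (simp add: W_upow A.upow_diff B.upow_diff)

text \<open>A sequence with one nonzero entry satisfies a Bessel bound, so the summed estimate also
  bounds a single value of \<open>Q\<close>.\<close>

lemma Q_le: "Q y \<le> \<kappa> * (norm y)\<^sup>2"
proof -
  have "bessel ((norm y)\<^sup>2) (\<lambda>n::nat. if n = 0 then y else 0)"
    unfolding bessel_def
  proof (intro conjI allI)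
    fix g :: 'a and N :: nat
    have "(\<Sum>n<N. (cmod (cinner g (if n = 0 then y else 0)))\<^sup>2) \<le> (\<Sum>n\<in>{0::nat}. (cmod (cinner g (if n = 0 then y else 0)))\<^sup>2)"
      by (cases N) (simp_all add: sum.lessThan_Suc_shift del: sum.lessThan_Suc)
    also have "\<dots> \<le> (norm g * norm y)\<^sup>2" by (simp add: cmod_cinner_le power_mono)
    finally show "(\<Sum>n<N. (cmod (cinner g (if n = 0 then y else 0)))\<^sup>2) \<le> (norm y)\<^sup>2 * (norm g)\<^sup>2"
      by (simp add: power_mult_distrib mult.commute)
  qed simp
  from Q_bessel[OF this, of 1] show ?thesis by simp
qed

text \<open>The form bound is tested on \<open>d\<close>, the difference itself; \<open>Q_le\<close>
  absorbs the factor \<open>Q d\<close> and one power of its squared norm cancels.\<close>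

lemma diff_norm_le: "(norm (U1 x - U2 x))\<^sup>2 \<le> \<kappa> * Q x"
proof -
  define d where "d = U1 x - U2 x"
  have "cmod (cinner d d) = (norm d)\<^sup>2" by (simp add: cinner_self norm_power)
  hence "((norm d)\<^sup>2)\<^sup>2 \<le> Q d * Q x" using Q_bound[of d x] by (simp add: d_def)
  also have "\<dots> \<le> (\<kappa> * (norm d)\<^sup>2) * Q x" by (intro mult_right_mono Q_le Q_nonneg)
  finally have "(norm d)\<^sup>2 * (norm d)\<^sup>2 \<le> (\<kappa> * Q x) * (norm d)\<^sup>2" by (simp add: power2_eq_square mult_ac)
  hence "(norm d)\<^sup>2 \<le> \<kappa> * Q x"
    using kappa_nonneg Q_nonneg[of x] mult_right_le_imp_le[of "(norm d)\<^sup>2" "(norm d)\<^sup>2" "\<kappa> * Q x"]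
    by (cases "d = 0") auto
  thus ?thesis by (simp add: d_def)
qed

context
  fixes \<phi> :: 'a and K :: real
  assumes smooth: "A.smooth K \<phi>"
begin

definition v :: "nat \<Rightarrow> 'a" where "v a = (U1 ^^ a) \<phi>"

text \<open>The tail from index \<open>s\<close> of the convergent series of \<open>Q\<close> along
  the orbit; its decay will make the wave sequence Cauchy.\<close>

definition R :: "nat \<Rightarrow> real" where "R s = (\<Sum>a. Q (v a)) - (\<Sum>a<s. Q (v a))"

lemma v_norm: "norm (v a) = norm \<phi>"
  by (simp add: v_def A.upow_of_nat[symmetric])

lemma bessel_v: "bessel K v"
  using A.smooth_bessel[OF smooth] by (simp add: v_def[abs_def])

lemma summable_Q: "summable (\<lambda>a. Q (v a))"
  by (rule summableI_nonneg_bounded[OF Q_nonneg Q_bessel[OF bessel_v]])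

lemma R_tendsto: "R \<longlonglongrightarrow> 0"
proof -
  have "(\<lambda>s. (\<Sum>a. Q (v a)) - (\<Sum>a<s. Q (v a))) \<longlonglongrightarrow> (\<Sum>a. Q (v a)) - (\<Sum>a. Q (v a))"
    by (intro tendsto_intros summable_LIMSEQ summable_Q)
  thus ?thesis by (simp add: R_def[abs_def])
qed

lemma sum_shift_le_R: "(\<Sum>a<N. Q (v (s + a))) \<le> R s"
proof -
  have "(\<Sum>a<N. Q (v (s + a))) + (\<Sum>a<s. Q (v a)) = (\<Sum>a<s + N. Q (v a))"
    by (induction N) simp_all
  also have "\<dots> \<le> (\<Sum>a. Q (v a))"
    by (rule sum_le_suminf[OF summable_Q]) (auto simp: Q_nonneg)
  finally show ?thesis by (simp add: R_def)
qed

text \<open>For a fixed number of steps \<open>t\<close>, the two evolutions agree far out on the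
  orbit: each step costs at most the square root of \<open>\<kappa> * Q (v (N + t))\<close>, which
  tends to 0.\<close>

lemma W_near_identity: "(\<lambda>N. norm (W t (v N) - v N)) \<longlonglongrightarrow> 0"
proof (induction t)
  case 0
  show ?case by (simp add: W_def)
next
  case (Suc t)
  have le: "norm (W (Suc t) (v N) - W t (v N)) \<le> sqrt (\<kappa> * Q (v (N + t)))" for N
  proof -
    have vt: "(U1 ^^ t) (v N) = v (N + t)" by (simp add: v_def funpow_add add.commute[of N t])
    have "W (Suc t) (v N) = B.upow (- int t) (V2 (U1 (v (N + t))))" "W t (v N) = B.upow (- int t) (v (N + t))"
      by (simp_all add: W_def vt B.upow_minus_of_nat funpow_swap1)
    hence "W (Suc t) (v N) - W t (v N) = B.upow (- int t) (V2 (U1 (v (N + t))) - v (N + t))"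
      by (simp only: B.upow_diff)
    hence "norm (W (Suc t) (v N) - W t (v N)) = norm (U2 (V2 (U1 (v (N + t))) - v (N + t)))"
      by simp
    also have "U2 (V2 (U1 (v (N + t))) - v (N + t)) = U1 (v (N + t)) - U2 (v (N + t))"
      using B.upow_diff[of 1] by simp
    finally show ?thesis using diff_norm_le by (simp add: real_le_rsqrt)
  qed
  have "(\<lambda>N. Q (v (N + t))) \<longlonglongrightarrow> 0"
    using LIMSEQ_ignore_initial_segment[OF summable_LIMSEQ_zero[OF summable_Q]] .
  hence "(\<lambda>N. sqrt (\<kappa> * Q (v (N + t))) + norm (W t (v N) - v N)) \<longlonglongrightarrow> sqrt (\<kappa> * 0) + 0"
    by (intro tendsto_intros Suc)
  hence L: "(\<lambda>N. sqrt (\<kappa> * Q (v (N + t))) + norm (W t (v N) - v N)) \<longlonglongrightarrow> 0" by simp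
  show ?case
  proof (rule tendsto_sandwich[OF _ _ tendsto_const L])
    show "\<forall>\<^sub>F N in sequentially. norm (W (Suc t) (v N) - v N) \<le> sqrt (\<kappa> * Q (v (N + t))) + norm (W t (v N) - v N)"
    proof (intro always_eventually allI)
      fix N
      show "norm (W (Suc t) (v N) - v N) \<le> sqrt (\<kappa> * Q (v (N + t))) + norm (W t (v N) - v N)"
        using norm_triangle_ineq[of "W (Suc t) (v N) - W t (v N)" "W t (v N) - v N"] le[of N] by simp
    qed
  qed simp
qed

text \<open>The value at infinity of the telescoping sum below; it is the squared norm of
  \<open>\<phi>\<close>, the value the correlation at \<open>N = 0\<close> would have if
  \<open>W t \<phi>\<close> and \<open>W s \<phi>\<close> were equal.\<close>

lemma correlation_tendsto: "(\<lambda>N. cinner (W t (v N)) (W s (v N))) \<longlonglongrightarrow> of_real ((norm \<phi>)\<^sup>2)"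
proof -
  have le: "cmod (cinner (W t (v N)) (W s (v N)) - of_real ((norm \<phi>)\<^sup>2)) \<le>
      norm (W t (v N) - v N) * norm \<phi> + norm \<phi> * norm (W s (v N) - v N)" for N
  proof -
    have "of_real ((norm \<phi>)\<^sup>2) = cinner (v N) (v N)" by (simp add: cinner_self v_norm)
    hence e: "cinner (W t (v N)) (W s (v N)) - of_real ((norm \<phi>)\<^sup>2) =
        cinner (W t (v N) - v N) (W s (v N)) + cinner (v N) (W s (v N) - v N)"
      by (simp add: cinner_diff_left cinner_diff_right)
    have "cmod (cinner (W t (v N)) (W s (v N)) - of_real ((norm \<phi>)\<^sup>2)) \<le>
        norm (W t (v N) - v N) * norm (W s (v N)) + norm (v N) * norm (W s (v N) - v N)"
      unfolding e by (intro order_trans[OF norm_triangle_ineq] add_mono cmod_cinner_le)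
    thus ?thesis by (simp add: v_norm)
  qed
  have "(\<lambda>N. norm (W t (v N) - v N) * norm \<phi> + norm \<phi> * norm (W s (v N) - v N)) \<longlonglongrightarrow> 0 * norm \<phi> + norm \<phi> * 0"
    by (intro tendsto_intros W_near_identity)
  hence L: "(\<lambda>N. norm (W t (v N) - v N) * norm \<phi> + norm \<phi> * norm (W s (v N) - v N)) \<longlonglongrightarrow> 0" by simp
  have "(\<lambda>N. cmod (cinner (W t (v N)) (W s (v N)) - of_real ((norm \<phi>)\<^sup>2))) \<longlonglongrightarrow> 0"
    by (rule tendsto_sandwich[OF _ _ tendsto_const L]) (use le in auto)
  thus ?thesis by (simp add: LIM_zero_iff tendsto_norm_zero_iff)
qed

lemma correlation_eq: "cinner (W t (v N)) (W s (v N)) = cinner (v (t + N)) (B.upow (int t - int s) (v (s + N)))"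
proof -
  have "W r (v N) = B.upow (- int r) (v (r + N))" for r
    by (simp add: W_def v_def funpow_add B.upow_minus_of_nat)
  thus ?thesis
    by (simp add: B.cinner_upow_upow B.upow_cinner_right[of "v (t + N)"])
       (simp add: B.upow_cinner_right[of "B.upow _ _"] B.upow_add[symmetric])
qed

text \<open>The telescoping identity behind Pearson's estimate: the increments of the correlation only
  see the commutator of \<open>U1\<close> with a power \<open>Z\<close> of \<open>U2\<close>, and
  \<open>Z U1 - U1 Z = Z (U1 - U2) - (U1 - U2) Z\<close>.\<close>

lemma correlation_step:
  "cmod (cinner (W t (v (Suc N))) (W s (v (Suc N))) - cinner (W t (v N)) (W s (v N)))
    \<le> sqrt (Q (B.upow (int s - int t) (v (Suc t + N))) * Q (v (s + N))) +
      sqrt (Q (v (Suc t + N)) * Q (B.upow (int t - int s) (v (s + N))))"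
proof -
  define n where "n = int t - int s"
  define x where "x = v (s + N)"
  define y where "y = v (Suc t + N)"
  have y: "y = U1 (v (t + N))" by (simp add: y_def v_def)
  have x': "v (s + Suc N) = U1 x" by (simp add: x_def v_def)
  have comm: "B.upow n (U2 z) = U2 (B.upow n z)" for z
    using B.upow_add[of n 1 z] B.upow_add[of 1 n z] by (simp add: add.commute)
  have e1: "cinner (W t (v (Suc N))) (W s (v (Suc N))) - cinner (W t (v N)) (W s (v N))
      = cinner y (B.upow n (U1 x)) - cinner (v (t + N)) (B.upow n x)"
    using x' unfolding correlation_eq n_def by (simp add: x_def y_def)
  have e2: "cinner (v (t + N)) (B.upow n x) = cinner y (U1 (B.upow n x))"
    unfolding y by simp
  have e3: "cinner y (B.upow n (U1 x)) - cinner y (U1 (B.upow n x)) =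
      cinner (B.upow (- n) y) (U1 x - U2 x) - cinner y (U1 (B.upow n x) - U2 (B.upow n x))"
    by (simp add: B.upow_cinner_right[symmetric] B.upow_diff comm cinner_diff_right)
  have "cmod (cinner (W t (v (Suc N))) (W s (v (Suc N))) - cinner (W t (v N)) (W s (v N))) \<le>
      cmod (cinner (B.upow (- n) y) (U1 x - U2 x)) + cmod (cinner y (U1 (B.upow n x) - U2 (B.upow n x)))"
    unfolding e1 e2 e3 by (rule norm_triangle_ineq4)
  also have "\<dots> \<le> sqrt (Q (B.upow (- n) y) * Q x) + sqrt (Q y * Q (B.upow n x))"
    by (intro add_mono real_le_rsqrt Q_bound)
  finally show ?thesis by (simp add: n_def x_def y_def)
qed

text \<open>The squared distance is twice the real part of the gap between the correlation at
  infinity and at 0. Summing the increments, Cauchy-Schwarz pairs a tail of \<open>Q\<close> along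
  the orbit with a sum over the orbit moved by a power of \<open>U2\<close>, which stays below
  \<open>\<kappa> * K\<close>.\<close>

lemma W_diff_bound:
  "(norm (W t \<phi> - W s \<phi>))\<^sup>2 \<le> 2 * (sqrt (\<kappa> * K) * (sqrt (R s) + sqrt (R (Suc t))))"
proof -
  define f where "f N = cinner (W t (v N)) (W s (v N))" for N
  define B1 where "B1 = sqrt (\<kappa> * K) * (sqrt (R s) + sqrt (R (Suc t)))"
  have bd: "cmod (f N - f 0) \<le> B1" for N
  proof -
    have "cmod (f N - f 0) = cmod (\<Sum>a<N. f (Suc a) - f a)" by (simp add: sum_lessThan_telescope)
    also have "\<dots> \<le> (\<Sum>a<N. sqrt (Q (B.upow (int s - int t) (v (Suc t + a))) * Q (v (s + a))) +
      sqrt (Q (v (Suc t + a)) * Q (B.upow (int t - int s) (v (s + a)))))"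
      unfolding f_def by (rule sum_norm_le) (rule correlation_step)
    also have "\<dots> \<le> sqrt (\<kappa> * K) * sqrt (R s) + sqrt (R (Suc t)) * sqrt (\<kappa> * K)"
      unfolding sum.distrib
    proof (intro add_mono sum_sqrt_mult_le Q_nonneg sum_shift_le_R)
      show "(\<Sum>a<N. Q (B.upow (int s - int t) (v (Suc t + a)))) \<le> \<kappa> * K"
        by (rule Q_bessel[OF B.bessel_upow[OF bessel_shift[OF bessel_v]]])
      show "(\<Sum>a<N. Q (B.upow (int t - int s) (v (s + a)))) \<le> \<kappa> * K"
        by (rule Q_bessel[OF B.bessel_upow[OF bessel_shift[OF bessel_v]]])
    qed
    finally show ?thesis by (simp add: B1_def algebra_simps)
  qed
  have "(\<lambda>N. cmod (f N - f 0)) \<longlonglongrightarrow> cmod (of_real ((norm \<phi>)\<^sup>2) - f 0)"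
    unfolding f_def by (intro tendsto_intros correlation_tendsto)
  hence le: "cmod (of_real ((norm \<phi>)\<^sup>2) - f 0) \<le> B1"
    by (rule LIMSEQ_le_const2) (use bd in blast)
  have "v 0 = \<phi>" by (simp add: v_def)
  hence "(norm (W t \<phi> - W s \<phi>))\<^sup>2 = 2 * Re (of_real ((norm \<phi>)\<^sup>2) - f 0)"
    by (simp add: norm_diff_sq f_def)
  also have "\<dots> \<le> 2 * B1"
    using le complex_Re_le_cmod[of "of_real ((norm \<phi>)\<^sup>2) - f 0"] by linarith
  finally show ?thesis by (simp add: B1_def)
qed

lemma W_Cauchy_smooth: "Cauchy (\<lambda>t. W t \<phi>)"
proof (rule CauchyI)
  fix e :: real assume e: "e > 0"
  have "(\<lambda>t. 2 * (sqrt (\<kappa> * K) * sqrt (R t))) \<longlonglongrightarrow> 2 * (sqrt (\<kappa> * K) * sqrt 0)"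
    by (intro tendsto_intros R_tendsto)
  hence "(\<lambda>t. 2 * (sqrt (\<kappa> * K) * sqrt (R t))) \<longlonglongrightarrow> 0" by simp
  from order_tendstoD(2)[OF this, of "e\<^sup>2 / 2"] e
  obtain N where N: "\<And>t. t \<ge> N \<Longrightarrow> 2 * (sqrt (\<kappa> * K) * sqrt (R t)) < e\<^sup>2 / 2"
    unfolding eventually_sequentially by auto
  have "norm (W t \<phi> - W s \<phi>) < e" if "t \<ge> N" "s \<ge> N" for t s
  proof -
    have "(norm (W t \<phi> - W s \<phi>))\<^sup>2 < e\<^sup>2"
      using W_diff_bound[of t s] N[of s] N[of "Suc t"] that by (simp add: distrib_left)
    thus ?thesis using e by (simp add: power2_less_imp_less)
  qed
  thus "\<exists>M. \<forall>m\<ge>M. \<forall>n\<ge>M. norm (W m \<phi> - W n \<phi>) < e" by blast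
qed

end

theorem wave_limit_exists:
  assumes "A.ac_vec x"
  shows "\<exists>w. (\<lambda>t. W t x) \<longlonglongrightarrow> w"
proof -
  obtain X K where X: "\<And>n. A.smooth (K n) (X n)" "X \<longlonglongrightarrow> x"
    using A.ac_approx_smooth[OF assms] by blast
  have "Cauchy (\<lambda>t. W t x)"
  proof (rule CauchyI)
    fix e :: real assume e: "e > 0"
    obtain n where n: "norm (X n - x) < e / 3"
      using LIMSEQ_D[OF X(2), of "e/3"] e by auto
    have "e / 3 > 0" using e by simp
    from CauchyD[OF W_Cauchy_smooth[OF X(1)] this]
    obtain M where M: "\<And>s t. s \<ge> M \<Longrightarrow> t \<ge> M \<Longrightarrow> norm (W s (X n) - W t (X n)) < e / 3" by blast
    have "norm (W s x - W t x) < e" if "s \<ge> M" "t \<ge> M" for s t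
    proof -
      have "norm (W s x - W t x) = norm (W s (x - X n) + (W s (X n) - W t (X n)) + W t (X n - x))"
        by (simp add: W_diff)
      also have "\<dots> \<le> norm (x - X n) + norm (W s (X n) - W t (X n)) + norm (X n - x)"
        by (intro order_trans[OF norm_triangle_ineq] add_mono) simp_all
      also have "\<dots> < e" using n M[OF that] by (simp add: norm_minus_commute)
      finally show ?thesis .
    qed
    thus "\<exists>M. \<forall>m\<ge>M. \<forall>n\<ge>M. norm (W m x - W n x) < e" by blast
  qed
  thus ?thesis using Cauchy_convergent convergent_def by blast
qed

text \<open>The limit intertwines the two unitaries, so \<open>w\<close> has the same correlations
  under \<open>U2\<close> as \<open>x\<close> under \<open>U1\<close>.\<close>

lemma wave_limit_ac:
  assumes "A.ac_vec x" "(\<lambda>t. W t x) \<longlonglongrightarrow> w"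
  shows "B.ac_vec w"
proof (rule A.ac_vec_same_moments[OF B.unitary_op_axioms assms(1)])
  fix n
  \<comment> \<open>With the second factor \<open>n\<close> steps ahead the intertwining is exact at
    finite time: \<open>U2 ^^ n\<close> applied to \<open>W (t + n) x\<close> is \<open>W t\<close>
    applied to \<open>(U1 ^^ n) x\<close>.\<close>
  have "(\<lambda>t. cinner (W t x) ((U2 ^^ n) (W (t + n) x))) \<longlonglongrightarrow> cinner w ((U2 ^^ n) w)"
    unfolding B.upow_of_nat[symmetric]
    by (intro tendsto_intros B.tendsto_upow LIMSEQ_ignore_initial_segment assms(2))
  moreover have "cinner (W t x) ((U2 ^^ n) (W (t + n) x)) = cinner x ((U1 ^^ n) x)" for t
  proof -
    have e: "(U2 ^^ n) (W (t + n) x) = B.upow (- int t) (A.upow (int t) (A.upow (int n) x))"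
      by (simp add: W_upow B.upow_of_nat[symmetric] B.upow_add[symmetric] A.upow_add[symmetric])
    show ?thesis unfolding e by (simp only: W_upow B.upow_cinner A.upow_cinner) (simp only: A.upow_of_nat)
  qed
  ultimately show "cinner w ((U2 ^^ n) w) = cinner x ((U1 ^^ n) x)"
    by (simp add: LIMSEQ_const_iff)
qed

end

subsection \<open>The Hilbert space of square summable states\<close>

lemma norm_vec2_sq: "(norm (v :: complex^2))\<^sup>2 = (cmod (v $ 1))\<^sup>2 + (cmod (v $ 2))\<^sup>2"
  by (simp add: norm_vec_def L2_set_def sum_2 real_sqrt_pow2)

lemma norm_vector_smult: "norm (c *s (v :: complex^2)) = cmod c * norm v"
proof -
  have "(norm (c *s v))\<^sup>2 = (cmod c * norm v)\<^sup>2"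
    unfolding power_mult_distrib norm_vec2_sq by (simp add: norm_mult power_mult_distrib distrib_left)
  thus ?thesis by (simp add: power2_eq_iff_nonneg)
qed

lemma l2_iff: "\<psi> \<in> l2 \<longleftrightarrow> (\<lambda>x. (norm (\<psi> x))\<^sup>2) summable_on UNIV"
  by (simp add: l2_def)

lemma l2I:
  assumes "\<And>F. finite F \<Longrightarrow> (\<Sum>x\<in>F. (norm (\<psi> x))\<^sup>2) \<le> B"
  shows "\<psi> \<in> l2"
  unfolding l2_iff
  by (rule nonneg_bdd_above_summable_on) (use assms in \<open>auto intro!: bdd_aboveI2\<close>)

lemma l2_dominated:
  assumes "\<phi> \<in> l2" "\<eta> \<in> l2" "\<And>x. (norm (\<psi> x))\<^sup>2 \<le> K * ((norm (\<phi> x))\<^sup>2 + (norm (\<eta> x))\<^sup>2)"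
  shows "\<psi> \<in> l2"
  unfolding l2_iff
proof (rule summable_on_comparison_test)
  show "(\<lambda>x. K * ((norm (\<phi> x))\<^sup>2 + (norm (\<eta> x))\<^sup>2)) summable_on UNIV"
    using assms(1,2) unfolding l2_iff by (intro summable_on_cmult_right summable_on_add)
qed (use assms(3) in auto)

lemma l2_add: "\<phi> \<in> l2 \<Longrightarrow> \<psi> \<in> l2 \<Longrightarrow> (\<lambda>x. \<phi> x + \<psi> x) \<in> l2"
  by (rule l2_dominated[where K = 2 and \<phi> = \<phi> and \<eta> = \<psi>]) (simp_all only: norm_add_sq_le)

lemma l2_smult: "\<phi> \<in> l2 \<Longrightarrow> (\<lambda>x. c *s \<phi> x) \<in> l2"
  by (rule l2_dominated[where K = "(cmod c)\<^sup>2" and \<phi> = \<phi> and \<eta> = \<phi>])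
    (auto simp: norm_vector_smult power_mult_distrib mult_left_mono)

lemma l2_zero: "(\<lambda>x. 0) \<in> l2"
  by (simp add: l2_iff)

lemma l2_uminus: "\<phi> \<in> l2 \<Longrightarrow> (\<lambda>x. - \<phi> x) \<in> l2"
  by (simp add: l2_iff)

lemma l2_scaleR: "\<phi> \<in> l2 \<Longrightarrow> (\<lambda>x. r *\<^sub>R \<phi> x) \<in> l2"
  by (rule l2_dominated[where K = "r\<^sup>2" and \<phi> = \<phi> and \<eta> = \<phi>])
    (auto simp: power_mult_distrib mult_left_mono)

text \<open>Membership in \<open>l2\<close> becomes a type, so that the abstract theory applies to
  it; \<open>Rep_l2state\<close> and \<open>Abs_l2state\<close> translate from and to the functions
  of the statement.\<close>

typedef l2state = l2
  by (rule exI[of _ "\<lambda>x. 0"]) (rule l2_zero)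

setup_lifting type_definition_l2state

lemma Rep_l2 [simp]: "Rep_l2state f \<in> l2"
  by (rule Rep_l2state)

abbreviation (input) cdot :: "complex^2 \<Rightarrow> complex^2 \<Rightarrow> complex" where
  "cdot v w \<equiv> \<Sum>i\<in>UNIV. cnj (v $ i) * (w $ i)"

lemma cdot_bound: "cmod (cdot v w) \<le> (norm v)\<^sup>2 + (norm w)\<^sup>2"
proof -
  have "cmod (cdot v w) \<le> cmod (v $ 1) * cmod (w $ 1) + cmod (v $ 2) * cmod (w $ 2)"
    unfolding sum_2 by (rule norm_triangle_le) (simp add: norm_mult)
  also have "\<dots> \<le> (norm v)\<^sup>2 + (norm w)\<^sup>2"
    unfolding norm_vec2_sq
    using sum_squares_bound[of "cmod (v $ 1)" "cmod (w $ 1)"] sum_squares_bound[of "cmod (v $ 2)" "cmod (w $ 2)"]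
      zero_le_power2[of "cmod (v $ 1)"] zero_le_power2[of "cmod (w $ 1)"]
      zero_le_power2[of "cmod (v $ 2)"] zero_le_power2[of "cmod (w $ 2)"]
    by linarith
  finally show ?thesis .
qed

lemma cdot_summable:
  assumes "\<phi> \<in> l2" "\<psi> \<in> l2"
  shows "(\<lambda>x. cdot (\<phi> x) (\<psi> x)) summable_on UNIV"
proof (rule abs_summable_summable)
  show "(\<lambda>x. norm (cdot (\<phi> x) (\<psi> x))) summable_on UNIV"
  proof (rule summable_on_comparison_test)
    show "(\<lambda>x. (norm (\<phi> x))\<^sup>2 + (norm (\<psi> x))\<^sup>2) summable_on UNIV"
      using assms unfolding l2_iff by (rule summable_on_add)
  qed (auto simp: cdot_bound)
qed

lemma cdot_self: "cdot v v = of_real ((norm v)\<^sup>2)"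
  unfolding norm_vec2_sq sum_2 by (simp add: complex_norm_square mult.commute del: of_real_power)

lemma l2inner_self: "\<psi> \<in> l2 \<Longrightarrow> l2inner \<psi> \<psi> = of_real ((l2norm \<psi>)\<^sup>2)"
proof -
  assume "\<psi> \<in> l2"
  hence "((\<lambda>x. (norm (\<psi> x))\<^sup>2) has_sum (\<Sum>\<^sub>\<infinity>x. (norm (\<psi> x))\<^sup>2)) UNIV" by (simp add: l2_iff)
  hence "((\<lambda>x. complex_of_real ((norm (\<psi> x))\<^sup>2)) has_sum of_real (\<Sum>\<^sub>\<infinity>x. (norm (\<psi> x))\<^sup>2)) UNIV"
    by (rule has_sum_of_real)
  hence "(\<Sum>\<^sub>\<infinity>x. complex_of_real ((norm (\<psi> x))\<^sup>2)) = of_real (\<Sum>\<^sub>\<infinity>x. (norm (\<psi> x))\<^sup>2)"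
    by (rule infsumI)
  moreover have "0 \<le> (\<Sum>\<^sub>\<infinity>x. (norm (\<psi> x))\<^sup>2)" by (intro infsum_nonneg) simp
  ultimately show ?thesis unfolding l2inner_def l2norm_def cdot_self by simp
qed

lemma l2inner_add_right:
  "\<phi> \<in> l2 \<Longrightarrow> \<psi> \<in> l2 \<Longrightarrow> \<eta> \<in> l2 \<Longrightarrow> l2inner \<phi> (\<lambda>x. \<psi> x + \<eta> x) = l2inner \<phi> \<psi> + l2inner \<phi> \<eta>"
  unfolding l2inner_def
  by (subst infsum_add[symmetric]) (simp_all add: cdot_summable distrib_left sum.distrib del: sum_2)

lemma l2inner_smult_right: "l2inner \<phi> (\<lambda>x. c *s \<psi> x) = c * l2inner \<phi> \<psi>"
  unfolding l2inner_def
  by (subst infsum_cmult_right'[symmetric]) (simp add: sum_distrib_left mult_ac)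

lemma l2inner_commute: "l2inner \<phi> \<psi> = cnj (l2inner \<psi> \<phi>)"
  unfolding l2inner_def by (subst infsum_cnj[symmetric]) (simp add: mult.commute)

instantiation l2state :: real_vector
begin

lift_definition zero_l2state :: l2state is "\<lambda>x. 0" by (rule l2_zero)
lift_definition plus_l2state :: "l2state \<Rightarrow> l2state \<Rightarrow> l2state" is "\<lambda>\<phi> \<psi> x. \<phi> x + \<psi> x" by (rule l2_add)
lift_definition uminus_l2state :: "l2state \<Rightarrow> l2state" is "\<lambda>\<phi> x. - \<phi> x" by (rule l2_uminus)
lift_definition minus_l2state :: "l2state \<Rightarrow> l2state \<Rightarrow> l2state" is "\<lambda>\<phi> \<psi> x. \<phi> x - \<psi> x"
  using l2_add l2_uminus by fastforce
lift_definition scaleR_l2state :: "real \<Rightarrow> l2state \<Rightarrow> l2state" is "\<lambda>r \<phi> x. r *\<^sub>R \<phi> x" by (rule l2_scaleR)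

instance
  by standard (transfer, simp add: algebra_simps)+

end

lemma L2_set_le_l2norm:
  assumes "\<psi> \<in> l2" "finite F"
  shows "L2_set (\<lambda>x. norm (\<psi> x)) F \<le> l2norm \<psi>"
  unfolding L2_set_def l2norm_def
  by (rule real_sqrt_le_mono) (use assms in \<open>auto simp: l2_iff intro!: finite_sum_le_infsum\<close>)

lemma l2norm_leI:
  assumes "0 \<le> B" "\<And>F. finite F \<Longrightarrow> L2_set (\<lambda>x. norm (\<psi> x)) F \<le> B"
  shows "\<psi> \<in> l2" "l2norm \<psi> \<le> B"
proof -
  have B: "(\<Sum>x\<in>F. (norm (\<psi> x))\<^sup>2) \<le> B\<^sup>2" if "finite F" for F
    using power_mono[OF assms(2)[OF that], of 2] by (simp add: L2_set_def sum_nonneg)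
  show 1: "\<psi> \<in> l2" by (rule l2I[OF B])
  have "(\<Sum>\<^sub>\<infinity>x. (norm (\<psi> x))\<^sup>2) \<le> B\<^sup>2"
    using 1 B unfolding l2_iff by (intro infsum_le_finite_sums) auto
  thus "l2norm \<psi> \<le> B" unfolding l2norm_def using assms(1) real_le_lsqrt by blast
qed

lemma norm_le_l2norm: "\<psi> \<in> l2 \<Longrightarrow> norm (\<psi> x) \<le> l2norm \<psi>"
  using L2_set_le_l2norm[of \<psi> "{x}"] by simp

lemma l2norm_nonneg: "0 \<le> l2norm \<psi>"
  unfolding l2norm_def by (intro real_sqrt_ge_zero infsum_nonneg) simp

lemma l2norm_triangle:
  assumes "\<phi> \<in> l2" "\<psi> \<in> l2"
  shows "l2norm (\<lambda>x. \<phi> x + \<psi> x) \<le> l2norm \<phi> + l2norm \<psi>"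
proof (rule l2norm_leI(2))
  fix F :: "int set" assume F: "finite F"
  have "L2_set (\<lambda>x. norm (\<phi> x + \<psi> x)) F \<le> L2_set (\<lambda>x. norm (\<phi> x) + norm (\<psi> x)) F"
    by (rule L2_set_mono) (auto simp: norm_triangle_ineq)
  also have "\<dots> \<le> L2_set (\<lambda>x. norm (\<phi> x)) F + L2_set (\<lambda>x. norm (\<psi> x)) F"
    by (rule L2_set_triangle_ineq)
  also have "\<dots> \<le> l2norm \<phi> + l2norm \<psi>" using F assms by (intro add_mono L2_set_le_l2norm)
  finally show "L2_set (\<lambda>x. norm (\<phi> x + \<psi> x)) F \<le> l2norm \<phi> + l2norm \<psi>" .
qed (simp add: l2norm_nonneg)

lemma l2norm_scaleR: "l2norm (\<lambda>x. r *\<^sub>R \<psi> x) = \<bar>r\<bar> * l2norm \<psi>"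
  unfolding l2norm_def
  by (simp add: power_mult_distrib infsum_cmult_right' real_sqrt_mult)

instantiation l2state :: real_normed_vector
begin

lift_definition norm_l2state :: "l2state \<Rightarrow> real" is l2norm .
definition dist_l2state :: "l2state \<Rightarrow> l2state \<Rightarrow> real" where "dist_l2state x y = norm (x - y)"
definition sgn_l2state :: "l2state \<Rightarrow> l2state" where "sgn_l2state x = inverse (norm x) *\<^sub>R x"
definition uniformity_l2state :: "(l2state \<times> l2state) filter"
  where "uniformity_l2state = (INF e\<in>{0 <..}. principal {(x, y). dist x y < e})"
definition open_l2state :: "l2state set \<Rightarrow> bool"
  where "open_l2state S = (\<forall>x\<in>S. \<forall>\<^sub>F (x', y) in uniformity. x' = x \<longrightarrow> y \<in> S)"

instance
proof
  fix x y :: l2state and r :: real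
  show "(norm x = 0) = (x = 0)"
  proof
    assume "norm x = 0"
    hence "l2norm (Rep_l2state x) = 0" by transfer
    hence "Rep_l2state x z = 0" for z using norm_le_l2norm[OF Rep_l2, of x z] by simp
    thus "x = 0" by (simp add: Rep_l2state_inject[symmetric] zero_l2state.rep_eq fun_eq_iff)
  next
    show "x = 0 \<Longrightarrow> norm x = 0" by (simp add: norm_l2state.rep_eq zero_l2state.rep_eq l2norm_def)
  qed
  show "norm (x + y) \<le> norm x + norm y" by transfer (rule l2norm_triangle)
  show "norm (r *\<^sub>R x) = \<bar>r\<bar> * norm x" by transfer (rule l2norm_scaleR)
qed (simp_all add: dist_l2state_def sgn_l2state_def uniformity_l2state_def open_l2state_def)

end

instance l2state :: banach
proof
  fix X :: "nat \<Rightarrow> l2state" assume X: "Cauchy X"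
  have diff: "Rep_l2state (X m) x - Rep_l2state (X n) x = Rep_l2state (X m - X n) x" for m n x
    by (simp add: minus_l2state.rep_eq)
  have "Cauchy (\<lambda>n. Rep_l2state (X n) x)" for x
  proof (rule CauchyI)
    fix e :: real assume "e > 0"
    then obtain M where M: "\<forall>m\<ge>M. \<forall>n\<ge>M. norm (X m - X n) < e" using CauchyD[OF X] by blast
    have "norm (Rep_l2state (X m) x - Rep_l2state (X n) x) \<le> norm (X m - X n)" for m n
      unfolding diff norm_l2state.rep_eq by (rule norm_le_l2norm) simp
    thus "\<exists>M. \<forall>m\<ge>M. \<forall>n\<ge>M. norm (Rep_l2state (X m) x - Rep_l2state (X n) x) < e"
      using M by (meson le_less_trans)
  qed
  hence "\<exists>l. (\<lambda>n. Rep_l2state (X n) x) \<longlonglongrightarrow> l" for x using Cauchy_convergent convergent_def by blast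
  then obtain \<psi> where \<psi>: "\<And>x. (\<lambda>n. Rep_l2state (X n) x) \<longlonglongrightarrow> \<psi> x" by metis
  \<comment> \<open>On a finite set of sites the limit over \<open>m\<close> can be taken termwise;
    \<open>l2norm_leI\<close> then passes from all finite sets to the whole lattice.\<close>
  have est: "L2_set (\<lambda>x. norm (\<psi> x - Rep_l2state (X n) x)) F \<le> e"
    if M: "\<forall>m\<ge>M. \<forall>n\<ge>M. norm (X m - X n) < e" and n: "n \<ge> M" and F: "finite F" for e M n F
  proof (rule LIMSEQ_le_const2)
    show "(\<lambda>m. L2_set (\<lambda>x. norm (Rep_l2state (X m) x - Rep_l2state (X n) x)) F) \<longlonglongrightarrow>
        L2_set (\<lambda>x. norm (\<psi> x - Rep_l2state (X n) x)) F"
      unfolding L2_set_def by (intro tendsto_intros \<psi>)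
    have "L2_set (\<lambda>x. norm (Rep_l2state (X m) x - Rep_l2state (X n) x)) F \<le> e" if "m \<ge> M" for m
    proof -
      have "L2_set (\<lambda>x. norm (Rep_l2state (X m) x - Rep_l2state (X n) x)) F \<le> norm (X m - X n)"
        unfolding diff norm_l2state.rep_eq by (rule L2_set_le_l2norm) (use F in auto)
      thus ?thesis using M that n by (meson less_imp_le order_trans)
    qed
    thus "\<exists>N. \<forall>m\<ge>N. L2_set (\<lambda>x. norm (Rep_l2state (X m) x - Rep_l2state (X n) x)) F \<le> e" by blast
  qed
  have in_l2: "(\<lambda>x. \<psi> x - Rep_l2state (X n) x) \<in> l2" "l2norm (\<lambda>x. \<psi> x - Rep_l2state (X n) x) \<le> e"
    if "e > 0" "\<forall>m\<ge>M. \<forall>n\<ge>M. norm (X m - X n) < e" "n \<ge> M" for e M n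
    using l2norm_leI[of e "\<lambda>x. \<psi> x - Rep_l2state (X n) x"] est[OF that(2,3)] that(1) by auto
  obtain M where M: "\<forall>m\<ge>M. \<forall>n\<ge>M. norm (X m - X n) < 1" using CauchyD[OF X, of 1] by auto
  have "(\<lambda>x. (\<psi> x - Rep_l2state (X M) x) + Rep_l2state (X M) x) \<in> l2"
    by (intro l2_add in_l2(1)[OF _ M]) auto
  hence \<psi>l2: "\<psi> \<in> l2" by simp
  have "X \<longlonglongrightarrow> Abs_l2state \<psi>"
  proof (rule LIMSEQ_I)
    fix e :: real assume e: "e > 0"
    then obtain M where M: "\<forall>m\<ge>M. \<forall>n\<ge>M. norm (X m - X n) < e / 2" using CauchyD[OF X, of "e/2"] by auto
    have "norm (X n - Abs_l2state \<psi>) < e" if "n \<ge> M" for n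
    proof -
      have "norm (Abs_l2state \<psi> - X n) \<le> e / 2"
        unfolding norm_l2state.rep_eq minus_l2state.rep_eq Abs_l2state_inverse[OF \<psi>l2]
        by (rule in_l2(2)[OF _ M that]) (use e in simp)
      thus ?thesis using e by (simp add: norm_minus_commute)
    qed
    thus "\<exists>no. \<forall>n\<ge>no. norm (X n - Abs_l2state \<psi>) < e" by blast
  qed
  thus "convergent X" unfolding convergent_def by blast
qed

instantiation l2state :: complex_hilbert
begin

lift_definition cinner_l2state :: "l2state \<Rightarrow> l2state \<Rightarrow> complex" is l2inner .
lift_definition scaleC_l2state :: "complex \<Rightarrow> l2state \<Rightarrow> l2state" is "\<lambda>c \<phi> x. c *s \<phi> x" by (rule l2_smult)

instance
proof
  fix x y z :: l2state and c d :: complex and r :: real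
  show "of_real r *\<^sub>C x = r *\<^sub>R x"
    by transfer (simp add: vec_eq_iff fun_eq_iff scaleR_conv_of_real[where ?'a = complex])
  show "c *\<^sub>C (x + y) = c *\<^sub>C x + c *\<^sub>C y" by transfer (simp add: vector_add_ldistrib)
  show "(c + d) *\<^sub>C x = c *\<^sub>C x + d *\<^sub>C x" by transfer (simp add: vector_sadd_rdistrib)
  show "c *\<^sub>C d *\<^sub>C x = (c * d) *\<^sub>C x" by transfer (simp add: vector_smult_assoc)
  show "cinner x (y + z) = cinner x y + cinner x z" by transfer (rule l2inner_add_right)
  show "cinner x (c *\<^sub>C y) = c * cinner x y" by transfer (rule l2inner_smult_right)
  show "cinner x y = cnj (cinner y x)" by transfer (rule l2inner_commute)
  show "cinner x x = of_real ((norm x)\<^sup>2)" by transfer (rule l2inner_self)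
qed

end

lemma l2conv_iff:
  assumes "\<And>t. X t \<in> l2"
  shows "l2conv X \<psi> \<longleftrightarrow> \<psi> \<in> l2 \<and> (\<lambda>t. Abs_l2state (X t)) \<longlonglongrightarrow> Abs_l2state \<psi>"
proof (cases "\<psi> \<in> l2")
  case True
  have "norm (Abs_l2state (X t) - Abs_l2state \<psi>) = l2norm (\<lambda>x. X t x - \<psi> x)" for t
    by (simp add: norm_l2state.rep_eq minus_l2state.rep_eq Abs_l2state_inverse True assms)
  thus ?thesis
    using True assms tendsto_norm_zero_iff[of "\<lambda>t. Abs_l2state (X t) - Abs_l2state \<psi>" sequentially]
    by (simp add: l2conv_def LIM_zero_iff)
qed (simp add: l2conv_def)

subsection \<open>Quantum walks as unitary operators\<close>

lemma cdot_matrix_adjoint: "cdot ((M::coin) *v a) b = cdot a (madj M *v b)"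
  by (simp add: matrix_vector_mult_def sum_2 madj_def algebra_simps)

lemma unitary2_norm:
  assumes "unitary2 M" shows "norm (M *v v) = norm v" "norm (madj M *v v) = norm v"
proof -
  have "cdot (M *v v) (M *v v) = cdot v v"
    using assms unfolding cdot_matrix_adjoint by (simp add: unitary2_def matrix_vector_mul_assoc)
  thus "norm (M *v v) = norm v" unfolding cdot_self of_real_eq_iff by (simp add: power2_eq_iff_nonneg)
  have "madj (madj M) = M" by (simp add: madj_def vec_eq_iff)
  hence "cdot (madj M *v v) (madj M *v v) = cdot v v"
    using assms unfolding cdot_matrix_adjoint by (simp add: unitary2_def matrix_vector_mul_assoc)
  thus "norm (madj M *v v) = norm v" unfolding cdot_self of_real_eq_iff by (simp add: power2_eq_iff_nonneg)
qed

text \<open>One family containing the shift and its inverse as steps 1 and -1, so that norm and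
  support facts are proved once.\<close>

definition shift_by :: "int \<Rightarrow> state \<Rightarrow> state" where
  "shift_by a \<psi> = (\<lambda>x. \<chi> i. if i = 1 then \<psi> (x + a) $ 1 else \<psi> (x - a) $ 2)"

lemma shift_eq: "Defs.shift = shift_by 1" "shift_inv = shift_by (- 1)"
  by (simp_all add: fun_eq_iff Defs.shift_def shift_inv_def shift_by_def)

lemma shift_by_inverse: "shift_by a (shift_by (- a) \<psi>) = \<psi>"
  by (simp add: shift_by_def fun_eq_iff vec_eq_iff forall_2)

text \<open>The two components move in opposite directions, so the sum is split by component and
  each half is reindexed by its own bijection.\<close>

lemma shift_by_l2:
  assumes "\<psi> \<in> l2"
  shows "shift_by a \<psi> \<in> l2" "l2norm (shift_by a \<psi>) = l2norm \<psi>"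
proof -
  have s: "(\<lambda>x. (cmod (\<psi> x $ i))\<^sup>2) summable_on UNIV" for i
  proof (rule summable_on_comparison_test)
    show "(\<lambda>x. (norm (\<psi> x))\<^sup>2) summable_on UNIV" using assms by (simp add: l2_iff)
    show "(cmod (\<psi> x $ i))\<^sup>2 \<le> (norm (\<psi> x))\<^sup>2" for x
      using Finite_Cartesian_Product.norm_nth_le[of "\<psi> x" i] by (intro power_mono) auto
  qed auto
  have bij: "bij_betw (\<lambda>x. x + a) UNIV (UNIV :: int set)" "bij_betw (\<lambda>x. x - a) UNIV (UNIV :: int set)"
    by (rule bij_betwI[where g = "\<lambda>x. x - a"], auto) (rule bij_betwI[where g = "\<lambda>x. x + a"], auto)
  note s1 = summable_on_reindex_bij_betw[OF bij(1), of "\<lambda>x. (cmod (\<psi> x $ 1))\<^sup>2", THEN iffD2, OF s]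
  note s2 = summable_on_reindex_bij_betw[OF bij(2), of "\<lambda>x. (cmod (\<psi> x $ 2))\<^sup>2", THEN iffD2, OF s]
  have eq: "(norm (shift_by a \<psi> x))\<^sup>2 = (cmod (\<psi> (x + a) $ 1))\<^sup>2 + (cmod (\<psi> (x - a) $ 2))\<^sup>2" for x
    by (simp add: norm_vec2_sq shift_by_def)
  show "shift_by a \<psi> \<in> l2"
    unfolding l2_iff eq by (rule summable_on_add[OF s1 s2])
  have "(\<Sum>\<^sub>\<infinity>x. (norm (shift_by a \<psi> x))\<^sup>2) = (\<Sum>\<^sub>\<infinity>x. (cmod (\<psi> (x + a) $ 1))\<^sup>2) + (\<Sum>\<^sub>\<infinity>x. (cmod (\<psi> (x - a) $ 2))\<^sup>2)"
    unfolding eq by (rule infsum_add[OF s1 s2])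
  also have "\<dots> = (\<Sum>\<^sub>\<infinity>x. (cmod (\<psi> x $ 1))\<^sup>2) + (\<Sum>\<^sub>\<infinity>x. (cmod (\<psi> x $ 2))\<^sup>2)"
    using infsum_reindex_bij_betw[OF bij(1), of "\<lambda>x. (cmod (\<psi> x $ 1))\<^sup>2"]
      infsum_reindex_bij_betw[OF bij(2), of "\<lambda>x. (cmod (\<psi> x $ 2))\<^sup>2"] by simp
  also have "\<dots> = (\<Sum>\<^sub>\<infinity>x. (norm (\<psi> x))\<^sup>2)"
    unfolding norm_vec2_sq by (rule infsum_add[OF s s, symmetric])
  finally show "l2norm (shift_by a \<psi>) = l2norm \<psi>" by (simp add: l2norm_def)
qed

lemma l2_cong_norm:
  assumes "\<And>x. norm (\<phi> x) = norm (\<psi> x)"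
  shows "\<phi> \<in> l2 \<longleftrightarrow> \<psi> \<in> l2" "l2norm \<phi> = l2norm \<psi>"
  using assms by (simp_all add: l2_iff l2norm_def)

locale quantum_walk =
  fixes C :: "int \<Rightarrow> coin"
  assumes unitary: "unitary2 (C x)"
begin

lemma coin_l2:
  assumes "\<psi> \<in> l2"
  shows "(\<lambda>x. C x *v \<psi> x) \<in> l2" "l2norm (\<lambda>x. C x *v \<psi> x) = l2norm \<psi>"
  using l2_cong_norm[of "\<lambda>x. C x *v \<psi> x" \<psi>] unitary2_norm[OF unitary] assms by auto

lemma walk_l2:
  assumes "\<psi> \<in> l2" shows "walk C \<psi> \<in> l2" "l2norm (walk C \<psi>) = l2norm \<psi>"
proof -
  note c = coin_l2[OF assms]
  show "walk C \<psi> \<in> l2" "l2norm (walk C \<psi>) = l2norm \<psi>"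
    unfolding walk_def shift_eq using shift_by_l2[OF c(1)] c(2) by auto
qed

lemma walk_inv_l2:
  assumes "\<psi> \<in> l2" shows "walk_inv C \<psi> \<in> l2"
  unfolding walk_inv_def shift_eq
  using l2_cong_norm[of "\<lambda>x. madj (C x) *v shift_by (- 1) \<psi> x" "shift_by (- 1) \<psi>"]
    unitary2_norm[OF unitary] shift_by_l2[OF assms] by auto

definition U :: "l2state \<Rightarrow> l2state" where "U x = Abs_l2state (walk C (Rep_l2state x))"
definition V :: "l2state \<Rightarrow> l2state" where "V x = Abs_l2state (walk_inv C (Rep_l2state x))"

lemma Rep_U: "Rep_l2state (U x) = walk C (Rep_l2state x)"
  by (simp add: U_def Abs_l2state_inverse walk_l2)

lemma Rep_V: "Rep_l2state (V x) = walk_inv C (Rep_l2state x)"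
  by (simp add: V_def Abs_l2state_inverse walk_inv_l2)

lemma walk_walk_inv: "walk C (walk_inv C \<psi>) = \<psi>"
  using unitary shift_by_inverse[of 1 \<psi>]
  by (simp add: walk_def walk_inv_def shift_eq matrix_vector_mul_assoc unitary2_def)

lemma walk_inv_walk: "walk_inv C (walk C \<psi>) = \<psi>"
  using unitary shift_by_inverse[of "- 1"]
  by (simp add: walk_def walk_inv_def shift_eq matrix_vector_mul_assoc unitary2_def)

sublocale unitary_op U V
proof
  fix x y :: l2state and c :: complex
  show "U (x + y) = U x + U y"
    unfolding Rep_l2state_inject[symmetric] Rep_U plus_l2state.rep_eq
    by (simp add: walk_def Defs.shift_def fun_eq_iff vec_eq_iff matrix_vector_right_distrib)
  show "U (c *\<^sub>C x) = c *\<^sub>C U x"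
    unfolding Rep_l2state_inject[symmetric] Rep_U scaleC_l2state.rep_eq
    by (simp add: walk_def Defs.shift_def fun_eq_iff vec_eq_iff vector_scalar_commute)
  show "norm (U x) = norm x"
    by (simp add: norm_l2state.rep_eq Rep_U walk_l2)
  show "U (V x) = x" "V (U x) = x"
    unfolding Rep_l2state_inject[symmetric] Rep_U Rep_V by (simp_all add: walk_walk_inv walk_inv_walk)
qed

lemma Rep_U_pow: "Rep_l2state ((U ^^ n) x) = (walk C ^^ n) (Rep_l2state x)"
  by (induction n) (simp_all add: Rep_U)

lemma Rep_V_pow: "Rep_l2state ((V ^^ n) x) = (walk_inv C ^^ n) (Rep_l2state x)"
  by (induction n) (simp_all add: Rep_V)

lemma Rep_upow: "Rep_l2state (upow n x) = walk_pow C n (Rep_l2state x)"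
  by (simp add: upow_def walk_pow_def Rep_U_pow Rep_V_pow)

lemma spectral_measure_iff: "spectral_measure C (Rep_l2state x) \<mu> \<longleftrightarrow> spec_meas x \<mu>"
  unfolding spectral_measure_def spec_meas_def circle_measure_def circle_measure_axioms_def
    cinner_l2state.rep_eq Rep_upow by blast

lemma ac_subspace_iff: "Rep_l2state x \<in> ac_subspace C \<longleftrightarrow> ac_vec x"
  by (simp add: ac_subspace_def ac_vec_def spectral_measure_iff lcirc_def)

lemma sc_subspace_iff: "Rep_l2state x \<in> sc_subspace C \<longleftrightarrow> sc_vec x"
  by (simp add: sc_subspace_def sc_vec_def spectral_measure_iff)

lemma ac_subspace_eq: "ac_subspace C = Rep_l2state ` {x. ac_vec x}"
proof -
  have "\<psi> \<in> ac_subspace C \<Longrightarrow> \<psi> \<in> range Rep_l2state" for \<psi>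
    using type_definition.Rep_range[OF type_definition_l2state] by (auto simp: ac_subspace_def)
  thus ?thesis using ac_subspace_iff by blast
qed

lemma eigenvectors_eq: "eigenvectors C = Rep_l2state ` (eigvecs - {0})"
proof -
  have 1: "Rep_l2state x \<in> eigenvectors C \<longleftrightarrow> x \<in> eigvecs - {0}" for x
    unfolding eigenvectors_def eigvecs_def
    by (simp add: Rep_l2state_inject[symmetric, of "U x"] Rep_l2state_inject[symmetric, of x 0]
        Rep_U scaleC_l2state.rep_eq zero_l2state.rep_eq fun_eq_iff conj_commute)
  have "\<psi> \<in> eigenvectors C \<Longrightarrow> \<psi> \<in> range Rep_l2state" for \<psi>
    using type_definition.Rep_range[OF type_definition_l2state] by (auto simp: eigenvectors_def)
  thus ?thesis using 1 by blast
qed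

end

lemma Rep_sum: "Rep_l2state (\<Sum>i\<in>I. f i) = (\<lambda>x. \<Sum>i\<in>I. Rep_l2state (f i) x)"
  by (induction I rule: infinite_finite_induct) (simp_all add: zero_l2state.rep_eq plus_l2state.rep_eq)

text \<open>\<open>l2span\<close> takes complex combinations and \<open>span\<close> real ones;
  complex coefficients are absorbed into the eigenvectors.\<close>

lemma (in quantum_walk) l2span_eq: "l2span (eigenvectors C) = Rep_l2state ` span eigvecs"
proof
  show "l2span (eigenvectors C) \<subseteq> Rep_l2state ` span eigvecs"
  proof
    fix \<psi> assume "\<psi> \<in> l2span (eigenvectors C)"
    then obtain F c where F: "finite F" "F \<subseteq> eigenvectors C" "\<psi> = (\<lambda>x. \<Sum>\<phi>\<in>F. c \<phi> *s \<phi> x)"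
      unfolding l2span_def by blast
    have l: "\<phi> \<in> l2" if "\<phi> \<in> F" for \<phi> using F(2) that by (auto simp: eigenvectors_def)
    have e: "Abs_l2state \<phi> \<in> eigvecs" if "\<phi> \<in> F" for \<phi>
      using F(2) that unfolding eigenvectors_eq by (auto simp: Rep_l2state_inverse)
    have "\<psi> = Rep_l2state (\<Sum>\<phi>\<in>F. c \<phi> *\<^sub>C Abs_l2state \<phi>)"
      unfolding F(3) Rep_sum by (intro ext sum.cong refl) (simp add: scaleC_l2state.rep_eq Abs_l2state_inverse l)
    moreover have "(\<Sum>\<phi>\<in>F. c \<phi> *\<^sub>C Abs_l2state \<phi>) \<in> span eigvecs"
      by (intro span_sum span_base eigvec_scaleC e)
    ultimately show "\<psi> \<in> Rep_l2state ` span eigvecs" by blast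
  qed
  show "Rep_l2state ` span eigvecs \<subseteq> l2span (eigenvectors C)"
  proof
    fix \<psi> assume "\<psi> \<in> Rep_l2state ` span eigvecs"
    then obtain t r where t: "finite t" "t \<subseteq> eigvecs" "\<psi> = Rep_l2state (\<Sum>a\<in>t. r a *\<^sub>R a)"
      unfolding span_explicit by blast
    \<comment> \<open>\<open>eigenvectors\<close> excludes the zero vector while
      \<open>eigvecs\<close> contains it, so a possible 0 is dropped from the sum.\<close>
    define F where "F = Rep_l2state ` (t - {0})"
    have "\<psi> = Rep_l2state (\<Sum>a\<in>t - {0}. of_real (r a) *\<^sub>C a)"
      unfolding t(3) scaleC_of_real using t(1) by (intro arg_cong[where f = Rep_l2state] sum.mono_neutral_right) auto
    also have "\<dots> = (\<lambda>x. \<Sum>\<phi>\<in>F. of_real (r (Abs_l2state \<phi>)) *s \<phi> x)"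
      unfolding F_def Rep_sum
      by (subst sum.reindex) (auto simp: inj_on_def Rep_l2state_inject Rep_l2state_inverse scaleC_l2state.rep_eq)
    finally have "\<psi> = (\<lambda>x. \<Sum>\<phi>\<in>F. of_real (r (Abs_l2state \<phi>)) *s \<phi> x)" .
    moreover have "finite F" "F \<subseteq> eigenvectors C" using t by (auto simp: F_def eigenvectors_eq)
    ultimately show "\<psi> \<in> l2span (eigenvectors C)" unfolding l2span_def
      by (auto intro!: exI[of _ F] exI[of _ "\<lambda>\<phi>. of_real (r (Abs_l2state \<phi>))"])
  qed
qed

lemma l2closure_eq: "l2closure (Rep_l2state ` S) = Rep_l2state ` closure S"
proof
  show "l2closure (Rep_l2state ` S) \<subseteq> Rep_l2state ` closure S"
  proof
    fix \<psi> assume "\<psi> \<in> l2closure (Rep_l2state ` S)"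
    then obtain X where X: "\<And>t. X t \<in> Rep_l2state ` S" "l2conv X \<psi>" unfolding l2closure_def by blast
    have l: "X t \<in> l2" for t using X(1)[of t] by auto
    have "Abs_l2state (X t) \<in> S" for t using X(1)[of t] by (auto simp: Rep_l2state_inverse)
    hence "Abs_l2state \<psi> \<in> closure S"
      using X(2) unfolding l2conv_iff[OF l] closure_sequential
      by (intro exI[of _ "\<lambda>t. Abs_l2state (X t)"]) simp
    moreover have "\<psi> \<in> l2" using X(2) by (simp add: l2conv_def)
    ultimately show "\<psi> \<in> Rep_l2state ` closure S" by (metis Abs_l2state_inverse imageI)
  qed
  show "Rep_l2state ` closure S \<subseteq> l2closure (Rep_l2state ` S)"
  proof
    fix \<psi> assume "\<psi> \<in> Rep_l2state ` closure S"
    then obtain x where x: "\<psi> = Rep_l2state x" "x \<in> closure S" by blast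
    from x(2) obtain X where "\<And>n. X n \<in> S" "X \<longlonglongrightarrow> x" unfolding closure_sequential by blast
    note X = x(1) this
    have "l2conv (\<lambda>n. Rep_l2state (X n)) \<psi>"
      using X(3) unfolding X(1) l2conv_iff[OF Rep_l2] Rep_l2state_inverse by (intro conjI Rep_l2)
    moreover have "\<forall>n. Rep_l2state (X n) \<in> Rep_l2state ` S" using X(2) by (intro allI imageI)
    ultimately show "\<psi> \<in> l2closure (Rep_l2state ` S)"
      unfolding l2closure_def by (intro CollectI exI[of _ "\<lambda>n. Rep_l2state (X n)"] conjI)
  qed
qed

lemma (in quantum_walk) pp_subspace_eq: "pp_subspace C = Rep_l2state ` pp"
  by (simp add: pp_subspace_def l2span_eq l2closure_eq pp_def)

section \<open>Values of the described projections and adjoints\<close>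

text \<open>A candidate with orthogonal remainder settles the description: two candidates differ by
  an element of \<open>T\<close> that is orthogonal to itself.\<close>

lemma proj_Rep:
  assumes p: "p \<in> T" and diff: "\<And>a b. a \<in> T \<Longrightarrow> b \<in> T \<Longrightarrow> a - b \<in> T"
    and orth: "\<And>y. y \<in> T \<Longrightarrow> cinner y (x - p) = 0"
  shows "proj (Rep_l2state ` T) (Rep_l2state x) = Rep_l2state p"
  unfolding Defs.proj_def
proof (rule the_equality)
  have d: "(\<lambda>z. Rep_l2state a z - Rep_l2state b z) = Rep_l2state (a - b)" for a b
    by (simp add: minus_l2state.rep_eq)
  show "Rep_l2state p \<in> Rep_l2state ` T \<and>
      (\<forall>\<eta>\<in>Rep_l2state ` T. l2inner \<eta> (\<lambda>z. Rep_l2state x z - Rep_l2state p z) = 0)"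
    unfolding d using p orth by (auto simp: cinner_l2state.rep_eq[symmetric])
  fix \<phi>
  assume \<phi>: "\<phi> \<in> Rep_l2state ` T \<and> (\<forall>\<eta>\<in>Rep_l2state ` T. l2inner \<eta> (\<lambda>z. Rep_l2state x z - \<phi> z) = 0)"
  then obtain q where q: "\<phi> = Rep_l2state q" "q \<in> T" by blast
  have "cinner y (x - q) = 0" if "y \<in> T" for y
    using \<phi> that unfolding q(1) d by (auto simp: cinner_l2state.rep_eq)
  hence "cinner (p - q) (x - q) = 0" "cinner (p - q) (x - p) = 0" using diff[OF p q(2)] orth by auto
  hence "cinner (p - q) (p - q) = 0" by (simp add: cinner_diff_right)
  hence "p = q" by (simp add: cinner_self)
  thus "\<phi> = Rep_l2state p" using q by simp
qed

lemma adjoint_op_Rep: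
  assumes "\<And>y. cinner y \<phi> = l2inner (W (Rep_l2state y)) \<psi>"
  shows "adjoint_op W \<psi> = Rep_l2state \<phi>"
  unfolding adjoint_op_def
proof (rule the_equality)
  have R: "\<eta> \<in> l2 \<Longrightarrow> \<exists>y. \<eta> = Rep_l2state y" for \<eta> by (metis Abs_l2state_inverse)
  show "Rep_l2state \<phi> \<in> l2 \<and> (\<forall>\<eta>\<in>l2. l2inner \<eta> (Rep_l2state \<phi>) = l2inner (W \<eta>) \<psi>)"
    using assms R by (auto simp: cinner_l2state.rep_eq)
  fix q' assume *: "q' \<in> l2 \<and> (\<forall>\<eta>\<in>l2. l2inner \<eta> q' = l2inner (W \<eta>) \<psi>)"
  then obtain q where q: "q' = Rep_l2state q" using R by blast
  have "cinner y q = cinner y \<phi>" for y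
    using * unfolding q assms by (simp add: cinner_l2state.rep_eq)
  hence "cinner (q - \<phi>) (q - \<phi>) = 0" by (simp add: cinner_diff_right)
  hence "q = \<phi>" by (simp add: cinner_self)
  thus "q' = Rep_l2state \<phi>" using q by simp
qed

subsection \<open>Summable perturbations of the coin\<close>

definition delta :: "int \<Rightarrow> 2 \<Rightarrow> l2state" where
  "delta p i = Abs_l2state (\<lambda>x. if x = p then axis i 1 else 0)"

lemma finite_support_l2:
  assumes "finite F" "\<And>x. x \<notin> F \<Longrightarrow> \<psi> x = 0"
  shows "\<psi> \<in> l2"
  unfolding l2_iff
  by (subst summable_on_cong_neutral[where T = F and g = "\<lambda>x. (norm (\<psi> x))\<^sup>2"])
     (use assms in \<open>auto intro: summable_on_finite\<close>)

lemma Rep_delta: "Rep_l2state (delta p i) = (\<lambda>x. if x = p then axis i 1 else 0)"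
  unfolding delta_def by (rule Abs_l2state_inverse) (rule finite_support_l2[of "{p}"], auto)

lemma cinner_delta: "cinner (delta p i) x = Rep_l2state x p $ i"
proof -
  have "cinner (delta p i) x = (\<Sum>\<^sub>\<infinity>q\<in>{p}. cdot (axis i 1) (Rep_l2state x q))"
    unfolding cinner_l2state.rep_eq l2inner_def Rep_delta by (rule infsum_cong_neutral) auto
  also have "\<dots> = Rep_l2state x p $ i"
    using exhaust_2[of i] by (auto simp: axis_def sum_2)
  finally show ?thesis .
qed

lemma norm_delta: "norm (delta p i) = 1"
proof -
  have "complex_of_real ((norm (delta p i))\<^sup>2) = 1"
    unfolding cinner_self[symmetric] cinner_delta by (simp add: Rep_delta axis_def)
  hence "(norm (delta p i))\<^sup>2 = 1" using of_real_eq_1_iff by blast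
  thus ?thesis by (simp add: power2_eq_1_iff) (use norm_ge_zero[of "delta p i"] in linarith)
qed

text \<open>The factor 2 counts the two spin components, each tested by a unit vector.\<close>

lemma bessel_site:
  assumes "bessel K v"
  shows "(\<Sum>n<N. (norm (Rep_l2state (v n) p))\<^sup>2) \<le> 2 * K"
proof -
  have "(\<Sum>n<N. (cmod (cinner (delta p i) (v n)))\<^sup>2) \<le> K" for i
    using assms norm_delta[of p i] unfolding bessel_def by (metis mult.right_neutral power_one)
  from this[of 1] this[of 2] show ?thesis
    unfolding norm_vec2_sq sum.distrib by (simp add: cinner_delta)
qed

lemma infsum_sum_lessThan:
  fixes f :: "nat \<Rightarrow> 'b \<Rightarrow> real"
  assumes "\<And>n. f n summable_on A"
  shows "(\<lambda>x. \<Sum>n<N. f n x) summable_on A" "(\<Sum>n<N. infsum (f n) A) = (\<Sum>\<^sub>\<infinity>x\<in>A. \<Sum>n<N. f n x)"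
proof -
  show 1: "(\<lambda>x. \<Sum>n<N. f n x) summable_on A" for N
    by (induction N) (auto intro: summable_on_add assms)
  show "(\<Sum>n<N. infsum (f n) A) = (\<Sum>\<^sub>\<infinity>x\<in>A. \<Sum>n<N. f n x)"
    by (induction N) (auto simp: infsum_add 1 assms)
qed

text \<open>With the identity coin a walk is the bare shift, which thereby comes with its inverse
  and unitarity.\<close>

interpretation free_shift: quantum_walk "\<lambda>_. mat 1"
proof
  have "madj (mat 1) = (mat 1 :: coin)" by (simp add: madj_def mat_def vec_eq_iff)
  thus "unitary2 (mat 1)" by (simp add: unitary2_def)
qed

locale coin_pair = A: quantum_walk C + B: quantum_walk D for C D :: "int \<Rightarrow> coin" +
  fixes d :: "int \<Rightarrow> real"
  assumes d_nonneg: "0 \<le> d x" and d_summable: "d summable_on UNIV"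
    and d_bound: "norm ((C x - D x) *v v) \<le> d x * norm v"
begin

text \<open>The weighted site form produced by the coin difference: \<open>d p\<close> bounds the
  operator norm of the difference at site \<open>p\<close>.\<close>

definition q :: "l2state \<Rightarrow> real" where
  "q v = (\<Sum>\<^sub>\<infinity>p. d p * (norm (Rep_l2state v p))\<^sup>2)"

lemma q_summable: "(\<lambda>p. d p * (norm (Rep_l2state v p))\<^sup>2) summable_on UNIV"
proof (rule summable_on_comparison_test)
  show "(\<lambda>p. d p * (norm v)\<^sup>2) summable_on UNIV"
    by (rule summable_on_cmult_left[OF d_summable])
  show "d p * (norm (Rep_l2state v p))\<^sup>2 \<le> d p * (norm v)\<^sup>2" for p
    using norm_le_l2norm[OF Rep_l2, of v p] d_nonneg[of p]
    by (intro mult_left_mono power_mono) (auto simp: norm_l2state.rep_eq)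
qed (simp add: d_nonneg)

lemma q_nonneg: "0 \<le> q v"
  unfolding q_def by (rule infsum_nonneg) (simp add: d_nonneg)

lemma q_bessel:
  assumes "bessel K v"
  shows "(\<Sum>n<N. q (v n)) \<le> 2 * (\<Sum>\<^sub>\<infinity>p. d p) * K"
proof -
  have "(\<Sum>n<N. q (v n)) = (\<Sum>\<^sub>\<infinity>p. \<Sum>n<N. d p * (norm (Rep_l2state (v n) p))\<^sup>2)"
    unfolding q_def by (rule infsum_sum_lessThan(2)[OF q_summable])
  also have "\<dots> \<le> (\<Sum>\<^sub>\<infinity>p. d p * (2 * K))"
  proof (rule infsum_mono)
    show "(\<Sum>n<N. d p * (norm (Rep_l2state (v n) p))\<^sup>2) \<le> d p * (2 * K)" for p
      unfolding sum_distrib_left[symmetric] by (intro mult_left_mono bessel_site[OF assms] d_nonneg)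
  qed (intro infsum_sum_lessThan(1) q_summable summable_on_cmult_left d_summable)+
  also have "\<dots> = 2 * (\<Sum>\<^sub>\<infinity>p. d p) * K" by (simp add: infsum_cmult_left')
  finally show ?thesis .
qed

text \<open>The matrix element of the difference sees \<open>y\<close> pulled back by the shift and
  \<open>x\<close> as it is. Adding both forms gives one \<open>Q\<close> that can be used on either
  side.\<close>

definition Q :: "l2state \<Rightarrow> real" where
  "Q v = q (free_shift.V v) + q v"

text \<open>The difference is the shift after sitewise multiplication by \<open>C p - D p\<close>.
  The shift moves to the left argument, and the weight \<open>d p\<close> is split into two square
  roots for Cauchy-Schwarz over the sites.\<close>

lemma difference_bound:
  "(cmod (cinner y (A.U x - B.U x)))\<^sup>2 \<le> Q y * Q x"
proof -
  define z where "z = (\<lambda>p. (C p - D p) *v Rep_l2state x p)"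
  define s where "s = free_shift.V y"
  have "Rep_l2state (A.U x - B.U x) = Defs.shift z"
    by (simp add: minus_l2state.rep_eq A.Rep_U B.Rep_U walk_def z_def Defs.shift_def fun_eq_iff vec_eq_iff
        matrix_vector_mult_diff_rdistrib)
  have zl2: "z \<in> l2"
  proof -
    have "z = (\<lambda>p. C p *v Rep_l2state x p + - (D p *v Rep_l2state x p))"
      by (simp add: z_def fun_eq_iff matrix_vector_mult_diff_rdistrib)
    thus ?thesis
      using l2_add[OF A.coin_l2(1)[OF Rep_l2] l2_uminus[OF B.coin_l2(1)[OF Rep_l2]]] by simp
  qed
  have "A.U x - B.U x = free_shift.U (Abs_l2state z)"
    unfolding Rep_l2state_inject[symmetric] free_shift.Rep_U Abs_l2state_inverse[OF zl2]
    using \<open>Rep_l2state (A.U x - B.U x) = Defs.shift z\<close> by (simp add: walk_def)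
  hence "cinner y (A.U x - B.U x) = cinner s (Abs_l2state z)"
    using free_shift.U_cinner[of s "Abs_l2state z"] by (simp add: s_def)
  also have "\<dots> = (\<Sum>\<^sub>\<infinity>p. cdot (Rep_l2state s p) (z p))"
    by (simp add: cinner_l2state.rep_eq l2inner_def Abs_l2state_inverse zl2)
  finally have eq: "cinner y (A.U x - B.U x) = (\<Sum>\<^sub>\<infinity>p. cdot (Rep_l2state s p) (z p))" .
  have bd: "cmod (cdot (Rep_l2state s p) (z p)) \<le> sqrt (d p) * norm (Rep_l2state s p) * (sqrt (d p) * norm (Rep_l2state x p))" for p
  proof -
    have "cmod (cdot a b) \<le> norm a * norm b" for a b :: "complex^2"
    proof -
      have "cmod (cdot a b) \<le> (\<Sum>i\<in>UNIV. \<bar>cmod (a $ i)\<bar> * \<bar>cmod (b $ i)\<bar>)"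
        by (rule sum_norm_le) (simp add: norm_mult)
      also have "\<dots> \<le> norm a * norm b"
        unfolding norm_vec_def by (rule L2_set_mult_ineq)
      finally show ?thesis .
    qed
    hence "cmod (cdot (Rep_l2state s p) (z p)) \<le> norm (Rep_l2state s p) * norm (z p)" .
    also have "\<dots> \<le> norm (Rep_l2state s p) * (d p * norm (Rep_l2state x p))"
      unfolding z_def by (intro mult_left_mono d_bound) simp
    also have "\<dots> = (sqrt (d p) * sqrt (d p)) * (norm (Rep_l2state s p) * norm (Rep_l2state x p))"
      using d_nonneg[of p] by simp
    finally show ?thesis by (simp only: mult_ac)
  qed
  have fin: "(\<Sum>p\<in>F. cmod (cdot (Rep_l2state s p) (z p))) \<le> sqrt (q s) * sqrt (q x)" if F: "finite F" for F
  proof -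
    have L: "L2_set (\<lambda>p. sqrt (d p) * norm (Rep_l2state w p)) F \<le> sqrt (q w)" for w
      unfolding L2_set_def q_def
    proof (rule real_sqrt_le_mono)
      have "(\<Sum>p\<in>F. (sqrt (d p) * norm (Rep_l2state w p))\<^sup>2) = (\<Sum>p\<in>F. d p * (norm (Rep_l2state w p))\<^sup>2)"
        by (simp add: power_mult_distrib d_nonneg)
      also have "\<dots> \<le> (\<Sum>\<^sub>\<infinity>p. d p * (norm (Rep_l2state w p))\<^sup>2)"
        by (rule finite_sum_le_infsum[OF q_summable F]) (auto simp: d_nonneg)
      finally show "(\<Sum>p\<in>F. (sqrt (d p) * norm (Rep_l2state w p))\<^sup>2) \<le> (\<Sum>\<^sub>\<infinity>p. d p * (norm (Rep_l2state w p))\<^sup>2)" .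
    qed
    have "(\<Sum>p\<in>F. cmod (cdot (Rep_l2state s p) (z p))) \<le>
        (\<Sum>p\<in>F. \<bar>sqrt (d p) * norm (Rep_l2state s p)\<bar> * \<bar>sqrt (d p) * norm (Rep_l2state x p)\<bar>)"
      by (intro sum_mono) (use bd d_nonneg in \<open>simp add: abs_mult\<close>)
    also have "\<dots> \<le> L2_set (\<lambda>p. sqrt (d p) * norm (Rep_l2state s p)) F * L2_set (\<lambda>p. sqrt (d p) * norm (Rep_l2state x p)) F"
      by (rule L2_set_mult_ineq)
    also have "\<dots> \<le> sqrt (q s) * sqrt (q x)"
      by (intro mult_mono L L2_set_nonneg real_sqrt_ge_zero q_nonneg)
    finally show ?thesis .
  qed
  have sm: "(\<lambda>p. cmod (cdot (Rep_l2state s p) (z p))) summable_on UNIV"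
    by (rule nonneg_bdd_above_summable_on) (use fin in \<open>auto intro!: bdd_aboveI2\<close>)
  have "cmod (cinner y (A.U x - B.U x)) \<le> (\<Sum>\<^sub>\<infinity>p. cmod (cdot (Rep_l2state s p) (z p)))"
    unfolding eq by (rule norm_infsum_bound[OF sm])
  also have "\<dots> \<le> sqrt (q s) * sqrt (q x)"
    by (rule infsum_le_finite_sums[OF sm fin])
  finally have "(cmod (cinner y (A.U x - B.U x)))\<^sup>2 \<le> (sqrt (q s) * sqrt (q x))\<^sup>2"
    by (intro power_mono) auto
  also have "\<dots> = q s * q x" using q_nonneg by (simp add: power_mult_distrib)
  also have "\<dots> \<le> Q y * Q x"
    unfolding Q_def s_def using q_nonneg by (intro mult_mono) (auto intro: add_nonneg_nonneg)
  finally show ?thesis .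
qed

text \<open>The 4 is two spin components times the two summands of \<open>Q\<close>.\<close>

sublocale trace_class_pair A.U A.V B.U B.V Q "4 * (\<Sum>\<^sub>\<infinity>p. d p)"
proof
  fix K :: real and v :: "nat \<Rightarrow> l2state" and N
  assume v: "bessel K v"
  have "bessel K (\<lambda>n. free_shift.V (v n))"
    using free_shift.bessel_upow[OF v, of "-1"] free_shift.upow_pred[of 0] by simp
  from q_bessel[OF this, of N] q_bessel[OF v, of N]
  show "(\<Sum>n<N. Q (v n)) \<le> 4 * (\<Sum>\<^sub>\<infinity>p. d p) * K"
    unfolding Q_def sum.distrib by linarith
qed (use q_nonneg difference_bound in \<open>auto simp: Q_def intro!: infsum_nonneg d_nonneg\<close>)

end

subsection \<open>Fourier series of square integrable functions\<close>

definition sqi :: "(real \<Rightarrow> complex) \<Rightarrow> bool" where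
  "sqi f \<longleftrightarrow> f \<in> borel_measurable lcirc \<and> integrable lcirc (\<lambda>k. (cmod (f k))\<^sup>2)"

text \<open>The positive exponent is that of the inverse transform, so \<open>fcoeff\<close> of a
  trigonometric polynomial returns its coefficients with reversed index.\<close>

definition fcoeff :: "(real \<Rightarrow> complex) \<Rightarrow> int \<Rightarrow> complex" where
  "fcoeff f n = (\<integral>k. cis (of_int n * k) * f k \<partial>lcirc) / of_real (2 * pi)"

lemma measure_lcirc: "measure lcirc (space lcirc) = 2 * pi"
proof -
  have "complex_of_real (measure lcirc (space lcirc)) = (\<integral>k. cis (of_int 0 * k) \<partial>lcirc)"
    by (simp add: scaleR_conv_of_real)
  also have "\<dots> = of_real (2 * pi)" by (simp only: integral_cis refl if_True)
  finally show ?thesis by (simp only: of_real_eq_iff)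
qed

lemma sqi_trig: "sqi (trig c)"
  using lcirc.bdd_integrable_sq[OF lcirc.bdd_trig] by (simp add: sqi_def)

lemma sqi_add: "sqi f \<Longrightarrow> sqi g \<Longrightarrow> sqi (\<lambda>k. f k + g k)"
  unfolding sqi_def by (auto intro: integral_sq_add_le(1))

lemma sqi_scale: "sqi f \<Longrightarrow> sqi (\<lambda>k. a * f k)"
  unfolding sqi_def by (auto simp: norm_mult power_mult_distrib)

lemma sqi_diff: "sqi f \<Longrightarrow> sqi g \<Longrightarrow> sqi (\<lambda>k. f k - g k)"
  using sqi_add[of f "\<lambda>k. (-1) * g k"] sqi_scale[of g "-1"] by simp

lemma cmod_le_sq: "cmod z \<le> 1 + (cmod z)\<^sup>2"
proof (cases "cmod z \<le> 1")
  case False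
  hence "cmod z * 1 \<le> cmod z * cmod z" by (intro mult_left_mono) auto
  thus ?thesis by (simp add: power2_eq_square)
qed (simp add: add_increasing2)

lemma sqi_integrable:
  assumes "sqi f" shows "integrable lcirc f"
proof (rule Bochner_Integration.integrable_bound)
  show "integrable lcirc (\<lambda>k. 1 + (cmod (f k))\<^sup>2)" using assms by (simp add: sqi_def)
qed (use assms cmod_le_sq in \<open>auto simp: sqi_def abs_of_nonneg\<close>)

lemma integrable_bdd_times:
  assumes "lcirc.bdd g" "integrable lcirc f"
  shows "integrable lcirc (\<lambda>k. g k * f k)"
proof -
  obtain B where B: "\<And>k. k \<in> circ \<Longrightarrow> cmod (g k) \<le> B" using assms(1) unfolding lcirc.bdd_def by blast
  show ?thesis
  proof (rule Bochner_Integration.integrable_bound)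
    show "integrable lcirc (\<lambda>k. B * cmod (f k))" using assms(2) by simp
    show "AE k in lcirc. norm (g k * f k) \<le> norm (B * cmod (f k))"
    proof (rule AE_I2)
      fix k assume "k \<in> space lcirc"
      hence "cmod (g k) * cmod (f k) \<le> B * cmod (f k)"
        by (intro mult_right_mono B) (auto simp: lcirc.space_eq)
      thus "norm (g k * f k) \<le> norm (B * cmod (f k))" by (simp add: norm_mult)
    qed
    show "(\<lambda>k. g k * f k) \<in> borel_measurable lcirc"
      using lcirc.bdd_measurable[OF assms(1)] assms(2) by measurable
  qed
qed

lemma integrable_cis_times: "integrable lcirc f \<Longrightarrow> integrable lcirc (\<lambda>k. cis (a * k) * f k)"
  by (rule integrable_bdd_times[OF lcirc.bdd_cis])

lemma fcoeff_diff: "sqi f \<Longrightarrow> sqi g \<Longrightarrow> fcoeff (\<lambda>k. f k - g k) n = fcoeff f n - fcoeff g n"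
  unfolding fcoeff_def using integrable_cis_times[OF sqi_integrable]
  by (simp add: right_diff_distrib diff_divide_distrib)

lemma integral_trig_times:
  assumes "integrable lcirc f"
  shows "(\<integral>k. trig c k * f k \<partial>lcirc) = of_real (2 * pi) * (\<Sum>n | c n \<noteq> 0. c n * fcoeff f n)"
proof -
  have "(\<integral>k. trig c k * f k \<partial>lcirc) = (\<integral>k. (\<Sum>n | c n \<noteq> 0. c n * (cis (of_int n * k) * f k)) \<partial>lcirc)"
    unfolding trig_def sum_distrib_right by (simp only: mult.assoc)
  also have "\<dots> = (\<Sum>n | c n \<noteq> 0. \<integral>k. c n * (cis (of_int n * k) * f k) \<partial>lcirc)"
    by (intro Bochner_Integration.integral_sum integrable_mult_right integrable_cis_times assms)
  also have "\<dots> = of_real (2 * pi) * (\<Sum>n | c n \<noteq> 0. c n * fcoeff f n)"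
    by (simp add: fcoeff_def sum_distrib_left)
  finally show ?thesis .
qed

lemma fcoeff_trig:
  assumes "fin_coeffs c" shows "fcoeff (trig c) n = c (- n)"
proof -
  have "(\<integral>k. cis (of_int n * k) * trig c k \<partial>lcirc) = (\<integral>k. (\<Sum>m | c m \<noteq> 0. c m * cis (of_int (n + m) * k)) \<partial>lcirc)"
    unfolding trig_def sum_distrib_left
    by (intro Bochner_Integration.integral_cong refl sum.cong) (simp add: cis_mult algebra_simps flip: cis_mult)
  also have "\<dots> = (\<Sum>m | c m \<noteq> 0. \<integral>k. c m * cis (of_int (n + m) * k) \<partial>lcirc)"
    by (intro Bochner_Integration.integral_sum lcirc.bdd_integrable lcirc.bdd_mult lcirc.bdd_const lcirc.bdd_cis)
  also have "\<dots> = (\<Sum>m | c m \<noteq> 0. if m = - n then c (- n) * of_real (2 * pi) else 0)"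
    unfolding integral_mult_right_zero integral_cis by (intro sum.cong refl) auto
  also have "\<dots> = c (- n) * of_real (2 * pi)"
    using assms by (simp add: sum.delta fin_coeffs_def)
  finally show ?thesis by (simp add: fcoeff_def)
qed

text \<open>Expand the nonnegative squared distance of \<open>f\<close> to its partial Fourier sum
  \<open>p\<close>: the cross term and the norm of \<open>p\<close> both produce the coefficient sum
  \<open>S\<close>.\<close>

lemma bessel_fcoeff:
  assumes f: "sqi f" and F: "finite F"
  shows "(\<Sum>n\<in>F. (cmod (fcoeff f n))\<^sup>2) \<le> (\<integral>k. (cmod (f k))\<^sup>2 \<partial>lcirc) / (2 * pi)"
proof -
  define c where "c n = (if - n \<in> F then fcoeff f (- n) else 0)" for n
  define S where "S = (\<Sum>n\<in>F. (cmod (fcoeff f n))\<^sup>2)"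
  define p where "p = trig c"
  have sub: "{n. c n \<noteq> 0} \<subseteq> uminus ` F"
    unfolding c_def by (auto simp: image_iff intro!: bexI[of _ "- _"])
  have fc: "fin_coeffs c" unfolding fin_coeffs_def by (rule finite_subset[OF sub]) (use F in simp)
  have S1: "(\<Sum>n | c n \<noteq> 0. (cmod (c n))\<^sup>2) = S"
  proof -
    have "(\<Sum>n | c n \<noteq> 0. (cmod (c n))\<^sup>2) = (\<Sum>n\<in>uminus ` F. (cmod (c n))\<^sup>2)"
      by (rule sum.mono_neutral_left) (use sub F in auto)
    thus ?thesis by (simp add: sum.reindex c_def S_def)
  qed
  have pp: "(\<integral>k. (cmod (p k))\<^sup>2 \<partial>lcirc) = 2 * pi * S"
    unfolding p_def parseval_trig[OF fc] S1 ..
  have ip: "integrable lcirc (\<lambda>k. cnj (p k) * f k)"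
    unfolding p_def by (intro integrable_bdd_times lcirc.bdd_cnj lcirc.bdd_trig sqi_integrable f)
  have "(\<integral>k. cnj (p k) * f k \<partial>lcirc) = (\<integral>k. trig (\<lambda>n. cnj (c (- n))) k * f k \<partial>lcirc)"
    by (simp add: trig_reflect p_def)
  also have "\<dots> = of_real (2 * pi) * (\<Sum>n | cnj (c (- n)) \<noteq> 0. cnj (c (- n)) * fcoeff f n)"
    by (rule integral_trig_times[OF sqi_integrable[OF f]])
  also have "(\<Sum>n | cnj (c (- n)) \<noteq> 0. cnj (c (- n)) * fcoeff f n) = (\<Sum>n\<in>F. cnj (c (- n)) * fcoeff f n)"
    by (rule sum.mono_neutral_left) (use F in \<open>auto simp: c_def\<close>)
  also have "\<dots> = of_real S"
    unfolding S_def of_real_sum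
    by (intro sum.cong refl) (simp add: c_def complex_norm_square mult.commute del: of_real_power)
  finally have cross: "(\<integral>k. cnj (p k) * f k \<partial>lcirc) = of_real (2 * pi * S)" by simp
  have sq: "(cmod (a - b))\<^sup>2 = (cmod a)\<^sup>2 + (cmod b)\<^sup>2 - 2 * Re (cnj b * a)" for a b
    unfolding cmod_power2 by (simp add: power2_eq_square algebra_simps)
  have "0 \<le> (\<integral>k. (cmod (f k - p k))\<^sup>2 \<partial>lcirc)" by simp
  also have "\<dots> = (\<integral>k. (cmod (f k))\<^sup>2 + (cmod (p k))\<^sup>2 - 2 * Re (cnj (p k) * f k) \<partial>lcirc)"
    by (simp only: sq)
  also have "\<dots> = (\<integral>k. (cmod (f k))\<^sup>2 \<partial>lcirc) + 2 * pi * S - 2 * Re (\<integral>k. cnj (p k) * f k \<partial>lcirc)"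
    using f sqi_trig[of c] ip unfolding sqi_def p_def[symmetric] pp[symmetric]
    by (simp add: integral_Re integrable_Re del: times_complex.sel)
  also have "\<dots> = (\<integral>k. (cmod (f k))\<^sup>2 \<partial>lcirc) - 2 * pi * S"
    unfolding cross by simp
  finally show ?thesis by (simp add: S_def[symmetric] field_simps)
qed

text \<open>Every trigonometric polynomial integrates to 0 against \<open>f\<close>. Approximating
  indicators in mean square shows that \<open>f\<close> has integral 0 over every measurable set.
  Young's inequality with a free parameter \<open>t\<close> bounds the error, first with
  \<open>n\<close> and then with \<open>t\<close> tending to infinity.\<close>

lemma fcoeff_zero_AE:
  assumes f: "sqi f" and zero: "\<And>n. fcoeff f n = 0"
  shows "AE k in lcirc. f k = 0"
proof (rule lcirc.density_zero[OF sqi_integrable[OF f]])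
  fix A assume A: "A \<in> sets lcirc"
  hence Ab: "A \<in> sets borel" by (rule lcirc.set_borel)
  define F where "F = (\<integral>k. (cmod (f k))\<^sup>2 \<partial>lcirc)"
  have F0: "F \<ge> 0" by (simp add: F_def)
  define z where "z = (\<integral>k. indicator A k * f k \<partial>lcirc)"
  interpret m: circle_measures "{lcirc}"
    by (rule circle_measures.intro) (auto intro: lcirc.circle_measure_axioms)
  obtain c where c: "\<And>n. fin_coeffs (c n)" and
    lim: "(\<lambda>n. \<integral>k. (cmod (trig (c n) k - indicator A k))\<^sup>2 \<partial>lcirc) \<longlonglongrightarrow> 0"
    using m.approx_seq[OF Ab] by blast
  have bd: "cmod z \<le> t / 2 * (\<integral>k. (cmod (trig (c n) k - indicator A k))\<^sup>2 \<partial>lcirc) + F / (2 * t)" if t: "t > 0" for t n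
  proof -
    have b: "lcirc.bdd (\<lambda>k. trig (c n) k - indicator A k)"
      by (intro lcirc.bdd_diff lcirc.bdd_trig lcirc.bdd_indicator Ab)
    have i1: "integrable lcirc (\<lambda>k. trig (c n) k * f k)" "integrable lcirc (\<lambda>k. indicator A k * f k)"
      by (intro integrable_bdd_times lcirc.bdd_trig lcirc.bdd_indicator Ab sqi_integrable f)+
    have "(\<integral>k. trig (c n) k * f k \<partial>lcirc) = 0"
      unfolding integral_trig_times[OF sqi_integrable[OF f]] zero by simp
    hence "- z = (\<integral>k. (trig (c n) k - indicator A k) * f k \<partial>lcirc)"
      using i1 by (simp add: z_def left_diff_distrib)
    hence "cmod z = cmod (\<integral>k. (trig (c n) k - indicator A k) * f k \<partial>lcirc)" by (metis norm_minus_cancel)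
    also have "\<dots> \<le> (\<integral>k. cmod ((trig (c n) k - indicator A k) * f k) \<partial>lcirc)" by (rule integral_norm_bound)
    also have "\<dots> \<le> (\<integral>k. t / 2 * (cmod (trig (c n) k - indicator A k))\<^sup>2 + 1 / (2 * t) * (cmod (f k))\<^sup>2 \<partial>lcirc)"
    proof (rule integral_mono)
      show "integrable lcirc (\<lambda>k. cmod ((trig (c n) k - indicator A k) * f k))"
        by (intro integrable_norm integrable_bdd_times b sqi_integrable f)
      show "integrable lcirc (\<lambda>k. t / 2 * (cmod (trig (c n) k - indicator A k))\<^sup>2 + 1 / (2 * t) * (cmod (f k))\<^sup>2)"
        using f lcirc.bdd_integrable_sq[OF b] by (simp add: sqi_def)
      fix k
      have "cmod (a * b) \<le> t / 2 * (cmod a)\<^sup>2 + 1 / (2 * t) * (cmod b)\<^sup>2" for a b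
      proof -
        have "0 \<le> (t * cmod a - cmod b)\<^sup>2 / (2 * t)" using t by simp
        thus ?thesis using t by (simp add: norm_mult power2_eq_square field_simps)
      qed
      thus "cmod ((trig (c n) k - indicator A k) * f k) \<le>
          t / 2 * (cmod (trig (c n) k - indicator A k))\<^sup>2 + 1 / (2 * t) * (cmod (f k))\<^sup>2" .
    qed
    also have "\<dots> = t / 2 * (\<integral>k. (cmod (trig (c n) k - indicator A k))\<^sup>2 \<partial>lcirc) + F / (2 * t)"
      using f lcirc.bdd_integrable_sq[OF b] by (simp add: sqi_def F_def)
    finally show ?thesis .
  qed
  have le: "cmod z \<le> F / (2 * t)" if t: "t > 0" for t
  proof -
    have "(\<lambda>n. t / 2 * (\<integral>k. (cmod (trig (c n) k - indicator A k))\<^sup>2 \<partial>lcirc) + F / (2 * t)) \<longlonglongrightarrow> t / 2 * 0 + F / (2 * t)"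
      by (intro tendsto_intros lim)
    from LIMSEQ_le_const[OF this, of "cmod z"] bd[OF t] show ?thesis by auto
  qed
  have "z = 0"
  proof (rule ccontr)
    assume "z \<noteq> 0"
    hence "cmod z > 0" by simp
    \<comment> \<open>This value of \<open>t\<close> makes the right side smaller than
      \<open>cmod z\<close>, the desired contradiction.\<close>
    moreover have "cmod z \<le> F / (2 * ((F + 1) / cmod z))"
      using F0 \<open>cmod z > 0\<close> by (intro le divide_pos_pos) auto
    ultimately have "F * cmod z + cmod z * 2 \<le> 0" using F0 by (simp add: field_simps)
    thus False using mult_nonneg_nonneg[OF F0 norm_ge_zero[of z]] \<open>cmod z > 0\<close> by linarith
  qed
  moreover have "indicator A k *\<^sub>R f k = indicator A k * f k" for k by (simp split: split_indicator)
  ultimately show "(LINT k:A|lcirc. f k) = 0"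
    by (simp only: z_def set_lebesgue_integral_def)
qed

text \<open>Finite index sets with tails below powers of 1/4 split the series into blocks whose L1
  norms decay geometrically. The block series therefore converges almost everywhere; Fatou's lemma
  gives the L2 bound, and summability of the L1 norms lets the coefficients be computed
  termwise.\<close>

lemma riesz_fischer:
  fixes c :: "int \<Rightarrow> complex"
  assumes c: "(\<lambda>n. (cmod (c n))\<^sup>2) summable_on UNIV"
  obtains f where "sqi f" "\<And>n. fcoeff f n = c n"
    "(\<integral>k. (cmod (f k))\<^sup>2 \<partial>lcirc) \<le> 2 * pi * (\<Sum>\<^sub>\<infinity>n. (cmod (c n))\<^sup>2)"
proof -
  define tot where "tot = (\<Sum>\<^sub>\<infinity>n. (cmod (c n))\<^sup>2)"
  define S where "S F = (\<Sum>n\<in>F. (cmod (c n))\<^sup>2)" for F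
  have S_le: "S F \<le> tot" if "finite F" for F
    unfolding S_def tot_def by (rule finite_sum_le_infsum[OF c that]) auto
  have S_mono: "S F \<le> S G" if "F \<subseteq> G" "finite G" for F G
    unfolding S_def by (rule sum_mono2) (use that in auto)
  have tot0: "tot \<ge> 0" unfolding tot_def by (rule infsum_nonneg) simp
  have "\<exists>F. finite F \<and> tot - S F \<le> (1/4) ^ j" for j :: nat
  proof -
    obtain F where "finite F" "dist (S F) tot \<le> (1/4) ^ j"
      using infsum_finite_approximation[OF c, of "(1/4) ^ j"] by (auto simp: S_def tot_def)
    thus ?thesis by (intro exI[of _ F]) (auto simp: dist_real_def)
  qed
  then obtain F where F: "\<And>j. finite (F j)" "\<And>j. tot - S (F j) \<le> (1/4) ^ j" by metis
  define G where "G j = (\<Union>i\<le>j. F i)" for j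
  have G: "finite (G j)" "tot - S (G j) \<le> (1/4) ^ j" "G j \<subseteq> G (Suc j)" for j
  proof -
    show 1: "finite (G j)" using F(1) by (simp add: G_def)
    have "S (F j) \<le> S (G j)" by (rule S_mono[OF _ 1]) (auto simp: G_def)
    thus "tot - S (G j) \<le> (1/4) ^ j" using F(2)[of j] by linarith
    show "G j \<subseteq> G (Suc j)" unfolding G_def by (rule UN_mono) auto
  qed
  define D where "D j = (case j of 0 \<Rightarrow> G 0 | Suc i \<Rightarrow> G (Suc i) - G i)" for j
  have finD: "finite (D j)" for j using G(1) by (cases j) (auto simp: D_def)
  \<comment> \<open>The \<open>tot\<close> pays for block 0, and the 4 for the later blocks, whose
    bound comes from the preceding index.\<close>
  have SD: "S (D j) \<le> (4 + tot) * (1/4) ^ j" for j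
  proof (cases j)
    case 0
    thus ?thesis using S_le[OF finD[of 0]] by simp
  next
    case (Suc i)
    have "S (D (Suc i)) = S (G (Suc i)) - S (G i)"
      unfolding S_def D_def using sum_diff[OF G(1) G(3)] by simp
    also have "\<dots> \<le> (1/4) ^ i" using S_le[OF G(1), of "Suc i"] G(2)[of i] by linarith
    also have "\<dots> = 4 * (1/4) ^ Suc i" by simp
    also have "\<dots> \<le> (4 + tot) * (1/4) ^ Suc i" using tot0 by (intro mult_right_mono) auto
    finally show ?thesis using Suc by simp
  qed
  define e where "e A n = (if - n \<in> A then c (- n) else 0)" for A and n :: int
  define T where "T A = trig (e A)" for A
  have esub: "{n. e A n \<noteq> 0} \<subseteq> uminus ` A" for A
    unfolding e_def by (auto simp: image_iff intro!: bexI[of _ "- _"])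
  have fe: "fin_coeffs (e A)" if "finite A" for A
    unfolding fin_coeffs_def by (rule finite_subset[OF esub]) (use that in simp)
  have Tsq: "(\<integral>k. (cmod (T A k))\<^sup>2 \<partial>lcirc) = 2 * pi * S A" if A: "finite A" for A
  proof -
    have "(\<Sum>n | e A n \<noteq> 0. (cmod (e A n))\<^sup>2) = (\<Sum>n\<in>uminus ` A. (cmod (e A n))\<^sup>2)"
      by (rule sum.mono_neutral_left) (use esub A in auto)
    also have "\<dots> = S A" by (simp add: sum.reindex e_def S_def)
    finally show ?thesis unfolding T_def by (simp add: parseval_trig[OF fe[OF A]])
  qed
  have Tsum: "(\<Sum>j\<le>J. T (D j) k) = T (G J) k" for J k
  proof (induction J)
    case (Suc J)
    have "e (G (Suc J)) = (\<lambda>n. e (G J) n + e (D (Suc J)) n)"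
      using G(3)[of J] by (auto simp: e_def D_def fun_eq_iff)
    hence "T (G (Suc J)) k = T (G J) k + T (D (Suc J)) k"
      unfolding T_def using trig_add[OF fe[OF G(1)] fe[OF finD]] by simp
    thus ?case using Suc by simp
  qed (simp add: D_def)
  have bT: "lcirc.bdd (T A)" for A unfolding T_def by (rule lcirc.bdd_trig)
  have iT: "integrable lcirc (\<lambda>k. cis (of_int n * k) * T A k)" for n A
    by (intro integrable_cis_times lcirc.bdd_integrable bT)
  have L1: "(\<integral>k. cmod (T (D j) k) \<partial>lcirc) \<le> pi * (5 + tot) * (1/2) ^ j" for j
  proof -
    \<comment> \<open>The arithmetic-geometric mean inequality with weight \<open>2 ^ j\<close>,
      which balances a block of square norm of order \<open>(1/4) ^ j\<close> against the
      constant.\<close>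
    have "(\<integral>k. cmod (T (D j) k) \<partial>lcirc) \<le> (\<integral>k. (2 ^ j * (cmod (T (D j) k))\<^sup>2 + (1/2) ^ j) / 2 \<partial>lcirc)"
    proof (rule integral_mono)
      fix k
      have "0 \<le> (2 ^ j * cmod (T (D j) k) - 1)\<^sup>2 / (2 ^ j * 2)" by simp
      also have "\<dots> = (2 ^ j * (cmod (T (D j) k))\<^sup>2 + (1/2) ^ j) / 2 - cmod (T (D j) k)"
        by (simp add: power2_eq_square field_simps power_one_over)
      finally show "cmod (T (D j) k) \<le> (2 ^ j * (cmod (T (D j) k))\<^sup>2 + (1/2) ^ j) / 2" by simp
    qed (use lcirc.bdd_integrable[OF bT] lcirc.bdd_integrable_sq[OF bT] in auto)
    also have "\<dots> = (2 ^ j * (2 * pi * S (D j)) + (1/2) ^ j * (2 * pi)) / 2"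
      using lcirc.bdd_integrable_sq[OF bT, of "D j"] by (simp add: Tsq[OF finD] measure_lcirc)
    also have "\<dots> \<le> (2 ^ j * (2 * pi * ((4 + tot) * (1/4) ^ j)) + (1/2) ^ j * (2 * pi)) / 2"
      by (intro divide_right_mono add_right_mono mult_left_mono SD) auto
    also have "\<dots> = pi * (5 + tot) * (1/2) ^ j"
    proof -
      have "(1/4::real) ^ j = (1/2) ^ j * (1/2) ^ j" by (simp add: power_mult_distrib[symmetric])
      hence "2 ^ j * (2 * pi * ((4 + tot) * (1/4) ^ j)) = 2 * pi * (4 + tot) * ((2 ^ j * (1/2) ^ j) * (1/2) ^ j)"
        by (simp only: mult_ac)
      also have "2 ^ j * (1/2::real) ^ j = 1" by (simp add: power_mult_distrib[symmetric])
      finally show ?thesis by (simp only: mult_1_left) (simp add: algebra_simps)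
    qed
    finally show ?thesis .
  qed
  have sumL1: "summable (\<lambda>j. \<integral>k. cmod (T (D j) k) \<partial>lcirc)"
    by (rule summable_comparison_test'[of "\<lambda>j. pi * (5 + tot) * (1/2) ^ j" 0])
      (use L1 in \<open>auto intro!: summable_mult summable_geometric\<close>)
  have AEs: "AE k in lcirc. summable (\<lambda>j. cmod (T (D j) k))"
  proof -
    have meas: "(\<lambda>k. ennreal (cmod (T (D j) k))) \<in> borel_measurable lcirc" for j
      using lcirc.bdd_measurable[OF bT] by measurable
    have "(\<integral>\<^sup>+k. (\<Sum>j. ennreal (cmod (T (D j) k))) \<partial>lcirc) = (\<Sum>j. \<integral>\<^sup>+k. ennreal (cmod (T (D j) k)) \<partial>lcirc)"
      by (rule nn_integral_suminf[OF meas])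
    also have "\<dots> = (\<Sum>j. ennreal (\<integral>k. cmod (T (D j) k) \<partial>lcirc))"
      by (intro suminf_cong nn_integral_eq_integral integrable_norm lcirc.bdd_integrable bT) auto
    also have "\<dots> \<noteq> \<infinity>"
      unfolding infinity_ennreal_def by (rule ennreal_suminf_neq_top[OF sumL1]) simp
    finally have "AE k in lcirc. (\<Sum>j. ennreal (cmod (T (D j) k))) \<noteq> \<infinity>"
      by (intro nn_integral_PInf_AE borel_measurable_suminf_order meas)
        (simp_all only: infinity_ennreal_def not_False_eq_True)
    thus ?thesis
    proof eventually_elim
      case (elim k)
      show ?case by (rule summable_suminf_not_top[OF norm_ge_zero]) (use elim in \<open>simp only: infinity_ennreal_def not_False_eq_True\<close>)
    qed
  qed
  define f where "f k = (\<Sum>j. T (D j) k)" for k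
  have Tconv: "AE k in lcirc. (\<lambda>J. T (G J) k) \<longlonglongrightarrow> f k"
    using AEs
  proof eventually_elim
    case (elim k)
    have "(\<lambda>J. \<Sum>j\<le>J. T (D j) k) \<longlonglongrightarrow> f k"
      unfolding f_def by (rule summable_LIMSEQ'[OF summable_norm_cancel[OF elim]])
    thus ?case by (simp add: Tsum)
  qed
  have fm: "f \<in> borel_measurable lcirc"
    unfolding f_def using lcirc.bdd_measurable[OF bT] by measurable
  have nn: "(\<integral>\<^sup>+k. ennreal ((cmod (f k))\<^sup>2) \<partial>lcirc) \<le> ennreal (2 * pi * tot)"
  proof -
    have "(\<integral>\<^sup>+k. ennreal ((cmod (f k))\<^sup>2) \<partial>lcirc) = (\<integral>\<^sup>+k. liminf (\<lambda>J. ennreal ((cmod (T (G J) k))\<^sup>2)) \<partial>lcirc)"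
    proof (rule nn_integral_cong_AE)
      show "AE k in lcirc. ennreal ((cmod (f k))\<^sup>2) = liminf (\<lambda>J. ennreal ((cmod (T (G J) k))\<^sup>2))"
        using Tconv
      proof eventually_elim
        case (elim k)
        have "(\<lambda>J. ennreal ((cmod (T (G J) k))\<^sup>2)) \<longlonglongrightarrow> ennreal ((cmod (f k))\<^sup>2)"
          by (intro tendsto_intros tendsto_ennrealI elim)
        from lim_imp_Liminf[OF _ this] show ?case by simp
      qed
    qed
    also have "\<dots> \<le> liminf (\<lambda>J. \<integral>\<^sup>+k. ennreal ((cmod (T (G J) k))\<^sup>2) \<partial>lcirc)"
      by (rule nn_integral_liminf) (use lcirc.bdd_measurable[OF bT] in measurable)
    also have "\<dots> \<le> ennreal (2 * pi * tot)"
    proof (rule Liminf_le)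
      show "\<forall>\<^sub>F J in sequentially. (\<integral>\<^sup>+k. ennreal ((cmod (T (G J) k))\<^sup>2) \<partial>lcirc) \<le> ennreal (2 * pi * tot)"
      proof (intro always_eventually allI)
        fix J
        have "(\<integral>\<^sup>+k. ennreal ((cmod (T (G J) k))\<^sup>2) \<partial>lcirc) = ennreal (2 * pi * S (G J))"
          unfolding Tsq[OF G(1), symmetric]
          by (rule nn_integral_eq_integral) (auto intro: lcirc.bdd_integrable_sq bT)
        also have "\<dots> \<le> ennreal (2 * pi * tot)"
          by (intro ennreal_leI mult_left_mono S_le G) auto
        finally show "(\<integral>\<^sup>+k. ennreal ((cmod (T (G J) k))\<^sup>2) \<partial>lcirc) \<le> ennreal (2 * pi * tot)" .
      qed
    qed simp
    finally show ?thesis .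
  qed
  have fsq: "integrable lcirc (\<lambda>k. (cmod (f k))\<^sup>2)"
    by (rule integrableI_bounded) (use fm nn in \<open>auto simp: less_top[symmetric] top_unique\<close>)
  hence sqf: "sqi f" using fm by (simp add: sqi_def)
  show thesis
  proof
    show "sqi f" by (rule sqf)
    show "(\<integral>k. (cmod (f k))\<^sup>2 \<partial>lcirc) \<le> 2 * pi * (\<Sum>\<^sub>\<infinity>n. (cmod (c n))\<^sup>2)"
    proof -
      have "ennreal (\<integral>k. (cmod (f k))\<^sup>2 \<partial>lcirc) \<le> ennreal (2 * pi * tot)"
        using nn nn_integral_eq_integral[OF fsq] by simp
      thus ?thesis using tot0 by (simp add: tot_def)
    qed
    fix n
    have "(\<lambda>j. \<integral>k. cis (of_int n * k) * T (D j) k \<partial>lcirc) sums (\<integral>k. (\<Sum>j. cis (of_int n * k) * T (D j) k) \<partial>lcirc)"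
      by (rule sums_integral[OF iT]) (use AEs sumL1 in \<open>simp_all add: norm_mult\<close>)
    also have "(\<integral>k. (\<Sum>j. cis (of_int n * k) * T (D j) k) \<partial>lcirc) = (\<integral>k. cis (of_int n * k) * f k \<partial>lcirc)"
    proof (rule integral_cong_AE)
      show "AE k in lcirc. (\<Sum>j. cis (of_int n * k) * T (D j) k) = cis (of_int n * k) * f k"
        using AEs by eventually_elim (simp add: f_def suminf_mult summable_norm_cancel)
    qed (use lcirc.bdd_measurable[OF bT] fm in measurable)
    finally have "(\<lambda>J. \<Sum>j\<le>J. \<integral>k. cis (of_int n * k) * T (D j) k \<partial>lcirc) \<longlonglongrightarrow> (\<integral>k. cis (of_int n * k) * f k \<partial>lcirc)"
      by (simp add: sums_def_le)
    also have "(\<lambda>J. \<Sum>j\<le>J. \<integral>k. cis (of_int n * k) * T (D j) k \<partial>lcirc) = (\<lambda>J. of_real (2 * pi) * e (G J) (- n))"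
    proof
      fix J
      have "(\<Sum>j\<le>J. \<integral>k. cis (of_int n * k) * T (D j) k \<partial>lcirc) = (\<integral>k. cis (of_int n * k) * T (G J) k \<partial>lcirc)"
        using iT by (simp add: Tsum[symmetric] sum_distrib_left)
      also have "\<dots> = of_real (2 * pi) * fcoeff (T (G J)) n" by (simp add: fcoeff_def)
      finally show "(\<Sum>j\<le>J. \<integral>k. cis (of_int n * k) * T (D j) k \<partial>lcirc) = of_real (2 * pi) * e (G J) (- n)"
        unfolding T_def fcoeff_trig[OF fe[OF G(1)]] .
    qed
    finally have A: "(\<lambda>J. of_real (2 * pi) * e (G J) (- n)) \<longlonglongrightarrow> (\<integral>k. cis (of_int n * k) * f k \<partial>lcirc)" .
    have est: "cmod (e (G J) (- n) - c n) \<le> (1/2) ^ J" for J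
    proof (cases "n \<in> G J")
      case False
      have "S (insert n (G J)) \<le> tot" by (rule S_le) (simp add: G)
      hence "(cmod (c n))\<^sup>2 \<le> (1/4) ^ J" using False G(1,2)[of J] by (simp add: S_def)
      also have "(1/4::real) ^ J = ((1/2) ^ J)\<^sup>2" by (simp add: power2_eq_square power_mult_distrib[symmetric])
      finally have "cmod (c n) \<le> (1/2) ^ J" by (rule power2_le_imp_le) simp
      thus ?thesis using False by (simp add: e_def)
    qed (simp add: e_def)
    have "(\<lambda>J. (1/2::real) ^ J) \<longlonglongrightarrow> 0" by (rule LIMSEQ_power_zero) simp
    hence "(\<lambda>J. e (G J) (- n) - c n) \<longlonglongrightarrow> 0"
      by (rule Lim_null_comparison[rotated]) (use est in simp)
    hence "(\<lambda>J. e (G J) (- n)) \<longlonglongrightarrow> c n" by (simp add: LIM_zero_iff)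
    hence "(\<lambda>J. of_real (2 * pi) * e (G J) (- n)) \<longlonglongrightarrow> of_real (2 * pi) * c n" by (intro tendsto_intros)
    with A have "(\<integral>k. cis (of_int n * k) * f k \<partial>lcirc) = of_real (2 * pi) * c n" by (rule LIMSEQ_unique)
    thus "fcoeff f n = c n" by (simp add: fcoeff_def)
  qed
qed

subsection \<open>The Fourier transform of states\<close>

lemma measurable_lcirc_iff:
  fixes g :: "real \<Rightarrow> 'b::real_normed_vector"
  shows "set_borel_measurable lborel circ g \<longleftrightarrow> g \<in> borel_measurable lcirc"
  unfolding set_borel_measurable_def lcirc_def
  by (rule borel_measurable_restrict_space_iff[symmetric]) simp

lemma continuous_on_axis: "continuous_on S (\<lambda>c. axis i c :: complex^2)"
  unfolding axis_def
proof (rule continuous_on_vec_lambda)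
  fix j show "continuous_on S (\<lambda>c::complex. if j = i then c else 0)" by (cases "j = i") simp_all
qed

lemma measurable_vec2_iff:
  "(g :: real \<Rightarrow> complex^2) \<in> borel_measurable M \<longleftrightarrow> (\<forall>i. (\<lambda>k. g k $ i) \<in> borel_measurable M)"
proof
  assume "\<forall>i. (\<lambda>k. g k $ i) \<in> borel_measurable M"
  hence "(\<lambda>k. \<Sum>i\<in>UNIV. axis i (g k $ i)) \<in> borel_measurable M"
    by (intro borel_measurable_sum borel_measurable_continuous_on[where f = "axis _"])
      (simp_all add: continuous_on_axis)
  moreover have "(\<lambda>k. \<Sum>i\<in>UNIV. axis i (g k $ i)) = g"
    by (simp add: fun_eq_iff vec_eq_iff axis_def sum_2 forall_2)
  ultimately show "g \<in> borel_measurable M" by simp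
qed (auto intro!: borel_measurable_continuous_on[where f = "\<lambda>v. v $ _"] continuous_intros)

lemma sq_int_iff: "sq_int g \<longleftrightarrow> (\<forall>i. sqi (\<lambda>k. g k $ i))"
proof -
  have m: "g \<in> borel_measurable lcirc \<longleftrightarrow> (\<forall>i. (\<lambda>k. g k $ i) \<in> borel_measurable lcirc)"
    by (rule measurable_vec2_iff)
  have i: "set_integrable lborel circ (\<lambda>k. (norm (g k))\<^sup>2) \<longleftrightarrow> integrable lcirc (\<lambda>k. (norm (g k))\<^sup>2)"
    unfolding set_integrable_def lcirc_def by (rule integrable_restrict_space[symmetric]) simp
  show ?thesis
  proof
    assume g: "sq_int g"
    hence gm: "g \<in> borel_measurable lcirc" and gi: "integrable lcirc (\<lambda>k. (norm (g k))\<^sup>2)"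
      by (auto simp: sq_int_def measurable_lcirc_iff i)
    show "\<forall>i. sqi (\<lambda>k. g k $ i)"
      unfolding sqi_def
    proof (intro allI conjI)
      fix i
      show gmi: "(\<lambda>k. g k $ i) \<in> borel_measurable lcirc" using gm m by blast
      show "integrable lcirc (\<lambda>k. (cmod (g k $ i))\<^sup>2)"
      proof (rule Bochner_Integration.integrable_bound[OF gi])
        show "(\<lambda>k. (cmod (g k $ i))\<^sup>2) \<in> borel_measurable lcirc" using gmi by measurable
        show "AE k in lcirc. norm ((cmod (g k $ i))\<^sup>2) \<le> norm ((norm (g k))\<^sup>2)"
          by (intro AE_I2) (simp add: power_mono Finite_Cartesian_Product.norm_nth_le)
      qed
    qed
  next
    assume a: "\<forall>i. sqi (\<lambda>k. g k $ i)"
    hence "g \<in> borel_measurable lcirc" unfolding m by (simp add: sqi_def)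
    moreover have "integrable lcirc (\<lambda>k. (norm (g k))\<^sup>2)"
      unfolding norm_vec2_sq using a by (simp add: sqi_def)
    ultimately show "sq_int g" by (simp add: sq_int_def measurable_lcirc_iff i)
  qed
qed

text \<open>Not normalised by the length of the circle, hence the factors \<open>2 * pi\<close> when
  it is compared with \<open>l2norm\<close>.\<close>

definition sqnorm :: "(real \<Rightarrow> complex^2) \<Rightarrow> real" where
  "sqnorm g = (\<integral>k. (norm (g k))\<^sup>2 \<partial>lcirc)"

lemma sqnorm_eq:
  assumes "sq_int g"
  shows "sqnorm g = (\<integral>k. (cmod (g k $ 1))\<^sup>2 \<partial>lcirc) + (\<integral>k. (cmod (g k $ 2))\<^sup>2 \<partial>lcirc)"
  using assms unfolding sq_int_iff sqi_def sqnorm_def norm_vec2_sq by simp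

lemma fourier_inv_eq: "fourier_inv g x $ i = fcoeff (\<lambda>k. g k $ i) x"
  by (simp add: fourier_inv_def fcoeff_def integral_lcirc mult.commute)

lemma sq_int_diff: "sq_int g \<Longrightarrow> sq_int h \<Longrightarrow> sq_int (\<lambda>k. g k - h k)"
  by (simp add: sq_int_iff sqi_diff)

lemma fourier_inv_diff:
  "sq_int g \<Longrightarrow> sq_int h \<Longrightarrow> fourier_inv (\<lambda>k. g k - h k) = (\<lambda>x. fourier_inv g x - fourier_inv h x)"
  by (simp add: fun_eq_iff vec_eq_iff fourier_inv_eq sq_int_iff fcoeff_diff)

lemma fourier_inv_l2:
  assumes "sq_int g"
  shows "fourier_inv g \<in> l2" "(l2norm (fourier_inv g))\<^sup>2 \<le> sqnorm g / (2 * pi)"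
proof -
  have b: "(\<Sum>x\<in>F. (norm (fourier_inv g x))\<^sup>2) \<le> sqnorm g / (2 * pi)" if F: "finite F" for F
  proof -
    have s: "sqi (\<lambda>k. g k $ i)" for i using assms by (simp add: sq_int_iff)
    show ?thesis
      unfolding norm_vec2_sq fourier_inv_eq sum.distrib sqnorm_eq[OF assms]
      using bessel_fcoeff[OF s F, of 1] bessel_fcoeff[OF s F, of 2] by (simp add: add_divide_distrib)
  qed
  show 1: "fourier_inv g \<in> l2" by (rule l2I[OF b])
  have "(l2norm (fourier_inv g))\<^sup>2 = (\<Sum>\<^sub>\<infinity>x. (norm (fourier_inv g x))\<^sup>2)"
    unfolding l2norm_def by (intro real_sqrt_pow2 infsum_nonneg) simp
  also have "\<dots> \<le> sqnorm g / (2 * pi)"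
    using 1 b unfolding l2_iff by (intro infsum_le_finite_sums) auto
  finally show "(l2norm (fourier_inv g))\<^sup>2 \<le> sqnorm g / (2 * pi)" .
qed

lemma fourier_inv_inj:
  assumes "sq_int g" "sq_int h" "fourier_inv g = fourier_inv h"
  shows "AE k in lcirc. g k = h k"
proof -
  have "AE k in lcirc. g k $ i - h k $ i = 0" for i
  proof (rule fcoeff_zero_AE)
    show "sqi (\<lambda>k. g k $ i - h k $ i)" using assms by (simp add: sq_int_iff sqi_diff)
    fix n
    have "fcoeff (\<lambda>k. g k $ i - h k $ i) n = fourier_inv g n $ i - fourier_inv h n $ i"
      using assms(1,2) by (simp add: fourier_inv_eq fcoeff_diff sq_int_iff)
    thus "fcoeff (\<lambda>k. g k $ i - h k $ i) n = 0" using assms(3) by simp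
  qed
  from this[of 1] this[of 2] show ?thesis
    by eventually_elim (simp add: vec_eq_iff forall_2)
qed

lemma fourier_exists:
  assumes "\<psi> \<in> l2"
  obtains g where "sq_int g" "fourier_inv g = \<psi>" "sqnorm g \<le> 2 * pi * (l2norm \<psi>)\<^sup>2"
proof -
  have s: "(\<lambda>x. (cmod (\<psi> x $ i))\<^sup>2) summable_on UNIV" for i
  proof (rule summable_on_comparison_test)
    show "(\<lambda>x. (norm (\<psi> x))\<^sup>2) summable_on UNIV" using assms by (simp add: l2_iff)
    show "(cmod (\<psi> x $ i))\<^sup>2 \<le> (norm (\<psi> x))\<^sup>2" for x
      using Finite_Cartesian_Product.norm_nth_le[of "\<psi> x" i] by (intro power_mono) auto
  qed auto
  have "\<exists>f. sqi f \<and> (\<forall>n. fcoeff f n = \<psi> n $ i) \<and> (\<integral>k. (cmod (f k))\<^sup>2 \<partial>lcirc) \<le> 2 * pi * (\<Sum>\<^sub>\<infinity>n. (cmod (\<psi> n $ i))\<^sup>2)" for i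
    by (rule riesz_fischer[OF s[of i]]) blast
  then obtain f where f: "\<And>i. sqi (f i)" "\<And>i n. fcoeff (f i) n = \<psi> n $ i"
    "\<And>i. (\<integral>k. (cmod (f i k))\<^sup>2 \<partial>lcirc) \<le> 2 * pi * (\<Sum>\<^sub>\<infinity>n. (cmod (\<psi> n $ i))\<^sup>2)" by metis
  define g :: "real \<Rightarrow> complex^2" where "g k = (\<chi> i. f i k)" for k
  have g: "sq_int g" using f(1) by (simp add: sq_int_iff g_def)
  show thesis
  proof
    show "fourier_inv g = \<psi>" by (simp add: fun_eq_iff vec_eq_iff fourier_inv_eq g_def f(2))
    have "sqnorm g \<le> 2 * pi * ((\<Sum>\<^sub>\<infinity>n. (cmod (\<psi> n $ 1))\<^sup>2) + (\<Sum>\<^sub>\<infinity>n. (cmod (\<psi> n $ 2))\<^sup>2))"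
      unfolding sqnorm_eq[OF g] using f(3)[of 1] f(3)[of 2] by (simp add: g_def distrib_left)
    also have "(\<Sum>\<^sub>\<infinity>n. (cmod (\<psi> n $ 1))\<^sup>2) + (\<Sum>\<^sub>\<infinity>n. (cmod (\<psi> n $ 2))\<^sup>2) = (\<Sum>\<^sub>\<infinity>n. (norm (\<psi> n))\<^sup>2)"
      unfolding norm_vec2_sq by (rule infsum_add[OF s s, symmetric])
    also have "\<dots> = (l2norm \<psi>)\<^sup>2"
      unfolding l2norm_def by (intro real_sqrt_pow2[symmetric] infsum_nonneg) simp
    finally show "sqnorm g \<le> 2 * pi * (l2norm \<psi>)\<^sup>2" .
  qed (rule g)
qed

lemma sqnorm_cong_AE:
  assumes "sq_int g" "sq_int h" "AE k in lcirc. g k = h k"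
  shows "sqnorm g = sqnorm h"
  unfolding sqnorm_def
proof (rule integral_cong_AE)
  show "AE k in lcirc. (norm (g k))\<^sup>2 = (norm (h k))\<^sup>2" using assms(3) by eventually_elim simp
qed (use assms in \<open>auto simp: sq_int_def measurable_lcirc_iff\<close>)

text \<open>\<open>fourier\<close> picks some preimage under \<open>fourier_inv\<close>. Preimages
  agree almost everywhere, so the norm bound of the constructed one holds for the chosen
  one.\<close>

lemma fourier:
  assumes "\<psi> \<in> l2"
  shows "sq_int (fourier \<psi>)" "fourier_inv (fourier \<psi>) = \<psi>" "sqnorm (fourier \<psi>) \<le> 2 * pi * (l2norm \<psi>)\<^sup>2"
proof -
  obtain g where g: "sq_int g" "fourier_inv g = \<psi>" "sqnorm g \<le> 2 * pi * (l2norm \<psi>)\<^sup>2"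
    using fourier_exists[OF assms] by blast
  have "sq_int (fourier \<psi>) \<and> fourier_inv (fourier \<psi>) = \<psi>"
    unfolding fourier_def by (rule someI[of _ g]) (use g in simp)
  thus 1: "sq_int (fourier \<psi>)" "fourier_inv (fourier \<psi>) = \<psi>" by auto
  have "sqnorm (fourier \<psi>) = sqnorm g"
    by (rule sqnorm_cong_AE[OF 1(1) g(1) fourier_inv_inj[OF 1(1) g(1)]]) (simp add: 1 g)
  thus "sqnorm (fourier \<psi>) \<le> 2 * pi * (l2norm \<psi>)\<^sup>2" using g by simp
qed

lemma fourier_AE:
  assumes "sq_int g" shows "AE k in lcirc. fourier (fourier_inv g) k = g k"
  using fourier[OF fourier_inv_l2(1)[OF assms]] assms by (intro fourier_inv_inj) auto

lemma fourier_diff_AE: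
  assumes "\<phi> \<in> l2" "\<psi> \<in> l2"
  shows "AE k in lcirc. fourier (\<lambda>x. \<phi> x - \<psi> x) k = fourier \<phi> k - fourier \<psi> k"
proof -
  have "fourier_inv (\<lambda>k. fourier \<phi> k - fourier \<psi> k) = (\<lambda>x. \<phi> x - \<psi> x)"
    by (simp add: fourier_inv_diff fourier[OF assms(1)] fourier[OF assms(2)])
  with fourier_AE[OF sq_int_diff[OF fourier(1)[OF assms(1)] fourier(1)[OF assms(2)]]]
  show ?thesis by simp
qed

lemma fourier_inv_cong_AE:
  assumes "sq_int g" "sq_int h" "AE k in lcirc. g k = h k"
  shows "fourier_inv g = fourier_inv h"
proof -
  have "fcoeff (\<lambda>k. g k $ i) n = fcoeff (\<lambda>k. h k $ i) n" for i n
    unfolding fcoeff_def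
  proof (intro arg_cong2[where f = "(/)"] refl integral_cong_AE)
    show "AE k in lcirc. cis (of_int n * k) * g k $ i = cis (of_int n * k) * h k $ i"
      using assms(3) by eventually_elim simp
  qed (use assms in \<open>auto simp: sq_int_iff sqi_def intro!: borel_measurable_times lcirc.cis_borel\<close>)
  thus ?thesis by (simp add: fun_eq_iff vec_eq_iff fourier_inv_eq)
qed

subsection \<open>Finitely supported states\<close>

definition fin_support :: "state \<Rightarrow> bool" where
  "fin_support \<psi> \<longleftrightarrow> finite {x. \<psi> x \<noteq> 0}"

text \<open>For finite support this is an everywhere defined, continuous representative of the
  Fourier transform, which can be evaluated at the shifted point \<open>k - \<xi> / t\<close>. The
  index is reversed because the transform uses the negative exponent.\<close>

definition hat :: "state \<Rightarrow> real \<Rightarrow> complex^2" where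
  "hat \<psi> k = (\<chi> i. trig (\<lambda>n. \<psi> (- n) $ i) k)"

lemma fin_coeffs_state:
  assumes "fin_support \<psi>" shows "fin_coeffs (\<lambda>n. \<psi> (- n) $ i)"
proof -
  have "{n. \<psi> (- n) $ i \<noteq> 0} \<subseteq> uminus ` {x. \<psi> x \<noteq> 0}"
  proof
    fix n assume "n \<in> {n. \<psi> (- n) $ i \<noteq> 0}"
    hence "- n \<in> {x. \<psi> x \<noteq> 0}" by auto
    thus "n \<in> uminus ` {x. \<psi> x \<noteq> 0}" by (rule rev_image_eqI) simp
  qed
  from finite_subset[OF this] show ?thesis using assms by (simp add: fin_coeffs_def fin_support_def)
qed

lemma fin_support_l2: "fin_support \<psi> \<Longrightarrow> \<psi> \<in> l2"
  unfolding fin_support_def by (rule finite_support_l2) auto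

lemma sq_int_hat: "sq_int (hat \<psi>)"
  by (simp add: sq_int_iff hat_def sqi_trig)

lemma fourier_inv_hat: "fin_support \<psi> \<Longrightarrow> fourier_inv (hat \<psi>) = \<psi>"
  by (simp add: fun_eq_iff vec_eq_iff fourier_inv_eq hat_def fcoeff_trig fin_coeffs_state)

lemma hat_bounded: obtains B where "\<And>k. norm (hat \<psi> k) \<le> B"
proof
  fix k
  have "norm (hat \<psi> k) \<le> (\<Sum>i\<in>UNIV. cmod (hat \<psi> k $ i))" 
    unfolding norm_vec_def by (rule L2_set_le_sum) simp
  also have "\<dots> \<le> (\<Sum>i\<in>UNIV. \<Sum>n | \<psi> (- n) $ i \<noteq> 0. cmod (\<psi> (- n) $ i))"
    unfolding hat_def by (intro sum_mono) (simp add: trig_bounded)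
  finally show "norm (hat \<psi> k) \<le> (\<Sum>i\<in>UNIV. \<Sum>n | \<psi> (- n) $ i \<noteq> 0. cmod (\<psi> (- n) $ i))" .
qed

lemma continuous_hat: "continuous_on S (hat \<psi>)"
  unfolding hat_def by (intro continuous_on_vec_lambda continuous_trig)

lemma fin_support_coin:
  assumes "fin_support \<psi>" shows "fin_support (\<lambda>x. C x *v \<psi> x)"
  using assms unfolding fin_support_def by (rule rev_finite_subset) auto

lemma fin_support_shift_by:
  assumes "fin_support \<psi>" shows "fin_support (shift_by a \<psi>)"
proof -
  have "{x. shift_by a \<psi> x \<noteq> 0} \<subseteq> (\<lambda>x. x - a) ` {x. \<psi> x \<noteq> 0} \<union> (\<lambda>x. x + a) ` {x. \<psi> x \<noteq> 0}"
  proof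
    fix x assume "x \<in> {x. shift_by a \<psi> x \<noteq> 0}"
    hence "\<psi> (x + a) \<noteq> 0 \<or> \<psi> (x - a) \<noteq> 0"
      by (auto simp: shift_by_def vec_eq_iff split: if_splits)
    thus "x \<in> (\<lambda>x. x - a) ` {x. \<psi> x \<noteq> 0} \<union> (\<lambda>x. x + a) ` {x. \<psi> x \<noteq> 0}"
      by (force simp: image_iff)
  qed
  from finite_subset[OF this] show ?thesis using assms by (simp add: fin_support_def)
qed

lemma fin_support_walk: "fin_support \<psi> \<Longrightarrow> fin_support (walk C \<psi>)"
  unfolding walk_def shift_eq by (intro fin_support_shift_by fin_support_coin)

lemma fin_support_walk_inv: "fin_support \<psi> \<Longrightarrow> fin_support (walk_inv C \<psi>)"
  unfolding walk_inv_def shift_eq by (intro fin_support_shift_by fin_support_coin)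

definition phase :: "real \<Rightarrow> state \<Rightarrow> state" where
  "phase a \<psi> = (\<lambda>x. exp (\<i> * of_real (a * of_int x)) *s \<psi> x)"

lemma fin_support_phase:
  assumes "fin_support \<psi>" shows "fin_support (phase a \<psi>)"
  using assms unfolding fin_support_def phase_def by (rule rev_finite_subset) auto

lemma hat_phase: "hat (phase a \<psi>) k = hat \<psi> (k - a)"
proof -
  have "trig (\<lambda>n. exp (\<i> * of_real (a * of_int (- n))) * c n) k = trig c (k - a)" for c
    unfolding trig_def
  proof (rule sum.cong)
    fix n
    have "exp (\<i> * of_real (a * of_int (- n))) = cis (- (a * of_int n))" by (simp add: cis_conv_exp)
    moreover have "cis (of_int n * (k - a)) = cis (- (a * of_int n)) * cis (of_int n * k)"
      by (simp add: cis_mult algebra_simps)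
    ultimately show "exp (\<i> * of_real (a * of_int (- n))) * c n * cis (of_int n * k) = c n * cis (of_int n * (k - a))"
      by simp
  qed simp
  thus ?thesis by (simp add: hat_def phase_def vec_eq_iff)
qed

definition symbol :: "coin \<Rightarrow> real \<Rightarrow> coin" where
  "symbol C0 k = (\<chi> a b. if a = b then (if a = 1 then cis k else cis (- k)) else 0) ** C0"

lemma symbol_mult:
  "(symbol C0 k *v w) $ 1 = cis k * (C0 *v w) $ 1" "(symbol C0 k *v w) $ 2 = cis (- k) * (C0 *v w) $ 2"
  by (simp_all add: symbol_def matrix_vector_mul_assoc[symmetric] matrix_vector_mult_def[of "\<chi> a b. _ a b"] sum_2)

lemma unitary2_iff_left: "madj M ** M = mat 1 \<Longrightarrow> unitary2 M"
  unfolding unitary2_def using matrix_left_right_inverse by blast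

lemma unitary2_symbol:
  assumes "unitary2 C0" shows "unitary2 (symbol C0 k)"
proof (rule unitary2_iff_left)
  let ?D = "(\<chi> a b. if a = b then (if a = 1 then cis k else cis (- k)) else 0) :: coin"
  have m: "madj (A ** B) = madj B ** madj A" for A B :: coin
    by (simp add: madj_def matrix_matrix_mult_def vec_eq_iff mult.commute)
  have D: "madj ?D ** ?D = mat 1"
    by (simp add: madj_def matrix_matrix_mult_def vec_eq_iff forall_2 sum_2 mat_def cis_cnj cis_mult)
  have "madj (symbol C0 k) ** symbol C0 k = madj C0 ** (madj ?D ** ?D) ** C0"
    unfolding symbol_def m by (simp only: matrix_mul_assoc)
  thus "madj (symbol C0 k) ** symbol C0 k = mat 1"
    using assms by (simp add: D unitary2_def)
qed

lemma hat_walk: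
  assumes "fin_support \<psi>"
  shows "hat (walk (\<lambda>_. C0) \<psi>) k = symbol C0 k *v hat \<psi> k"
proof -
  define \<phi> where "\<phi> = (\<lambda>x. C0 *v \<psi> x)"
  have c: "trig (\<lambda>n. \<phi> (- n) $ i) k = (C0 *v hat \<psi> k) $ i" for i
  proof -
    have "trig (\<lambda>n. C0 $ i $ 1 * \<psi> (- n) $ 1 + C0 $ i $ 2 * \<psi> (- n) $ 2) k =
      C0 $ i $ 1 * trig (\<lambda>n. \<psi> (- n) $ 1) k + C0 $ i $ 2 * trig (\<lambda>n. \<psi> (- n) $ 2) k"
      by (subst trig_add) (simp_all add: trig_scale fin_coeffs_scale fin_coeffs_state[OF assms])
    thus ?thesis by (simp add: \<phi>_def matrix_vector_mult_def sum_2 hat_def)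
  qed
  have "hat (walk (\<lambda>_. C0) \<psi>) k $ 1 = cis k * (C0 *v hat \<psi> k) $ 1"
    using trig_shift[of "\<lambda>n. \<phi> (- n) $ 1" 1 k] c[of 1]
    by (simp add: hat_def walk_def Defs.shift_def \<phi>_def)
  moreover have "hat (walk (\<lambda>_. C0) \<psi>) k $ 2 = cis (- k) * (C0 *v hat \<psi> k) $ 2"
    using trig_shift[of "\<lambda>n. \<phi> (- n) $ 2" "-1" k] c[of 2]
    by (simp add: hat_def walk_def Defs.shift_def \<phi>_def)
  ultimately show ?thesis by (simp add: vec_eq_iff forall_2 symbol_mult)
qed

subsection \<open>The velocity of the free walk\<close>

lemma phase_l2:
  assumes "\<psi> \<in> l2" shows "phase a \<psi> \<in> l2" "l2norm (phase a \<psi>) = l2norm \<psi>"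
proof -
  have "norm (phase a \<psi> x) = norm (\<psi> x)" for x
    by (simp add: phase_def norm_vector_smult)
  from l2_cong_norm[OF this] assms show "phase a \<psi> \<in> l2" "l2norm (phase a \<psi>) = l2norm \<psi>" by auto
qed

lemma exp_pos_t_eq: "exp_pos_t C \<xi> t \<psi> = (walk_inv C ^^ t) (phase (\<xi> / real t) ((walk C ^^ t) \<psi>))"
  by (simp add: exp_pos_t_def phase_def)

definition phase_op :: "real \<Rightarrow> l2state \<Rightarrow> l2state" where
  "phase_op a x = Abs_l2state (phase a (Rep_l2state x))"

lemma Rep_phase_op: "Rep_l2state (phase_op a x) = phase a (Rep_l2state x)"
  by (simp add: phase_op_def Abs_l2state_inverse phase_l2)

lemma phase_op_norm: "norm (phase_op a x) = norm x"
  by (simp add: norm_l2state.rep_eq Rep_phase_op phase_l2)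

lemma phase_op_diff: "phase_op a (x - y) = phase_op a x - phase_op a y"
  unfolding Rep_l2state_inject[symmetric] Rep_phase_op minus_l2state.rep_eq
  by (simp add: phase_def vector_ssub_ldistrib)

definition (in quantum_walk) epos :: "real \<Rightarrow> nat \<Rightarrow> l2state \<Rightarrow> l2state" where
  "epos \<xi> t x = (V ^^ t) (phase_op (\<xi> / real t) ((U ^^ t) x))"

context quantum_walk
begin

lemma Rep_epos: "Rep_l2state (epos \<xi> t x) = exp_pos_t C \<xi> t (Rep_l2state x)"
  by (simp add: epos_def Rep_V_pow Rep_phase_op Rep_U_pow exp_pos_t_eq)

lemma epos_norm [simp]: "norm (epos \<xi> t x) = norm x"
  by (simp add: epos_def phase_op_norm upow_of_nat[symmetric] upow_minus_of_nat[symmetric])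

lemma epos_diff: "epos \<xi> t (x - y) = epos \<xi> t x - epos \<xi> t y"
  by (simp add: epos_def phase_op_diff upow_of_nat[symmetric] upow_minus_of_nat[symmetric] upow_diff)

end

section \<open>Operators diagonal in an orthonormal frame\<close>

lemma proj_vec_mult: "proj_vec w *v v = cdot w v *s w"
  by (simp add: proj_vec_def matrix_vector_mult_def vec_eq_iff sum_2 algebra_simps)

lemma mscale_mult: "mscale c M *v v = c *s (M *v v)"
  by (simp add: mscale_def matrix_vector_mult_def vec_eq_iff sum_2 algebra_simps)

lemma cdot_smult_right: "cdot v (c *s w) = c * cdot v w"
  by (simp add: sum_2 algebra_simps)

lemma cdot_add_right: "cdot v (w + w') = cdot v w + cdot v w'"
  by (simp add: sum_2 algebra_simps)

text \<open>The operator with eigenvalue \<open>l j\<close> on \<open>e j\<close>, as a map on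
  vectors; functions of the symbol take this form.\<close>

definition eigen_sum :: "(2 \<Rightarrow> complex) \<Rightarrow> (2 \<Rightarrow> complex^2) \<Rightarrow> complex^2 \<Rightarrow> complex^2" where
  "eigen_sum l e v = (\<Sum>j\<in>UNIV. (l j * cdot (e j) v) *s e j)"

lemma eigen_sum_matrix: "(\<Sum>j\<in>UNIV. mscale (l j) (proj_vec (e j))) *v v = eigen_sum l e v"
  by (simp add: eigen_sum_def sum_2[of "\<lambda>j. mscale (l j) (proj_vec (e j))"]
      sum_2[of "\<lambda>j. (l j * cdot (e j) v) *s e j"]
      matrix_vector_mult_add_rdistrib mscale_mult proj_vec_mult vector_smult_assoc del: sum_2)

lemma cdot_eigen_sum_general: "cdot w (eigen_sum l e v) = (\<Sum>j\<in>UNIV. (l j * cdot (e j) v) * cdot w (e j))"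
  unfolding eigen_sum_def sum_2[of "\<lambda>j. (l j * cdot (e j) v) *s e j"]
    sum_2[of "\<lambda>j. (l j * cdot (e j) v) * cdot w (e j)"] cdot_add_right cdot_smult_right ..

lemma sum_smult: "(\<Sum>j\<in>UNIV. f j) *s (v :: complex^2) = (\<Sum>j\<in>(UNIV::2 set). f j *s v)"
  by (simp add: sum_2 vector_sadd_rdistrib)

lemma cdot_eigen_sum:
  assumes "\<And>i j. cdot (e i) (e j) = (if i = j then 1 else 0)"
  shows "cdot (e i) (eigen_sum l e v) = l i * cdot (e i) v"
proof -
  note cdot_eigen_sum_general[of "e i" l e v]
  thus ?thesis unfolding assms by (simp add: if_distrib sum.delta' cong: if_cong)
qed

lemma eigen_sum_comp:
  assumes "\<And>i j. cdot (e i) (e j) = (if i = j then 1 else 0)"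
  shows "eigen_sum l e (eigen_sum m e v) = eigen_sum (\<lambda>j. l j * m j) e v"
  unfolding eigen_sum_def[of l] cdot_eigen_sum[OF assms] by (simp add: eigen_sum_def mult.assoc)

text \<open>Exponents start at 1: orthonormality handles composition, whereas exponent 0 would give
  the identity and require completeness of the frame.\<close>

lemma eigen_sum_pow:
  assumes "\<And>i j. cdot (e i) (e j) = (if i = j then 1 else 0)"
  shows "(eigen_sum l e ^^ Suc t) v = eigen_sum (\<lambda>j. l j ^ Suc t) e v"
  by (induction t) (simp_all add: eigen_sum_comp[OF assms])

lemma madj_eigen_sum: "madj (\<Sum>j\<in>UNIV. mscale (l j) (proj_vec (e j))) = (\<Sum>j\<in>UNIV. mscale (cnj (l j)) (proj_vec (e j)))"
  by (simp add: madj_def mscale_def proj_vec_def sum_2 vec_eq_iff mult_ac)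

locale free_walk =
  fixes C0 :: coin and lam lam' :: "2 \<Rightarrow> real \<Rightarrow> complex" and u :: "2 \<Rightarrow> real \<Rightarrow> complex^2"
  assumes unitary_C0: "unitary2 C0"
    and decomp: "k \<in> circ \<Longrightarrow> symbol C0 k = (\<Sum>j\<in>UNIV. mscale (lam j k) (proj_vec (u j k)))"
    and orthonormal: "k \<in> circ \<Longrightarrow> cdot (u j k) (u j' k) = (if j = j' then 1 else 0)"
    and lam_diff: "k \<in> circ \<Longrightarrow> (lam j has_vector_derivative lam' j k) (at k within circ)"
    and u_cont: "continuous_on circ (u j)"
begin

sublocale W: quantum_walk "\<lambda>_. C0"
  by unfold_locales (rule unitary_C0)

abbreviation (input) M :: "real \<Rightarrow> complex^2 \<Rightarrow> complex^2" where "M k v \<equiv> symbol C0 k *v v"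
abbreviation (input) N :: "real \<Rightarrow> complex^2 \<Rightarrow> complex^2" where "N k v \<equiv> madj (symbol C0 k) *v v"

text \<open>The fibre over \<open>k\<close> of the exponential of the free velocity.\<close>

definition A :: "real \<Rightarrow> real \<Rightarrow> coin" where
  "A \<xi> k = (\<Sum>j\<in>UNIV. mscale (exp (\<i> * of_real \<xi> * (\<i> * lam' j k / lam j k))) (proj_vec (u j k)))"

lemma M_eigen: "k \<in> circ \<Longrightarrow> M k = eigen_sum (\<lambda>j. lam j k) (\<lambda>j. u j k)"
  by (rule ext) (simp only: decomp eigen_sum_matrix)

lemma N_eigen: "k \<in> circ \<Longrightarrow> N k = eigen_sum (\<lambda>j. cnj (lam j k)) (\<lambda>j. u j k)"
  by (rule ext) (simp only: decomp madj_eigen_sum eigen_sum_matrix)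

lemma A_eigen: "A \<xi> k *v v = eigen_sum (\<lambda>j. exp (\<i> * of_real \<xi> * (\<i> * lam' j k / lam j k))) (\<lambda>j. u j k) v"
  by (simp only: A_def eigen_sum_matrix)

lemma lam_norm:
  assumes "k \<in> circ" shows "cmod (lam j k) = 1"
proof -
  have "complex_of_real ((norm (u j k))\<^sup>2) = 1"
    unfolding cdot_self[symmetric] orthonormal[OF assms] by simp
  hence n: "norm (u j k) = 1"
    by (metis abs_norm_cancel of_real_eq_1_iff power2_eq_1_iff abs_1 abs_minus_cancel)
  have "cdot (u j k) (M k (u j k)) = lam j k"
    unfolding M_eigen[OF assms] cdot_eigen_sum[OF orthonormal[OF assms]] orthonormal[OF assms] by simp
  moreover have "M k (u j k) = lam j k *s u j k"
    unfolding M_eigen[OF assms] eigen_sum_def orthonormal[OF assms]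
    using exhaust_2[of j] by (auto simp: sum_2)
  hence "norm (M k (u j k)) = cmod (lam j k) * norm (u j k)" by (simp add: norm_vector_smult)
  ultimately show ?thesis
    using n unitary2_norm(1)[OF unitary2_symbol[OF unitary_C0], of k "u j k"] by simp
qed

text \<open>The base \<open>h (1 / t)\<close> starts from \<open>h 0 = 1\<close> with derivative
  \<open>D\<close>. Hence \<open>t * Ln (h (1 / t))\<close> tends to \<open>D\<close>, and
  exponentiating gives the powers. Taking \<open>k\<close> in the open interval makes the derivative
  two-sided and keeps \<open>k - \<xi> / t\<close> in range eventually, whatever the sign of
  \<open>\<xi>\<close>.\<close>

lemma power_limit:
  assumes k: "k \<in> {0<..<2 * pi}"
  shows "(\<lambda>t. (cnj (lam j k) * lam j (k - \<xi> / real t)) ^ t) \<longlonglongrightarrow> exp (\<i> * of_real \<xi> * (\<i> * lam' j k / lam j k))"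
proof -
  have kc: "k \<in> circ" using k by simp
  \<comment> \<open>The conjugate is the reciprocal of the unimodular eigenvalue, so
    \<open>D\<close> is the exponent in the claimed limit.\<close>
  define D where "D = cnj (lam j k) * (- of_real \<xi> * lam' j k)"
  have one: "cnj (lam j k) * lam j k = 1"
    using lam_norm[OF kc, of j] by (simp add: complex_norm_square[symmetric] mult.commute[of "cnj _"])
  have inv: "cnj (lam j k) = 1 / lam j k"
    using one by (metis nonzero_mult_div_cancel_right mult_zero_right zero_neq_one)
  have Dexp: "exp D = exp (\<i> * of_real \<xi> * (\<i> * lam' j k / lam j k))"
    unfolding D_def inv by (simp add: mult.assoc[symmetric]) (simp add: mult_ac)
  define h where "h s = cnj (lam j k) * lam j (k - \<xi> * s)" for s
  have h0: "h 0 = 1" by (simp add: h_def one)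
  have "(lam j has_vector_derivative lam' j k) (at k)"
    using lam_diff[OF kc, of j] k at_within_interior[of k circ] by (simp add: interior_atLeastLessThan)
  hence l: "(lam j has_vector_derivative lam' j k) (at (k - \<xi> * 0))" by simp
  have "((\<lambda>s. k - \<xi> * s) has_vector_derivative - \<xi>) (at 0)"
    by (auto intro!: derivative_eq_intros simp: has_real_derivative_iff_has_vector_derivative[symmetric])
  from vector_diff_chain_at[OF this l]
  have "(h has_vector_derivative cnj (lam j k) * (- \<xi> *\<^sub>R lam' j k)) (at 0)"
    unfolding h_def o_def by (rule has_vector_derivative_mult_right)
  hence hD: "(h has_vector_derivative D) (at 0)" by (simp add: D_def scaleR_conv_of_real)
  have "(Ln has_field_derivative 1) (at (h 0))"
    unfolding h0 using has_field_derivative_Ln[of 1] by simp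
  from field_vector_diff_chain_at[OF hD this]
  have "((\<lambda>s. Ln (h s)) has_vector_derivative D) (at 0)" by (simp add: o_def)
  hence L0: "(\<lambda>s. norm (Ln (h (0 + s)) - Ln (h 0) - s *\<^sub>R D) / norm s) \<midarrow>0\<rightarrow> 0"
    unfolding has_vector_derivative_def has_derivative_at by blast
  have f0: "filterlim (\<lambda>t. 1 / real t) (at 0) sequentially"
    unfolding filterlim_at by (auto intro!: lim_1_over_n eventually_sequentiallyI[of 1])
  have "(\<lambda>t. norm (of_nat t * Ln (h (1 / real t)) - D)) \<longlonglongrightarrow> 0"
  proof (rule Lim_transform_eventually[OF filterlim_compose[OF L0 f0]])
    show "\<forall>\<^sub>F t in sequentially. norm (Ln (h (0 + 1 / real t)) - Ln (h 0) - (1 / real t) *\<^sub>R D) / norm (1 / real t) =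
        norm (of_nat t * Ln (h (1 / real t)) - D)"
    proof (rule eventually_sequentiallyI[of 1])
      fix t :: nat assume t: "1 \<le> t"
      have "of_nat t * Ln (h (1 / real t)) - D = of_nat t * (Ln (h (1 / real t)) - (1 / real t) *\<^sub>R D)"
        using t by (simp add: right_diff_distrib scaleR_conv_of_real)
      hence "norm (of_nat t * Ln (h (1 / real t)) - D) = real t * norm (Ln (h (1 / real t)) - (1 / real t) *\<^sub>R D)"
        by (simp only: norm_mult norm_of_nat)
      thus "norm (Ln (h (0 + 1 / real t)) - Ln (h 0) - (1 / real t) *\<^sub>R D) / norm (1 / real t) =
        norm (of_nat t * Ln (h (1 / real t)) - D)" using t by (simp add: h0 mult.commute)
    qed
  qed
  hence "(\<lambda>t. of_nat t * Ln (h (1 / real t))) \<longlonglongrightarrow> D"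
    by (simp add: LIM_zero_iff tendsto_norm_zero_iff)
  hence E: "(\<lambda>t. exp (of_nat t * Ln (h (1 / real t)))) \<longlonglongrightarrow> exp D" by (rule tendsto_exp)
  have "(\<lambda>t. k - \<xi> * (1 / real t)) \<longlonglongrightarrow> k - \<xi> * 0" by (intro tendsto_intros lim_1_over_n)
  hence l: "(\<lambda>t. k - \<xi> / real t) \<longlonglongrightarrow> k" by simp
  have "eventually (\<lambda>t. k - \<xi> / real t \<in> {0<..<2*pi}) sequentially"
    by (rule topological_tendstoD[OF l _ k]) simp
  hence "eventually (\<lambda>t. exp (of_nat t * Ln (h (1 / real t))) = (cnj (lam j k) * lam j (k - \<xi> / real t)) ^ t) sequentially"
  proof eventually_elim
    case (elim t)
    have "cmod (h (1 / real t)) = 1"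
      using elim kc lam_norm[of k j] lam_norm[of "k - \<xi> / real t" j] by (simp add: h_def norm_mult)
    hence "h (1 / real t) \<noteq> 0" by auto
    thus ?case by (simp add: exp_of_nat_mult h_def)
  qed
  from Lim_transform_eventually[OF E this] show ?thesis by (simp only: Dexp)
qed

lemma shifted_tendsto:
  assumes k: "k \<in> {0<..<2 * pi}"
  shows "eventually (\<lambda>t. k - \<xi> / real t \<in> circ) sequentially" "(\<lambda>t. u j (k - \<xi> / real t)) \<longlonglongrightarrow> u j k"
proof -
  have "(\<lambda>t. k - \<xi> * (1 / real t)) \<longlonglongrightarrow> k - \<xi> * 0" by (intro tendsto_intros lim_1_over_n)
  hence l: "(\<lambda>t. k - \<xi> / real t) \<longlonglongrightarrow> k" by simp
  have "eventually (\<lambda>t. k - \<xi> / real t \<in> {0<..<2*pi}) sequentially"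
    by (rule topological_tendstoD[OF l _ k]) simp
  thus e: "eventually (\<lambda>t. k - \<xi> / real t \<in> circ) sequentially" by eventually_elim simp
  show "(\<lambda>t. u j (k - \<xi> / real t)) \<longlonglongrightarrow> u j k"
    using continuous_on_tendsto_compose[OF u_cont l _ e] k by simp
qed

text \<open>Expand in the frames at \<open>k\<close> and at \<open>k - \<xi> / t\<close>. For
  \<open>l = j\<close> the eigenvalue factor is the limit of powers; for \<open>l\<close> different
  from \<open>j\<close> it has modulus 1 and the overlap of the frames tends to 0. The vector may
  vary with \<open>t\<close>, as it will be a transform taken at the shifted point.\<close>

lemma pointwise_limit:
  assumes k: "k \<in> {0<..<2 * pi}" and w: "w \<longlonglongrightarrow> w0"
  shows "(\<lambda>t. (N k ^^ t) ((M (k - \<xi> / real t) ^^ t) (w t))) \<longlonglongrightarrow> A \<xi> k *v w0"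
proof -
  have kc: "k \<in> circ" using k by simp
  let ?k = "\<lambda>t::nat. k - \<xi> / real t"
  let ?z = "\<lambda>l j t. (cnj (lam l k) * lam j (?k t)) ^ t"
  let ?T = "\<lambda>l j t. (?z l j t * (cdot (u l k) (u j (?k t)) * cdot (u j (?k t)) (w t))) *s u l k"
  have eq: "eventually (\<lambda>t. (\<Sum>l\<in>UNIV. \<Sum>j\<in>UNIV. ?T l j t) = (N k ^^ t) ((M (?k t) ^^ t) (w t))) sequentially"
    using shifted_tendsto(1)[OF k, of \<xi>] eventually_gt_at_top[of 0]
  proof eventually_elim
    case (elim t)
    then obtain s where s: "t = Suc s" using gr0_conv_Suc by blast
    have "(N k ^^ t) ((M (?k t) ^^ t) (w t)) =
        eigen_sum (\<lambda>l. cnj (lam l k) ^ t) (\<lambda>l. u l k) (eigen_sum (\<lambda>j. lam j (?k t) ^ t) (\<lambda>j. u j (?k t)) (w t))"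
      unfolding N_eigen[OF kc] M_eigen[OF elim(1)] unfolding s
      by (simp only: eigen_sum_pow[OF orthonormal[OF kc]] eigen_sum_pow[OF orthonormal[OF elim(1)[unfolded s]]])
    also have "\<dots> = (\<Sum>l\<in>UNIV. \<Sum>j\<in>UNIV. ?T l j t)"
      unfolding eigen_sum_def[of "\<lambda>l. cnj (lam l k) ^ t"] cdot_eigen_sum_general
    proof (intro sum.cong refl, subst sum_distrib_left, subst sum_smult, intro sum.cong refl)
      fix l j
      have "c * (d * a * b) = (c * d) * (b * a)" for a b c d :: complex by (simp only: mult_ac)
      thus "(cnj (lam l k) ^ t * ((lam j (?k t) ^ t * cdot (u j (?k t)) (w t)) * cdot (u l k) (u j (?k t)))) *s u l k = ?T l j t"
        unfolding power_mult_distrib by simp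
    qed
    finally show ?case ..
  qed
  have cd: "(\<lambda>t. cdot (f t) (g t)) \<longlonglongrightarrow> cdot a b" if "f \<longlonglongrightarrow> a" "g \<longlonglongrightarrow> b" for f g :: "nat \<Rightarrow> complex^2" and a b
    using that by (intro tendsto_intros)
  have smult: "(\<lambda>t. c t *s v) \<longlonglongrightarrow> c0 *s v" if "c \<longlonglongrightarrow> c0" for c c0 and v :: "complex^2"
    using that by (intro vec_tendstoI) (simp add: tendsto_mult_right)
  have lim: "?T l j \<longlonglongrightarrow> (if j = l then exp (\<i> * of_real \<xi> * (\<i> * lam' l k / lam l k)) * cdot (u l k) w0 else 0) *s u l k" for l j
  proof (rule smult)
    have c1: "(\<lambda>t. cdot (u l k) (u j (?k t)) * cdot (u j (?k t)) (w t)) \<longlonglongrightarrow> cdot (u l k) (u j k) * cdot (u j k) w0"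
      by (intro tendsto_mult cd tendsto_const shifted_tendsto(2)[OF k] w)
    show "(\<lambda>t. ?z l j t * (cdot (u l k) (u j (?k t)) * cdot (u j (?k t)) (w t))) \<longlonglongrightarrow>
      (if j = l then exp (\<i> * of_real \<xi> * (\<i> * lam' l k / lam l k)) * cdot (u l k) w0 else 0)"
    proof (cases "j = l")
      case True
      show ?thesis
        using tendsto_mult[OF power_limit[OF k, of l \<xi>] c1] True unfolding orthonormal[OF kc] by simp
    next
      case False
      hence c0: "(\<lambda>t. norm (cdot (u l k) (u j (?k t)) * cdot (u j (?k t)) (w t))) \<longlonglongrightarrow> 0"
        using tendsto_norm[OF c1] unfolding orthonormal[OF kc] by simp
      have "eventually (\<lambda>t. norm (?z l j t * (cdot (u l k) (u j (?k t)) * cdot (u j (?k t)) (w t))) \<le>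
          norm (cdot (u l k) (u j (?k t)) * cdot (u j (?k t)) (w t))) sequentially"
        using shifted_tendsto(1)[OF k, of \<xi>]
      proof eventually_elim
        case (elim t)
        have "norm (?z l j t) = 1"
          unfolding norm_power norm_mult complex_mod_cnj using lam_norm[OF kc] lam_norm[OF elim] by simp
        thus ?case unfolding norm_mult[of "?z l j t"] by simp
      qed
      from Lim_null_comparison[OF this c0] show ?thesis using False by simp
    qed
  qed
  have "(\<lambda>t. \<Sum>l\<in>UNIV. \<Sum>j\<in>UNIV. ?T l j t) \<longlonglongrightarrow>
      (\<Sum>l\<in>UNIV. \<Sum>j\<in>UNIV. (if j = l then exp (\<i> * of_real \<xi> * (\<i> * lam' l k / lam l k)) * cdot (u l k) w0 else 0) *s u l k)"
    by (intro tendsto_sum lim)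
  also have "(\<Sum>l\<in>UNIV. \<Sum>j\<in>UNIV. (if j = l then exp (\<i> * of_real \<xi> * (\<i> * lam' l k / lam l k)) * cdot (u l k) w0 else 0) *s u l k)
      = A \<xi> k *v w0"
    unfolding A_eigen eigen_sum_def
  proof (rule sum.cong)
    fix l :: 2
    have "(\<Sum>j\<in>UNIV. (if j = l then c else 0) *s v) = c *s v" for c and v :: "complex^2"
      using exhaust_2[of l] by (auto simp: sum_2)
    thus "(\<Sum>j\<in>UNIV. (if j = l then exp (\<i> * of_real \<xi> * (\<i> * lam' l k / lam l k)) * cdot (u l k) w0 else 0) *s u l k)
      = (exp (\<i> * of_real \<xi> * (\<i> * lam' l k / lam l k)) * cdot (u l k) w0) *s u l k" .
  qed simp
  finally show ?thesis by (rule Lim_transform_eventually[OF _ eq])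
qed

lemma M_pow_norm: "norm ((M k ^^ t) v) = norm v"
  by (induction t) (simp_all add: unitary2_norm[OF unitary2_symbol[OF unitary_C0]])

lemma N_pow_norm: "norm ((N k ^^ t) v) = norm v"
  by (induction t) (simp_all add: unitary2_norm[OF unitary2_symbol[OF unitary_C0]])

text \<open>A limit of isometries is isometric, which bypasses showing that
  \<open>\<i> * lam' j k / lam j k\<close> is real.\<close>

lemma A_norm:
  assumes "k \<in> {0<..<2 * pi}" shows "norm (A \<xi> k *v v) = norm v"
  using tendsto_norm[OF pointwise_limit[OF assms tendsto_const, of \<xi> v]]
  by (simp add: M_pow_norm N_pow_norm LIMSEQ_const_iff)

lemma A_norm_AE: "AE k in lcirc. norm (A \<xi> k *v g k) = norm (g k)"
proof -
  have "{0} \<in> null_sets lcirc" unfolding null_sets_lcirc by (simp add: null_sets_def)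
  hence "AE k in lcirc. k \<notin> {0}" by (rule AE_not_in)
  thus ?thesis
  proof (rule AE_mp, intro AE_I2 impI)
    fix k assume "k \<in> space lcirc" "k \<notin> {0}"
    thus "norm (A \<xi> k *v g k) = norm (g k)" by (intro A_norm) (auto simp: lcirc.space_eq)
  qed
qed

lemma fin_support_walk_pow: "fin_support \<psi> \<Longrightarrow> fin_support ((walk C ^^ t) \<psi>)"
  by (induction t) (auto intro: fin_support_walk)

lemma fin_support_walk_inv_pow: "fin_support \<psi> \<Longrightarrow> fin_support ((walk_inv C ^^ t) \<psi>)"
  by (induction t) (auto intro: fin_support_walk_inv)

lemma hat_walk_inv:
  assumes "fin_support \<psi>"
  shows "hat (walk_inv (\<lambda>_. C0) \<psi>) k = N k (hat \<psi> k)"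
proof -
  have "hat \<psi> k = hat (walk (\<lambda>_. C0) (walk_inv (\<lambda>_. C0) \<psi>)) k" by (simp add: W.walk_walk_inv)
  also have "\<dots> = M k (hat (walk_inv (\<lambda>_. C0) \<psi>) k)"
    by (rule hat_walk[OF fin_support_walk_inv[OF assms]])
  finally show ?thesis
    using unitary2_symbol[OF unitary_C0, of k] by (simp add: matrix_vector_mul_assoc unitary2_def)
qed

text \<open>The position phase becomes a translation in \<open>k\<close>, so the forward steps act
  at the shifted point and the backward steps at \<open>k\<close>.\<close>

lemma hat_exp_pos:
  assumes \<psi>: "fin_support \<psi>"
  shows "hat (exp_pos_t (\<lambda>_. C0) \<xi> t \<psi>) k = (N k ^^ t) ((M (k - \<xi> / real t) ^^ t) (hat \<psi> (k - \<xi> / real t)))"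
proof -
  have 1: "hat ((walk (\<lambda>_. C0) ^^ s) \<psi>) k = (M k ^^ s) (hat \<psi> k)" for s k
    by (induction s) (simp_all add: hat_walk fin_support_walk_pow[OF \<psi>])
  have 2: "hat ((walk_inv (\<lambda>_. C0) ^^ s) \<phi>) k = (N k ^^ s) (hat \<phi> k)" if "fin_support \<phi>" for s \<phi>
    by (induction s) (simp_all add: hat_walk_inv fin_support_walk_inv_pow[OF that])
  show ?thesis
    unfolding exp_pos_t_eq
    by (simp only: 2[OF fin_support_phase[OF fin_support_walk_pow[OF \<psi>]]] hat_phase 1)
qed

lemma fin_support_exp_pos: "fin_support \<psi> \<Longrightarrow> fin_support (exp_pos_t C \<xi> t \<psi>)"
  unfolding exp_pos_t_eq by (intro fin_support_walk_inv_pow fin_support_phase fin_support_walk_pow)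

lemma hat_limit:
  assumes "fin_support \<psi>" "k \<in> {0<..<2 * pi}"
  shows "(\<lambda>t. hat (exp_pos_t (\<lambda>_. C0) \<xi> t \<psi>) k) \<longlonglongrightarrow> A \<xi> k *v hat \<psi> k"
  unfolding hat_exp_pos[OF assms(1)]
proof (rule pointwise_limit[OF assms(2)])
  have "(\<lambda>t. k - \<xi> * (1 / real t)) \<longlonglongrightarrow> k - \<xi> * 0" by (intro tendsto_intros lim_1_over_n)
  hence l: "(\<lambda>t. k - \<xi> / real t) \<longlonglongrightarrow> k" by simp
  show "(\<lambda>t. hat \<psi> (k - \<xi> / real t)) \<longlonglongrightarrow> hat \<psi> k"
    using continuous_on_tendsto_compose[OF continuous_hat[of UNIV \<psi>] l] by simp
qed

text \<open>Measurability comes from the pointwise limit, the transforms on its left being continuous; no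
  regularity of \<open>lam'\<close> is needed.\<close>

lemma A_measurable_const: "(\<lambda>k. A \<xi> k *v v) \<in> borel_measurable lcirc"
proof -
  define \<psi> :: state where "\<psi> = (\<lambda>x. if x = 0 then v else 0)"
  have fs: "fin_support \<psi>" unfolding fin_support_def \<psi>_def by (rule finite_subset[of _ "{0}"]) auto
  have "trig (\<lambda>n. \<psi> (- n) $ i) k = v $ i" for i k
    by (subst trig_superset[of "{0}"]) (auto simp: \<psi>_def)
  hence hat: "hat \<psi> k = v" for k by (simp add: hat_def vec_eq_iff)
  \<comment> \<open>At the end point 0, where the limit has not been established, the approximants
    are set equal to the target.\<close>
  define G where "G t k = (if k = 0 then A \<xi> 0 *v v else hat (exp_pos_t (\<lambda>_. C0) \<xi> t \<psi>) k)" for t k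
  show ?thesis
  proof (rule borel_measurable_LIMSEQ_metric[where f = G])
    fix t
    have "(\<lambda>k. hat (exp_pos_t (\<lambda>_. C0) \<xi> t \<psi>) k) \<in> borel_measurable borel"
      by (rule borel_measurable_continuous_onI[OF continuous_hat])
    hence "G t \<in> borel_measurable borel"
      unfolding G_def[abs_def] by (intro measurable_If) auto
    thus "G t \<in> borel_measurable lcirc" by (rule lcirc.borel_measurableI)
  next
    fix k assume "k \<in> space lcirc"
    thus "(\<lambda>t. G t k) \<longlonglongrightarrow> A \<xi> k *v v"
      using hat_limit[OF fs, of k \<xi>] by (cases "k = 0") (auto simp: G_def hat lcirc.space_eq)
  qed
qed

lemma sq_int_A:
  assumes g: "sq_int g"
  shows "sq_int (\<lambda>k. A \<xi> k *v g k)" "sqnorm (\<lambda>k. A \<xi> k *v g k) = sqnorm g"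
proof -
  have gm: "(\<lambda>k. g k $ j) \<in> borel_measurable lcirc" for j using g by (simp add: sq_int_iff sqi_def)
  have basis: "(B *v axis j 1) $ i = B $ i $ j" for B :: coin and i j
    using exhaust_2[of j] by (auto simp: matrix_vector_mult_def axis_def sum_2)
  \<comment> \<open>Entries of the matrix are components of images of basis vectors, which reduces
    to the case of a constant vector.\<close>
  have "(\<lambda>k. (A \<xi> k *v axis j 1) $ i) \<in> borel_measurable lcirc" for i j
    using A_measurable_const[of \<xi> "axis j 1"] unfolding measurable_vec2_iff by blast
  hence Am: "(\<lambda>k. A \<xi> k $ i $ j) \<in> borel_measurable lcirc" for i j
    unfolding basis .
  have m: "(\<lambda>k. A \<xi> k *v g k) \<in> borel_measurable lcirc"
    unfolding measurable_vec2_iff matrix_vector_mult_def using Am gm by simp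
  have gi: "integrable lcirc (\<lambda>k. (norm (g k))\<^sup>2)" "g \<in> borel_measurable lcirc"
    using g unfolding sq_int_def measurable_lcirc_iff set_integrable_def lcirc_def
    by (auto simp: integrable_restrict_space)
  have ae: "AE k in lcirc. (norm (A \<xi> k *v g k))\<^sup>2 = (norm (g k))\<^sup>2"
    using A_norm_AE[of \<xi> g] by eventually_elim simp
  have "integrable lcirc (\<lambda>k. (norm (A \<xi> k *v g k))\<^sup>2)"
    by (rule integrable_cong_AE_imp[OF gi(1)]) (use m ae in \<open>auto elim: AE_mp\<close>)
  thus "sq_int (\<lambda>k. A \<xi> k *v g k)"
    using m unfolding sq_int_def measurable_lcirc_iff set_integrable_def lcirc_def
    by (auto simp: integrable_restrict_space)
  show "sqnorm (\<lambda>k. A \<xi> k *v g k) = sqnorm g"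
    unfolding sqnorm_def by (rule integral_cong_AE) (use m gi ae in auto)
qed

definition E :: "real \<Rightarrow> l2state \<Rightarrow> l2state" where
  "E \<xi> x = Abs_l2state (exp_v0 lam lam' u \<xi> (Rep_l2state x))"

lemma exp_v0_eq: "exp_v0 lam lam' u \<xi> \<psi> = fourier_inv (\<lambda>k. A \<xi> k *v fourier \<psi> k)"
  by (simp add: exp_v0_def A_def)

lemma Rep_E: "Rep_l2state (E \<xi> x) = exp_v0 lam lam' u \<xi> (Rep_l2state x)"
  unfolding E_def exp_v0_eq
  by (rule Abs_l2state_inverse) (rule fourier_inv_l2(1)[OF sq_int_A(1)[OF fourier(1)[OF Rep_l2]]])

lemma E_norm_le: "norm (E \<xi> x) \<le> norm x"
proof -
  have "(norm (E \<xi> x))\<^sup>2 \<le> sqnorm (\<lambda>k. A \<xi> k *v fourier (Rep_l2state x) k) / (2 * pi)"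
    unfolding norm_l2state.rep_eq Rep_E exp_v0_eq
    by (rule fourier_inv_l2(2)[OF sq_int_A(1)[OF fourier(1)[OF Rep_l2]]])
  also have "\<dots> = sqnorm (fourier (Rep_l2state x)) / (2 * pi)"
    by (simp only: sq_int_A(2)[OF fourier(1)[OF Rep_l2]])
  also have "\<dots> \<le> (2 * pi * (norm x)\<^sup>2) / (2 * pi)"
    unfolding norm_l2state.rep_eq by (intro divide_right_mono fourier(3) Rep_l2) simp
  finally have "(norm (E \<xi> x))\<^sup>2 \<le> (norm x)\<^sup>2" by simp
  thus ?thesis by (rule power2_le_imp_le) simp
qed

lemma E_diff: "E \<xi> (x - y) = E \<xi> x - E \<xi> y"
proof -
  let ?f = "\<lambda>x. fourier (Rep_l2state x)"
  have s: "sq_int (\<lambda>k. A \<xi> k *v ?f x k)" for x by (rule sq_int_A(1)[OF fourier(1)[OF Rep_l2]])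
  have "fourier_inv (\<lambda>k. A \<xi> k *v ?f (x - y) k) = fourier_inv (\<lambda>k. A \<xi> k *v ?f x k - A \<xi> k *v ?f y k)"
  proof (rule fourier_inv_cong_AE[OF s sq_int_diff[OF s s]])
    show "AE k in lcirc. A \<xi> k *v ?f (x - y) k = A \<xi> k *v ?f x k - A \<xi> k *v ?f y k"
      using fourier_diff_AE[OF Rep_l2[of x] Rep_l2[of y]]
      by eventually_elim (simp add: minus_l2state.rep_eq matrix_vector_mult_diff_distrib)
  qed
  thus ?thesis
    unfolding Rep_l2state_inject[symmetric] minus_l2state.rep_eq[of "E \<xi> x"] Rep_E exp_v0_eq
    by (simp only: fourier_inv_diff[OF s s])
qed

text \<open>The norm bound for \<open>fourier_inv\<close> reduces the claim to an integral over the
  circle. There dominated convergence applies with a constant bound, because the powers of the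
  symbol and \<open>A\<close> preserve fibre norms and the transform is bounded by
  \<open>B\<close>.\<close>

lemma epos_limit_finite:
  assumes "fin_support (Rep_l2state x)"
  shows "(\<lambda>t. W.epos \<xi> t x) \<longlonglongrightarrow> E \<xi> x"
proof -
  let ?h = "hat (Rep_l2state x)"
  let ?h' = "\<lambda>t. hat (exp_pos_t (\<lambda>_. C0) \<xi> t (Rep_l2state x))"
  have s: "sq_int (\<lambda>k. A \<xi> k *v fourier (Rep_l2state x) k)" by (rule sq_int_A(1)[OF fourier(1)[OF Rep_l2]])
  have sA: "sq_int (\<lambda>k. A \<xi> k *v ?h k)" by (rule sq_int_A(1)[OF sq_int_hat])
  have E: "Rep_l2state (E \<xi> x) = fourier_inv (\<lambda>k. A \<xi> k *v ?h k)"
    unfolding Rep_E exp_v0_eq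
  proof (rule fourier_inv_cong_AE[OF s sA])
    show "AE k in lcirc. A \<xi> k *v fourier (Rep_l2state x) k = A \<xi> k *v ?h k"
      using fourier_AE[OF sq_int_hat, of "Rep_l2state x"] unfolding fourier_inv_hat[OF assms]
      by eventually_elim simp
  qed
  have le: "(norm (E \<xi> x - W.epos \<xi> t x))\<^sup>2 \<le> sqnorm (\<lambda>k. A \<xi> k *v ?h k - ?h' t k) / (2 * pi)" for t
  proof -
    have "Rep_l2state (E \<xi> x - W.epos \<xi> t x) = fourier_inv (\<lambda>k. A \<xi> k *v ?h k - ?h' t k)"
      unfolding minus_l2state.rep_eq E W.Rep_epos fourier_inv_diff[OF sA sq_int_hat]
      by (simp add: fourier_inv_hat[OF fin_support_exp_pos[OF assms]])
    thus ?thesis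
      unfolding norm_l2state.rep_eq using fourier_inv_l2(2)[OF sq_int_diff[OF sA sq_int_hat]] by simp
  qed
  obtain B where B: "\<And>k. norm (?h k) \<le> B" using hat_bounded by blast
  have nz: "AE k in lcirc. k \<in> {0<..<2 * pi}"
  proof -
    have "{0} \<in> null_sets lcirc" unfolding null_sets_lcirc by (simp add: null_sets_def)
    hence "AE k in lcirc. k \<notin> {0}" by (rule AE_not_in)
    thus ?thesis by (rule AE_mp) (intro AE_I2 impI, auto simp: lcirc.space_eq)
  qed
  have mA: "(\<lambda>k. A \<xi> k *v ?h k) \<in> borel_measurable lcirc" using sA by (simp add: sq_int_def measurable_lcirc_iff)
  have mh: "?h' t \<in> borel_measurable lcirc" for t
    using sq_int_hat by (simp add: sq_int_def measurable_lcirc_iff)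
  have "(\<lambda>t. sqnorm (\<lambda>k. A \<xi> k *v ?h k - ?h' t k)) \<longlonglongrightarrow> (\<integral>k. 0 \<partial>lcirc)"
    unfolding sqnorm_def
  proof (rule integral_dominated_convergence[where w = "\<lambda>_. (2 * B)\<^sup>2"])
    show "AE k in lcirc. (\<lambda>t. (norm (A \<xi> k *v ?h k - ?h' t k))\<^sup>2) \<longlonglongrightarrow> 0"
      using nz
    proof eventually_elim
      case (elim k)
      have "(\<lambda>t. (norm (A \<xi> k *v ?h k - ?h' t k))\<^sup>2) \<longlonglongrightarrow> (norm (A \<xi> k *v ?h k - A \<xi> k *v ?h k))\<^sup>2"
        by (intro tendsto_intros hat_limit assms elim)
      thus ?case by simp
    qed
    show "AE k in lcirc. norm ((norm (A \<xi> k *v ?h k - ?h' t k))\<^sup>2) \<le> (2 * B)\<^sup>2" for t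
      using nz
    proof eventually_elim
      case (elim k)
      have "norm (?h' t k) \<le> B" unfolding hat_exp_pos[OF assms] N_pow_norm M_pow_norm by (rule B)
      moreover have "norm (A \<xi> k *v ?h k) \<le> B" unfolding A_norm[OF elim] by (rule B)
      ultimately have "norm (A \<xi> k *v ?h k - ?h' t k) \<le> 2 * B"
        using norm_triangle_ineq4[of "A \<xi> k *v ?h k" "?h' t k"] by linarith
      from power_mono[OF this, of 2] show ?case by simp
    qed
  qed (use mA mh in auto)
  hence "(\<lambda>t. sqnorm (\<lambda>k. A \<xi> k *v ?h k - ?h' t k) / (2 * pi)) \<longlonglongrightarrow> 0 / (2 * pi)"
    by (intro tendsto_intros) auto
  hence L: "(\<lambda>t. sqnorm (\<lambda>k. A \<xi> k *v ?h k - ?h' t k) / (2 * pi)) \<longlonglongrightarrow> 0" by simp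
  have "(\<lambda>t. (norm (E \<xi> x - W.epos \<xi> t x))\<^sup>2) \<longlonglongrightarrow> 0"
    by (rule tendsto_sandwich[OF _ _ tendsto_const L]) (use le in auto)
  from tendsto_real_sqrt[OF this] have "(\<lambda>t. norm (W.epos \<xi> t x - E \<xi> x)) \<longlonglongrightarrow> 0"
    by (simp add: norm_minus_commute)
  thus ?thesis by (simp add: LIM_zero_iff tendsto_norm_zero_iff)
qed

end

lemma fin_support_dense:
  assumes "e > 0"
  obtains y where "fin_support (Rep_l2state y)" "norm (x - y) < e"
proof -
  let ?\<psi> = "Rep_l2state x"
  have sm: "(\<lambda>p. (norm (?\<psi> p))\<^sup>2) summable_on UNIV" using Rep_l2[of x] by (simp add: l2_iff)
  obtain F where F: "finite F" "dist (\<Sum>p\<in>F. (norm (?\<psi> p))\<^sup>2) (\<Sum>\<^sub>\<infinity>p. (norm (?\<psi> p))\<^sup>2) \<le> (e/2)\<^sup>2"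
    using infsum_finite_approximation[OF sm, of "(e/2)\<^sup>2"] assms by auto
  define \<phi> where "\<phi> p = (if p \<in> F then ?\<psi> p else 0)" for p
  have fs: "fin_support \<phi>" unfolding fin_support_def \<phi>_def by (rule finite_subset[OF _ F(1)]) auto
  have R: "Rep_l2state (Abs_l2state \<phi>) = \<phi>" by (rule Abs_l2state_inverse[OF fin_support_l2[OF fs]])
  have "norm (x - Abs_l2state \<phi>) \<le> e / 2"
    unfolding norm_l2state.rep_eq minus_l2state.rep_eq R
  proof (rule l2norm_leI(2))
    fix G :: "int set" assume G: "finite G"
    have "(\<Sum>p\<in>G. (norm (?\<psi> p - \<phi> p))\<^sup>2) = (\<Sum>p\<in>G - F. (norm (?\<psi> p))\<^sup>2)"
      by (rule sum.mono_neutral_cong_right) (use G in \<open>auto simp: \<phi>_def\<close>)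
    also have "\<dots> = (\<Sum>p\<in>G \<union> F. (norm (?\<psi> p))\<^sup>2) - (\<Sum>p\<in>F. (norm (?\<psi> p))\<^sup>2)"
      using sum_diff[of "G \<union> F" F "\<lambda>p. (norm (?\<psi> p))\<^sup>2"] G F(1) by (simp add: Un_Diff)
    also have "\<dots> \<le> (\<Sum>\<^sub>\<infinity>p. (norm (?\<psi> p))\<^sup>2) - (\<Sum>p\<in>F. (norm (?\<psi> p))\<^sup>2)"
      using finite_sum_le_infsum[OF sm, of "G \<union> F"] G F(1) by simp
    also have "\<dots> \<le> (e/2)\<^sup>2" using F(2) by (auto simp: dist_real_def)
    finally show "L2_set (\<lambda>p. norm (?\<psi> p - \<phi> p)) G \<le> e / 2"
      unfolding L2_set_def using assms by (intro real_le_lsqrt) auto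
  qed (use assms in simp)
  thus thesis using that[of "Abs_l2state \<phi>"] fs assms by (simp add: R)
qed

section \<open>The free velocity limit for all states and its commutation with the walk\<close>

context free_walk
begin

theorem epos_limit: "(\<lambda>t. W.epos \<xi> t x) \<longlonglongrightarrow> E \<xi> x"
proof (rule LIMSEQ_I)
  fix e :: real assume e: "e > 0"
  obtain y where y: "fin_support (Rep_l2state y)" "norm (x - y) < e / 3"
    using fin_support_dense[of "e/3" x] e by auto
  obtain T where T: "\<And>t. t \<ge> T \<Longrightarrow> norm (W.epos \<xi> t y - E \<xi> y) < e / 3"
    using LIMSEQ_D[OF epos_limit_finite[OF y(1), of \<xi>], of "e/3"] e by auto
  have "norm (W.epos \<xi> t x - E \<xi> x) < e" if "t \<ge> T" for t
  proof -
    have "norm (W.epos \<xi> t x - E \<xi> x) =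
        norm (W.epos \<xi> t (x - y) + (W.epos \<xi> t y - E \<xi> y) - E \<xi> (x - y))"
      by (simp add: W.epos_diff E_diff)
    also have "\<dots> \<le> norm (x - y) + norm (W.epos \<xi> t y - E \<xi> y) + norm (x - y)"
      using norm_triangle_ineq4[of "W.epos \<xi> t (x - y) + (W.epos \<xi> t y - E \<xi> y)" "E \<xi> (x - y)"]
        norm_triangle_ineq[of "W.epos \<xi> t (x - y)" "W.epos \<xi> t y - E \<xi> y"] E_norm_le[of \<xi> "x - y"] by simp
    also have "\<dots> < e" using y(2) T[OF that] by linarith
    finally show ?thesis .
  qed
  thus "\<exists>no. \<forall>n\<ge>no. norm (W.epos \<xi> n x - E \<xi> x) < e" by blast
qed

text \<open>The contraction estimate was enough to extend the limit; as a limit of isometries,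
  \<open>E\<close> is then an isometry.\<close>

lemma E_norm: "norm (E \<xi> x) = norm x"
  using tendsto_norm[OF epos_limit[of \<xi> x]] by (simp add: LIMSEQ_const_iff)

lemma E_add: "E \<xi> (x + y) = E \<xi> x + E \<xi> y"
proof -
  have "E \<xi> 0 = 0" using E_norm[of \<xi> 0] by simp
  hence "E \<xi> (- y) = - E \<xi> y" using E_diff[of \<xi> 0 y] by simp
  thus ?thesis using E_diff[of \<xi> x "- y"] by simp
qed

lemma sq_int_symbol:
  assumes "sq_int g" shows "sq_int (\<lambda>k. M k (g k))"
proof -
  have C: "sqi (\<lambda>k. (C0 *v g k) $ i)" for i
    using assms unfolding matrix_vector_mult_def sq_int_iff by (simp add: sum_2 sqi_add sqi_scale)
  have cis: "sqi (\<lambda>k. cis (a * k) * f k)" if "sqi f" for a f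
    using that unfolding sqi_def norm_mult norm_cis mult_1 by (intro conjI borel_measurable_times lcirc.cis_borel) auto
  show ?thesis
    unfolding sq_int_iff
  proof
    fix i :: 2
    show "sqi (\<lambda>k. M k (g k) $ i)"
      using exhaust_2[of i] cis[OF C[of 1], of 1] cis[OF C[of 2], of "-1"] by (auto simp: symbol_mult)
  qed
qed

lemma fourier_inv_symbol: "fourier_inv (\<lambda>k. M k (g k)) = walk (\<lambda>_. C0) (fourier_inv g)" if g: "sq_int g"
proof -
  have s: "integrable lcirc (\<lambda>k. g k $ i)" for i using g by (simp add: sq_int_iff sqi_integrable)
  have C: "fcoeff (\<lambda>k. (C0 *v g k) $ i) n = (C0 *v fourier_inv g n) $ i" for i n
  proof -
    have "(\<integral>k. cis (of_int n * k) * (C0 *v g k) $ i \<partial>lcirc) =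
      (\<integral>k. C0 $ i $ 1 * (cis (of_int n * k) * g k $ 1) + C0 $ i $ 2 * (cis (of_int n * k) * g k $ 2) \<partial>lcirc)"
      by (simp add: matrix_vector_mult_def sum_2 algebra_simps)
    also have "\<dots> = C0 $ i $ 1 * (\<integral>k. cis (of_int n * k) * g k $ 1 \<partial>lcirc) + C0 $ i $ 2 * (\<integral>k. cis (of_int n * k) * g k $ 2 \<partial>lcirc)"
      using integrable_cis_times[OF s] by simp
    finally show ?thesis
      by (simp add: fcoeff_def matrix_vector_mult_def sum_2 fourier_inv_eq add_divide_distrib)
  qed
  have shift: "fcoeff (\<lambda>k. cis (of_int m * k) * f k) n = fcoeff f (n + m)" for f m n
  proof -
    have "cis (of_int n * k) * (cis (of_int m * k) * f k) = cis (of_int (n + m) * k) * f k" for k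
      by (simp only: mult.assoc[symmetric] cis_mult of_int_add distrib_right)
    thus ?thesis unfolding fcoeff_def by (simp only:)
  qed
  show ?thesis
    using shift[of 1 "\<lambda>k. (C0 *v g k) $ 1"] shift[of "-1" "\<lambda>k. (C0 *v g k) $ 2"]
    by (simp add: fun_eq_iff vec_eq_iff forall_2 fourier_inv_eq symbol_mult walk_def Defs.shift_def C)
qed

text \<open>In each fibre both operators are diagonal in the same frame. The commutation serves to
  show that \<open>E\<close> keeps vectors absolutely continuous.\<close>

lemma E_commute: "E \<xi> (W.U x) = W.U (E \<xi> x)"
proof -
  let ?\<psi> = "Rep_l2state x"
  let ?f = "fourier ?\<psi>"
  have sf: "sq_int ?f" by (rule fourier(1)[OF Rep_l2])
  have inv: "fourier_inv (\<lambda>k. M k (?f k)) = walk (\<lambda>_. C0) ?\<psi>"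
    by (simp add: fourier_inv_symbol[OF sf] fourier(2)[OF Rep_l2])
  have "Rep_l2state (E \<xi> (W.U x)) = fourier_inv (\<lambda>k. A \<xi> k *v fourier (walk (\<lambda>_. C0) ?\<psi>) k)"
    by (simp add: Rep_E exp_v0_eq W.Rep_U)
  also have "\<dots> = fourier_inv (\<lambda>k. M k (A \<xi> k *v ?f k))"
  proof (rule fourier_inv_cong_AE)
    show "sq_int (\<lambda>k. A \<xi> k *v fourier (walk (\<lambda>_. C0) ?\<psi>) k)"
      by (intro sq_int_A fourier W.walk_l2 Rep_l2)
    show "sq_int (\<lambda>k. M k (A \<xi> k *v ?f k))" by (intro sq_int_symbol sq_int_A sf)
    have "AE k in lcirc. fourier (walk (\<lambda>_. C0) ?\<psi>) k = M k (?f k)"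
      using fourier_AE[OF sq_int_symbol[OF sf]] by (simp add: inv)
    thus "AE k in lcirc. A \<xi> k *v fourier (walk (\<lambda>_. C0) ?\<psi>) k = M k (A \<xi> k *v ?f k)"
    proof (rule AE_mp, intro AE_I2 impI)
      fix k assume k: "k \<in> space lcirc" and e: "fourier (walk (\<lambda>_. C0) ?\<psi>) k = M k (?f k)"
      have kc: "k \<in> circ" using k by (simp add: lcirc.space_eq)
      show "A \<xi> k *v fourier (walk (\<lambda>_. C0) ?\<psi>) k = M k (A \<xi> k *v ?f k)"
        unfolding e A_eigen unfolding fun_cong[OF M_eigen[OF kc]]
        by (simp only: eigen_sum_comp[OF orthonormal[OF kc]] mult.commute)
    qed
  qed
  also have "\<dots> = walk (\<lambda>_. C0) (fourier_inv (\<lambda>k. A \<xi> k *v ?f k))"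
    by (rule fourier_inv_symbol[OF sq_int_A(1)[OF sf]])
  also have "\<dots> = Rep_l2state (W.U (E \<xi> x))" by (simp add: W.Rep_U Rep_E exp_v0_eq)
  finally show ?thesis by (simp add: Rep_l2state_inject)
qed

end

subsection \<open>Asymptotic velocity of the perturbed walk\<close>

lemma phase_op_scaleC: "phase_op a (c *\<^sub>C x) = c *\<^sub>C phase_op a x"
  unfolding Rep_l2state_inject[symmetric] Rep_phase_op scaleC_l2state.rep_eq
  by (simp add: phase_def vector_smult_assoc mult.commute)

lemma phase_op_tendsto_finite:
  assumes "fin_support (Rep_l2state x)"
  shows "(\<lambda>t. phase_op (\<xi> / real t) x) \<longlonglongrightarrow> x"
proof -
  let ?\<psi> = "Rep_l2state x"
  let ?F = "{z. ?\<psi> z \<noteq> 0}"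
  let ?g = "\<lambda>t z. phase (\<xi> / real t) ?\<psi> z - ?\<psi> z"
  have fin: "finite ?F" using assms by (simp add: fin_support_def)
  have nrm: "(norm (phase_op (\<xi> / real t) x - x))\<^sup>2 = (\<Sum>z\<in>?F. (norm (?g t z))\<^sup>2)" for t
  proof -
    have "(norm (phase_op (\<xi> / real t) x - x))\<^sup>2 = (\<Sum>\<^sub>\<infinity>z. (norm (?g t z))\<^sup>2)"
      unfolding norm_l2state.rep_eq minus_l2state.rep_eq Rep_phase_op l2norm_def
      by (intro real_sqrt_pow2 infsum_nonneg) simp
    also have "\<dots> = (\<Sum>\<^sub>\<infinity>z\<in>?F. (norm (?g t z))\<^sup>2)"
      by (rule infsum_cong_neutral) (auto simp: phase_def)
    finally show ?thesis using fin by simp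
  qed
  have "(\<lambda>t. ?g t z) \<longlonglongrightarrow> 0" for z
  proof -
    have "(\<lambda>t. \<xi> * (1 / real t) * of_int z) \<longlonglongrightarrow> \<xi> * 0 * of_int z" by (intro tendsto_intros lim_1_over_n)
    hence "(\<lambda>t. \<xi> / real t * of_int z) \<longlonglongrightarrow> 0" by simp
    hence "(\<lambda>t. exp (\<i> * complex_of_real (\<xi> / real t * of_int z))) \<longlonglongrightarrow> exp (\<i> * of_real 0)"
      by (intro tendsto_intros)
    hence "(\<lambda>t. exp (\<i> * complex_of_real (\<xi> / real t * of_int z)) * ?\<psi> z $ i - ?\<psi> z $ i) \<longlonglongrightarrow> exp (\<i> * of_real 0) * ?\<psi> z $ i - ?\<psi> z $ i" for i
      by (intro tendsto_diff tendsto_mult tendsto_const)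
    hence "(\<lambda>t. ?g t z $ i) \<longlonglongrightarrow> 0 $ i" for i by (simp add: phase_def)
    thus ?thesis by (rule vec_tendstoI)
  qed
  hence "(\<lambda>t. \<Sum>z\<in>?F. (norm (?g t z))\<^sup>2) \<longlonglongrightarrow> (\<Sum>z\<in>?F. (norm (0 :: complex^2))\<^sup>2)"
    by (intro tendsto_intros)
  hence "(\<lambda>t. (norm (phase_op (\<xi> / real t) x - x))\<^sup>2) \<longlonglongrightarrow> 0" unfolding nrm by simp
  from tendsto_real_sqrt[OF this] have "(\<lambda>t. norm (phase_op (\<xi> / real t) x - x)) \<longlonglongrightarrow> 0" by simp
  thus ?thesis by (simp add: LIM_zero_iff tendsto_norm_zero_iff)
qed

text \<open>The maps are uniformly Lipschitz, so convergence to the identity passes to limits of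
  vectors.\<close>

lemma isometry_limit_closed:
  fixes T :: "nat \<Rightarrow> 'a::complex_hilbert \<Rightarrow> 'a"
  assumes diff: "\<And>t x y. T t (x - y) = T t x - T t y" and nrm: "\<And>t x. norm (T t x) = norm x"
    and dense: "\<And>e. e > 0 \<Longrightarrow> \<exists>y. (\<lambda>t. T t y) \<longlonglongrightarrow> y \<and> norm (x - y) < e"
  shows "(\<lambda>t. T t x) \<longlonglongrightarrow> x"
proof (rule LIMSEQ_I)
  fix e :: real assume e: "e > 0"
  obtain y where y: "(\<lambda>t. T t y) \<longlonglongrightarrow> y" "norm (x - y) < e / 3" using dense[of "e/3"] e by auto
  obtain N where N: "\<And>t. t \<ge> N \<Longrightarrow> norm (T t y - y) < e / 3" using LIMSEQ_D[OF y(1), of "e/3"] e by auto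
  have "norm (T t x - x) < e" if "t \<ge> N" for t
  proof -
    have "norm (T t x - x) = norm (T t (x - y) + (T t y - y) - (x - y))" by (simp add: diff)
    also have "\<dots> \<le> norm (x - y) + norm (T t y - y) + norm (x - y)"
      using norm_triangle_ineq4[of "T t (x - y) + (T t y - y)" "x - y"]
        norm_triangle_ineq[of "T t (x - y)" "T t y - y"] by (simp add: nrm)
    finally show ?thesis using y(2) N[OF that] by linarith
  qed
  thus "\<exists>no. \<forall>n\<ge>no. norm (T n x - x) < e" by blast
qed

lemma phase_op_tendsto: "(\<lambda>t. phase_op (\<xi> / real t) x) \<longlonglongrightarrow> x"
proof (rule isometry_limit_closed[OF phase_op_diff phase_op_norm])
  fix e :: real assume "e > 0"
  then obtain y where "fin_support (Rep_l2state y)" "norm (x - y) < e" using fin_support_dense by blast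
  thus "\<exists>y. (\<lambda>t. phase_op (\<xi> / real t) y) \<longlonglongrightarrow> y \<and> norm (x - y) < e"
    using phase_op_tendsto_finite by blast
qed

context quantum_walk
begin

lemma epos_scaleC: "epos \<xi> t (c *\<^sub>C x) = c *\<^sub>C epos \<xi> t x"
  by (simp add: epos_def upow_of_nat[symmetric] upow_minus_of_nat[symmetric] upow_scaleC phase_op_scaleC)

lemma epos_add: "epos \<xi> t (x + y) = epos \<xi> t x + epos \<xi> t y"
  using epos_diff[of \<xi> t x "- y"] epos_scaleC[of \<xi> t "-1" y] by (simp add: scaleC_minus_one)

text \<open>\<open>U ^^ t\<close> multiplies \<open>v\<close> by a unimodular number, so up to the
  isometry \<open>upow (- int t)\<close> the distance to \<open>v\<close> is that of
  \<open>phase_op (\<xi> / real t) v\<close>.\<close>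

lemma epos_eigvec:
  assumes "v \<in> eigvecs" shows "(\<lambda>t. epos \<xi> t v) \<longlonglongrightarrow> v"
proof -
  obtain e where e: "U v = e *\<^sub>C v" using assms by (auto simp: eigvecs_def)
  have pow: "(U ^^ t) v = (e ^ t) *\<^sub>C v" for t
    by (induction t) (simp_all add: U_scaleC e mult.commute)
  have eq: "norm (epos \<xi> t v - v) = norm (phase_op (\<xi> / real t) v - v)" for t
  proof -
    have n: "cmod (e ^ t) * norm v = norm v"
      using upow_norm[of "int t" v] by (simp only: upow_of_nat pow norm_scaleC)
    have "epos \<xi> t v - v = upow (- int t) (phase_op (\<xi> / real t) ((U ^^ t) v) - (U ^^ t) v)"
      by (simp add: epos_def upow_diff upow_minus_of_nat[symmetric] upow_of_nat[symmetric])
    hence "norm (epos \<xi> t v - v) = cmod (e ^ t) * norm (phase_op (\<xi> / real t) v - v)"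
      by (simp only: upow_norm pow phase_op_scaleC scaleC_diff_right[symmetric] norm_scaleC)
    moreover have "cmod (e ^ t) = 1 \<or> v = 0" using n by auto
    moreover have "v = 0 \<Longrightarrow> norm (phase_op (\<xi> / real t) v - v) = 0"
      using phase_op_norm[of _ "0 :: l2state"] by simp
    ultimately show ?thesis by auto
  qed
  have "(\<lambda>t. norm (phase_op (\<xi> / real t) v - v)) \<longlonglongrightarrow> 0"
    using phase_op_tendsto[of \<xi> v] by (simp add: LIM_zero_iff tendsto_norm_zero_iff)
  hence "(\<lambda>t. norm (epos \<xi> t v - v)) \<longlonglongrightarrow> 0" by (simp only: eq)
  thus ?thesis by (simp add: LIM_zero_iff tendsto_norm_zero_iff)
qed

lemma epos_pp:
  assumes "p \<in> pp" shows "(\<lambda>t. epos \<xi> t p) \<longlonglongrightarrow> p"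
proof (rule isometry_limit_closed[where T = "epos \<xi>"])
  have span: "(\<lambda>t. epos \<xi> t w) \<longlonglongrightarrow> w" if "w \<in> span eigvecs" for w
    using that
  proof (induction rule: span_induct_alt)
    case base
    have "epos \<xi> t 0 = 0" for t using epos_norm[of \<xi> t 0] by (simp only: norm_zero norm_eq_zero)
    thus ?case by simp
  next
    case (step c y z)
    have "(\<lambda>t. of_real c *\<^sub>C epos \<xi> t y + epos \<xi> t z) \<longlonglongrightarrow> of_real c *\<^sub>C y + z"
      by (intro tendsto_add tendsto_scaleC epos_eigvec step)
    thus ?case by (simp add: epos_add epos_scaleC scaleC_of_real[symmetric])
  qed
  fix e :: real assume "e > 0"
  then obtain y where "y \<in> span eigvecs" "dist y p < e"
    using assms unfolding pp_def closure_approachable by blast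
  thus "\<exists>y. (\<lambda>t. epos \<xi> t y) \<longlonglongrightarrow> y \<and> norm (p - y) < e"
    by (intro exI[of _ y] conjI span) (simp_all add: dist_norm norm_minus_commute)
qed (simp_all add: epos_diff)

text \<open>The choice is unique, because absolutely continuous vectors are orthogonal to singular ones.\<close>

definition ac_part :: "l2state \<Rightarrow> l2state" where
  "ac_part x = (SOME a. ac_vec a \<and> sing_vec (x - a))"

lemma ac_part: "ac_vec (ac_part x)" "sing_vec (x - ac_part x)"
proof -
  obtain a s p where "x = a + (s + p)" "ac_vec a" "sing_vec (s + p)" by (rule spectral_decomposition)
  hence "ac_vec a \<and> sing_vec (x - a)" by simp
  from someI[of "\<lambda>a. ac_vec a \<and> sing_vec (x - a)", OF this]
  show "ac_vec (ac_part x)" "sing_vec (x - ac_part x)" unfolding ac_part_def by auto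
qed

lemma ac_part_ac: assumes "ac_vec x" shows "ac_part x = x"
proof -
  have "cinner (x - ac_part x) (x - ac_part x) = 0"
    by (rule ac_sing_orthogonal[OF ac_vec_diff[OF assms ac_part(1)] ac_part(2)])
  thus ?thesis by (simp add: cinner_self)
qed

lemma Pi_ac_Rep:
  assumes "ac_vec a" "\<And>y. ac_vec y \<Longrightarrow> cinner y (x - a) = 0"
  shows "Pi_ac C (Rep_l2state x) = Rep_l2state a"
  unfolding Pi_ac_def ac_subspace_eq by (rule proj_Rep) (use assms ac_vec_diff in auto)

lemma Pi_p_Rep:
  assumes "p \<in> pp" "\<And>y. y \<in> pp \<Longrightarrow> cinner y (x - p) = 0"
  shows "Pi_p C (Rep_l2state x) = Rep_l2state p"
  unfolding Pi_p_def pp_subspace_eq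
proof (rule proj_Rep)
  fix a b assume "a \<in> pp" "b \<in> pp"
  then obtain X Y where "\<And>n. X n \<in> span eigvecs" "X \<longlonglongrightarrow> a" "\<And>n. Y n \<in> span eigvecs" "Y \<longlonglongrightarrow> b"
    unfolding pp_def closure_sequential by blast
  thus "a - b \<in> pp"
    unfolding pp_def closure_sequential
    by (intro exI[of _ "\<lambda>n. X n - Y n"]) (auto intro: span_diff tendsto_diff)
qed (use assms in auto)

end

lemma (in free_walk) E_scaleC: "E \<xi> (c *\<^sub>C x) = c *\<^sub>C E \<xi> x"
proof (rule LIMSEQ_unique[OF epos_limit])
  show "(\<lambda>t. W.epos \<xi> t (c *\<^sub>C x)) \<longlonglongrightarrow> c *\<^sub>C E \<xi> x"
    unfolding W.epos_scaleC by (intro tendsto_scaleC epos_limit)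
qed

lemma (in free_walk) E_cinner: "cinner (E \<xi> x) (E \<xi> y) = cinner x y"
  unfolding polarization[of "E \<xi> x"] polarization[of x]
  by (simp add: E_add[symmetric] E_scaleC[symmetric] E_norm)

text \<open>\<open>E\<close> commutes with the walk and preserves inner products, hence preserves
  all correlations; so the wave limit exists on the image as well.\<close>

lemma (in free_walk) E_ac:
  assumes "W.ac_vec x" shows "W.ac_vec (E \<xi> x)"
proof (rule W.ac_vec_same_moments[OF W.unitary_op_axioms assms])
  fix n
  have "(W.U ^^ n) (E \<xi> x) = E \<xi> ((W.U ^^ n) x)" by (induction n) (simp_all add: E_commute)
  thus "cinner (E \<xi> x) ((W.U ^^ n) (E \<xi> x)) = cinner x ((W.U ^^ n) x)" by (simp add: E_cinner)
qed

section \<open>Wave operators in both directions and the perturbed velocity\<close>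

locale perturbed_walk = free_walk C0 lam lam' u + P: coin_pair "\<lambda>_. C0" C d
  for C0 :: coin and lam lam' u and C :: "int \<Rightarrow> coin" and d
begin

text \<open>The hypotheses are symmetric in the two coins. \<open>P\<close> compares along free
  orbits and gives the wave operator; \<open>R\<close> compares along perturbed orbits and gives its
  inverse.\<close>

sublocale R: coin_pair C "\<lambda>_. C0" d
proof unfold_locales
  show "norm ((C x - C0) *v v) \<le> d x * norm v" for x v
    using P.d_bound[of x v] by (simp add: matrix_vector_mult_diff_rdistrib norm_minus_commute)
qed (rule P.d_nonneg P.d_summable)+

definition Om :: "l2state \<Rightarrow> l2state" where
  "Om x = lim (\<lambda>t. P.W t (W.ac_part x))"

lemma Om_limit: "(\<lambda>t. P.W t (W.ac_part x)) \<longlonglongrightarrow> Om x"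
  unfolding Om_def using P.wave_limit_exists[OF W.ac_part(1)] by (simp add: convergent_LIMSEQ_iff[symmetric] convergent_def)

lemma Om_ac_limit: "W.ac_vec x \<Longrightarrow> (\<lambda>t. P.W t x) \<longlonglongrightarrow> Om x"
  using Om_limit[of x] by (simp add: W.ac_part_ac)

lemma wave_op_Rep: "wave_op C C0 (Rep_l2state x) = Rep_l2state (Om x)"
proof -
  have pi: "Pi_ac (\<lambda>_. C0) (Rep_l2state x) = Rep_l2state (W.ac_part x)"
    by (rule W.Pi_ac_Rep[OF W.ac_part(1)]) (rule W.ac_sing_orthogonal[OF _ W.ac_part(2)])
  have seq: "(walk_inv C ^^ t) ((walk (\<lambda>_. C0) ^^ t) (Rep_l2state (W.ac_part x))) = Rep_l2state (P.W t (W.ac_part x))" for t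
    by (simp add: P.W_def P.B.Rep_V_pow W.Rep_U_pow)
  show ?thesis
    unfolding wave_op_def pi seq l2conv_iff[OF Rep_l2] Rep_l2state_inverse
  proof (rule the_equality)
    show "Rep_l2state (Om x) \<in> l2 \<and> (\<lambda>t. P.W t (W.ac_part x)) \<longlonglongrightarrow> Abs_l2state (Rep_l2state (Om x))"
      by (simp add: Rep_l2state_inverse Om_limit)
    fix \<phi> assume "\<phi> \<in> l2 \<and> (\<lambda>t. P.W t (W.ac_part x)) \<longlonglongrightarrow> Abs_l2state \<phi>"
    thus "\<phi> = Rep_l2state (Om x)"
      using LIMSEQ_unique[OF Om_limit] Abs_l2state_inverse by metis
  qed
qed

lemma P_W_R_W: "P.W t (R.W t x) = x"
  by (simp add: P.W_upow R.W_upow)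

text \<open>The reverse limit \<open>f\<close> is a preimage of \<open>a\<close>, because
  \<open>P.W t\<close> and \<open>R.W t\<close> are mutually inverse isometries. It is also the
  adjoint image: inner products of forward images are constant in time, and the singular part of
  \<open>y\<close> is orthogonal to \<open>f\<close>.\<close>

lemma asymptotic_completeness:
  assumes "P.B.ac_vec a"
  obtains f where "(\<lambda>t. R.W t a) \<longlonglongrightarrow> f" "W.ac_vec f" "Om f = a"
    "adjoint_op (wave_op C C0) (Rep_l2state a) = Rep_l2state f"
proof -
  obtain f where f: "(\<lambda>t. R.W t a) \<longlonglongrightarrow> f" using R.wave_limit_exists[OF assms] by blast
  have ac: "W.ac_vec f" by (rule R.wave_limit_ac[OF assms f])
  have Omf: "Om f = a"
  proof (rule LIMSEQ_unique[OF Om_ac_limit[OF ac]])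
    have "norm (P.W t f - a) = norm (R.W t a - f)" for t
    proof -
      have "P.W t f - a = P.W t (f - R.W t a)" by (simp add: P.W_diff P_W_R_W)
      thus ?thesis by (simp add: norm_minus_commute)
    qed
    moreover have "(\<lambda>t. norm (R.W t a - f)) \<longlonglongrightarrow> 0"
      using f by (simp add: LIM_zero_iff tendsto_norm_zero_iff)
    ultimately have "(\<lambda>t. norm (P.W t f - a)) \<longlonglongrightarrow> 0" by simp
    thus "(\<lambda>t. P.W t f) \<longlonglongrightarrow> a" by (simp add: LIM_zero_iff tendsto_norm_zero_iff)
  qed
  have adj: "adjoint_op (wave_op C C0) (Rep_l2state a) = Rep_l2state f"
  proof (rule adjoint_op_Rep)
    fix y
    have "(\<lambda>t. cinner (P.W t (W.ac_part y)) (P.W t f)) \<longlonglongrightarrow> cinner (Om y) (Om f)"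
      by (intro tendsto_intros Om_limit Om_ac_limit ac)
    moreover have "cinner (P.W t (W.ac_part y)) (P.W t f) = cinner (W.ac_part y) f" for t
      by (simp add: P.W_upow)
    ultimately have "cinner (Om y) a = cinner (W.ac_part y) f" by (simp add: LIMSEQ_const_iff Omf)
    also have "\<dots> = cinner y f"
    proof -
      have "cinner f (y - W.ac_part y) = 0" by (rule W.ac_sing_orthogonal[OF ac W.ac_part(2)])
      hence "cinner (y - W.ac_part y) f = 0" by (metis cinner_commute complex_cnj_zero)
      thus ?thesis by (simp add: cinner_diff_left)
    qed
    finally show "cinner y f = l2inner (wave_op C C0 (Rep_l2state y)) (Rep_l2state a)"
      by (simp add: wave_op_Rep cinner_l2state.rep_eq)
  qed
  show thesis by (rule that[OF f ac Omf adj])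
qed

text \<open>Replacing the perturbed orbit of \<open>a\<close> by the free orbit of \<open>f\<close>
  costs \<open>R.W t a - f\<close> in norm, since the phase is isometric; what remains is
  \<open>P.W t\<close> applied to the free expression, whose limit is known.\<close>

lemma epos_ac_limit:
  assumes f: "(\<lambda>t. R.W t a) \<longlonglongrightarrow> f" and ac: "W.ac_vec f"
  shows "(\<lambda>t. P.B.epos \<xi> t a) \<longlonglongrightarrow> Om (E \<xi> f)"
proof -
  have le: "norm (P.B.epos \<xi> t a - P.W t (E \<xi> f)) \<le> norm (R.W t a - f) + norm (W.epos \<xi> t f - E \<xi> f)" for t
  proof -
    let ?p = "phase_op (\<xi> / real t)"
    have "P.W t (W.epos \<xi> t f) = P.B.upow (- int t) (?p (W.upow (int t) f))"
      by (simp add: P.W_upow W.epos_def W.upow_of_nat[symmetric] W.upow_minus_of_nat[symmetric])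
    moreover have "P.B.epos \<xi> t a = P.B.upow (- int t) (?p (P.B.upow (int t) a))"
      by (simp add: P.B.epos_def P.B.upow_of_nat[symmetric] P.B.upow_minus_of_nat[symmetric])
    ultimately have "norm (P.B.epos \<xi> t a - P.W t (W.epos \<xi> t f)) = norm (P.B.upow (int t) a - W.upow (int t) f)"
      by (simp add: P.B.upow_diff[symmetric] phase_op_diff[symmetric] phase_op_norm)
    also have "\<dots> = norm (W.upow (- int t) (P.B.upow (int t) a - W.upow (int t) f))" by simp
    also have "\<dots> = norm (R.W t a - f)" by (simp add: W.upow_diff R.W_upow)
    finally have 1: "norm (P.B.epos \<xi> t a - P.W t (W.epos \<xi> t f)) = norm (R.W t a - f)" .
    have 2: "norm (P.W t (W.epos \<xi> t f) - P.W t (E \<xi> f)) = norm (W.epos \<xi> t f - E \<xi> f)"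
      by (simp add: P.W_diff[symmetric])
    show ?thesis
      using norm_triangle_ineq[of "P.B.epos \<xi> t a - P.W t (W.epos \<xi> t f)" "P.W t (W.epos \<xi> t f) - P.W t (E \<xi> f)"] 1 2
      by simp
  qed
  have "(\<lambda>t. norm (R.W t a - f) + norm (W.epos \<xi> t f - E \<xi> f)) \<longlonglongrightarrow> norm (f - f) + norm (E \<xi> f - E \<xi> f)"
    by (intro tendsto_intros f epos_limit)
  hence L: "(\<lambda>t. norm (R.W t a - f) + norm (W.epos \<xi> t f - E \<xi> f)) \<longlonglongrightarrow> 0" by simp
  have "(\<lambda>t. P.B.epos \<xi> t a - P.W t (E \<xi> f)) \<longlonglongrightarrow> 0"
    by (rule Lim_null_comparison[OF _ L]) (use le in auto)
  from tendsto_add[OF this Om_ac_limit[OF E_ac[OF ac, of \<xi>]]] show ?thesis by simp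
qed

text \<open>With the singular continuous part gone, the state is \<open>a + p\<close>; orthogonality
  of the two parts identifies them with the two projections, and each has its own limit.\<close>

theorem velocity_limit:
  assumes sc: "\<And>s. P.B.sc_vec s \<Longrightarrow> s = 0" and \<psi>: "\<psi> \<in> l2"
  shows "l2conv (\<lambda>t. exp_pos_t C \<xi> t \<psi>) (\<lambda>x. Pi_p C \<psi> x + exp_vplus_ac C C0 lam lam' u \<xi> \<psi> x)"
proof -
  define x where "x = Abs_l2state \<psi>"
  have \<psi>x: "\<psi> = Rep_l2state x" using \<psi> by (simp add: x_def Abs_l2state_inverse)
  obtain a s p where d: "x = a + (s + p)" "P.B.ac_vec a" "P.B.sc_vec s" "p \<in> P.B.pp"
    by (rule P.B.spectral_decomposition)
  hence xd: "x = a + p" using sc by simp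
  have orth: "cinner y z = 0" "cinner z y = 0" if "P.B.ac_vec y" "z \<in> P.B.pp" for y z
    using P.B.ac_pp_orthogonal[OF that] by (metis cinner_commute complex_cnj_zero)+
  have Pa: "Pi_ac C \<psi> = Rep_l2state a"
    unfolding \<psi>x by (rule P.B.Pi_ac_Rep[OF d(2)]) (simp add: xd orth d)
  have Pp: "Pi_p C \<psi> = Rep_l2state p"
    unfolding \<psi>x by (rule P.B.Pi_p_Rep[OF d(4)]) (simp add: xd orth d)
  obtain f where f: "(\<lambda>t. R.W t a) \<longlonglongrightarrow> f" "W.ac_vec f"
    "adjoint_op (wave_op C C0) (Rep_l2state a) = Rep_l2state f"
    using asymptotic_completeness[OF d(2)] by metis
  have target: "(\<lambda>z. Pi_p C \<psi> z + exp_vplus_ac C C0 lam lam' u \<xi> \<psi> z) = Rep_l2state (p + Om (E \<xi> f))"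
    by (simp add: exp_vplus_ac_def Pa Pp f(3) Rep_E[symmetric] wave_op_Rep plus_l2state.rep_eq)
  have "(\<lambda>t. P.B.epos \<xi> t p + P.B.epos \<xi> t a) \<longlonglongrightarrow> p + Om (E \<xi> f)"
    by (intro tendsto_add P.B.epos_pp d epos_ac_limit f)
  hence "(\<lambda>t. P.B.epos \<xi> t x) \<longlonglongrightarrow> p + Om (E \<xi> f)"
    by (simp add: xd P.B.epos_add add.commute)
  thus ?thesis
    unfolding target unfolding \<psi>x P.B.Rep_epos[symmetric] l2conv_iff[OF Rep_l2] Rep_l2state_inverse by simp
qed

end

text \<open>Both half-lines are compared with the convergent p-series of exponent
  \<open>1 + \<epsilon>\<close>, starting from 1 because the bound says nothing at 0.\<close>

lemma summable_on_int_powr_bound: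
  fixes d :: "int \<Rightarrow> real"
  assumes nn: "\<And>x. 0 \<le> d x" and "\<epsilon> > 0"
    and le: "\<And>x. x \<noteq> 0 \<Longrightarrow> d x \<le> c * \<bar>real_of_int x\<bar> powr (- 1 - \<epsilon>)"
  shows "d summable_on UNIV"
proof -
  have S: "summable (\<lambda>n. c * real n powr (- 1 - \<epsilon>))"
    using assms(2) by (intro summable_mult) (simp add: summable_real_powr_iff)
  have s1: "summable (\<lambda>n. d (int n))"
    by (rule summable_comparison_test_ev[OF eventually_sequentiallyI[of 1] S])
      (use nn le[of "int _"] in auto)
  have s2: "summable (\<lambda>n. d (- int n))"
  proof (rule summable_comparison_test_ev[OF eventually_sequentiallyI[of 1] S])
    fix n :: nat assume "1 \<le> n"
    thus "norm (d (- int n)) \<le> c * real n powr (- 1 - \<epsilon>)" using nn[of "- int n"] le[of "- int n"] by simp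
  qed
  \<comment> \<open>Starting at -1 keeps the two half-lines disjoint, so that 0 is counted
    once.\<close>
  have s2': "summable (\<lambda>n. d (- int (Suc n)))" using summable_Suc_iff[of "\<lambda>n. d (- int n)"] s2 by simp
  have "d summable_on range int"
    by (subst summable_on_reindex) (use s1 nn in \<open>auto simp: o_def summable_on_UNIV_nonneg_real_iff\<close>)
  moreover have "d summable_on range (\<lambda>n. - int (Suc n))"
    by (subst summable_on_reindex) (use s2' nn in \<open>auto simp: o_def summable_on_UNIV_nonneg_real_iff inj_on_def\<close>)
  ultimately have "d summable_on (range int \<union> range (\<lambda>n. - int (Suc n)))"
    by (rule summable_on_Un_disjoint) auto
  moreover have "x \<in> range int \<union> range (\<lambda>n. - int (Suc n))" for x
    by (cases x rule: int_cases) blast+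
  hence "range int \<union> range (\<lambda>n. - int (Suc n)) = UNIV" by blast
  ultimately show ?thesis by simp
qed

theorem theorem2p4:
  fixes C :: "int \<Rightarrow> complex^2^2" and C0 :: "complex^2^2"
    and lam lam' :: "2 \<Rightarrow> real \<Rightarrow> complex" and u u' :: "2 \<Rightarrow> real \<Rightarrow> complex^2"
  assumes unitary_C: "\<forall>x. unitary2 (C x)" and unitary_C0: "unitary2 C0"
    and A1: "\<exists>c1>0. \<exists>\<epsilon>>0. \<forall>x. x \<noteq> 0 \<longrightarrow>
               onorm (\<lambda>v. (C x - C0) *v v) \<le> c1 * \<bar>real_of_int x\<bar> powr (- 1 - \<epsilon>)"
    and decomp: "\<forall>k\<in>{0..<2*pi}.
               (\<chi> a b. if a = b then (if a = 1 then cis k else cis (- k)) else 0) ** C0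
               = (\<Sum>j\<in>UNIV. mscale (lam j k) (proj_vec (u j k)))"
    and orthonormal: "\<forall>k\<in>{0..<2*pi}. \<forall>j j'.
               (\<Sum>i\<in>UNIV. cnj (u j k $ i) * u j' k $ i) = (if j = j' then 1 else 0)"
    and lam_diff: "\<forall>j. \<forall>k\<in>{0..<2*pi}.
               (lam j has_vector_derivative lam' j k) (at k within {0..<2*pi})"
    and A2: "\<forall>j. (\<forall>k\<in>{0..<2*pi}. (u j has_vector_derivative u' j k) (at k within {0..<2*pi}))
               \<and> continuous_on {0..<2*pi} (u' j) \<and> bounded (u' j ` {0..<2*pi})"
    and A3: "sc_subspace C \<subseteq> {\<lambda>x. 0}"
  shows "\<forall>\<xi>::real. \<forall>\<psi>\<in>l2.
           l2conv (\<lambda>t. exp_pos_t C \<xi> t \<psi>)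
             (\<lambda>x. Pi_p C \<psi> x + exp_vplus_ac C (C0) lam lam' u \<xi> \<psi> x)"
proof -
  \<comment> \<open>The sitewise operator norm of the coin difference, the weight of
    \<open>coin_pair\<close>. Its value at 0 is finite without any decay bound.\<close>
  define d where "d x = onorm (\<lambda>v. (C x - C0) *v v)" for x
  have bl: "bounded_linear (\<lambda>v. (C x - C0) *v v)" for x
    by (rule linear_conv_bounded_linear[THEN iffD1])
      (simp add: linear_iff matrix_vector_right_distrib vec_eq_iff matrix_vector_mult_def
        scaleR_sum_right distrib_left sum.distrib)
  have d_nonneg: "0 \<le> d x" for x unfolding d_def by (rule onorm_pos_le[OF bl])
  have d_summable: "d summable_on UNIV"
    using A1 summable_on_int_powr_bound[of d, OF d_nonneg] unfolding d_def[symmetric] by blast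
  interpret F: free_walk C0 lam lam' u
  proof
    show "continuous_on circ (u j)" for j
      using A2 by (intro continuous_on_vector_derivative[where f' = "u' j"]) blast
  qed (use unitary_C0 decomp orthonormal lam_diff in \<open>auto simp: symbol_def\<close>)
  interpret perturbed_walk C0 lam lam' u C d
  proof
    show "norm ((C0 - C x) *v v) \<le> d x * norm v" for x v
      using onorm[OF bl, of x v] by (simp add: d_def matrix_vector_mult_diff_rdistrib norm_minus_commute)
  qed (use unitary_C d_nonneg d_summable in auto)
  have "s = 0" if "P.B.sc_vec s" for s
  proof -
    \<comment> \<open>The set-level form of empty singular continuous spectrum, read for a vector of
      \<open>l2state\<close>.\<close>
    have "Rep_l2state s = (\<lambda>x. 0)" using that A3 P.B.sc_subspace_iff by blast
    thus ?thesis by (simp add: Rep_l2state_inject[symmetric] zero_l2state.rep_eq)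
  qed
  thus ?thesis using velocity_limit by blast
qed

end
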